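(* Polynomial processes with zero-stable generator matrix exhibit short-range dependence: their cross-moments in equilibrium decay exponentially fast. Under inverse $\alpha$-stable time change, this class of processes exhibits long-range dependence, with these quantities decaying according to a power law with exponent $\alpha\in(0,1)$. In detail: Let $k\in\mathbb{N}$, $\alpha\in(0,1)$, and let $L_t=\inf\{s>0:\sigma_s>t\}$, $t\ge0$, be the inverse of an $\alpha$-stable subordinator $\sigma$. Let $X$ be a $2k$-polynomial process on $S$, independent of $\sigma$, with extended generator $\mathcal{G}$, such that $\mathcal{G}|_{\mathcal{P}_{2k}}$ is zero-stable, and let $\mu$ be $2k$-limiting for $X$. Assume moreover that the matrix $A=\mathcal{G}|_{\mathcal{P}_k}$ is diagonalisable, $A=QDQ^{-1}$, with $D=\mathrm{diag}(0,-\lambda_1,\dots,-\lambda_l)$, $\lambda_1,\dots,\lambda_l>0$, the columns of $Q$ being the right eigenvectors of $A$. Let $v$ be the left eigenvector of $\mathcal{G}|_{\mathcal{P}_{2k}}$ for the eigenvalue $0$, normalized such that its first element is one. Let $p,q\in\mathcal{P}_k$ and write $\mu(p)=\int_Sp(x)\,\mu(dx)$, $\mu(q)=\int_Sq(x)\,\mu(dx)$. Then: (1) for all $s,t\ge0$, $$\mathbb{E}_\mu[p(X_{L_{t+s}})q(X_{L_t})]=v^\top M_qQ\,\hat F_{s,t}(-D)\,Q^{-1}\vec p,\qquad \hat F_{s,t}(-D)=\mathrm{diag}(1,\hat F_{s,t}(\lambda_1),\dots,\hat F_{s,t}(\lambda_l));$$ (2) for any fixed $t\ge0$, as $s\to\infty$,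 $$\hat F_{s,t}(\lambda_i)\sim R_{s,t}(\lambda_i):=\frac{1}{(t+s)^\alpha\Gamma(1-\alpha)}\left(\frac1{\lambda_i}+\frac{t^\alpha}{\Gamma(1+\alpha)}\right),$$ and $$\mathbb{E}_\mu[p(X_{L_{t+s}})q(X_{L_t})]\sim v^\top M_qQ\,R_{s,t}(D)\,Q^{-1}\vec p,\qquad R_{s,t}(D):=\mathrm{diag}(1,R_{s,t}(\lambda_1),\dots,R_{s,t}(\lambda_l));$$ (3) for all $t\ge0$, $$\lim_{s\to\infty}\mathbb{E}_\mu[p(X_{L_{t+s}})q(X_{L_t})]=v^\top\vec q\;v^\top\vec p=\mu(p)\mu(q);$$ (4) for any fixed $t\ge0$, as $s\to\infty$, $$\mathbb{E}_\mu[p(X_{L_{t+s}})q(X_{L_t})]\sim\mu(p)\mu(q)+\frac{1}{(t+s)^\alpha\Gamma(1-\alpha)}\sum_{i=1}^lc_i\left(\frac1{\lambda_i}+\frac{t^\alpha}{\Gamma(1+\alpha)}\right),$$ where each $c_i\in\mathbb{R}$ is a constant depending on $p$, $q$ and $Q$.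
   Context: $S\subseteq\mathbb{R}^d$ is closed with nonempty interior. $\mathcal{P}_k$ is the finite-dimensional space of (restrictions to $S$ of) real polynomials of degree at most $k$. Fix a basis of $\mathcal{P}_{2k}$ that extends a basis of $\mathcal{P}_k$ and whose first element is the constant $1$. For a polynomial $p$, $\vec p$ denotes its coordinate vector, so $p(x)=H(x)^\top\vec p$ with $H$ the basis vector (coordinates in $\mathcal{P}_k$ are padded with zeros when regarded in $\mathcal{P}_{2k}$). $M_q$ is the matrix of the multiplication map $\mathcal{P}_k\to\mathcal{P}_{2k}$, $p\mapsto pq$. $X=(X_t)_{t\ge0}$ is an $S$-valued time-homogeneous càdlàg Markov process (without killing or explosion); $\mathbb{P}_x,\mathbb{E}_x$ refer to $X_0=x$ and $\mathbb{E}_\mu$ to $X_0\sim\mu$. Its extended generator $\mathcal{G}$ has as domain the Borel functions $u:S\to\mathbb{R}$ for which there is a function $\mathcal{G}u$ such that $u(X_t)-u(x)-\int_0^t\mathcal{G}u(X_s)\,ds$, $t\ge0$, is a $\mathbb{P}_x$-local martingale for every $x\in S$. $X$ is $m$-polynomial if for all $j\in\{1,\dots,m\}$, $u\in\mathcal{P}_j$, $x\in S$ and $t\ge0$: $\mathbb{E}_x[|u(X_t)|]<\infty$, and $\mathcal{G}(\mathcal{P}_j)\subseteq\mathcal{P}_j$. The matrix $G$ of $\mathcal{G}|_{\mathcal{P}_j}$ in a basis $H$ is defined by $\mathcal{G}p(x)=H(x)^\top G\vec p$; it is denoted $\mathcal{G}|_{\mathcal{P}_j}$ as well. A square real matrix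 is zero-stable if the maximum of the real parts of its eigenvalues is $0$, $0$ is the only eigenvalue with real part $0$, and $0$ is a simple eigenvalue. A probability measure $\mu$ on $S$ is $j$-limiting for $X$ if $\lim_{t\to\infty}\mathbb{E}_x[u(X_t)]=\int_Su(y)\,\mu(dy)$ for all $u\in\mathcal{P}_j$ and $x\in S$. The $\alpha$-stable subordinator is the non-decreasing Lévy process with $\mathbb{E}[e^{-\lambda\sigma_s}]=e^{-s\lambda^\alpha}$, $s,\lambda>0$. $\hat F_{s,t}$ is the Laplace transform of the distribution of $L_{t+s}-L_t$, given for $\lambda>0$ by $$\hat F_{s,t}(\lambda)=\frac{\alpha\lambda(t+s)^\alpha}{\Gamma(1+\alpha)}\int_0^{\frac{t}{t+s}}\frac{E_\alpha(-\lambda(t+s)^\alpha(1-z)^\alpha)}{z^{1-\alpha}}\,dz+E_\alpha(-\lambda(t+s)^\alpha),$$ where $E_\alpha(z)=\sum_{n\ge0}z^n/\Gamma(\alpha n+1)$ is the Mittag-Leffler function. The symbol $\sim$ denotes asymptotic equivalence as $s\to\infty$.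
   Formalization: In (2) (second relation) and (4), "∼" is asserted only when the right-hand side is not eventually zero, since the literal claim can fail if it vanishes identically; in all cases the difference of the two sides is shown to be o((t+s)^(-α)) as s→∞. *)

theory Defs
  imports
    "HOL-Probability.Probability"
    "HOL-Library.Landau_Symbols"
    "Jordan_Normal_Form.Spectral_Radius"
begin

(* From here on, $ and \<bullet> are the operations on the variable-size vectors of Jordan_Normal_Form;
   components of x :: real^'d are written vec_nth x i. *)
unbundle no vec_syntax
unbundle no inner_syntax

section \<open>Polynomials\<close>

text \<open>The elements of the space of polynomials of degree at most k are represented by functions on
  all of R^d. Everything below evaluates them only at points of the state space S, so that they
  stand for their restrictions to S.\<close>

definition polys :: "nat \<Rightarrow> (real^'d \<Rightarrow> real) set" where
  "polys k = {p. \<exists>c :: ('d \<Rightarrow> nat) \<Rightarrow> real.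
     p = (\<lambda>x. \<Sum>m | (\<Sum>i\<in>UNIV. m i) \<le> k. c m * (\<Prod>i\<in>UNIV. vec_nth x i ^ m i))}"

definition lin_comb :: "nat \<Rightarrow> (nat \<Rightarrow> real^'d \<Rightarrow> real) \<Rightarrow> real vec \<Rightarrow> real^'d \<Rightarrow> real" where
  "lin_comb n H c x = (\<Sum>i<n. c $ i * H i x)"

definition poly_basis :: "(real^'d) set \<Rightarrow> nat \<Rightarrow> nat \<Rightarrow> (nat \<Rightarrow> real^'d \<Rightarrow> real) \<Rightarrow> bool" where
  "poly_basis S k n H \<longleftrightarrow> (\<forall>i<n. H i \<in> polys k) \<and>
     (\<forall>p\<in>polys k. \<exists>!c. c \<in> carrier_vec n \<and> (\<forall>x\<in>S. p x = lin_comb n H c x))"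

definition coords :: "(real^'d) set \<Rightarrow> nat \<Rightarrow> (nat \<Rightarrow> real^'d \<Rightarrow> real) \<Rightarrow> (real^'d \<Rightarrow> real) \<Rightarrow> real vec" where
  "coords S n H p = (THE c. c \<in> carrier_vec n \<and> (\<forall>x\<in>S. p x = lin_comb n H c x))"

text \<open>The matrix of multiplication by q, from the span of the first n to the span of the first N
  basis elements.\<close>

definition mult_matrix :: "(real^'d) set \<Rightarrow> nat \<Rightarrow> nat \<Rightarrow> (nat \<Rightarrow> real^'d \<Rightarrow> real) \<Rightarrow> (real^'d \<Rightarrow> real) \<Rightarrow> real mat" where
  "mult_matrix S N n H q = mat N n (\<lambda>(i, j). coords S N H (\<lambda>x. H j x * q x) $ i)"

section \<open>Markov processes and the extended generator\<close>

text \<open>P x is the law on the sample space M for the starting point x. The filtration F is arbitrary,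
  subject to the Markov property; the natural filtration of X is a special case. Time is real, but
  X is only ever used at times t >= 0.\<close>

locale cadlag_markov_process = filtration "space M" F
  for M :: "'w measure" and F :: "real \<Rightarrow> 'w measure" +
  fixes S :: "(real^'d) set" and X :: "real \<Rightarrow> 'w \<Rightarrow> real^'d" and P :: "real^'d \<Rightarrow> 'w measure"
  assumes sets_F: "\<And>t. sets (F t) \<subseteq> sets M"
    and kernel: "P \<in> restrict_space borel S \<rightarrow>\<^sub>M prob_algebra M"
    and adapted: "\<And>t. 0 \<le> t \<Longrightarrow> X t \<in> F t \<rightarrow>\<^sub>M restrict_space borel S"
    and right_continuous:
      "\<And>t \<omega>. 0 \<le> t \<Longrightarrow> \<omega> \<in> space M \<Longrightarrow> continuous (at_right t) (\<lambda>s. X s \<omega>)"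
    and left_limits:
      "\<And>t \<omega>. 0 < t \<Longrightarrow> \<omega> \<in> space M \<Longrightarrow> \<exists>y. ((\<lambda>s. X s \<omega>) \<longlongrightarrow> y) (at_left t)"
    and start: "\<And>x. x \<in> S \<Longrightarrow> AE \<omega> in P x. X 0 \<omega> = x"
    and markov:
      "\<And>x s t B. x \<in> S \<Longrightarrow> 0 \<le> s \<Longrightarrow> 0 \<le> t \<Longrightarrow> B \<in> sets (restrict_space borel S) \<Longrightarrow>
        AE \<omega> in P x. real_cond_exp (P x) (F s) (\<lambda>\<omega>'. indicator B (X (s + t) \<omega>')) \<omega> =
          measure (P (X s \<omega>)) {\<omega>' \<in> space M. X t \<omega>' \<in> B}"

definition martingale :: "'w measure \<Rightarrow> (real \<Rightarrow> 'w measure) \<Rightarrow> (real \<Rightarrow> 'w \<Rightarrow> real) \<Rightarrow> bool" where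
  "martingale N F Y \<longleftrightarrow>
     (\<forall>t\<ge>0. Y t \<in> borel_measurable (F t) \<and> integrable N (Y t)) \<and>
     (\<forall>s t. 0 \<le> s \<longrightarrow> s \<le> t \<longrightarrow> (AE \<omega> in N. real_cond_exp N (F s) (Y t) \<omega> = Y s \<omega>))"

text \<open>Real-valued localizing times lose no generality: pass from T n to the minimum of T n and n.\<close>

definition local_martingale :: "'w measure \<Rightarrow> (real \<Rightarrow> 'w measure) \<Rightarrow> (real \<Rightarrow> 'w \<Rightarrow> real) \<Rightarrow> bool" where
  "local_martingale N F Y \<longleftrightarrow> (\<exists>T :: nat \<Rightarrow> 'w \<Rightarrow> real.
     (\<forall>n. stopping_time F (T n) \<and> (\<forall>\<omega>. 0 \<le> T n \<omega>)) \<and>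
     (AE \<omega> in N. incseq (\<lambda>n. T n \<omega>) \<and> filterlim (\<lambda>n. T n \<omega>) at_top sequentially) \<and>
     (\<forall>n. martingale N F (\<lambda>t \<omega>. Y (min t (T n \<omega>)) \<omega>)))"

text \<open>A function g with this property is in general not unique, so the extended generator is a
  relation. It is single-valued among continuous g, in particular among polynomials.\<close>

definition ext_generator ::
    "(real^'d) set \<Rightarrow> (real \<Rightarrow> 'w measure) \<Rightarrow> (real \<Rightarrow> 'w \<Rightarrow> real^'d) \<Rightarrow> (real^'d \<Rightarrow> 'w measure) \<Rightarrow>
      (real^'d \<Rightarrow> real) \<Rightarrow> (real^'d \<Rightarrow> real) \<Rightarrow> bool" where
  "ext_generator S F X P u g \<longleftrightarrow>
     u \<in> borel_measurable (restrict_space borel S) \<and>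
     g \<in> borel_measurable (restrict_space borel S) \<and>
     (\<forall>x\<in>S. (AE \<omega> in P x. \<forall>t\<ge>0. set_integrable lborel {0..t} (\<lambda>s. g (X s \<omega>))) \<and>
       local_martingale (P x) F
         (\<lambda>t \<omega>. u (X t \<omega>) - u x - (LINT s:{0..t}|lborel. g (X s \<omega>))))"

definition polynomial_process ::
    "nat \<Rightarrow> (real^'d) set \<Rightarrow> (real \<Rightarrow> 'w measure) \<Rightarrow> (real \<Rightarrow> 'w \<Rightarrow> real^'d) \<Rightarrow> (real^'d \<Rightarrow> 'w measure) \<Rightarrow> bool" where
  "polynomial_process m S F X P \<longleftrightarrow> (\<forall>j\<in>{1..m}. \<forall>u\<in>polys j.
     (\<forall>x\<in>S. \<forall>t\<ge>0. integrable (P x) (\<lambda>\<omega>. u (X t \<omega>))) \<and>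
     (\<exists>g\<in>polys j. ext_generator S F X P u g))"

definition generator_matrix ::
    "(real^'d) set \<Rightarrow> (real \<Rightarrow> 'w measure) \<Rightarrow> (real \<Rightarrow> 'w \<Rightarrow> real^'d) \<Rightarrow> (real^'d \<Rightarrow> 'w measure) \<Rightarrow>
      nat \<Rightarrow> (nat \<Rightarrow> real^'d \<Rightarrow> real) \<Rightarrow> real mat \<Rightarrow> bool" where
  "generator_matrix S F X P n H G \<longleftrightarrow> G \<in> carrier_mat n n \<and>
     (\<forall>c\<in>carrier_vec n. ext_generator S F X P (lin_comb n H c) (lin_comb n H (G *\<^sub>v c)))"

definition zero_stable :: "real mat \<Rightarrow> bool" where
  "zero_stable A \<longleftrightarrow> square_mat A \<and>
     (let A' = map_mat complex_of_real A in
       Max (Re ` spectrum A') = 0 \<and> (\<forall>z\<in>spectrum A'. Re z = 0 \<longrightarrow> z = 0) \<and>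
       Polynomial.order 0 (char_poly A') = 1)"

definition limiting ::
    "nat \<Rightarrow> (real^'d) set \<Rightarrow> (real \<Rightarrow> 'w \<Rightarrow> real^'d) \<Rightarrow> (real^'d \<Rightarrow> 'w measure) \<Rightarrow> (real^'d) measure \<Rightarrow> bool" where
  "limiting j S X P \<mu> \<longleftrightarrow> sets \<mu> = sets (restrict_space borel S) \<and> prob_space \<mu> \<and>
     (\<forall>u\<in>polys j. integrable \<mu> u \<and>
       (\<forall>x\<in>S. ((\<lambda>t. \<integral>\<omega>. u (X t \<omega>) \<partial>P x) \<longlongrightarrow> (\<integral>y. u y \<partial>\<mu>)) at_top))"

section \<open>Stable subordinators and their inverses\<close>

text \<open>Left limits of the paths exist by monotonicity.\<close>

definition stable_subordinator :: "'w measure \<Rightarrow> real \<Rightarrow> (real \<Rightarrow> 'w \<Rightarrow> real) \<Rightarrow> bool" where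
  "stable_subordinator N \<alpha> \<sigma> \<longleftrightarrow>
     (\<forall>s\<ge>0. \<sigma> s \<in> borel_measurable N) \<and>
     (\<forall>\<omega>\<in>space N. \<sigma> 0 \<omega> = 0 \<and> mono_on {0..} (\<lambda>s. \<sigma> s \<omega>) \<and>
        (\<forall>s\<ge>0. continuous (at_right s) (\<lambda>r. \<sigma> r \<omega>))) \<and>
     (\<forall>(n::nat) \<tau>. 0 \<le> \<tau> 0 \<longrightarrow> mono \<tau> \<longrightarrow>
        prob_space.indep_vars N (\<lambda>_. borel) (\<lambda>i \<omega>. \<sigma> (\<tau> (Suc i)) \<omega> - \<sigma> (\<tau> i) \<omega>) {..<n}) \<and>
     (\<forall>s r. 0 \<le> s \<longrightarrow> s \<le> r \<longrightarrow>
        distr N borel (\<lambda>\<omega>. \<sigma> r \<omega> - \<sigma> s \<omega>) = distr N borel (\<sigma> (r - s))) \<and>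
     (\<forall>s>0. \<forall>\<theta>>0. (\<integral>\<omega>. exp (- \<theta> * \<sigma> s \<omega>) \<partial>N) = exp (- s * \<theta> powr \<alpha>))"

text \<open>The infimum is taken in the extended reals, so that it is well-behaved on the null set where
  no s qualifies (there the value is infinity, which is sent to 0).\<close>

definition first_passage :: "(real \<Rightarrow> 'w \<Rightarrow> real) \<Rightarrow> real \<Rightarrow> 'w \<Rightarrow> real" where
  "first_passage \<sigma> t \<omega> = real_of_ereal (Inf (ereal ` {s. 0 < s \<and> t < \<sigma> s \<omega>}))"

text \<open>The sigma-algebra generated by a process with time axis [0, \<infinity>).\<close>

definition process_events :: "'w set \<Rightarrow> (real \<Rightarrow> 'w \<Rightarrow> 'a::topological_space) \<Rightarrow> 'w set set" where
  "process_events \<Omega> Y =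
     sets (vimage_algebra \<Omega> (\<lambda>\<omega>. \<lambda>t\<in>{0..}. Y t \<omega>) (PiM {0..} (\<lambda>_. borel)))"

definition indep_processes ::
    "'w measure \<Rightarrow> (real \<Rightarrow> 'w \<Rightarrow> 'a::topological_space) \<Rightarrow> (real \<Rightarrow> 'w \<Rightarrow> 'b::topological_space) \<Rightarrow> bool" where
  "indep_processes N Y Z \<longleftrightarrow>
     prob_space.indep_set N (process_events (space N) Y) (process_events (space N) Z)"

definition time_change :: "(real \<Rightarrow> 'w \<Rightarrow> 'a) \<Rightarrow> (real \<Rightarrow> 'w \<Rightarrow> real) \<Rightarrow> real \<Rightarrow> 'w \<Rightarrow> 'a" where
  "time_change X L t \<omega> = X (L t \<omega>) \<omega>"

definition Mittag_Leffler :: "real \<Rightarrow> real \<Rightarrow> real" where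
  "Mittag_Leffler \<alpha> z = (\<Sum>n. z ^ n / Gamma (\<alpha> * real n + 1))"

text \<open>At t = s = 0 the quotient t / (t + s) is 0 and the value is 1, as it should be.\<close>

definition F_hat :: "real \<Rightarrow> real \<Rightarrow> real \<Rightarrow> real \<Rightarrow> real" where
  "F_hat \<alpha> s t \<theta> =
     \<alpha> * \<theta> * (t + s) powr \<alpha> / Gamma (1 + \<alpha>) *
       (LINT z:{0..t / (t + s)}|lborel.
          Mittag_Leffler \<alpha> (- \<theta> * (t + s) powr \<alpha> * (1 - z) powr \<alpha>) / z powr (1 - \<alpha>)) +
     Mittag_Leffler \<alpha> (- \<theta> * (t + s) powr \<alpha>)"

definition R_asymp :: "real \<Rightarrow> real \<Rightarrow> real \<Rightarrow> real \<Rightarrow> real" where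
  "R_asymp \<alpha> s t \<theta> =
     1 / ((t + s) powr \<alpha> * Gamma (1 - \<alpha>)) * (1 / \<theta> + t powr \<alpha> / Gamma (1 + \<alpha>))"

section \<open>Cross-moments\<close>

definition cross_moment ::
    "'w measure \<Rightarrow> (real \<Rightarrow> 'w \<Rightarrow> 'a) \<Rightarrow> ('a \<Rightarrow> real) \<Rightarrow> ('a \<Rightarrow> real) \<Rightarrow> real \<Rightarrow> real \<Rightarrow> real" where
  "cross_moment N Y p q s t = (\<integral>\<omega>. p (Y (t + s) \<omega>) * q (Y t \<omega>) \<partial>N)"

text \<open>The (n x n)-matrix diag(1, f 1, ..., f (n - 1)).\<close>

definition diag_one :: "nat \<Rightarrow> (nat \<Rightarrow> real) \<Rightarrow> real mat" where
  "diag_one n f = mat_diag n (\<lambda>i. if i = 0 then 1 else f i)"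

text \<open>The asymptotic equivalence f ~ g, where the remainder is in addition controlled at the scale h.
  Since no relation f ~ 0 can hold unless f vanishes, the ratio form of ~ is
  asserted only if g is not eventually zero, whereas the remainder form is asserted in all cases.\<close>

definition asymp_equiv_scale ::
    "(real \<Rightarrow> real) \<Rightarrow> (real \<Rightarrow> real) \<Rightarrow> (real \<Rightarrow> real) \<Rightarrow> bool" where
  "asymp_equiv_scale h f g \<longleftrightarrow>
     (\<lambda>s. f s - g s) \<in> o[at_top](h) \<and>
     ((\<exists>\<^sub>F s in at_top. g s \<noteq> 0) \<longrightarrow> f \<sim>[at_top] g)"

end

theory Submission
  imports Defs
begin

text \<open>The proof reduces everything to one identity. If w is an eigenfunction of the generator on
the polynomials of degree at most k, with eigenvalue minus lambda, then the conditional
expectation of w(X at b) given the past up to a is exp(- lambda (b - a)) w(X at a). Conditioning on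
the independent clock L therefore gives
  E w(X at L(t+s)) q(X at L(t)) = E exp(- lambda (L(t+s) - L(t))) W(X at L(t))  with  W = w q,
and in equilibrium the right-hand side is the mean of W times the Laplace transform of
L(t+s) - L(t) at lambda (time_changed_eigenfunction). Expanding p in eigenfunctions yields (1)
(spectral_expansion). The eigenvalue 0 contributes the product of the two means, and the others
decay like the Laplace transform; this gives (2) to (4).

Three ingredients have to be built.

(a) The moment semigroup. The hypotheses only provide local martingales, and moments of order 2k
have no integrability to spare, so that uniform integrability is not available for all of them at
once. A dominating polynomial f of degree 2k satisfies Gf \<le> c f; discounting by exp(- c t) turns
f(X) into a supermartingale (discounted_bound, stopped_f). This bounds the squares of polynomials
of degree k at all stopping times, and Dynkin's formula follows for them (moment_half_degree). Every
polynomial of degree 2k is a combination of squares p^2, and p(X) is, up to an integral, a square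
integrable martingale whose square is a submartingale; Fatou's lemma applied to both p^2 and its
submartingale majorant gives Dynkin's formula in degree 2k (moment_square, Dynkin_formula). The
expectations of the basis polynomials then solve a linear differential equation, and the solution
stays in the span of the basis (picard_tendsto, T_eq).

(b) Equilibrium. A left null vector of the generator is invariant under the semigroup, so passing to
the limit identifies it with the means under the limiting distribution (left_null_eq_limit). On a
finite-dimensional space convergence of the semigroup is automatically exponential
(submultiplicative_decay, E_exponential), which is the short-range dependence of X.

(c) The clock. Laplace transforms identify the potential measures of the subordinator
(potential_eq); these give the moments of L and hence
  E exp(- theta L(t)) = E_alpha(- theta t^alpha)
(Laplace_L), which also shows that the Mittag-Leffler function is nonnegative and decreasing there.
The independence of increments gives the law of L(t+s) - L(t) and, more generally, the expectation
of exp(- theta (L(t+s) - L(t))) psi(L(t)) in terms of one-dimensional laws of the subordinator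
only (expectation_time_changed). The latter is needed because the subordinator lives on the same
space as X, under a law that depends on the starting point: it shows that these expectations do not.
The asymptotics come from a fractional integral equation for the Mittag-Leffler function and the
monotone density theorem (Mittag_Leffler_asymp, F_hat_asymp).\<close>

abbreviation (input) BM where "BM \<equiv> borel_measurable"
abbreviation (input) ind where "ind \<equiv> indicator"

lemmas lebesgue_cong = Bochner_Integration.integral_cong
lemmas lebesgue_sum = Bochner_Integration.integral_sum
lemmas lebesgue_nonneg = Bochner_Integration.integral_nonneg
lemmas integrable_by = Bochner_Integration.integrable_bound

section \<open>Uniqueness of Laplace transforms\<close>

text \<open>The substitution of exp(- y) maps the half-line to the unit interval, where polynomials are
uniformly dense. The factor exp(- y) makes the measures finite.\<close>

lemma integral_exp_continuous_eq:
 fixes M1 M2 :: "real measure"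
 assumes sets: "sets M1 = sets borel" "sets M2 = sets borel"
  and nonneg: "AE y in M1. 0 <= y" "AE y in M2. 0 <= y"
  and int: "\<And>n. integrable M1 (%y. exp (- (real n + 1) * y))" "\<And>n. integrable M2 (%y. exp (- (real n + 1) * y))"
  and eq: "\<And>n. (LINT y|M1. exp (- (real n + 1) * y)) = (LINT y|M2. exp (- (real n + 1) * y))"
  and g: "continuous_on {0..1} g" "g : BM borel"
 shows "(LINT y|M1. exp (- y) * g (exp (- y))) = (LINT y|M2. exp (- y) * g (exp (- y)))"
proof -
 note [measurable_cong] = sets
 note [measurable] = g(2)
 have int0: "integrable M1 (%y. exp (- y))" "integrable M2 (%y. exp (- y))"
  using int[of 0] by simp_all
 let ?D = "\<bar>(LINT y|M1. exp (- y) * g (exp (- y))) - (LINT y|M2. exp (- y) * g (exp (- y)))\<bar>"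
 let ?C = "(LINT y|M1. exp (- y)) + (LINT y|M2. exp (- y))"
 have C0: "0 <= ?C" by (intro add_nonneg_nonneg integral_nonneg) auto
 have bound: "?D <= e * ?C" if e: "e > 0" for e
 proof -
  obtain p where p: "real_polynomial_function p" "\<And>x. x : {0..1} ==> \<bar>g x - p x\<bar> < e"
   using Stone_Weierstrass_real_polynomial_function[OF compact_Icc g(1) e] by blast
  obtain a m where pa: "p = (%x. \<Sum>i\<le>m. a i * x ^ i)"
   using p(1) unfolding real_polynomial_function_iff_sum by blast
  have pe: "exp (- y) * p (exp (- y)) = (\<Sum>i\<le>m. a i * exp (- (real i + 1) * y))" for y :: real
   unfolding pa sum_distrib_left
   by (intro sum.cong refl) (simp add: exp_of_nat_mult[symmetric] exp_add[symmetric] algebra_simps)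
  have intp: "integrable M1 (%y. exp (- y) * p (exp (- y)))" "integrable M2 (%y. exp (- y) * p (exp (- y)))"
   unfolding pe using int by auto
  have eqp: "(LINT y|M1. exp (- y) * p (exp (- y))) = (LINT y|M2. exp (- y) * p (exp (- y)))"
   unfolding pe using int eq by (simp add: lebesgue_sum)
  have one: "\<bar>(LINT y|M. exp (- y) * g (exp (- y))) - (LINT y|M. exp (- y) * p (exp (- y)))\<bar> <= e * (LINT y|M. exp (- y))"
   if s: "sets M = sets borel" and nn: "AE y in M. 0 <= y"
    and i0: "integrable M (%y. exp (- y))" and ip: "integrable M (%y. exp (- y) * p (exp (- y)))" for M :: "real measure"
  proof -
   note [measurable_cong] = s
   have b: "AE y in M. \<bar>exp (- y) * g (exp (- y)) - exp (- y) * p (exp (- y))\<bar> <= e * exp (- y)"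
    using nn
   proof eventually_elim
    case (elim y)
    have "\<bar>g (exp (- y)) - p (exp (- y))\<bar> <= e"
     using p(2)[of "exp (- y)"] elim by simp
    hence "exp (- y) * \<bar>g (exp (- y)) - p (exp (- y))\<bar> <= exp (- y) * e"
     by (intro mult_left_mono) auto
    then show ?case
     by (simp add: abs_mult mult.commute[of e] flip: right_diff_distrib)
   qed
   have pm[measurable]: "p : BM borel"
    unfolding pa by measurable
   have id: "integrable M (%y. exp (- y) * g (exp (- y)) - exp (- y) * p (exp (- y)))"
    by (rule integrable_by[OF integrable_mult_right[OF i0, of e]])
     (use b e in auto)
   have ig: "integrable M (%y. exp (- y) * g (exp (- y)))"
    using Bochner_Integration.integrable_add[OF id ip] by simp
   have "\<bar>(LINT y|M. exp (- y) * g (exp (- y))) - (LINT y|M. exp (- y) * p (exp (- y)))\<bar>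
     = \<bar>\<integral>y. exp (- y) * g (exp (- y)) - exp (- y) * p (exp (- y)) \<partial>M\<bar>"
    using ig ip by simp
   also have "... <= (LINT y|M. \<bar>exp (- y) * g (exp (- y)) - exp (- y) * p (exp (- y))\<bar>)"
    by (rule integral_abs_bound)
   also have "... <= (LINT y|M. e * exp (- y))"
    by (intro integral_mono_AE) (use id i0 b in auto)
   finally show ?thesis by simp
  qed
  show ?thesis
   using one[OF sets(1) nonneg(1) int0(1) intp(1)] one[OF sets(2) nonneg(2) int0(2) intp(2)] eqp
   by (simp add: algebra_simps)
 qed
 have "?D <= e" if e: "e > 0" for e
 proof -
  have "?D <= (e / (?C + 1)) * ?C" using C0 e by (intro bound divide_pos_pos) linarith+
  also have "... = e * (?C / (?C + 1))" by simp
  also have "... <= e * 1"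
  proof (rule mult_left_mono)
   show "?C / (?C + 1) <= 1" using C0 unfolding divide_le_eq_1 by linarith
  qed (use e in simp)
  also have "... = e" by simp
  finally show ?thesis .
 qed
 hence "?D <= 0" by (rule field_le_epsilon) auto
 thus ?thesis by simp
qed

lemma Laplace_uniqueness:
 fixes M1 M2 :: "real measure"
 assumes sets: "sets M1 = sets borel" "sets M2 = sets borel"
  and nonneg: "AE y in M1. 0 <= y" "AE y in M2. 0 <= y"
  and eq: "\<And>\<xi>. 0 < \<xi> ==> (\<integral>\<^sup>+y. ennreal (exp (- \<xi> * y)) \<partial>M1) = (\<integral>\<^sup>+y. ennreal (exp (- \<xi> * y)) \<partial>M2)"
  and fin: "\<And>\<xi>. 0 < \<xi> ==> (\<integral>\<^sup>+y. ennreal (exp (- \<xi> * y)) \<partial>M1) < \<infinity>"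
 shows "M1 = M2"
proof -
 note [measurable_cong] = sets
 have int: "integrable M1 (%y. exp (- (real n + 1) * y))" "integrable M2 (%y. exp (- (real n + 1) * y))" for n
  using fin[of "real n + 1"] eq[of "real n + 1"] by (auto simp: integrable_iff_bounded)
 have eq': "(LINT y|M1. exp (- (real n + 1) * y)) = (LINT y|M2. exp (- (real n + 1) * y))" for n
  using eq[of "real n + 1"] by (simp add: integral_eq_nn_integral)
 have intM: "M = M1 \<or> M = M2 ==> integrable M (%y. exp (- y))" for M
  using int[of 0] by auto
 have fin_b: "emeasure M {..b} < \<infinity>" if M: "M = M1 \<or> M = M2" for M b
 proof -
  have [measurable_cong]: "sets M = sets borel" using M sets by auto
  have "emeasure M {..b} = (\<integral>\<^sup>+y. ind {..b} y \<partial>M)" by simp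
  also have "... <= (\<integral>\<^sup>+y. ennreal (exp b) * ennreal (exp (- 1 * y)) \<partial>M)"
  proof (rule nn_integral_mono)
   fix y
   have "ennreal 1 <= ennreal (exp (b + - 1 * y))" if "y <= b"
    using that by (intro ennreal_leI) simp
   thus "ind {..b} y <= ennreal (exp b) * ennreal (exp (- 1 * y))"
    by (auto simp: indicator_def ennreal_mult simp flip: exp_add ennreal_mult')
  qed
  also have "... = ennreal (exp b) * (\<integral>\<^sup>+y. ennreal (exp (- 1 * y)) \<partial>M)"
   by (intro nn_integral_cmult) measurable
  also have "... < \<infinity>" using M fin[of 1] eq[of 1] by (auto intro!: ennreal_mult_less_top[THEN iffD2])
  finally show ?thesis .
 qed
 have cdf: "emeasure M1 {..b} = emeasure M2 {..b}" for b
 proof -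
  define z where "z = exp (- b)"
  have z: "z > 0" by (simp add: z_def)
  define g where "g j x = max 0 (min 1 (1 + real j * (x - z))) / max x z" for j :: nat and x :: real
  have gm[measurable]: "g j : BM borel" for j unfolding g_def by measurable
  have gc: "continuous_on {0..1} (g j)" for j
   unfolding g_def using z by (intro continuous_intros) (auto simp: max_def)
  have gb: "\<bar>g j x\<bar> <= 1 / z" for j x
  proof -
   have "\<bar>max 0 (min 1 (1 + real j * (x - z)))\<bar> <= 1" by auto
   moreover have "z <= \<bar>max x z\<bar>" by auto
   ultimately show ?thesis
    unfolding g_def abs_divide using z by (intro frac_le) auto
  qed
  have glim: "(%j. exp (- y) * g j (exp (- y))) \<longlonglongrightarrow> ind {..b} y" for y
  proof (cases "y <= b")
   case True
   hence "exp (- y) \<ge> z" by (simp add: z_def)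
   hence "g j (exp (- y)) = 1 / exp (- y)" for j
    using z unfolding g_def by (simp add: max_def min_def)
   thus ?thesis using True by simp
  next
   case False
   hence lt: "exp (- y) < z" by (simp add: z_def)
   obtain J :: nat where J: "real J > 1 / (z - exp (- y))" using reals_Archimedean2 by blast
   have "g j (exp (- y)) = 0" if "j \<ge> J" for j
   proof -
    have "real j * (z - exp (- y)) > 1" 
    proof -
     have "real j > 1 / (z - exp (- y))" using J that by (meson less_le_trans of_nat_mono)
     thus ?thesis using lt by (simp add: field_simps)
    qed
    hence "1 + real j * (exp (- y) - z) < 0" by (simp add: algebra_simps)
    thus ?thesis unfolding g_def by simp
   qed
   hence "eventually (%j. exp (- y) * g j (exp (- y)) = 0) sequentially"
    unfolding eventually_sequentially by (intro exI[of _ J]) auto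
   thus ?thesis using False by (auto intro: tendsto_eventually)
  qed
  have lim: "(%j. \<integral>y. exp (- y) * g j (exp (- y)) \<partial>M) \<longlonglongrightarrow> (LINT y|M. ind {..b} y)"
   if M: "M = M1 \<or> M = M2" for M
  proof -
   have [measurable_cong]: "sets M = sets borel" using M sets by auto
   show ?thesis
   proof (rule integral_dominated_convergence[where w="%y. 1 / z * exp (- y)"])
    show "integrable M (%y. 1 / z * exp (- y))" using intM[OF M] by simp
    show "AE y in M. norm (exp (- y) * g j (exp (- y))) <= 1 / z * exp (- y)" for j
    proof (rule AE_I2)
     fix y :: real
     have "\<bar>g j (exp (- y))\<bar> * exp (- y) <= 1 / z * exp (- y)" by (intro mult_right_mono gb) simp
     thus "norm (exp (- y) * g j (exp (- y))) <= 1 / z * exp (- y)"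
      by (simp add: abs_mult mult.commute)
    qed
   qed (use glim in auto)
  qed
  have "(%j. \<integral>y. exp (- y) * g j (exp (- y)) \<partial>M1) \<longlonglongrightarrow> (LINT y|M2. ind {..b} y)"
   using lim[of M2] integral_exp_continuous_eq[OF sets nonneg int eq' gc gm] by simp
  with lim[of M1] have "(LINT y|M1. ind {..b} y) = (\<integral>y. ind {..b} y \<partial>M2 :: real)"
   by (intro LIMSEQ_unique) auto
  hence "measure M1 {..b} = measure M2 {..b}"
   using sets_eq_imp_space_eq[OF sets(1)] sets_eq_imp_space_eq[OF sets(2)]
   by simp
  thus ?thesis using fin_b[of M1 b] fin_b[of M2 b]
   by (simp add: emeasure_eq_ennreal_measure less_top)
 qed
 show ?thesis
 proof (rule measure_eqI_generator_eq[where E="range (%b. {..b})" and \<Omega>=UNIV and A="%n. {..real n}"])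
  show "Int_stable (range (%b::real. {..b}))" by (auto simp: Int_stable_def)
  show "sets M1 = sigma_sets UNIV (range (%b::real. {..b}))" "sets M2 = sigma_sets UNIV (range (%b::real. {..b}))"
   unfolding sets borel_eq_atMost by (auto simp: image_def)
  show "(\<Union>n. {..real n}) = UNIV" using real_arch_simple by auto
  show "emeasure M1 {..real i} \<noteq> \<infinity>" for i using fin_b[of M1 "real i"] by simp
 qed (use cdf in auto)
qed

section \<open>The Mittag-Leffler function\<close>

lemma has_bochner_integral_Beta:
 fixes a b t :: real
 assumes "a > 0" "b > 0" "t > 0"
 shows "has_bochner_integral lborel (%y. ind {0..t} y * (y powr (a - 1) * (t - y) powr (b - 1)))
     (t powr (a + b - 1) * Beta a b)"
proof -
 have B: "Beta a b \<ge> 0" using assms by (simp add: Beta_def Gamma_real_pos less_imp_le)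
 have "(\<integral>\<^sup>+z. ennreal (ind {0..1} z * (z powr (a - 1) * (1 - z) powr (b - 1))) \<partial>lborel) = ennreal (Beta a b)"
  by (rule nn_integral_has_integral_lebesgue[OF _ has_integral_Beta_real]) (use assms in auto)
 hence "has_bochner_integral lborel (%z. ind {0..1} z * (z powr (a - 1) * (1 - z) powr (b - 1))) (Beta a b)"
  using B by (intro has_bochner_integral_nn_integral) auto
 hence "has_bochner_integral lborel
   (%z. t powr (a + b - 2) * (ind {0..1} z * (z powr (a - 1) * (1 - z) powr (b - 1)))) (t powr (a + b - 2) * Beta a b)"
  by (rule has_bochner_integral_mult_right)
 moreover have "t powr (a + b - 2) * (ind {0..1} z * (z powr (a - 1) * (1 - z) powr (b - 1)))
   = ind {0..t} (0 + t * z) * ((0 + t * z) powr (a - 1) * (t - (0 + t * z)) powr (b - 1))" for z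
 proof (cases "z : {0..1}")
  case True
  hence "(t * z) powr (a - 1) * (t - t * z) powr (b - 1) = (t powr (a - 1) * t powr (b - 1)) * (z powr (a - 1) * (1 - z) powr (b - 1))"
   using assms powr_mult[of t "1 - z" "b - 1"] by (simp add: powr_mult right_diff_distrib)
  also have "t powr (a - 1) * t powr (b - 1) = t powr (a + b - 2)"
   by (simp add: powr_add[symmetric])
  finally show ?thesis using True assms by (simp add: mult_left_le)
 next
  case False
  thus ?thesis using assms by (auto simp: zero_le_mult_iff)
 qed
 moreover have "t powr (a + b - 2) * Beta a b = (t powr (a + b - 1) * Beta a b) /\<^sub>R \<bar>t\<bar>"
  using assms powr_add[of t "a + b - 2" 1] by (simp add: field_simps)
 ultimately show ?thesis
  using assms by (subst lborel_has_bochner_integral_real_affine_iff[of t _ _ 0]) auto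
qed

text \<open>A cheap lower bound, sufficient for the everywhere convergence of the Mittag-Leffler series.\<close>

lemma Gamma_real_ge:
 assumes "x \<ge> (1::real)" "R \<ge> 0"
 shows "R powr (x - 1) * exp (- R) <= Gamma x"
proof -
 have 1: "(\<integral>\<^sup>+t. ennreal (ind {R..} t * exp (- t)) \<partial>lborel) = ennreal (exp (- R))"
  using nn_integral_has_integral_lebesgue[OF _ has_integral_exp_minus_to_infinity[of 1 R]] by simp
 have "ennreal (R powr (x - 1) * exp (- R)) = (\<integral>\<^sup>+t. ennreal (R powr (x - 1)) * ennreal (ind {R..} t * exp (- t)) \<partial>lborel)"
  by (subst nn_integral_cmult, measurable) (simp only: 1 ennreal_mult[OF powr_ge_zero exp_ge_zero])
 also have "... <= (\<integral>\<^sup>+t. ennreal (ind {0..} t * t powr (x - 1) / exp t) \<partial>lborel)"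
  using assms by (intro nn_integral_mono)
   (auto simp: indicator_def exp_minus field_simps ennreal_mult[symmetric] intro!: ennreal_leI powr_mono2 divide_right_mono)
 also have "... = ennreal (Gamma x)" using assms by (subst Gamma_conv_nn_integral_real) auto
 finally show ?thesis using assms by (subst (asm) ennreal_le_iff) (auto intro!: less_imp_le Gamma_real_pos)
qed

lemma summable_Mittag_Leffler:
 fixes z \<alpha> b :: real
 assumes "\<alpha> > 0" "b \<ge> 1"
 shows "summable (%n. \<bar>z\<bar> ^ n / Gamma (\<alpha> * real n + b))"
proof -
 define R where "R = (2 * (\<bar>z\<bar> + 1)) powr (1 / \<alpha>)"
 have R: "R powr \<alpha> = 2 * (\<bar>z\<bar> + 1)" "R \<ge> 1" using assms by (auto simp: R_def powr_powr ge_one_powr_ge_zero)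
 have ge1: "1 <= \<alpha> * real n + b" for n using assms by (simp add: add_increasing)
 hence Gpos: "Gamma (\<alpha> * real n + b) > 0" for n by (intro Gamma_real_pos) (use ge1[of n] in linarith)
 have bound: "\<bar>z\<bar> ^ n / Gamma (\<alpha> * real n + b) <= exp R * (1/2) ^ n" for n
 proof -
  have "\<bar>z\<bar> ^ n * 2 ^ n <= (2 * (\<bar>z\<bar> + 1)) ^ n"
   by (subst power_mult_distrib[symmetric]) (intro power_mono, auto)
  also have "... = (R powr \<alpha>) powr real n" using R by (simp add: powr_realpow)
  also have "... = R powr (\<alpha> * real n)" by (simp add: powr_powr)
  also have "... <= R powr (\<alpha> * real n + b - 1)" using R assms by (intro powr_mono) auto
  also have "... <= exp R * Gamma (\<alpha> * real n + b)"
   using Gamma_real_ge[OF ge1[of n], of R] R by (simp add: exp_minus divide_simps mult.commute)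
  finally have "\<bar>z\<bar> ^ n * 2 ^ n <= exp R * Gamma (\<alpha> * real n + b)" .
  hence "\<bar>z\<bar> ^ n <= exp R * Gamma (\<alpha> * real n + b) / 2 ^ n" by (simp add: pos_le_divide_eq)
  thus ?thesis using Gpos[of n] by (simp add: pos_divide_le_eq power_divide mult.commute)
 qed
 show ?thesis
  by (rule summable_comparison_test'[of "%n. exp R * (1/2) ^ n" 0])
   (use bound Gpos in \<open>simp_all add: summable_mult summable_geometric abs_of_pos\<close>)
qed

lemma Mittag_Leffler_sums:
 assumes "\<alpha> > 0"
 shows "(%n. z ^ n / Gamma (\<alpha> * real n + 1)) sums Mittag_Leffler \<alpha> z"
proof -
 have G: "\<bar>Gamma (\<alpha> * real n + 1)\<bar> = Gamma (\<alpha> * real n + 1)" for n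
  using assms by (intro abs_of_pos Gamma_real_pos add_nonneg_pos) auto
 have "norm (z ^ n / Gamma (\<alpha> * real n + 1)) = \<bar>z\<bar> ^ n / Gamma (\<alpha> * real n + 1)" for n
  unfolding real_norm_def abs_divide power_abs G ..
 hence "summable (%n. norm (z ^ n / Gamma (\<alpha> * real n + 1)))"
  using summable_Mittag_Leffler[OF assms order_refl, of z] by (simp only:)
 thus ?thesis unfolding Mittag_Leffler_def by (rule summable_sums[OF summable_norm_cancel])
qed

lemma Mittag_Leffler_0 [simp]: "Mittag_Leffler \<alpha> 0 = 1"
proof -
 have "(%n. 0 ^ n / Gamma (\<alpha> * real n + 1)) sums (\<Sum>n\<in>{0}. 0 ^ n / Gamma (\<alpha> * real n + 1))"
  by (rule sums_finite) auto
 hence "Mittag_Leffler \<alpha> 0 = (\<Sum>n\<in>{0}. 0 ^ n / Gamma (\<alpha> * real n + 1))"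
  unfolding Mittag_Leffler_def by (rule sums_unique[symmetric])
 also have "... = 1" by simp
 finally show ?thesis .
qed

lemma continuous_Mittag_Leffler:
 assumes "\<alpha> > 0" shows "continuous_on UNIV (Mittag_Leffler \<alpha>)"
proof -
 have s: "summable (%n. (1 / Gamma (\<alpha> * real n + 1)) * z ^ n)" for z
  using sums_summable[OF Mittag_Leffler_sums[OF assms, of z]] by simp
 have "isCont (%z. \<Sum>n. (1 / Gamma (\<alpha> * real n + 1)) * z ^ n) z" for z :: real
  by (rule isCont_powser_converges_everywhere[OF s])
 thus ?thesis unfolding Mittag_Leffler_def by (simp add: continuous_at_imp_continuous_on)
qed

lemma borel_measurable_Mittag_Leffler [measurable]:
 assumes "\<alpha> > 0" shows "Mittag_Leffler \<alpha> : BM borel"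
 using continuous_Mittag_Leffler[OF assms] by (rule borel_measurable_continuous_onI)

text \<open>Compare the increments of F over [t, l t] with f at the two end points and let l tend to 1. The
two inequalities say that f is a decreasing derivative of F.\<close>

lemma monotone_density:
 fixes F f :: "real => real"
 assumes upper: "\<And>a b. 0 < a ==> a < b ==> F b - F a <= (b - a) * f a"
  and lower: "\<And>a b. 0 < a ==> a < b ==> (b - a) * f b <= F b - F a"
  and lim: "((%t. F t / t powr \<rho>) \<longlongrightarrow> c) at_top"
 shows "((%t. f t * t powr (1 - \<rho>)) \<longlongrightarrow> c * \<rho>) at_top"
proof -
 define q where "q l = c * ((l powr \<rho> - 1) / (l - 1))" for l :: real
 have "((%l. l powr \<rho>) has_real_derivative \<rho> * 1 powr (\<rho> - 1)) (at 1)"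
  by (rule has_real_derivative_powr) simp
 hence "((%l. (l powr \<rho> - 1) / (l - 1)) \<longlongrightarrow> \<rho>) (at (1::real))"
  by (simp add: has_field_derivative_iff)
 hence q: "(q \<longlongrightarrow> c * \<rho>) (at 1)"
  unfolding q_def by (rule tendsto_mult_left)
 have quot: "((%t. (F (l * t) - F t) / ((l - 1) * t powr \<rho>)) \<longlongrightarrow> q l) at_top" if l: "l > 0" "l \<noteq> 1" for l
 proof -
  have "filterlim (%t. l * t) at_top at_top"
   using l by (intro filterlim_tendsto_pos_mult_at_top[OF tendsto_const]) (auto simp: filterlim_ident)
  from filterlim_compose[OF lim this]
  have "((%t. (l powr \<rho> * (F (l * t) / (l * t) powr \<rho>) - F t / t powr \<rho>) / (l - 1)) \<longlongrightarrow> (l powr \<rho> * c - c) / (l - 1)) at_top"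
   using lim l by (intro tendsto_intros) auto
  moreover have "(l powr \<rho> * c - c) / (l - 1) = q l" by (simp add: q_def algebra_simps)
  moreover have "\<forall>\<^sub>F t in at_top. (l powr \<rho> * (F (l * t) / (l * t) powr \<rho>) - F t / t powr \<rho>) / (l - 1)
    = (F (l * t) - F t) / ((l - 1) * t powr \<rho>)"
   using eventually_gt_at_top[of 0]
  proof eventually_elim
   case (elim t)
   then show ?case using l by (simp add: powr_mult diff_divide_distrib[symmetric])
  qed
  ultimately show ?thesis by (auto intro: Lim_transform_eventually)
 qed
 have powr1: "x / (k * t powr \<rho>) = (x / (k * t)) * t powr (1 - \<rho>)" if "t > 0" for x k t :: real
  using that by (simp add: powr_diff)
 show ?thesis
 proof (rule order_tendstoI)
  fix a assume a: "a < c * \<rho>"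
  obtain l where l: "l > 1" "q l > a"
  proof -
   have "eventually (%l. q l > a) (at_right 1)"
    using order_tendstoD(1)[OF q a] by (simp add: eventually_at_split)
   moreover have "eventually (%l::real. l > 1) (at_right 1)" by (simp add: eventually_at_filter)
   ultimately have "eventually (%l. l > 1 \<and> q l > a) (at_right 1)" by eventually_elim auto
   thus thesis using that eventually_happens'[OF trivial_limit_at_right_real] by blast
  qed
  have "\<forall>\<^sub>F t in at_top. a < (F (l * t) - F t) / ((l - 1) * t powr \<rho>)"
   using order_tendstoD(1)[OF quot l(2)] l by auto
  with eventually_gt_at_top[of 0] show "\<forall>\<^sub>F t in at_top. a < f t * t powr (1 - \<rho>)"
  proof eventually_elim
   case (elim t)
   have "t < l * t" using elim l by simp
   hence "F (l * t) - F t <= (l * t - t) * f t" using upper elim by blast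
   hence "(F (l * t) - F t) / ((l - 1) * t) <= f t"
    using elim l by (simp add: pos_divide_le_eq algebra_simps)
   hence "(F (l * t) - F t) / ((l - 1) * t) * t powr (1 - \<rho>) <= f t * t powr (1 - \<rho>)"
    by (rule mult_right_mono) simp
   then show ?case using elim powr1[of t "F (l * t) - F t" "l - 1"] by simp
  qed
 next
  fix a assume a: "c * \<rho> < a"
  obtain l where l: "0 < l" "l < 1" "q l < a"
  proof -
   have "eventually (%l. q l < a) (at_left 1)"
    using order_tendstoD(2)[OF q a] by (simp add: eventually_at_split)
   moreover have "eventually (%l::real. l : {0<..<1}) (at_left 1)" by (rule eventually_at_leftI[of 0]) auto
   ultimately have "eventually (%l. l : {0<..<1} \<and> q l < a) (at_left 1)" by eventually_elim auto
   then obtain l where "l : {0<..<1} \<and> q l < a"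
    using eventually_happens'[OF trivial_limit_at_left_real] by blast
   thus thesis using that[of l] by simp
  qed
  have "\<forall>\<^sub>F t in at_top. (F (l * t) - F t) / ((l - 1) * t powr \<rho>) < a"
   using order_tendstoD(2)[OF quot l(3)] l by auto
  with eventually_gt_at_top[of 0] show "\<forall>\<^sub>F t in at_top. f t * t powr (1 - \<rho>) < a"
  proof eventually_elim
   case (elim t)
   have "l * t < t" using elim l by simp
   hence "(t - l * t) * f t <= F t - F (l * t)" using lower[of "l * t" t] elim l by simp
   hence "f t * ((1 - l) * t) <= F t - F (l * t)" by (simp add: algebra_simps)
   hence "f t <= (F t - F (l * t)) / ((1 - l) * t)"
    using elim l by (simp add: pos_le_divide_eq)
   also have "... = (F (l * t) - F t) / ((l - 1) * t)"
    using minus_divide_divide[of "F t - F (l * t)" "(1 - l) * t"] by (simp add: algebra_simps)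
   finally have "f t * t powr (1 - \<rho>) <= (F (l * t) - F t) / ((l - 1) * t) * t powr (1 - \<rho>)"
    by (rule mult_right_mono) simp
   then show ?case using elim powr1[of t "F (l * t) - F t" "l - 1"] by simp
  qed
 qed
qed

text \<open>Termwise integration of the series: each term is a Beta integral. The cases beta = alpha and
beta = 0 are the fractional and the ordinary primitive.\<close>

lemma Mittag_Leffler_convolution:
 fixes \<alpha> \<beta> \<theta> t :: real
 assumes "0 < \<alpha>" "0 <= \<beta>" "\<beta> < 1" "0 < t"
 defines "h \<equiv> %y. ind {0..t} y * (Mittag_Leffler \<alpha> (- \<theta> * y powr \<alpha>) * (t - y) powr (- \<beta>))"
 shows "integrable lborel h"
  and "(%n. Gamma (1 - \<beta>) * ((- \<theta>) ^ n * t powr (\<alpha> * real n + 1 - \<beta>) / Gamma (\<alpha> * real n + 2 - \<beta>))) sums integral\<^sup>L lborel h"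
proof -
 define u where "u n y = ind {0..t} y * ((y powr ((\<alpha> * real n + 1) - 1)) * (t - y) powr ((1 - \<beta>) - 1))" for n :: nat and y
 define e where "e n = (- \<theta>) ^ n / Gamma (\<alpha> * real n + 1)" for n :: nat
 define s where "s n = Gamma (1 - \<beta>) * (t powr (\<alpha> * real n + 1 - \<beta>) / Gamma (\<alpha> * real n + 2 - \<beta>))" for n :: nat
 have pos: "0 < \<alpha> * real n + 1" for n using assms by (intro add_nonneg_pos) auto
 have G: "0 < Gamma (\<alpha> * real n + 1)" for n using pos by (rule Gamma_real_pos)
 have G2: "0 < Gamma (\<alpha> * real n + 2 - \<beta>)" for n using pos[of n] assms by (intro Gamma_real_pos) linarith
 have hb: "has_bochner_integral lborel (u n) (Gamma (\<alpha> * real n + 1) * s n)" for n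
 proof -
  have "t powr ((\<alpha> * real n + 1) + (1 - \<beta>) - 1) * Beta (\<alpha> * real n + 1) (1 - \<beta>) = Gamma (\<alpha> * real n + 1) * s n"
   by (simp add: Beta_def s_def algebra_simps)
  thus ?thesis
   using has_bochner_integral_Beta[OF pos[of n], of "1 - \<beta>" t] assms unfolding u_def by simp
 qed
 have hbe: "has_bochner_integral lborel (%y. e n * u n y) ((- \<theta>) ^ n * s n)" for n
  using has_bochner_integral_mult_right[OF hb[of n], of "e n"] G[of n] by (simp add: e_def)
 have u0: "0 <= u n y" for n y by (simp add: u_def)
 have hbn: "(LINT y|lborel. norm (e n * u n y)) = \<bar>\<theta>\<bar> ^ n * s n" for n
 proof -
  have "norm (e n * u n y) = \<bar>e n\<bar> * u n y" for y using u0[of n y] by (simp add: abs_mult)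
  hence "(LINT y|lborel. norm (e n * u n y)) = \<bar>e n\<bar> * (Gamma (\<alpha> * real n + 1) * s n)"
   using hb[of n] by (simp add: has_bochner_integral_iff)
  thus ?thesis using G[of n] by (simp add: e_def abs_mult power_abs)
 qed
 have s_alt: "\<bar>\<theta>\<bar> ^ n * s n = Gamma (1 - \<beta>) * t powr (1 - \<beta>) * (\<bar>\<theta> * t powr \<alpha>\<bar> ^ n / Gamma (\<alpha> * real n + (2 - \<beta>)))" for n
 proof -
  have "t powr (\<alpha> * real n + 1 - \<beta>) = t powr (1 - \<beta>) * (t powr \<alpha>) ^ n"
   using assms by (simp add: powr_realpow[symmetric] powr_powr powr_add[symmetric] algebra_simps)
  thus ?thesis by (simp add: s_def abs_mult power_mult_distrib add_diff_eq)
 qed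
 have summ: "summable (%n. \<integral>y. norm (e n * u n y) \<partial>lborel)"
  unfolding hbn s_alt using assms by (intro summable_mult summable_Mittag_Leffler) auto
 have e_sums: "(%n. e n * u n y) sums h y" if y0: "y \<noteq> 0" for y
 proof (cases "y : {0..t}")
  case True
  have "(%n. ((- \<theta> * y powr \<alpha>) ^ n / Gamma (\<alpha> * real n + 1)) * (t - y) powr (- \<beta>)) sums (Mittag_Leffler \<alpha> (- \<theta> * y powr \<alpha>) * (t - y) powr (- \<beta>))"
   using assms by (intro sums_mult2 Mittag_Leffler_sums)
  moreover have "((- \<theta> * y powr \<alpha>) ^ n / Gamma (\<alpha> * real n + 1)) * (t - y) powr (- \<beta>) = e n * u n y" for n
  proof -
   have "(- \<theta> * y powr \<alpha>) ^ n = (- \<theta>) ^ n * y powr (\<alpha> * real n)"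
    using True y0 by (simp only: power_mult_distrib) (simp add: powr_realpow[symmetric] powr_powr)
   thus ?thesis using True by (simp add: e_def u_def)
  qed
  ultimately show ?thesis using True by (simp add: h_def)
 next
  case False
  thus ?thesis by (simp add: u_def h_def)
 qed
 have AE0: "AE y in lborel. y \<noteq> (0::real)" by (rule AE_lborel_singleton)
 have hm: "h : BM lborel"
  unfolding h_def using assms(1) by measurable
 have int: "integrable lborel (%y. e n * u n y)" for n using hbe[of n] by (simp add: has_bochner_integral_iff)
 have sn: "summable (%n. norm (e n * u n y))" if y0: "y \<noteq> 0" for y
 proof (cases "y : {0..t}")
  case True
  have eq: "norm (e n * u n y) = (\<bar>\<theta> * y powr \<alpha>\<bar> ^ n / Gamma (\<alpha> * real n + 1)) * (t - y) powr (- \<beta>)" for n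
  proof -
   have "\<bar>\<theta> * y powr \<alpha>\<bar> ^ n = \<bar>\<theta>\<bar> ^ n * y powr (\<alpha> * real n)"
    using True y0 by (simp only: power_mult_distrib abs_mult) (simp add: powr_realpow[symmetric] powr_powr)
   thus ?thesis using True G[of n] by (simp add: e_def u_def abs_mult power_abs)
  qed
  show ?thesis unfolding eq using assms by (intro summable_mult2 summable_Mittag_Leffler) auto
 next
  case False
  thus ?thesis by (simp add: u_def)
 qed
 have AEs: "AE y in lborel. summable (%n. norm (e n * u n y))"
  using AE0 by eventually_elim (rule sn)
 have AEh: "AE y in lborel. (\<Sum>n. e n * u n y) = h y"
  using AE0 by eventually_elim (rule sums_unique[symmetric, OF e_sums])
 show "integrable lborel h"
  using integrable_suminf[OF int AEs summ] AEh hm integrable_cong_AE[of "%y. \<Sum>n. e n * u n y" lborel h] by (auto dest: borel_measurable_integrable)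
 have "integral\<^sup>L lborel h = (LINT y|lborel. (\<Sum>n. e n * u n y))"
  using AEh hm integrable_suminf[OF int AEs summ] by (intro integral_cong_AE) (auto dest: borel_measurable_integrable)
 moreover have "(%n. \<integral>y. e n * u n y \<partial>lborel) sums (LINT y|lborel. (\<Sum>n. e n * u n y))"
  by (rule sums_integral[OF int AEs summ])
 ultimately show "(%n. Gamma (1 - \<beta>) * ((- \<theta>) ^ n * t powr (\<alpha> * real n + 1 - \<beta>) / Gamma (\<alpha> * real n + 2 - \<beta>))) sums integral\<^sup>L lborel h"
  using hbe by (simp add: has_bochner_integral_iff s_def algebra_simps)
qed

text \<open>The two primitives of the preceding lemma are related: the fractional one equals t^(1 - alpha) /
Gamma(2 - alpha) - theta times the ordinary one. The former is of smaller order by monotonicity,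
which determines the ordinary primitive asymptotically, and the density is then recovered by
monotonicity.\<close>

lemma Mittag_Leffler_asymp:
 fixes \<alpha> \<theta> :: real
 assumes a: "0 < \<alpha>" "\<alpha> < 1" and th: "0 < \<theta>"
  and nonneg: "\<And>t. 0 <= t ==> 0 <= Mittag_Leffler \<alpha> (- \<theta> * t powr \<alpha>)"
  and anti: "\<And>s t. 0 <= s ==> s <= t ==> Mittag_Leffler \<alpha> (- \<theta> * t powr \<alpha>) <= Mittag_Leffler \<alpha> (- \<theta> * s powr \<alpha>)"
 shows "((%t. Mittag_Leffler \<alpha> (- \<theta> * t powr \<alpha>) * t powr \<alpha>) \<longlongrightarrow> 1 / (\<theta> * Gamma (1 - \<alpha>))) at_top"
proof -
 define f where "f t = Mittag_Leffler \<alpha> (- \<theta> * t powr \<alpha>)" for t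
 have fm[measurable]: "f : BM borel" unfolding f_def using a(1) by measurable
 have f0: "0 <= f t" if "0 <= t" for t using nonneg that by (simp add: f_def)
 have fanti: "f t <= f s" if "0 <= s" "s <= t" for s t using anti that by (simp add: f_def)
 define h where "h \<beta> t y = ind {0..t} y * (f y * (t - y) powr (- \<beta>))" for \<beta> t y
 define F where "F t = (LINT y|lborel. ind {0..t} y * f y)" for t
 have inth: "integrable lborel (h \<beta> t)" if "0 <= \<beta>" "\<beta> < 1" "0 < t" for \<beta> t
  unfolding h_def f_def by (rule Mittag_Leffler_convolution(1)) (use a that in auto)
 have sumsh: "(%n. Gamma (1 - \<beta>) * ((- \<theta>) ^ n * t powr (\<alpha> * real n + 1 - \<beta>) / Gamma (\<alpha> * real n + 2 - \<beta>))) sums integral\<^sup>L lborel (h \<beta> t)"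
  if "0 <= \<beta>" "\<beta> < 1" "0 < t" for \<beta> t
  unfolding h_def f_def by (rule Mittag_Leffler_convolution(2)) (use a that in auto)
 have AE0: "AE y in lborel. h 0 t y = ind {0..t} y * f y" for t
  using AE_lborel_singleton[of t] by eventually_elim (simp add: h_def indicator_def)
 have intF: "integrable lborel (%y. ind {0..t} y * f y)" if "0 < t" for t
  using inth[of 0 t] that AE0[of t] by (subst integrable_cong_AE[where g="h 0 t"]) (auto simp: h_def)
 have F_h: "F t = integral\<^sup>L lborel (h 0 t)" if "0 < t" for t
 proof -
  have "h 0 t : BM lborel" unfolding h_def by measurable
  thus ?thesis unfolding F_def using AE0[of t] by (intro integral_cong_AE) auto
 qed
 define I where "I t = integral\<^sup>L lborel (h \<alpha> t) / Gamma (1 - \<alpha>)" for t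
 have G1: "0 < Gamma (1 - \<alpha>)" using a by (intro Gamma_real_pos) simp
 have G2: "0 < Gamma (2 - \<alpha>)" using a by (intro Gamma_real_pos) simp
 have G2': "Gamma (2 - \<alpha>) = (1 - \<alpha>) * Gamma (1 - \<alpha>)"
  using Gamma_plus1[of "1 - \<alpha>"] a nonpos_Ints_nonpos[of "1 - \<alpha>"] by force
 have volterra: "I t = t powr (1 - \<alpha>) / Gamma (2 - \<alpha>) - \<theta> * F t" if t: "0 < t" for t
 proof -
  define S where "S n = (- \<theta>) ^ n * t powr (\<alpha> * real n + 1 - \<alpha>) / Gamma (\<alpha> * real n + 2 - \<alpha>)" for n :: nat
  have "(%n. Gamma (1 - \<alpha>) * S n) sums integral\<^sup>L lborel (h \<alpha> t)"
   unfolding S_def by (rule sumsh) (use a t in auto)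
  hence "(%n. (Gamma (1 - \<alpha>) * S n) / Gamma (1 - \<alpha>)) sums I t"
   unfolding I_def by (rule sums_divide)
  hence 1: "S sums I t" using G1 by simp
  have "(%n. (- \<theta>) * ((- \<theta>) ^ n * t powr (\<alpha> * real n + 1) / Gamma (\<alpha> * real n + 2))) sums ((- \<theta>) * F t)"
   using sumsh[of 0 t] t unfolding F_h[OF t] by (intro sums_mult) simp
  moreover have "(- \<theta>) * ((- \<theta>) ^ n * t powr (\<alpha> * real n + 1) / Gamma (\<alpha> * real n + 2)) = S (Suc n)" for n
   by (simp add: S_def algebra_simps)
  ultimately have "(%n. S (Suc n)) sums ((- \<theta>) * F t)" by simp
  hence "S sums ((- \<theta>) * F t + S 0)" by (simp add: sums_Suc_iff)
  hence "I t = (- \<theta>) * F t + S 0" using 1 sums_unique2 by blast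
  thus ?thesis by (simp add: S_def)
 qed
 have h0: "0 <= h \<beta> t y" for \<beta> t y using f0[of y] by (auto simp: h_def indicator_def)
 have I0: "0 <= I t" for t unfolding I_def using G1 h0 by (intro divide_nonneg_pos integral_nonneg) auto
 have Fdiff: "F b - F s = (LINT y|lborel. ind {s<..b} y * f y)"
  and intd: "integrable lborel (%y. ind {s<..b} y * f y)" if "0 < s" "s < b" for s b
 proof -
  have e: "ind {s<..b} y * f y = ind {0..b} y * f y - ind {0..s} y * f y" for y
   using that by (auto simp: indicator_def)
  show "integrable lborel (%y. ind {s<..b} y * f y)"
   unfolding e using intF[of s] intF[of b] that by auto
  show "F b - F s = (LINT y|lborel. ind {s<..b} y * f y)"
   unfolding e F_def using intF[of s] intF[of b] that by simp
 qed
 have upper: "F b - F s <= (b - s) * f s" if "0 < s" "s < b" for s b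
 proof -
  have "(LINT y|lborel. ind {s<..b} y * f y) <= (LINT y|lborel. ind {s<..b} y * f s)"
   using intd[OF that] that fanti[of s] by (intro integral_mono) (auto split: split_indicator)
  thus ?thesis using Fdiff[OF that] that by simp
 qed
 have lower: "(b - s) * f b <= F b - F s" if "0 < s" "s < b" for s b
 proof -
  have "(LINT y|lborel. ind {s<..b} y * f b) <= (LINT y|lborel. ind {s<..b} y * f y)"
   using intd[OF that] that fanti[of _ b] by (intro integral_mono) (auto split: split_indicator)
  thus ?thesis using Fdiff[OF that] that by simp
 qed
 define c where "c = 1 / (\<theta> * Gamma (2 - \<alpha>))"
 have c0: "0 < c" using th G2 by (simp add: c_def)
 have Fle: "F t <= c * t powr (1 - \<alpha>)" if t: "0 < t" for t
 proof -
  have "\<theta> * F t <= t powr (1 - \<alpha>) / Gamma (2 - \<alpha>)" using volterra[OF t] I0[of t] by simp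
  thus ?thesis using th G2 by (simp add: c_def pos_le_divide_eq mult_ac)
 qed
 have fle: "f t <= c * t powr (- \<alpha>)" if t: "0 < t" for t
 proof -
  have "(LINT y|lborel. ind {0..t} y * f t) <= F t"
   unfolding F_def
  proof (rule integral_mono)
   show "integrable lborel (%y. ind {0..t} y * f t)"
    using t by (intro integrable_mult_left integrable_real_indicator) auto
   show "ind {0..t} y * f t <= ind {0..t} y * f y" for y
    using fanti[of y t] by (auto split: split_indicator)
  qed (rule intF[OF t])
  hence "t * f t <= c * t powr (1 - \<alpha>)" using Fle[OF t] t by simp
  also have "... = t * (c * t powr (- \<alpha>))" using t powr_add[of t 1 "- \<alpha>"] by simp
  finally show ?thesis using t by simp
 qed
 define C where "C = c * Beta (1 - \<alpha>) (1 - \<alpha>) / Gamma (1 - \<alpha>)"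
 have Ile: "I t <= C * t powr (1 - 2 * \<alpha>)" if t: "0 < t" for t
 proof -
  have hb: "has_bochner_integral lborel (%y. c * (ind {0..t} y * (y powr ((1 - \<alpha>) - 1) * (t - y) powr ((1 - \<alpha>) - 1))))
   (c * (t powr ((1 - \<alpha>) + (1 - \<alpha>) - 1) * Beta (1 - \<alpha>) (1 - \<alpha>)))"
   using a t by (intro has_bochner_integral_mult_right has_bochner_integral_Beta) auto
  have "integral\<^sup>L lborel (h \<alpha> t) <= (LINT y|lborel. c * (ind {0..t} y * (y powr ((1 - \<alpha>) - 1) * (t - y) powr ((1 - \<alpha>) - 1))))"
  proof (rule integral_mono_AE)
   show "integrable lborel (h \<alpha> t)" using inth a t by simp
   show "integrable lborel (%y. c * (ind {0..t} y * (y powr ((1 - \<alpha>) - 1) * (t - y) powr ((1 - \<alpha>) - 1))))"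
    using hb by (simp add: has_bochner_integral_iff)
   show "AE y in lborel. h \<alpha> t y <= c * (ind {0..t} y * (y powr ((1 - \<alpha>) - 1) * (t - y) powr ((1 - \<alpha>) - 1)))"
    using AE_lborel_singleton[of 0]
   proof eventually_elim
    case (elim y)
    show ?case
    proof (cases "y : {0..t}")
     case True
     hence "f y * (t - y) powr (- \<alpha>) <= (c * y powr (- \<alpha>)) * (t - y) powr (- \<alpha>)"
      using elim by (intro mult_right_mono fle) auto
     thus ?thesis using True by (simp add: h_def)
    qed (simp add: h_def)
   qed
  qed
  also have "... = c * (t powr ((1 - \<alpha>) + (1 - \<alpha>) - 1) * Beta (1 - \<alpha>) (1 - \<alpha>))"
   using hb by (simp add: has_bochner_integral_iff)
  also have "(1 - \<alpha>) + (1 - \<alpha>) - 1 = 1 - 2 * \<alpha>" by simp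
  finally show ?thesis using G1 by (simp add: I_def C_def field_simps)
 qed
 have lim0: "((%t. (C / \<theta>) * t powr (- \<alpha>)) \<longlongrightarrow> (C / \<theta>) * 0) at_top"
  by (intro tendsto_mult_left tendsto_neg_powr[OF _ filterlim_ident]) (use a in auto)
 have "((%t. F t / t powr (1 - \<alpha>)) \<longlongrightarrow> c) at_top"
 proof (rule tendsto_sandwich)
  show "((%t. c - (C / \<theta>) * t powr (- \<alpha>)) \<longlongrightarrow> c) at_top"
   using tendsto_diff[OF tendsto_const[of c] lim0] by simp
  show "\<forall>\<^sub>F t in at_top. F t / t powr (1 - \<alpha>) <= c"
   using eventually_gt_at_top[of 0] by eventually_elim (simp add: Fle pos_divide_le_eq)
  show "\<forall>\<^sub>F t in at_top. c - (C / \<theta>) * t powr (- \<alpha>) <= F t / t powr (1 - \<alpha>)"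
   using eventually_gt_at_top[of 0]
  proof eventually_elim
   case (elim t)
   have "t powr (1 - 2 * \<alpha>) = t powr (- \<alpha>) * t powr (1 - \<alpha>)" by (simp add: powr_add[symmetric])
   hence "t powr (1 - \<alpha>) / Gamma (2 - \<alpha>) - \<theta> * F t <= C * (t powr (- \<alpha>) * t powr (1 - \<alpha>))"
    using Ile[OF elim] volterra[OF elim] by simp
   hence "(t powr (1 - \<alpha>) / Gamma (2 - \<alpha>) - \<theta> * F t) / \<theta> <= (C * (t powr (- \<alpha>) * t powr (1 - \<alpha>))) / \<theta>"
    using th by (intro divide_right_mono) auto
   hence "c * t powr (1 - \<alpha>) - F t <= (C / \<theta> * t powr (- \<alpha>)) * t powr (1 - \<alpha>)"
    using th by (simp add: c_def diff_divide_distrib mult_ac)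
   then show ?case using elim by (simp add: pos_le_divide_eq left_diff_distrib)
  qed
 qed simp
 from monotone_density[OF upper lower this]
 have "((%t. f t * t powr \<alpha>) \<longlongrightarrow> c * (1 - \<alpha>)) at_top" by simp
 moreover have "c * (1 - \<alpha>) = 1 / (\<theta> * Gamma (1 - \<alpha>))"
  using a by (simp add: c_def G2')
 ultimately show ?thesis by (simp add: f_def)
qed

lemma Gamma_one_plus:
 assumes "0 < (\<alpha>::real)"
 shows "Gamma (1 + \<alpha>) = \<alpha> * Gamma \<alpha>" "0 < Gamma \<alpha>"
 using assms Gamma_plus1[of \<alpha>] nonpos_Ints_nonpos[of \<alpha>] Gamma_real_pos[of \<alpha>] by (auto simp: add.commute)

lemma integral_powr_Icc:
 fixes \<alpha> t :: real
 assumes "0 < \<alpha>" "0 <= t"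
 shows "has_bochner_integral lborel (%y. ind {0..t} y * y powr (\<alpha> - 1)) (t powr \<alpha> / \<alpha>)"
proof (cases "t = 0")
 case True
 have "AE y in lborel. ind {0..t} y * y powr (\<alpha> - 1) = (0::real)"
  using AE_lborel_singleton[of 0] by eventually_elim (auto simp: True indicator_def)
 thus ?thesis
  using True by (subst has_bochner_integral_cong_AE[where g="%_. 0"]) (auto intro: has_bochner_integral_zero)
next
 case False
 hence t: "0 < t" using assms by simp
 have "has_bochner_integral lborel (%y. ind {0..t} y * (y powr (\<alpha> - 1) * (t - y) powr (1 - 1))) (t powr (\<alpha> + 1 - 1) * Beta \<alpha> 1)"
  by (intro has_bochner_integral_Beta) (use assms t in auto)
 moreover have "t powr (\<alpha> + 1 - 1) * Beta \<alpha> 1 = t powr \<alpha> / \<alpha>"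
  using Gamma_one_plus[OF assms(1)] by (simp add: Beta_def add.commute)
 moreover have "AE y in lborel. ind {0..t} y * (y powr (\<alpha> - 1) * (t - y) powr (1 - 1)) = ind {0..t} y * y powr (\<alpha> - 1)"
  using AE_lborel_singleton[of t] by eventually_elim (simp add: indicator_def)
 ultimately show ?thesis
  by (subst (asm) has_bochner_integral_cong_AE[where g="%y. ind {0..t} y * y powr (\<alpha> - 1)"]) auto
qed

text \<open>The substitution y = (t + s) z.\<close>

lemma F_hat_renewal:
 fixes \<alpha> \<theta> s t :: real
 assumes "0 < \<alpha>" "0 <= s" "0 <= t"
 shows "F_hat \<alpha> s t \<theta> = \<theta> * (LINT y|lborel. ind {0..t} y * (Mittag_Leffler \<alpha> (- \<theta> * (t + s - y) powr \<alpha>) * (y powr (\<alpha> - 1) / Gamma \<alpha>)))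
   + Mittag_Leffler \<alpha> (- \<theta> * (t + s) powr \<alpha>)"
proof (cases "t + s = 0")
 case True
 hence "t = 0" "s = 0" using assms by auto
 have "AE y in lborel. ind {0..t} y * (Mittag_Leffler \<alpha> (- \<theta> * (t + s - y) powr \<alpha>) * (y powr (\<alpha> - 1) / Gamma \<alpha>)) = 0"
  using AE_lborel_singleton[of 0] by eventually_elim (auto simp: \<open>t = 0\<close> indicator_def)
 hence "(LINT y|lborel. ind {0..t} y * (Mittag_Leffler \<alpha> (- \<theta> * (t + s - y) powr \<alpha>) * (y powr (\<alpha> - 1) / Gamma \<alpha>))) = 0"
  by (rule integral_eq_zero_AE)
 thus ?thesis using \<open>t = 0\<close> \<open>s = 0\<close> by (simp add: F_hat_def)
next
 case False
 define T where "T = t + s"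
 have T: "0 < T" "t <= T" using False assms by (auto simp: T_def)
 define g where "g y = ind {0..t} y * (Mittag_Leffler \<alpha> (- \<theta> * (T - y) powr \<alpha>) * (y powr (\<alpha> - 1) / Gamma \<alpha>))" for y
 have Ga: "Gamma (1 + \<alpha>) = \<alpha> * Gamma \<alpha>" "0 < Gamma \<alpha>"
  by (rule Gamma_one_plus, rule assms)+
 have "(LINT y|lborel. g y) = \<bar>T\<bar> *\<^sub>R (LINT z|lborel. g (0 + T * z))"
  using T by (intro lborel_integral_real_affine) simp
 also have "(LINT z|lborel. g (0 + T * z)) = (LINT z|lborel. T powr (\<alpha> - 1) / Gamma \<alpha> * (ind {0..t / T} z * (Mittag_Leffler \<alpha> (- \<theta> * T powr \<alpha> * (1 - z) powr \<alpha>) / z powr (1 - \<alpha>))))"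
 proof (rule lebesgue_cong[OF refl])
  fix z
  show "g (0 + T * z) = T powr (\<alpha> - 1) / Gamma \<alpha> * (ind {0..t / T} z * (Mittag_Leffler \<alpha> (- \<theta> * T powr \<alpha> * (1 - z) powr \<alpha>) / z powr (1 - \<alpha>)))"
  proof (cases "0 <= z \<and> z <= t / T")
   case True
   have z1: "T * z <= t" using True T by (simp add: field_simps)
   have "t / T <= 1" using T by simp
   hence z2: "z <= 1" using True by linarith
   have "(T - T * z) powr \<alpha> = T powr \<alpha> * (1 - z) powr \<alpha>"
    using powr_mult[of T "1 - z" \<alpha>] T z1 z2 by (simp add: right_diff_distrib)
   moreover have "(T * z) powr (\<alpha> - 1) = T powr (\<alpha> - 1) / z powr (1 - \<alpha>)"
    using True T powr_minus_divide[of z "1 - \<alpha>"] by (simp add: powr_mult)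
   ultimately show ?thesis using True z1 T by (simp add: g_def mult_ac)
  next
   case False
   hence "\<not> (0 <= T * z \<and> T * z <= t)" using T by (auto simp: zero_le_mult_iff field_simps)
   thus ?thesis using False by (simp add: g_def)
  qed
 qed
 also have "... = T powr (\<alpha> - 1) / Gamma \<alpha> * (LINT z:{0..t / T}|lborel. Mittag_Leffler \<alpha> (- \<theta> * T powr \<alpha> * (1 - z) powr \<alpha>) / z powr (1 - \<alpha>))"
  by (simp only: set_lebesgue_integral_def integral_mult_right_zero real_scaleR_def)
 finally have "(LINT y|lborel. g y) = T powr \<alpha> / Gamma \<alpha> * (LINT z:{0..t / T}|lborel. Mittag_Leffler \<alpha> (- \<theta> * T powr \<alpha> * (1 - z) powr \<alpha>) / z powr (1 - \<alpha>))"
  using T powr_add[of T 1 "\<alpha> - 1"] by simp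
 moreover have "\<alpha> * \<theta> * T powr \<alpha> / Gamma (1 + \<alpha>) = \<theta> * (T powr \<alpha> / Gamma \<alpha>)"
  using Ga assms by simp
 ultimately show ?thesis
  unfolding F_hat_def T_def[symmetric] g_def[symmetric] by (simp only: mult.assoc)
qed

lemma F_hat_asymp:
 fixes \<alpha> \<theta> t :: real
 assumes a: "0 < \<alpha>" "\<alpha> < 1" and th: "0 < \<theta>" and t: "0 <= t"
  and nonneg: "\<And>t. 0 <= t ==> 0 <= Mittag_Leffler \<alpha> (- \<theta> * t powr \<alpha>)"
  and anti: "\<And>s t. 0 <= s ==> s <= t ==> Mittag_Leffler \<alpha> (- \<theta> * t powr \<alpha>) <= Mittag_Leffler \<alpha> (- \<theta> * s powr \<alpha>)"
 shows "((%s. F_hat \<alpha> s t \<theta> * (t + s) powr \<alpha>) \<longlongrightarrow> 1 / Gamma (1 - \<alpha>) * (1 / \<theta> + t powr \<alpha> / Gamma (1 + \<alpha>))) at_top"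
proof -
 define f where "f t = Mittag_Leffler \<alpha> (- \<theta> * t powr \<alpha>)" for t
 have fm[measurable]: "f : BM borel" unfolding f_def using a(1) by measurable
 have f0: "0 <= f t" if "0 <= t" for t using nonneg that by (simp add: f_def)
 have fanti: "f t <= f s" if "0 <= s" "s <= t" for s t using anti that by (simp add: f_def)
 have lim: "((%t. f t * t powr \<alpha>) \<longlongrightarrow> 1 / (\<theta> * Gamma (1 - \<alpha>))) at_top"
  unfolding f_def by (rule Mittag_Leffler_asymp) (use assms in auto)
 have Ga: "Gamma (1 + \<alpha>) = \<alpha> * Gamma \<alpha>" "0 < Gamma \<alpha>"
  by (rule Gamma_one_plus, rule a)+
 define J where "J s = (LINT y|lborel. ind {0..t} y * (f (t + s - y) * (y powr (\<alpha> - 1) / Gamma \<alpha>)))" for s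
 define k where "k = t powr \<alpha> / Gamma (1 + \<alpha>)"
 have hb: "has_bochner_integral lborel (%y. c / Gamma \<alpha> * (ind {0..t} y * y powr (\<alpha> - 1))) (c * k)" for c
  using has_bochner_integral_mult_right[OF integral_powr_Icc[OF a(1) t], of "c / Gamma \<alpha>"] by (simp add: k_def Ga mult_ac)
 have J: "f (t + s) * k <= J s \<and> J s <= f s * k" if s: "0 <= s" for s
 proof -
  have int: "integrable lborel (%y. ind {0..t} y * (f (t + s - y) * (y powr (\<alpha> - 1) / Gamma \<alpha>)))"
  proof (rule integrable_by)
   show "integrable lborel (%y. f s / Gamma \<alpha> * (ind {0..t} y * y powr (\<alpha> - 1)))"
    using hb[of "f s"] by (simp add: has_bochner_integral_iff)
   show "AE y in lborel. norm (ind {0..t} y * (f (t + s - y) * (y powr (\<alpha> - 1) / Gamma \<alpha>)))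
     <= norm (f s / Gamma \<alpha> * (ind {0..t} y * y powr (\<alpha> - 1)))"
   proof (rule AE_I2)
    fix y
    have "f (t + s - y) * (y powr (\<alpha> - 1) / Gamma \<alpha>) <= f s * (y powr (\<alpha> - 1) / Gamma \<alpha>)" "0 <= f (t + s - y)" if "y : {0..t}"
     using that Ga s f0[of "t + s - y"] fanti[of s "t + s - y"] by (simp_all add: mult_right_mono divide_right_mono)
    thus "norm (ind {0..t} y * (f (t + s - y) * (y powr (\<alpha> - 1) / Gamma \<alpha>)))
     <= norm (f s / Gamma \<alpha> * (ind {0..t} y * y powr (\<alpha> - 1)))"
     using Ga f0[OF s] by (auto simp: abs_mult split: split_indicator)
   qed
  qed measurable
  have "(LINT y|lborel. f (t + s) / Gamma \<alpha> * (ind {0..t} y * y powr (\<alpha> - 1))) <= J s"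
   unfolding J_def
  proof (rule integral_mono)
   fix y
   have *: "f (t + s) <= f (t + s - y)" "f (t + s - y) <= f s" if "0 <= y" "y <= t"
    using that s by (simp_all add: fanti)
   show "f (t + s) / Gamma \<alpha> * (ind {0..t} y * y powr (\<alpha> - 1)) <= ind {0..t} y * (f (t + s - y) * (y powr (\<alpha> - 1) / Gamma \<alpha>))"
    using * Ga by (auto split: split_indicator simp: mult_right_mono divide_right_mono)
  qed (use hb[of "f (t + s)"] int in \<open>simp_all add: has_bochner_integral_iff\<close>)
  moreover have "J s <= (LINT y|lborel. f s / Gamma \<alpha> * (ind {0..t} y * y powr (\<alpha> - 1)))"
   unfolding J_def
  proof (rule integral_mono)
   fix y
   have *: "f (t + s) <= f (t + s - y)" "f (t + s - y) <= f s" if "0 <= y" "y <= t"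
    using that s by (simp_all add: fanti)
   show "ind {0..t} y * (f (t + s - y) * (y powr (\<alpha> - 1) / Gamma \<alpha>)) <= f s / Gamma \<alpha> * (ind {0..t} y * y powr (\<alpha> - 1))"
    using * Ga by (auto split: split_indicator simp: mult_right_mono divide_right_mono)
  qed (use hb[of "f s"] int in \<open>simp_all add: has_bochner_integral_iff\<close>)
  ultimately show ?thesis using hb by (simp add: has_bochner_integral_iff)
 qed
 have ren: "F_hat \<alpha> s t \<theta> = \<theta> * J s + f (t + s)" if "0 <= s" for s
  unfolding J_def f_def by (rule F_hat_renewal) (use a that t in auto)
 have k0: "0 <= k" using a t Ga by (simp add: k_def)
 have sh: "filterlim (%s. t + s) at_top at_top"
  by (intro filterlim_tendsto_add_at_top[OF tendsto_const] filterlim_ident)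
 have L1: "((%s. f (t + s) * (t + s) powr \<alpha>) \<longlongrightarrow> 1 / (\<theta> * Gamma (1 - \<alpha>))) at_top"
  by (rule filterlim_compose[OF lim sh])
 have r: "((%s. ((t + s) / s) powr \<alpha>) \<longlongrightarrow> 1 powr \<alpha>) at_top"
 proof (rule tendsto_powr)
  have "((%s. t / s + 1) \<longlongrightarrow> 0 + 1) at_top"
   by (intro tendsto_intros tendsto_divide_0[OF tendsto_const] filterlim_at_top_imp_at_infinity filterlim_ident)
  moreover have "\<forall>\<^sub>F s in at_top. t / s + 1 = (t + s) / s"
   using eventually_gt_at_top[of 0] by eventually_elim (simp add: add_divide_distrib)
  ultimately show "((%s. (t + s) / s) \<longlongrightarrow> 1) at_top"
   using Lim_transform_eventually by fastforce
 qed auto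
 have "((%s. (f s * s powr \<alpha>) * ((t + s) / s) powr \<alpha>) \<longlongrightarrow> 1 / (\<theta> * Gamma (1 - \<alpha>)) * 1 powr \<alpha>) at_top"
  by (rule tendsto_mult[OF lim r])
 moreover have "\<forall>\<^sub>F s in at_top. (f s * s powr \<alpha>) * ((t + s) / s) powr \<alpha> = f s * (t + s) powr \<alpha>"
  using eventually_gt_at_top[of 0] by eventually_elim (use t in \<open>simp add: powr_divide\<close>)
 ultimately have L2: "((%s. f s * (t + s) powr \<alpha>) \<longlongrightarrow> 1 / (\<theta> * Gamma (1 - \<alpha>))) at_top"
  by (subst (asm) tendsto_cong) auto
 let ?l = "\<theta> * (1 / (\<theta> * Gamma (1 - \<alpha>)) * k) + 1 / (\<theta> * Gamma (1 - \<alpha>))"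
 have "((%s. F_hat \<alpha> s t \<theta> * (t + s) powr \<alpha>) \<longlongrightarrow> ?l) at_top"
 proof (rule tendsto_sandwich)
  show "((%s. \<theta> * (f (t + s) * (t + s) powr \<alpha> * k) + f (t + s) * (t + s) powr \<alpha>) \<longlongrightarrow> ?l) at_top"
   by (intro tendsto_intros L1)
  show "((%s. \<theta> * (f s * (t + s) powr \<alpha> * k) + f (t + s) * (t + s) powr \<alpha>) \<longlongrightarrow> ?l) at_top"
   by (intro tendsto_intros L1 L2)
  have eq: "F_hat \<alpha> s t \<theta> * (t + s) powr \<alpha> = \<theta> * (J s * (t + s) powr \<alpha>) + f (t + s) * (t + s) powr \<alpha>" if "0 <= s" for s
   using ren[OF that] by (simp add: algebra_simps)
  show "\<forall>\<^sub>F s in at_top. \<theta> * (f (t + s) * (t + s) powr \<alpha> * k) + f (t + s) * (t + s) powr \<alpha> <= F_hat \<alpha> s t \<theta> * (t + s) powr \<alpha>"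
   using eventually_ge_at_top[of 0]
  proof eventually_elim
   case (elim s)
   have "f (t + s) * k * (t + s) powr \<alpha> <= J s * (t + s) powr \<alpha>" using J[OF elim] by (intro mult_right_mono) auto
   hence "\<theta> * (f (t + s) * k * (t + s) powr \<alpha>) <= \<theta> * (J s * (t + s) powr \<alpha>)" using th by (intro mult_left_mono) auto
   then show ?case unfolding eq[OF elim] by (simp add: mult_ac)
  qed
  show "\<forall>\<^sub>F s in at_top. F_hat \<alpha> s t \<theta> * (t + s) powr \<alpha> <= \<theta> * (f s * (t + s) powr \<alpha> * k) + f (t + s) * (t + s) powr \<alpha>"
   using eventually_ge_at_top[of 0]
  proof eventually_elim
   case (elim s)
   have "J s * (t + s) powr \<alpha> <= f s * k * (t + s) powr \<alpha>" using J[OF elim] by (intro mult_right_mono) auto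
   hence "\<theta> * (J s * (t + s) powr \<alpha>) <= \<theta> * (f s * k * (t + s) powr \<alpha>)" using th by (intro mult_left_mono) auto
   then show ?case unfolding eq[OF elim] by (simp add: mult_ac)
  qed
 qed
 moreover have "?l = 1 / Gamma (1 - \<alpha>) * (1 / \<theta> + t powr \<alpha> / Gamma (1 + \<alpha>))"
  using th by (simp add: k_def divide_simps) (simp add: algebra_simps)?
 ultimately show ?thesis by simp
qed

section \<open>Paths of a subordinator and first passage\<close>

text \<open>Approximation from the right by processes that are constant on time intervals of length 1 / (n +
1).\<close>

lemma measurable_right_continuous:
 fixes Y :: "real => 'w => 'b::{metric_space}"
 assumes meas: "\<And>t. 0 <= t ==> Y t : BM R"
  and rc: "\<And>t z. 0 <= t ==> z : space R ==> continuous (at_right t) (%s. Y s z)"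
 shows "(%(t, z). Y (max 0 t) z) : BM (borel \<Otimes>\<^sub>M R)"
proof -
 define \<tau> where "\<tau> n t = real (nat \<lfloor>real (Suc n) * max 0 t\<rfloor> + 1) / real (Suc n)" for n :: nat and t :: real
 have gt: "max 0 t < \<tau> n t" and le: "\<tau> n t <= max 0 t + 1 / real (Suc n)" for n t
 proof -
  let ?x = "real (Suc n) * max 0 t"
  have fl: "real (nat \<lfloor>?x\<rfloor>) = of_int \<lfloor>?x\<rfloor>" by simp
  have "?x < of_int \<lfloor>?x\<rfloor> + 1" "of_int \<lfloor>?x\<rfloor> <= ?x" by linarith+
  hence 1: "?x < real (nat \<lfloor>?x\<rfloor> + 1)" and 2: "real (nat \<lfloor>?x\<rfloor> + 1) <= ?x + 1" using fl by linarith+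
  show "max 0 t < \<tau> n t" unfolding \<tau>_def using 1 by (subst pos_less_divide_eq) (auto simp: mult.commute)
  have "\<tau> n t <= (?x + 1) / real (Suc n)" unfolding \<tau>_def by (rule divide_right_mono[OF 2]) simp
  also have "... = max 0 t + 1 / real (Suc n)" by (simp add: add_divide_distrib del: of_nat_Suc)
  finally show "\<tau> n t <= max 0 t + 1 / real (Suc n)" .
 qed
 have lim: "(%n. \<tau> n t) \<longlonglongrightarrow> max 0 t" for t
 proof (rule tendsto_sandwich)
  show "\<forall>\<^sub>F n in sequentially. max 0 t <= \<tau> n t" using gt by (intro always_eventually allI less_imp_le)
  show "\<forall>\<^sub>F n in sequentially. \<tau> n t <= max 0 t + 1 / real (Suc n)" using le by (intro always_eventually allI)
  show "(%n. max 0 t + 1 / real (Suc n)) \<longlonglongrightarrow> max 0 t"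
   using tendsto_add[OF tendsto_const lim_1_over_n[THEN LIMSEQ_Suc]] by simp
 qed simp
 show ?thesis
 proof (rule borel_measurable_LIMSEQ_metric)
  fix n
  have "(%x. Y (real (nat \<lfloor>real (Suc n) * max 0 (fst x)\<rfloor> + 1) / real (Suc n)) (snd x)) : BM (borel \<Otimes>\<^sub>M R)"
  proof (rule measurable_compose_countable[where f="%i x. Y (real (i + 1) / real (Suc n)) (snd x)" and g="%x. nat \<lfloor>real (Suc n) * max 0 (fst x)\<rfloor>"])
   show "(%x. Y (real (i + 1) / real (Suc n)) (snd x)) : BM (borel \<Otimes>\<^sub>M R)" for i
    by (rule measurable_compose[OF measurable_snd meas]) simp
  qed measurable
  thus "(%(t, z). Y (\<tau> n t) z) : BM (borel \<Otimes>\<^sub>M R)"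
   by (simp add: \<tau>_def case_prod_beta)
 next
  fix x :: "real \<times> 'w" assume x: "x : space (borel \<Otimes>\<^sub>M R)"
  obtain t z where xt: "x = (t, z)" by (cases x)
  have z: "z : space R" using x xt by (simp add: space_pair_measure)
  have "filterlim (%n. \<tau> n t) (at_right (max 0 t)) sequentially"
   using lim gt by (intro tendsto_imp_filterlim_at_right) auto
  moreover have "((%s. Y s z) \<longlongrightarrow> Y (max 0 t) z) (at_right (max 0 t))"
   using rc[of "max 0 t" z] z by (simp add: continuous_within)
  ultimately show "(%n. case x of (t, z) => Y (\<tau> n t) z) \<longlonglongrightarrow> (case x of (t, z) => Y (max 0 t) z)"
   unfolding xt prod.case by (rule filterlim_compose[rotated])
 qed
qed

definition subordinator_path :: "(real => 'w => real) => 'w => bool" where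
 "subordinator_path \<sigma> z \<longleftrightarrow> \<sigma> 0 z = 0 \<and> mono_on {0..} (%s. \<sigma> s z) \<and>
  (\<forall>s\<ge>0. continuous (at_right s) (%r. \<sigma> r z))"

text \<open>On the null set where the path stays below t forever, the infimum is infinite and is mapped to
0. The total time spent below t describes both cases and, unlike the infimum, is an integral and
hence measurable and computable.\<close>

lemma first_passage_cases:
 assumes path: "subordinator_path \<sigma> z" and t: "0 <= t"
 shows "emeasure lborel {s. 0 <= s \<and> \<sigma> s z <= t} = \<infinity> \<and> first_passage \<sigma> t z = 0 \<or>
  emeasure lborel {s. 0 <= s \<and> \<sigma> s z <= t} = ennreal (first_passage \<sigma> t z) \<and> 0 <= first_passage \<sigma> t z \<and>
  {0..<first_passage \<sigma> t z} \<subseteq> {s. 0 <= s \<and> \<sigma> s z <= t} \<and> {s. 0 <= s \<and> \<sigma> s z <= t} \<subseteq> {0..first_passage \<sigma> t z}"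
proof -
 define A where "A = {s. 0 <= s \<and> \<sigma> s z <= t}"
 define B where "B = {s. 0 < s \<and> t < \<sigma> s z}"
 define I where "I = Inf (ereal ` B)"
 have L: "first_passage \<sigma> t z = real_of_ereal I" by (simp add: first_passage_def I_def B_def)
 have \<sigma>0: "\<sigma> 0 z = 0" and mono: "\<And>r s. 0 <= r ==> r <= s ==> \<sigma> r z <= \<sigma> s z"
  using path by (auto simp: subordinator_path_def mono_on_def)
 show ?thesis
 proof (cases "B = {}")
  case True
  have "A = {0..}"
  proof -
   have "\<sigma> s z <= t" if "0 <= s" for s
   proof (rule ccontr)
    assume "\<not> \<sigma> s z <= t"
    hence "s : B" using that \<sigma>0 t by (cases "s = 0") (simp_all add: B_def)
    thus False using True by simp
   qed
   thus ?thesis by (auto simp: A_def)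
  qed
  moreover have "emeasure lborel {0::real..} = \<infinity>"
  proof -
   have "ennreal (real n) <= emeasure lborel {0::real..}" for n
    using emeasure_mono[of "{0..real n}" "{0::real..}" lborel] by simp
   moreover have "r = \<infinity>" if "\<And>n. ennreal (real n) <= r" for r
   proof (cases r)
    case (real x)
    obtain n where "x < real n" using reals_Archimedean2 by blast
    thus ?thesis using that[of n] real by simp
   qed simp
   ultimately show ?thesis by blast
  qed
  moreover have "I = \<infinity>" by (simp add: I_def True top_ereal_def)
  ultimately show ?thesis by (simp add: L A_def)
 next
  case False
  then obtain b0 where b0: "b0 : B" by auto
  have "0 <= I" unfolding I_def by (intro Inf_greatest) (auto simp: B_def)
  moreover have "I <= ereal b0" unfolding I_def by (intro Inf_lower) (use b0 in auto)
  ultimately obtain b where b: "I = ereal b" "0 <= b" by (cases I) auto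
  have sub1: "{0..<b} \<subseteq> A"
  proof
   fix r assume r: "r : {0..<b}"
   have "r \<notin> B"
   proof
    assume "r : B"
    hence "I <= ereal r" unfolding I_def by (intro Inf_lower) auto
    thus False using b r by simp
   qed
   thus "r : A" using r \<sigma>0 t by (cases "r = 0") (auto simp: A_def B_def)
  qed
  have sub2: "A \<subseteq> {0..b}"
  proof
   fix r assume r: "r : A"
   show "r : {0..b}"
   proof (rule ccontr)
    assume "r \<notin> {0..b}"
    hence "I < ereal r" using r b by (auto simp: A_def)
    then obtain b' where "b' : B" "b' < r" unfolding I_def by (auto simp: Inf_less_iff)
    hence "t < \<sigma> r z" using mono[of b' r] by (auto simp: B_def)
    thus False using r by (simp add: A_def)
   qed
  qed
  have "A = {0..<b} \<or> A = {0..b}"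
   using sub1 sub2 b(2) by (cases "b : A") (auto simp: le_less)
  hence "emeasure lborel A = ennreal b" using b(2) by auto
  thus ?thesis using b sub1 sub2 by (simp add: L A_def)
 qed
qed

lemma first_passage_eq_enn2real:
 assumes path: "subordinator_path \<sigma> z" and t: "0 <= t"
 shows "first_passage \<sigma> t z = enn2real (emeasure lborel {s. 0 <= s \<and> \<sigma> s z <= t})"
 using first_passage_cases[OF assms] by (auto simp: enn2real_eq_posreal_iff)

lemma first_passage_nonneg:
 assumes path: "subordinator_path \<sigma> z" and t: "0 <= t"
 shows "0 <= first_passage \<sigma> t z"
 using first_passage_cases[OF assms] by auto

lemma
 assumes meas: "\<And>s. 0 <= s ==> \<sigma> s : BM R"
  and path: "\<And>z. z : space R ==> subordinator_path \<sigma> z" and t: "0 <= t"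
 shows borel_measurable_first_passage: "first_passage \<sigma> t : BM R"
  and borel_measurable_occupation: "(%z. emeasure lborel {s. 0 <= s \<and> \<sigma> s z <= t}) : BM R"
proof -
 have [measurable]: "(%(s, z). \<sigma> (max 0 s) z) : BM (borel \<Otimes>\<^sub>M R)"
  by (rule measurable_right_continuous) (use meas path in \<open>auto simp: subordinator_path_def\<close>)
 have eq: "emeasure lborel {s. 0 <= s \<and> \<sigma> s z <= t} = (\<integral>\<^sup>+s. ind {0..} s * ind {..t} (\<sigma> (max 0 s) z) \<partial>lborel)"
  if z: "z : space R" for z
 proof -
  have m: "(%s. \<sigma> (max 0 s) z) : BM borel"
   using measurable_compose[OF measurable_Pair2'[OF z], of "%(s, z). \<sigma> (max 0 s) z" borel borel] by simp
  have "{s : space lborel. 0 <= s \<and> \<sigma> (max 0 s) z <= t} : sets lborel"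
   using m by measurable
  also have "{s : space lborel. 0 <= s \<and> \<sigma> (max 0 s) z <= t} = {s. 0 <= s \<and> \<sigma> s z <= t}" by auto
  finally have "emeasure lborel {s. 0 <= s \<and> \<sigma> s z <= t} = (\<integral>\<^sup>+s. ind {s. 0 <= s \<and> \<sigma> s z <= t} s \<partial>lborel)"
   by (simp only: nn_integral_indicator)
  also have "... = (\<integral>\<^sup>+s. ind {0..} s * ind {..t} (\<sigma> (max 0 s) z) \<partial>lborel)"
   by (intro nn_integral_cong) (auto split: split_indicator)
  finally show ?thesis .
 qed
 have "(%z. \<integral>\<^sup>+s. ind {0..} s * ind {..t} (\<sigma> (max 0 s) z) \<partial>lborel) : BM R"
 proof (rule lborel.borel_measurable_nn_integral)
  have "(%(s, z). (ind {0..} s * ind {..t} (\<sigma> (max 0 s) z))::ennreal) : BM (borel \<Otimes>\<^sub>M R)"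
   by measurable
  from measurable_pair_swap[OF this]
  show "(%(z, s). (ind {0..} s * ind {..t} (\<sigma> (max 0 s) z))::ennreal) : BM (R \<Otimes>\<^sub>M lborel)"
   by (simp add: case_prod_beta cong: measurable_cong_sets)
 qed
 thus 1: "(%z. emeasure lborel {s. 0 <= s \<and> \<sigma> s z <= t}) : BM R"
  by (subst measurable_cong[OF eq])
 hence "(%z. enn2real (emeasure lborel {s. 0 <= s \<and> \<sigma> s z <= t})) : BM R" by measurable
 thus "first_passage \<sigma> t : BM R"
  by (subst measurable_cong[OF first_passage_eq_enn2real[OF path t]])
qed

section \<open>Potential measures and the inverse of a stable subordinator\<close>

lemma nn_integral_Gamma:
 fixes a c :: real
 assumes "0 < a" "0 < c"
 shows "(\<integral>\<^sup>+y. ennreal (ind {0..} y * (y powr (a - 1) * exp (- c * y))) \<partial>lborel) = ennreal (Gamma a * c powr (- a))"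
proof -
 have "(\<integral>\<^sup>+y. ennreal (ind {0..} y * (y powr (a - 1) * exp (- c * y))) \<partial>lborel)
   = ennreal \<bar>1 / c\<bar> * (\<integral>\<^sup>+x. ennreal (ind {0..} (0 + 1 / c * x) * ((0 + 1 / c * x) powr (a - 1) * exp (- c * (0 + 1 / c * x)))) \<partial>lborel)"
  using assms by (intro nn_integral_real_affine) auto
 also have "(\<integral>\<^sup>+x. ennreal (ind {0..} (0 + 1 / c * x) * ((0 + 1 / c * x) powr (a - 1) * exp (- c * (0 + 1 / c * x)))) \<partial>lborel)
   = (\<integral>\<^sup>+x. ennreal ((1 / c) powr (a - 1)) * ennreal (ind {0..} x * x powr (a - 1) / exp x) \<partial>lborel)"
 proof (rule nn_integral_cong)
  fix x :: real
  show "ennreal (ind {0..} (0 + 1 / c * x) * ((0 + 1 / c * x) powr (a - 1) * exp (- c * (0 + 1 / c * x))))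
    = ennreal ((1 / c) powr (a - 1)) * ennreal (ind {0..} x * x powr (a - 1) / exp x)"
  proof (cases "0 <= x")
   case True
   thus ?thesis using assms by (simp add: ennreal_mult[symmetric] powr_divide exp_minus field_simps)
  next
   case False
   thus ?thesis using assms by (simp add: zero_le_divide_iff)
  qed
 qed
 also have "... = ennreal ((1 / c) powr (a - 1)) * ennreal (Gamma a)"
  using assms by (subst nn_integral_cmult) (auto simp: Gamma_conv_nn_integral_real)
 also have "ennreal \<bar>1 / c\<bar> * ... = ennreal (Gamma a * c powr (- a))"
 proof -
  have "\<bar>1 / c\<bar> * ((1 / c) powr (a - 1) * Gamma a) = Gamma a * c powr (- a)"
   using assms powr_add[of c 1 "a - 1"] by (simp add: powr_divide powr_minus_divide)
  moreover have "0 <= Gamma a" using Gamma_real_pos[of a] assms by simp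
  ultimately show ?thesis by (simp add: ennreal_mult[symmetric] del: abs_divide)
 qed
 finally show ?thesis .
qed

lemma nn_integral_power_Gamma:
 fixes c :: real
 assumes "0 < c"
 shows "(\<integral>\<^sup>+u. ennreal (ind {0..} u * (u ^ m / fact m * exp (- c * u))) \<partial>lborel) = ennreal (c powr (- real (Suc m)))"
proof -
 have "(\<integral>\<^sup>+u. ennreal (ind {0..} u * (u ^ m / fact m * exp (- c * u))) \<partial>lborel)
  = (\<integral>\<^sup>+y. ennreal (1 / fact m) * ennreal (ind {0..} y * (y powr (real (Suc m) - 1) * exp (- c * y))) \<partial>lborel)"
 proof (rule nn_integral_cong_AE)
  show "AE u in lborel. ennreal (ind {0..} u * (u ^ m / fact m * exp (- c * u)))
   = ennreal (1 / fact m) * ennreal (ind {0..} u * (u powr (real (Suc m) - 1) * exp (- c * u)))"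
   using AE_lborel_singleton[of 0]
   by eventually_elim (auto simp: ennreal_mult[symmetric] powr_realpow split: split_indicator)
 qed
 also have "... = ennreal (1 / fact m) * ennreal (Gamma (real (Suc m)) * c powr (- real (Suc m)))"
  using nn_integral_Gamma[of "real (Suc m)" c] assms by (subst nn_integral_cmult) (simp_all del: of_nat_Suc mult_minus_left)
 also have "... = ennreal (c powr (- real (Suc m)))"
  using Gamma_fact[of m, where 'a=real] by (simp add: ennreal_mult[symmetric])
 finally show ?thesis .
qed

locale stable_subordinator_space = prob_space N for N :: "'w measure" +
 fixes \<alpha> :: real and \<sigma> :: "real => 'w => real"
 assumes \<alpha>: "0 < \<alpha>" and subordinator: "stable_subordinator N \<alpha> \<sigma>"
begin

lemma measurable_\<sigma>: "0 <= s ==> \<sigma> s : BM N"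
 using subordinator by (simp add: stable_subordinator_def)

lemma path: "z : space N ==> subordinator_path \<sigma> z"
 using subordinator by (simp add: stable_subordinator_def subordinator_path_def)

lemma \<sigma>_0: "z : space N ==> \<sigma> 0 z = 0"
 using path by (simp add: subordinator_path_def)

lemma \<sigma>_mono: "z : space N ==> 0 <= r ==> r <= s ==> \<sigma> r z <= \<sigma> s z"
 using path[of z] by (auto simp: subordinator_path_def mono_on_def)

lemma \<sigma>_nonneg: "z : space N ==> 0 <= s ==> 0 <= \<sigma> s z"
 using \<sigma>_mono[of z 0 s] \<sigma>_0 by simp

lemma measurable_\<sigma>_pair [measurable]: "(%(s, z). \<sigma> (max 0 s) z) : BM (borel \<Otimes>\<^sub>M N)"
 by (rule measurable_right_continuous) (use measurable_\<sigma> path in \<open>auto simp: subordinator_path_def\<close>)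

lemma measurable_\<sigma>_max [measurable]: "\<sigma> (max 0 s) : BM N"
 by (rule measurable_\<sigma>) simp

lemma Laplace_\<sigma>:
 assumes s: "0 <= s" and \<xi>: "0 < \<xi>"
 shows "(\<integral>\<^sup>+z. ennreal (exp (- \<xi> * \<sigma> s z)) \<partial>N) = ennreal (exp (- s * \<xi> powr \<alpha>))"
proof (cases "s = 0")
 case True
 have "(\<integral>\<^sup>+z. ennreal (exp (- \<xi> * \<sigma> s z)) \<partial>N) = (\<integral>\<^sup>+z. 1 \<partial>N)"
  by (intro nn_integral_cong) (simp add: True \<sigma>_0)
 thus ?thesis by (simp add: True emeasure_space_1)
next
 case False
 hence eq: "(LINT z|N. exp (- \<xi> * \<sigma> s z)) = exp (- s * \<xi> powr \<alpha>)"
  using s \<xi> subordinator by (simp add: stable_subordinator_def)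
 hence "integrable N (%z. exp (- \<xi> * \<sigma> s z))"
  using not_integrable_integral_eq by fastforce
 thus ?thesis by (subst nn_integral_eq_integral) (simp_all only: eq, simp)
qed

text \<open>The potential measure of order m + 1: the occupation measure of sigma with time weighted by u^m
/ m!.\<close>

definition potential :: "nat => real measure" where
 "potential m = distr (density (lborel \<Otimes>\<^sub>M N) (%(u, z). ennreal (ind {0..} u * (u ^ m / fact m)))) borel (%(u, z). \<sigma> (max 0 u) z)"

lemma nn_integral_potential':
 assumes [measurable]: "g : BM borel"
 shows "(\<integral>\<^sup>+y. g y \<partial>potential m) = (\<integral>\<^sup>+u. ennreal (ind {0..} u * (u ^ m / fact m)) * (\<integral>\<^sup>+z. g (\<sigma> (max 0 u) z) \<partial>N) \<partial>lborel)"
proof -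
 have m1: "(%(u, z). \<sigma> (max 0 u) z) : BM (lborel \<Otimes>\<^sub>M N)"
  using measurable_\<sigma>_pair by (simp cong: measurable_cong_sets)
 have "(\<integral>\<^sup>+y. g y \<partial>potential m) = (\<integral>\<^sup>+x. (case x of (u, z) => ennreal (ind {0..} u * (u ^ m / fact m)) * g (\<sigma> (max 0 u) z)) \<partial>(lborel \<Otimes>\<^sub>M N))"
  unfolding potential_def using m1
  by (subst nn_integral_distr, simp, simp, subst nn_integral_density) (auto simp: split_beta')
 also have "... = (\<integral>\<^sup>+u. \<integral>\<^sup>+z. ennreal (ind {0..} u * (u ^ m / fact m)) * g (\<sigma> (max 0 u) z) \<partial>N \<partial>lborel)"
  using m1 by (subst nn_integral_fst[symmetric]) (auto simp: case_prod_beta)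
 also have "... = (\<integral>\<^sup>+u. ennreal (ind {0..} u * (u ^ m / fact m)) * (\<integral>\<^sup>+z. g (\<sigma> (max 0 u) z) \<partial>N) \<partial>lborel)"
  by (intro nn_integral_cong nn_integral_cmult) measurable
 finally show ?thesis .
qed

text \<open>Both sides have Laplace transform xi^(- alpha (m + 1)).\<close>

lemma potential_eq:
 "potential m = density lborel (%y. ennreal (ind {0..} y * (y powr (\<alpha> * real (Suc m) - 1) / Gamma (\<alpha> * real (Suc m)))))" (is "_ = ?V")
proof (rule Laplace_uniqueness)
 let ?a = "\<alpha> * real (Suc m)"
 have a: "0 < ?a" using \<alpha> by simp
 hence G: "0 < Gamma ?a" by (rule Gamma_real_pos)
 show "sets (potential m) = sets borel" "sets ?V = sets borel" by (simp_all add: potential_def)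
 show "AE y in ?V. 0 <= y" by (subst AE_density) (auto split: split_indicator)
 have neg: "(\<integral>\<^sup>+y. ind {..<0} y \<partial>potential m) = 0"
 proof -
  have "(\<integral>\<^sup>+z. ind {..<0} (\<sigma> (max 0 u) z) \<partial>N) = (\<integral>\<^sup>+z. 0 \<partial>N)" for u
  proof (rule nn_integral_cong)
   fix z assume "z : space N"
   hence "0 <= \<sigma> (max 0 u) z" by (intro \<sigma>_nonneg) auto
   thus "ind {..<0} (\<sigma> (max 0 u) z) = (0::ennreal)" by simp
  qed
  thus ?thesis by (subst nn_integral_potential') auto
 qed
 have "{..<0} : null_sets (potential m)"
  using neg by (simp add: null_sets_def potential_def)
 thus "AE y in potential m. 0 <= y" by (rule AE_I') auto
 fix \<xi> :: real assume \<xi>: "0 < \<xi>"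
 have "(\<integral>\<^sup>+y. ennreal (exp (- \<xi> * y)) \<partial>potential m)
   = (\<integral>\<^sup>+u. ennreal (ind {0..} u * (u ^ m / fact m * exp (- (\<xi> powr \<alpha>) * u))) \<partial>lborel)"
 proof (subst nn_integral_potential')
  show "(\<integral>\<^sup>+u. ennreal (ind {0..} u * (u ^ m / fact m)) * (\<integral>\<^sup>+z. ennreal (exp (- \<xi> * \<sigma> (max 0 u) z)) \<partial>N) \<partial>lborel)
   = (\<integral>\<^sup>+u. ennreal (ind {0..} u * (u ^ m / fact m * exp (- (\<xi> powr \<alpha>) * u))) \<partial>lborel)"
  proof (rule nn_integral_cong)
   fix u :: real
   have "(\<integral>\<^sup>+z. ennreal (exp (- \<xi> * \<sigma> (max 0 u) z)) \<partial>N) = ennreal (exp (- max 0 u * \<xi> powr \<alpha>))"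
    using \<xi> by (intro Laplace_\<sigma>) auto
   thus "ennreal (ind {0..} u * (u ^ m / fact m)) * (\<integral>\<^sup>+z. ennreal (exp (- \<xi> * \<sigma> (max 0 u) z)) \<partial>N)
    = ennreal (ind {0..} u * (u ^ m / fact m * exp (- (\<xi> powr \<alpha>) * u)))"
    by (cases "0 <= u") (simp_all add: ennreal_mult[symmetric] mult.commute)
  qed
 qed simp
 also have "... = ennreal ((\<xi> powr \<alpha>) powr (- real (Suc m)))"
  using \<xi> by (intro nn_integral_power_Gamma) simp
 also have "(\<xi> powr \<alpha>) powr (- real (Suc m)) = \<xi> powr (- ?a)" by (simp add: powr_powr algebra_simps)
 finally have 1: "(\<integral>\<^sup>+y. ennreal (exp (- \<xi> * y)) \<partial>potential m) = ennreal (\<xi> powr (- ?a))" .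
 have "(\<integral>\<^sup>+y. ennreal (exp (- \<xi> * y)) \<partial>?V) = (\<integral>\<^sup>+y. ennreal (1 / Gamma ?a) * ennreal (ind {0..} y * (y powr (?a - 1) * exp (- \<xi> * y))) \<partial>lborel)"
  using G by (subst nn_integral_density) (auto intro!: nn_integral_cong simp: ennreal_mult[symmetric])
 also have "... = ennreal (1 / Gamma ?a) * ennreal (Gamma ?a * \<xi> powr (- ?a))"
  using nn_integral_Gamma[OF a \<xi>] by (subst nn_integral_cmult) auto
 also have "... = ennreal (\<xi> powr (- ?a))" using G by (simp add: ennreal_mult[symmetric])
 finally have 2: "(\<integral>\<^sup>+y. ennreal (exp (- \<xi> * y)) \<partial>?V) = ennreal (\<xi> powr (- ?a))" .
 show "(\<integral>\<^sup>+y. ennreal (exp (- \<xi> * y)) \<partial>potential m) = (\<integral>\<^sup>+y. ennreal (exp (- \<xi> * y)) \<partial>?V)"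
  using 1 2 by simp
 show "(\<integral>\<^sup>+y. ennreal (exp (- \<xi> * y)) \<partial>potential m) < \<infinity>" using 1 by simp
qed

lemma nn_integral_potential:
 assumes [measurable]: "g : BM borel"
 shows "(\<integral>\<^sup>+u. ennreal (ind {0..} u * (u ^ m / fact m)) * (\<integral>\<^sup>+z. g (\<sigma> (max 0 u) z) \<partial>N) \<partial>lborel)
  = (\<integral>\<^sup>+y. ennreal (ind {0..} y * (y powr (\<alpha> * real (Suc m) - 1) / Gamma (\<alpha> * real (Suc m)))) * g y \<partial>lborel)"
 unfolding nn_integral_potential'[OF assms, symmetric] potential_eq by (simp add: nn_integral_density)

lemma potential_atMost:
 assumes t: "0 <= t"
 shows "(\<integral>\<^sup>+z. (\<integral>\<^sup>+u. ennreal (ind {0..} u * (u ^ m / fact m)) * ind {..t} (\<sigma> (max 0 u) z) \<partial>lborel) \<partial>N)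
  = ennreal (t powr (\<alpha> * real (Suc m)) / Gamma (\<alpha> * real (Suc m) + 1))"
proof -
 interpret L: pair_sigma_finite lborel N by unfold_locales
 let ?a = "\<alpha> * real (Suc m)"
 have a: "0 < ?a" using \<alpha> by simp
 have m1[measurable]: "(%(u, z). \<sigma> (max 0 u) z) : BM (lborel \<Otimes>\<^sub>M N)"
  using measurable_\<sigma>_pair by (simp cong: measurable_cong_sets)
 have "(\<integral>\<^sup>+z. (\<integral>\<^sup>+u. ennreal (ind {0..} u * (u ^ m / fact m)) * ind {..t} (\<sigma> (max 0 u) z) \<partial>lborel) \<partial>N)
  = (\<integral>\<^sup>+u. (\<integral>\<^sup>+z. ennreal (ind {0..} u * (u ^ m / fact m)) * ind {..t} (\<sigma> (max 0 u) z) \<partial>N) \<partial>lborel)"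
  by (rule L.Fubini') measurable
 also have "... = (\<integral>\<^sup>+u. ennreal (ind {0..} u * (u ^ m / fact m)) * (\<integral>\<^sup>+z. ind {..t} (\<sigma> (max 0 u) z) \<partial>N) \<partial>lborel)"
  by (intro nn_integral_cong nn_integral_cmult) measurable
 also have "... = (\<integral>\<^sup>+y. ennreal (ind {0..} y * (y powr (?a - 1) / Gamma ?a)) * ind {..t} y \<partial>lborel)"
  by (rule nn_integral_potential) measurable
 also have "... = (\<integral>\<^sup>+y. ennreal (1 / Gamma ?a * (ind {0..t} y * y powr (?a - 1))) \<partial>lborel)"
  by (intro nn_integral_cong) (auto split: split_indicator)
 also have "... = ennreal (1 / Gamma ?a * (t powr ?a / ?a))"
  using has_bochner_integral_mult_right[OF integral_powr_Icc[OF a t], of "1 / Gamma ?a"] Gamma_real_pos[OF a]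
  by (subst nn_integral_eq_integral) (auto simp: has_bochner_integral_iff simp del: of_nat_Suc)
 also have "1 / Gamma ?a * (t powr ?a / ?a) = t powr ?a / Gamma (?a + 1)"
  using Gamma_one_plus[OF a] by (simp add: add.commute mult.commute)
 finally show ?thesis .
qed

end

context stable_subordinator_space
begin

abbreviation "L \<equiv> first_passage \<sigma>"

definition occupied :: "real => 'w => bool" where
 "occupied t z \<longleftrightarrow> emeasure lborel {s. 0 <= s \<and> \<sigma> s z <= t} < \<infinity>"

lemma measurable_L [measurable (raw)]: "0 <= t ==> L t : BM N"
 by (rule borel_measurable_first_passage) (use measurable_\<sigma> path in auto)

lemma L_nonneg: "0 <= t ==> z : space N ==> 0 <= L t z"
 using first_passage_nonneg[OF path] by auto

lemma L_less: "0 <= t ==> z : space N ==> 0 <= u ==> u < L t z ==> \<sigma> u z <= t"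
 using first_passage_cases[OF path, of z t] by auto

lemma L_ge: "0 <= t ==> z : space N ==> occupied t z ==> 0 <= u ==> \<sigma> u z <= t ==> u <= L t z"
 using first_passage_cases[OF path, of z t] by (auto simp: occupied_def)

lemma L_mono:
 assumes "0 <= s" "s <= t" "z : space N" "occupied t z"
 shows "L s z <= L t z"
proof (rule ccontr)
 assume "\<not> ?thesis"
 hence "L t z < L s z" by simp
 then obtain u where u: "L t z < u" "u < L s z" using dense by blast
 have "0 <= u" using L_nonneg[of t z] assms u by simp
 hence "\<sigma> u z <= t" using L_less[of s z u] assms u by simp
 hence "u <= L t z" using L_ge[of t z u] assms \<open>0 <= u\<close> by simp
 thus False using u by simp
qed

lemma occupation_indicator:
 assumes "0 <= t" "z : space N" "occupied t z"
 shows "AE u in lborel. ind {0..} u * ind {..t} (\<sigma> (max 0 u) z) = (ind {0..L t z} u :: 'a::{comm_semiring_1})"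
 using AE_lborel_singleton[of "L t z"]
proof eventually_elim
 case (elim u)
 show ?case
 proof (cases "0 <= u")
  case True
  hence "\<sigma> u z <= t \<longleftrightarrow> u <= L t z"
   using elim L_less[of t z u] L_ge[of t z u] assms by (auto simp: less_le)
  thus ?thesis using True by (simp add: indicator_def)
 qed simp
qed

text \<open>The potential measure of [0, t] is finite.\<close>

lemma AE_occupied:
 assumes t: "0 <= t"
 shows "AE z in N. occupied t z"
proof -
 have eq: "(\<integral>\<^sup>+u. ennreal (ind {0..} u * (u ^ 0 / fact 0)) * ind {..t} (\<sigma> (max 0 u) z) \<partial>lborel) = emeasure lborel {s. 0 <= s \<and> \<sigma> s z <= t}"
  if "z : space N" for z
 proof -
  have m: "(%s. \<sigma> (max 0 s) z) : BM borel"
   using measurable_compose[OF measurable_Pair2'[OF that], of "%(s, z). \<sigma> (max 0 s) z" borel borel] by simp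
  have "{s : space lborel. 0 <= s \<and> \<sigma> (max 0 s) z <= t} : sets lborel"
   using m by measurable
  also have "{s : space lborel. 0 <= s \<and> \<sigma> (max 0 s) z <= t} = {s. 0 <= s \<and> \<sigma> s z <= t}" by auto
  finally have "emeasure lborel {s. 0 <= s \<and> \<sigma> s z <= t} = (\<integral>\<^sup>+s. ind {s. 0 <= s \<and> \<sigma> s z <= t} s \<partial>lborel)"
   by (simp only: nn_integral_indicator)
  also have "... = (\<integral>\<^sup>+u. ennreal (ind {0..} u * (u ^ 0 / fact 0)) * ind {..t} (\<sigma> (max 0 u) z) \<partial>lborel)"
   by (intro nn_integral_cong) (auto split: split_indicator)
  finally show ?thesis by simp
 qed
 have "(\<integral>\<^sup>+z. emeasure lborel {s. 0 <= s \<and> \<sigma> s z <= t} \<partial>N) = ennreal (t powr (\<alpha> * real (Suc 0)) / Gamma (\<alpha> * real (Suc 0) + 1))"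
  unfolding potential_atMost[OF t, symmetric] by (intro nn_integral_cong eq[symmetric])
 hence "(\<integral>\<^sup>+z. emeasure lborel {s. 0 <= s \<and> \<sigma> s z <= t} \<partial>N) \<noteq> \<infinity>" by simp
 hence "AE z in N. emeasure lborel {s. 0 <= s \<and> \<sigma> s z <= t} \<noteq> \<infinity>"
  by (intro nn_integral_PInf_AE borel_measurable_occupation measurable_\<sigma> path t)
 thus ?thesis by eventually_elim (simp add: occupied_def less_top)
qed

text \<open>L^(m+1) / (m+1)! is the integral of u^m / m! over [0, L], that is, over the times that sigma
spends in [0, t].\<close>

lemma moment_L:
 assumes t: "0 <= t"
 shows "has_bochner_integral N (%z. L t z ^ n / fact n) ((t powr \<alpha>) ^ n / Gamma (\<alpha> * real n + 1))"
proof (cases n)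
 case 0
 thus ?thesis by (simp add: prob_space has_bochner_integral_iff)
next
 case (Suc m)
 have G: "0 < Gamma (\<alpha> * real n + 1)" using \<alpha> by (intro Gamma_real_pos add_nonneg_pos) auto
 have "(\<integral>\<^sup>+z. ennreal (L t z ^ n / fact n) \<partial>N)
  = (\<integral>\<^sup>+z. (\<integral>\<^sup>+u. ennreal (ind {0..} u * (u ^ m / fact m)) * ind {..t} (\<sigma> (max 0 u) z) \<partial>lborel) \<partial>N)"
 proof (rule nn_integral_cong_AE)
  show "AE z in N. ennreal (L t z ^ n / fact n) = (\<integral>\<^sup>+u. ennreal (ind {0..} u * (u ^ m / fact m)) * ind {..t} (\<sigma> (max 0 u) z) \<partial>lborel)"
   using AE_occupied[OF t] AE_space
  proof eventually_elim
   case (elim z)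
   have "(\<integral>\<^sup>+u. ennreal (ind {0..} u * (u ^ m / fact m)) * ind {..t} (\<sigma> (max 0 u) z) \<partial>lborel)
    = (\<integral>\<^sup>+u. ennreal (max 0 u ^ m / fact m) * ind {0..L t z} u \<partial>lborel)"
   proof (rule nn_integral_cong_AE)
    show "AE u in lborel. ennreal (ind {0..} u * (u ^ m / fact m)) * ind {..t} (\<sigma> (max 0 u) z)
     = ennreal (max 0 u ^ m / fact m) * ind {0..L t z} u"
     using occupation_indicator[OF t elim(2,1), where 'a=ennreal]
     by eventually_elim (auto split: split_indicator_asm split_indicator)
   qed
   also have "... = (\<integral>\<^sup>+u. ennreal (\<bar>u\<bar> ^ m / fact m) * ind {0..L t z} u \<partial>lborel)"
    by (intro nn_integral_cong) (auto split: split_indicator)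
   also have "... = ennreal (L t z ^ n / fact n - 0 ^ n / fact n)"
   proof (rule nn_integral_FTC_Icc[where F="%u. u ^ n / fact n"])
    fix x :: real assume "x : {0..L t z}"
    thus "((%u. u ^ n / fact n) has_real_derivative \<bar>x\<bar> ^ m / fact m) (at x)"
     using DERIV_cdivide[OF DERIV_pow[of n x UNIV], of "fact n"] by (simp add: Suc del: of_nat_Suc)
   qed (use L_nonneg[OF t elim(2)] in auto)
   finally show ?case using Suc by simp
  qed
 qed
 also have "... = ennreal (t powr (\<alpha> * real n) / Gamma (\<alpha> * real n + 1))"
  unfolding Suc by (rule potential_atMost[OF t])
 also have "t powr (\<alpha> * real n) = (t powr \<alpha>) ^ n"
 proof (cases "t = 0")
  case False
  hence "(t powr \<alpha>) ^ n = (t powr \<alpha>) powr real n" using t by (intro powr_realpow[symmetric]) simp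
  thus ?thesis by (simp only: powr_powr)
 qed (simp add: Suc)
 finally show ?thesis
  using G t by (intro has_bochner_integral_nn_integral) (auto intro!: divide_nonneg_pos zero_le_power L_nonneg AE_I2)
qed

lemma Laplace_L:
 assumes t: "0 <= t"
 shows "has_bochner_integral N (%z. exp (- \<theta> * L t z)) (Mittag_Leffler \<alpha> (- \<theta> * t powr \<alpha>))"
proof -
 define f where "f n z = (- \<theta>) ^ n * (L t z ^ n / fact n)" for n z
 have hb: "has_bochner_integral N (f n) ((- \<theta>) ^ n * ((t powr \<alpha>) ^ n / Gamma (\<alpha> * real n + 1)))" for n
  unfolding f_def by (intro has_bochner_integral_mult_right moment_L t)
 have nf: "(LINT z|N. norm (f n z)) = \<bar>\<theta> * t powr \<alpha>\<bar> ^ n / Gamma (\<alpha> * real n + 1)" for n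
 proof -
  have "(LINT z|N. norm (f n z)) = (LINT z|N. \<bar>\<theta>\<bar> ^ n * (L t z ^ n / fact n))"
   by (intro lebesgue_cong refl) (simp add: f_def abs_mult power_abs L_nonneg t)
  also have "... = \<bar>\<theta>\<bar> ^ n * ((t powr \<alpha>) ^ n / Gamma (\<alpha> * real n + 1))"
   using moment_L[OF t, of n] by (simp only: integral_mult_right_zero has_bochner_integral_iff)
  finally show ?thesis by (simp add: power_mult_distrib abs_mult)
 qed
 have int: "integrable N (f n)" for n using hb by (simp add: has_bochner_integral_iff)
 have summ: "summable (%n. \<integral>z. norm (f n z) \<partial>N)"
  unfolding nf using \<alpha> by (intro summable_Mittag_Leffler) auto
 have fe: "f n z = (- \<theta> * L t z) ^ n /\<^sub>R fact n" for n z
  by (simp only: f_def power_mult_distrib divide_inverse real_scaleR_def mult_ac)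
 have sums: "(%n. f n z) sums exp (- \<theta> * L t z)" for z
  unfolding fe by (rule exp_converges)
 have sn: "AE z in N. summable (%n. norm (f n z))"
  unfolding fe by (intro AE_I2 summable_norm_exp)
 have e: "(%z. \<Sum>n. f n z) = (%z. exp (- \<theta> * L t z))"
  using sums by (auto simp: sums_iff)
 have "(\<Sum>n. integral\<^sup>L N (f n)) = (\<Sum>n. (- \<theta> * t powr \<alpha>) ^ n / Gamma (\<alpha> * real n + 1))"
 proof (rule suminf_cong)
  fix n show "integral\<^sup>L N (f n) = (- \<theta> * t powr \<alpha>) ^ n / Gamma (\<alpha> * real n + 1)"
   using hb[of n] unfolding power_mult_distrib by (simp add: has_bochner_integral_iff)
 qed
 thus ?thesis
  using integrable_suminf[OF int sn summ] integral_suminf[OF int sn summ]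
  unfolding e by (simp add: has_bochner_integral_iff Mittag_Leffler_def)
qed

lemma
 assumes "0 <= t" "0 <= \<theta>"
 shows Mittag_Leffler_nonneg: "0 <= Mittag_Leffler \<alpha> (- \<theta> * t powr \<alpha>)"
  and Mittag_Leffler_le_1: "Mittag_Leffler \<alpha> (- \<theta> * t powr \<alpha>) <= 1"
proof -
 have eq: "Mittag_Leffler \<alpha> (- \<theta> * t powr \<alpha>) = (LINT z|N. exp (- \<theta> * L t z))"
  and int: "integrable N (%z. exp (- \<theta> * L t z))"
  using Laplace_L[OF assms(1), of \<theta>] by (auto simp: has_bochner_integral_iff)
 show "0 <= Mittag_Leffler \<alpha> (- \<theta> * t powr \<alpha>)" unfolding eq by (intro lebesgue_nonneg) auto
 have "(LINT z|N. exp (- \<theta> * L t z)) <= (LINT z|N. 1)"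
  using int assms L_nonneg by (intro integral_mono) auto
 thus "Mittag_Leffler \<alpha> (- \<theta> * t powr \<alpha>) <= 1" unfolding eq by (simp add: prob_space)
qed

lemma Mittag_Leffler_antimono:
 assumes "0 <= s" "s <= t" "0 <= \<theta>"
 shows "Mittag_Leffler \<alpha> (- \<theta> * t powr \<alpha>) <= Mittag_Leffler \<alpha> (- \<theta> * s powr \<alpha>)"
proof -
 have t: "0 <= t" using assms by simp
 have "(LINT z|N. exp (- \<theta> * L t z)) <= (LINT z|N. exp (- \<theta> * L s z))"
 proof (rule integral_mono_AE)
  show "AE z in N. exp (- \<theta> * L t z) <= exp (- \<theta> * L s z)"
   using AE_occupied[OF t] AE_space
   by eventually_elim (use L_mono assms in \<open>simp add: mult_left_mono\<close>)
 qed (use Laplace_L[OF t, of \<theta>] Laplace_L[OF assms(1), of \<theta>] in \<open>simp_all add: has_bochner_integral_iff\<close>)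
 thus ?thesis
  using Laplace_L[OF t, of \<theta>] Laplace_L[OF assms(1), of \<theta>] by (simp add: has_bochner_integral_iff)
qed

lemma increments_independent:
 assumes u: "0 <= u" and r: "0 <= r" and g[measurable]: "(%(a, b). g a b :: ennreal) : BM (borel \<Otimes>\<^sub>M borel)"
 shows "(\<integral>\<^sup>+z. g (\<sigma> u z) (\<sigma> (u + r) z) \<partial>N) = (\<integral>\<^sup>+z. \<integral>\<^sup>+z'. g (\<sigma> u z) (\<sigma> u z + \<sigma> r z') \<partial>N \<partial>N)"
proof -
 define \<tau> where "\<tau> i = (if i = 0 then 0 else if i = 1 then u else u + r)" for i :: nat
 define Y where "Y i z = \<sigma> (\<tau> (Suc i)) z - \<sigma> (\<tau> i) z" for i z
 note [measurable] = measurable_\<sigma>[OF u] measurable_\<sigma>[OF r] measurable_\<sigma>[of "u + r"]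
 have ur: "0 <= u + r" using u r by simp
 have "mono \<tau>" using u r by (auto simp: mono_def \<tau>_def)
 moreover have "0 <= \<tau> 0" by (simp add: \<tau>_def)
 moreover have "\<forall>(n::nat) \<tau>. 0 <= \<tau> 0 \<longrightarrow> mono \<tau> \<longrightarrow> indep_vars (%_. borel) (%i z. \<sigma> (\<tau> (Suc i)) z - \<sigma> (\<tau> i) z) {..<n}"
  using subordinator by (simp add: stable_subordinator_def)
 ultimately have "indep_vars (%_. borel) (%i z. \<sigma> (\<tau> (Suc i)) z - \<sigma> (\<tau> i) z) {..<2}"
  by blast
 hence "indep_vars (%_. borel) Y {..<2}" by (simp only: Y_def[abs_def])
 hence "indep_var (PiM {0} (%_. borel)) (%z. restrict (%i. Y i z) {0}) (PiM {1} (%_. borel)) (%z. restrict (%i. Y i z) {1})"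
  by (rule indep_var_restrict) auto
 hence "indep_var borel ((%f. f 0) \<circ> (%z. restrict (%i. Y i z) {0})) borel ((%f. f 1) \<circ> (%z. restrict (%i. Y i z) {1}))"
  by (rule indep_var_compose) auto
 hence "indep_var borel (Y 0) borel (Y 1)" by (simp add: comp_def)
 hence prod: "distr N borel (Y 0) \<Otimes>\<^sub>M distr N borel (Y 1) = distr N (borel \<Otimes>\<^sub>M borel) (%z. (Y 0 z, Y 1 z))"
  by (simp add: indep_var_distribution_eq)
 have Y0: "Y 0 z = \<sigma> u z" if "z : space N" for z using that by (simp add: Y_def \<tau>_def \<sigma>_0)
 have Y1: "Y 1 z = \<sigma> (u + r) z - \<sigma> u z" for z by (simp add: Y_def \<tau>_def)
 have Y1': "Y 1 = (%z. \<sigma> (u + r) z - \<sigma> u z)" by (rule ext) (rule Y1)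
 have [measurable]: "Y 0 : BM N" using Y0 by (subst measurable_cong[where g="\<sigma> u"]) auto
 have Y1m[measurable]: "Y 1 : BM N" unfolding Y1' using ur by measurable
 note [measurable] = Y1m[unfolded One_nat_def]
 have d1: "distr N borel (Y 1) = distr N borel (\<sigma> r)"
 proof -
  have "\<forall>s r. 0 <= s \<longrightarrow> s <= r \<longrightarrow> distr N borel (%z. \<sigma> r z - \<sigma> s z) = distr N borel (\<sigma> (r - s))"
   using subordinator by (simp add: stable_subordinator_def)
  from this[rule_format, of u "u + r"] show ?thesis unfolding Y1' using u r by simp
 qed
 interpret D: prob_space "distr N borel (Y 1)" by (rule prob_space_distr) (rule Y1m)
 have "(\<integral>\<^sup>+z. g (\<sigma> u z) (\<sigma> (u + r) z) \<partial>N) = (\<integral>\<^sup>+z. (%(a, b). g a (a + b)) (Y 0 z, Y 1 z) \<partial>N)"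
  by (intro nn_integral_cong) (simp add: Y0 Y1[unfolded One_nat_def])
 also have "... = (\<integral>\<^sup>+x. (%(a, b). g a (a + b)) x \<partial>distr N (borel \<Otimes>\<^sub>M borel) (%z. (Y 0 z, Y 1 z)))"
  by (rule nn_integral_distr[symmetric]) measurable
 also have "... = (\<integral>\<^sup>+x. (%(a, b). g a (a + b)) x \<partial>(distr N borel (Y 0) \<Otimes>\<^sub>M distr N borel (Y 1)))"
  by (simp only: prod)
 also have "... = (\<integral>\<^sup>+a. \<integral>\<^sup>+b. g a (a + b) \<partial>distr N borel (Y 1) \<partial>distr N borel (Y 0))"
  by (subst D.nn_integral_fst[symmetric]) auto
 also have "... = (\<integral>\<^sup>+z. \<integral>\<^sup>+b. g (Y 0 z) (Y 0 z + b) \<partial>distr N borel (Y 1) \<partial>N)"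
  by (rule nn_integral_distr) measurable
 also have "... = (\<integral>\<^sup>+z. \<integral>\<^sup>+b. g (\<sigma> u z) (\<sigma> u z + b) \<partial>distr N borel (\<sigma> r) \<partial>N)"
  unfolding d1 by (intro nn_integral_cong) (simp add: Y0)
 also have "... = (\<integral>\<^sup>+z. \<integral>\<^sup>+z'. g (\<sigma> u z) (\<sigma> u z + \<sigma> r z') \<partial>N \<partial>N)"
  by (intro nn_integral_cong nn_integral_distr) auto
 finally show ?thesis .
qed

end

context stable_subordinator_space
begin

text \<open>The time that remains after u until sigma exceeds t, weighted with the density of an exponential
variable.\<close>

lemma residual_exp:
 assumes "0 <= t" "z : space N" "occupied t z" "0 <= u" "\<sigma> u z <= t" "0 <= \<theta>"
 shows "(\<integral>\<^sup>+r. ennreal (ind {0..} r * (\<theta> * exp (- \<theta> * r))) * ind {..t} (\<sigma> (max 0 (u + max 0 r)) z) \<partial>lborel)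
  = ennreal (1 - exp (- \<theta> * max 0 (L t z - u)))"
proof -
 have uL: "u <= L t z" using L_ge assms by simp
 have "(\<integral>\<^sup>+r. ennreal (ind {0..} r * (\<theta> * exp (- \<theta> * r))) * ind {..t} (\<sigma> (max 0 (u + max 0 r)) z) \<partial>lborel)
  = (\<integral>\<^sup>+r. ennreal (\<theta> * exp (- \<theta> * r)) * ind {0..L t z - u} r \<partial>lborel)"
 proof (rule nn_integral_cong_AE)
  show "AE r in lborel. ennreal (ind {0..} r * (\<theta> * exp (- \<theta> * r))) * ind {..t} (\<sigma> (max 0 (u + max 0 r)) z)
   = ennreal (\<theta> * exp (- \<theta> * r)) * ind {0..L t z - u} r"
   using AE_lborel_singleton[of "L t z - u"]
  proof eventually_elim
   case (elim r)
   show ?case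
   proof (cases "0 <= r")
    case True
    hence "\<sigma> (u + r) z <= t \<longleftrightarrow> r <= L t z - u"
     using elim L_less[of t z "u + r"] L_ge[of t z "u + r"] assms by (auto simp: less_le)
    thus ?thesis using True assms by (simp add: indicator_def)
   qed simp
  qed
 qed
 also have "... = ennreal (- exp (- \<theta> * (L t z - u)) - - exp (- \<theta> * 0))"
  by (rule nn_integral_FTC_Icc) (use uL assms in \<open>auto intro!: derivative_eq_intros\<close>)
 finally show ?thesis using uL by simp
qed

text \<open>The contribution of the level u: the probability that sigma is at most t at time u, weighted
with the discounted time from there to t'. It depends on the path only through the law of sigma
at u.\<close>

definition residual :: "real => real => real => real => real" where
 "residual \<theta> t t' u = (\<integral>y. ind {..t} y * Mittag_Leffler \<alpha> (- \<theta> * (t' - y) powr \<alpha>) \<partial>distr N borel (\<sigma> (max 0 u)))"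

lemma nn_residual:
 assumes t: "0 <= t" "t <= t'" and \<theta>: "0 <= \<theta>" and u: "0 <= u"
 shows "(\<integral>\<^sup>+z. ind {..t} (\<sigma> u z) * ennreal (1 - exp (- \<theta> * max 0 (L t' z - u))) \<partial>N)
  = (\<integral>\<^sup>+z. ind {..t} (\<sigma> u z) * ennreal (1 - Mittag_Leffler \<alpha> (- \<theta> * (t' - \<sigma> u z) powr \<alpha>)) \<partial>N)"
proof -
 interpret LN: pair_sigma_finite lborel N by unfold_locales
 have t': "0 <= t'" using t by simp
 note [measurable] = measurable_\<sigma>[OF u] measurable_L[OF t']
 define w where "w r = ennreal (ind {0..} r * (\<theta> * exp (- \<theta> * r)))" for r
 have [measurable]: "w : BM borel" unfolding w_def by measurable
 have \<sigma>m[measurable]: "(%x. \<sigma> (max 0 (u + max 0 (fst x))) (snd x)) : BM (lborel \<Otimes>\<^sub>M N)"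
  using measurable_compose[OF _ measurable_\<sigma>_pair, of "%x. (u + max 0 (fst x), snd x)" "lborel \<Otimes>\<^sub>M N"]
  by (simp add: case_prod_beta)
 have \<sigma>m2[measurable]: "(%x. \<sigma> (max 0 (fst x)) (snd x)) : BM (lborel \<Otimes>\<^sub>M N)"
  using measurable_compose[OF _ measurable_\<sigma>_pair, of "%x. (fst x, snd x)" "lborel \<Otimes>\<^sub>M N"]
  by (simp add: case_prod_beta)
 have \<sigma>m3[measurable]: "(%x. \<sigma> (max 0 (fst (fst x))) (snd x)) : BM ((lborel \<Otimes>\<^sub>M borel) \<Otimes>\<^sub>M N)"
  using measurable_compose[OF _ measurable_\<sigma>_pair, of "%x. (fst (fst x), snd x)" "(lborel \<Otimes>\<^sub>M borel) \<Otimes>\<^sub>M N"]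
  by (simp add: case_prod_beta)
 define G where "G r y = (\<integral>\<^sup>+z'. ind {..y} (\<sigma> (max 0 r) z') \<partial>N)" for r y :: real
 have Gm[measurable]: "(%x. G (fst x) (snd x)) : BM (lborel \<Otimes>\<^sub>M borel)"
  unfolding G_def
 proof (rule borel_measurable_nn_integral)
  have "{x : space ((lborel \<Otimes>\<^sub>M borel) \<Otimes>\<^sub>M N). \<sigma> (max 0 (fst (fst x))) (snd x) <= snd (fst x)} : sets ((lborel \<Otimes>\<^sub>M borel) \<Otimes>\<^sub>M N)"
   by measurable
  hence "(%x. ind {x : space ((lborel \<Otimes>\<^sub>M borel) \<Otimes>\<^sub>M N). \<sigma> (max 0 (fst (fst x))) (snd x) <= snd (fst x)} x :: ennreal) : BM ((lborel \<Otimes>\<^sub>M borel) \<Otimes>\<^sub>M N)"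
   by simp
  thus "(%(x, z'). ind {..snd x} (\<sigma> (max 0 (fst x)) z') :: ennreal) : BM ((lborel \<Otimes>\<^sub>M borel) \<Otimes>\<^sub>M N)"
   by (rule measurable_cong[THEN iffD1, rotated]) (auto simp: indicator_def)
 qed
 have step1: "(\<integral>\<^sup>+z. ind {..t} (\<sigma> u z) * ennreal (1 - exp (- \<theta> * max 0 (L t' z - u))) \<partial>N)
  = (\<integral>\<^sup>+z. (\<integral>\<^sup>+r. w r * (ind {..t} (\<sigma> u z) * ind {..t'} (\<sigma> (max 0 (u + max 0 r)) z)) \<partial>lborel) \<partial>N)"
 proof (rule nn_integral_cong_AE)
  show "AE z in N. ind {..t} (\<sigma> u z) * ennreal (1 - exp (- \<theta> * max 0 (L t' z - u)))
   = (\<integral>\<^sup>+r. w r * (ind {..t} (\<sigma> u z) * ind {..t'} (\<sigma> (max 0 (u + max 0 r)) z)) \<partial>lborel)"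
   using AE_occupied[OF t'] AE_space
  proof eventually_elim
   case (elim z)
   show ?case
   proof (cases "\<sigma> u z <= t")
    case True
    hence "(\<integral>\<^sup>+r. w r * ind {..t'} (\<sigma> (max 0 (u + max 0 r)) z) \<partial>lborel) = ennreal (1 - exp (- \<theta> * max 0 (L t' z - u)))"
     unfolding w_def by (intro residual_exp) (use t t' \<theta> u elim in auto)
    thus ?thesis using True by simp
   qed simp
  qed
 qed
 also have "... = (\<integral>\<^sup>+r. (\<integral>\<^sup>+z. w r * (ind {..t} (\<sigma> u z) * ind {..t'} (\<sigma> (max 0 (u + max 0 r)) z)) \<partial>N) \<partial>lborel)"
  by (rule LN.Fubini'[symmetric, where f="%r z. w r * (ind {..t} (\<sigma> u z) * ind {..t'} (\<sigma> (max 0 (u + max 0 r)) z))", symmetric]) (simp add: case_prod_beta)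
 also have "... = (\<integral>\<^sup>+r. (\<integral>\<^sup>+z. w r * (ind {..t} (\<sigma> u z) * G r (t' - \<sigma> u z)) \<partial>N) \<partial>lborel)"
 proof (rule nn_integral_cong)
  fix r :: real
  show "(\<integral>\<^sup>+z. w r * (ind {..t} (\<sigma> u z) * ind {..t'} (\<sigma> (max 0 (u + max 0 r)) z)) \<partial>N)
   = (\<integral>\<^sup>+z. w r * (ind {..t} (\<sigma> u z) * G r (t' - \<sigma> u z)) \<partial>N)"
  proof (cases "0 <= r")
   case True
   have "(\<integral>\<^sup>+z. w r * (ind {..t} (\<sigma> u z) * ind {..t'} (\<sigma> (u + r) z)) \<partial>N)
    = (\<integral>\<^sup>+z. \<integral>\<^sup>+z'. w r * (ind {..t} (\<sigma> u z) * ind {..t'} (\<sigma> u z + \<sigma> r z')) \<partial>N \<partial>N)"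
    by (rule increments_independent[OF u True, of "%a b. w r * (ind {..t} a * ind {..t'} b)"]) measurable
   also have "... = (\<integral>\<^sup>+z. w r * (ind {..t} (\<sigma> u z) * G r (t' - \<sigma> u z)) \<partial>N)"
   proof (rule nn_integral_cong)
    fix z
    have "ind {..t'} (\<sigma> u z + \<sigma> r z') = (ind {..t' - \<sigma> u z} (\<sigma> (max 0 r) z') :: ennreal)" for z'
     using True by (auto simp: indicator_def)
    hence "(\<integral>\<^sup>+z'. w r * (ind {..t} (\<sigma> u z) * ind {..t'} (\<sigma> u z + \<sigma> r z')) \<partial>N)
     = (\<integral>\<^sup>+z'. (w r * ind {..t} (\<sigma> u z)) * ind {..t' - \<sigma> u z} (\<sigma> (max 0 r) z') \<partial>N)"
     by (simp add: mult.assoc)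
    also have "... = (w r * ind {..t} (\<sigma> u z)) * G r (t' - \<sigma> u z)"
     unfolding G_def by (intro nn_integral_cmult) measurable
    finally show "(\<integral>\<^sup>+z'. w r * (ind {..t} (\<sigma> u z) * ind {..t'} (\<sigma> u z + \<sigma> r z')) \<partial>N)
     = w r * (ind {..t} (\<sigma> u z) * G r (t' - \<sigma> u z))" by (simp add: mult.assoc)
   qed
   finally show ?thesis using True u by simp
  qed (simp add: w_def)
 qed
 also have "... = (\<integral>\<^sup>+z. (\<integral>\<^sup>+r. w r * (ind {..t} (\<sigma> u z) * G r (t' - \<sigma> u z)) \<partial>lborel) \<partial>N)"
 proof (rule LN.Fubini'[symmetric])
  have "(%x. G (fst x) (t' - \<sigma> u (snd x))) : BM (lborel \<Otimes>\<^sub>M N)"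
   using measurable_compose[OF _ Gm, of "%x. (fst x, t' - \<sigma> u (snd x))" "lborel \<Otimes>\<^sub>M N"] by simp
  thus "(%(r, z). w r * (ind {..t} (\<sigma> u z) * G r (t' - \<sigma> u z))) : BM (lborel \<Otimes>\<^sub>M N)"
   by (simp add: case_prod_beta)
 qed
 also have "... = (\<integral>\<^sup>+z. ind {..t} (\<sigma> u z) * ennreal (1 - Mittag_Leffler \<alpha> (- \<theta> * (t' - \<sigma> u z) powr \<alpha>)) \<partial>N)"
 proof (rule nn_integral_cong)
  fix z assume z: "z : space N"
  show "(\<integral>\<^sup>+r. w r * (ind {..t} (\<sigma> u z) * G r (t' - \<sigma> u z)) \<partial>lborel)
   = ind {..t} (\<sigma> u z) * ennreal (1 - Mittag_Leffler \<alpha> (- \<theta> * (t' - \<sigma> u z) powr \<alpha>))"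
  proof (cases "\<sigma> u z <= t")
   case True
   define y where "y = t' - \<sigma> u z"
   have y: "0 <= y" using True t by (simp add: y_def)
   have "(\<integral>\<^sup>+r. w r * G r y \<partial>lborel) = (\<integral>\<^sup>+r. \<integral>\<^sup>+z'. w r * ind {..y} (\<sigma> (max 0 r) z') \<partial>N \<partial>lborel)"
    unfolding G_def by (intro nn_integral_cong nn_integral_cmult[symmetric]) measurable
   also have "... = (\<integral>\<^sup>+z'. \<integral>\<^sup>+r. w r * ind {..y} (\<sigma> (max 0 r) z') \<partial>lborel \<partial>N)"
    by (rule LN.Fubini'[symmetric]) (simp add: case_prod_beta)
   also have "... = (\<integral>\<^sup>+z'. ennreal (1 - exp (- \<theta> * L y z')) \<partial>N)"
   proof (rule nn_integral_cong_AE)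
    show "AE z' in N. (\<integral>\<^sup>+r. w r * ind {..y} (\<sigma> (max 0 r) z') \<partial>lborel) = ennreal (1 - exp (- \<theta> * L y z'))"
     using AE_occupied[OF y] AE_space
    proof eventually_elim
     case (elim z')
     then show ?case
      using residual_exp[OF y elim(2,1), of 0 \<theta>] \<theta> y \<sigma>_0[OF elim(2)] L_nonneg[OF y elim(2)] by (simp add: w_def max_absorb2)
    qed
   qed
   also have "... = ennreal (LINT z'|N. 1 - exp (- \<theta> * L y z'))"
    using Laplace_L[OF y, of \<theta>] \<theta> L_nonneg[OF y]
    by (intro nn_integral_eq_integral) (auto simp: has_bochner_integral_iff)
   also have "(LINT z'|N. 1 - exp (- \<theta> * L y z')) = 1 - Mittag_Leffler \<alpha> (- \<theta> * y powr \<alpha>)"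
    using Laplace_L[OF y, of \<theta>] by (simp add: has_bochner_integral_iff prob_space)
   finally show ?thesis using True by (simp add: y_def)
  qed simp
 qed
 finally show ?thesis .
qed

lemma Mittag_Leffler_bounds:
 "0 <= t ==> 0 <= \<theta> ==> \<bar>Mittag_Leffler \<alpha> (- \<theta> * t powr \<alpha>)\<bar> <= 1"
 using Mittag_Leffler_nonneg[of t \<theta>] Mittag_Leffler_le_1[of t \<theta>] by simp

text \<open>The increments after time u form a subordinator with the same law that starts at the level
reached, so that Laplace_L applies with t' - y in place of t'.\<close>

lemma residual_eq:
 assumes t: "0 <= t" "t <= t'" and \<theta>: "0 <= \<theta>" and u: "0 <= u"
 shows "(LINT z|N. ind {..t} (\<sigma> u z) * exp (- \<theta> * max 0 (L t' z - u))) = residual \<theta> t t' u"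
proof -
 have t': "0 <= t'" using t by simp
 note [measurable] = measurable_\<sigma>[OF u] measurable_L[OF t'] borel_measurable_Mittag_Leffler[OF \<alpha>]
 have i1: "integrable N (%z. ind {..t} (\<sigma> u z) * exp (- \<theta> * max 0 (L t' z - u)))"
  by (rule integrable_const_bound[of _ 1]) (use \<theta> in \<open>auto split: split_indicator\<close>)
 have i2: "integrable N (%z. ind {..t} (\<sigma> u z) * Mittag_Leffler \<alpha> (- \<theta> * (t' - \<sigma> u z) powr \<alpha>))"
 proof (rule integrable_const_bound[of _ 1])
  show "AE z in N. norm (ind {..t} (\<sigma> u z) * Mittag_Leffler \<alpha> (- \<theta> * (t' - \<sigma> u z) powr \<alpha>)) <= 1"
   using Mittag_Leffler_bounds[of "t' - \<sigma> u _" \<theta>] \<theta> t by (auto split: split_indicator)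
 qed measurable
 have i0: "integrable N (%z. ind {..t} (\<sigma> u z) :: real)"
  by (rule integrable_const_bound[of _ 1]) (auto split: split_indicator)
 have "ennreal (LINT z|N. ind {..t} (\<sigma> u z) - ind {..t} (\<sigma> u z) * exp (- \<theta> * max 0 (L t' z - u)))
   = (\<integral>\<^sup>+z. ind {..t} (\<sigma> u z) * ennreal (1 - exp (- \<theta> * max 0 (L t' z - u))) \<partial>N)"
  using i0 i1 \<theta> by (subst nn_integral_eq_integral[symmetric]) (auto split: split_indicator intro!: nn_integral_cong)
 also have "... = ennreal (LINT z|N. ind {..t} (\<sigma> u z) - ind {..t} (\<sigma> u z) * Mittag_Leffler \<alpha> (- \<theta> * (t' - \<sigma> u z) powr \<alpha>))"
  unfolding nn_residual[OF assms] using i0 i2 \<theta> t Mittag_Leffler_le_1[of "t' - \<sigma> u _" \<theta>]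
  by (subst nn_integral_eq_integral[symmetric]) (auto split: split_indicator intro!: nn_integral_cong)
 finally have "(LINT z|N. ind {..t} (\<sigma> u z) - ind {..t} (\<sigma> u z) * exp (- \<theta> * max 0 (L t' z - u)))
  = (LINT z|N. ind {..t} (\<sigma> u z) - ind {..t} (\<sigma> u z) * Mittag_Leffler \<alpha> (- \<theta> * (t' - \<sigma> u z) powr \<alpha>))"
 proof (subst (asm) ennreal_inj)
  show "0 <= (LINT z|N. ind {..t} (\<sigma> u z) - ind {..t} (\<sigma> u z) * exp (- \<theta> * max 0 (L t' z - u)))"
   by (intro lebesgue_nonneg) (use \<theta> in \<open>auto split: split_indicator\<close>)
  show "0 <= (LINT z|N. ind {..t} (\<sigma> u z) - ind {..t} (\<sigma> u z) * Mittag_Leffler \<alpha> (- \<theta> * (t' - \<sigma> u z) powr \<alpha>))"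
   by (intro lebesgue_nonneg) (use \<theta> t Mittag_Leffler_le_1[of "t' - \<sigma> u _" \<theta>] in \<open>auto split: split_indicator\<close>)
 qed
 hence "(LINT z|N. ind {..t} (\<sigma> u z) * exp (- \<theta> * max 0 (L t' z - u)))
  = (LINT z|N. ind {..t} (\<sigma> u z) * Mittag_Leffler \<alpha> (- \<theta> * (t' - \<sigma> u z) powr \<alpha>))"
  using i0 i1 i2 by simp
 also have "... = residual \<theta> t t' u"
  unfolding residual_def using u by (subst integral_distr) auto
 finally show ?thesis .
qed

end

text \<open>Two subordinators, possibly on different spaces, have the same one-dimensional laws.\<close>

lemma distr_\<sigma>_unique:
 assumes "stable_subordinator_space N1 \<alpha> \<sigma>1" "stable_subordinator_space N2 \<alpha> \<sigma>2" and s: "0 <= s"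
 shows "distr N1 borel (\<sigma>1 s) = distr N2 borel (\<sigma>2 s)"
proof (rule Laplace_uniqueness)
 interpret A: stable_subordinator_space N1 \<alpha> \<sigma>1 by fact
 interpret B: stable_subordinator_space N2 \<alpha> \<sigma>2 by fact
 note [measurable] = A.measurable_\<sigma>[OF s] B.measurable_\<sigma>[OF s]
 show "AE y in distr N1 borel (\<sigma>1 s). 0 <= y" using A.\<sigma>_nonneg s by (subst AE_distr_iff) auto
 show "AE y in distr N2 borel (\<sigma>2 s). 0 <= y" using B.\<sigma>_nonneg s by (subst AE_distr_iff) auto
 fix \<xi> :: real assume \<xi>: "0 < \<xi>"
 show "(\<integral>\<^sup>+y. ennreal (exp (- \<xi> * y)) \<partial>distr N1 borel (\<sigma>1 s)) = (\<integral>\<^sup>+y. ennreal (exp (- \<xi> * y)) \<partial>distr N2 borel (\<sigma>2 s))"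
  using A.Laplace_\<sigma>[OF s \<xi>] B.Laplace_\<sigma>[OF s \<xi>] by (simp add: nn_integral_distr)
 show "(\<integral>\<^sup>+y. ennreal (exp (- \<xi> * y)) \<partial>distr N1 borel (\<sigma>1 s)) < \<infinity>"
  using A.Laplace_\<sigma>[OF s \<xi>] by (simp add: nn_integral_distr)
qed simp_all

context stable_subordinator_space
begin

lemma residual_bounds:
 assumes "0 <= t" "t <= t'" "0 <= \<theta>"
 shows "0 <= residual \<theta> t t' u"
  and "residual \<theta> t t' u = (LINT z|N. ind {..t} (\<sigma> (max 0 u) z) * Mittag_Leffler \<alpha> (- \<theta> * (t' - \<sigma> (max 0 u) z) powr \<alpha>))"
proof -
 note [measurable] = borel_measurable_Mittag_Leffler[OF \<alpha>]
 show "residual \<theta> t t' u = (LINT z|N. ind {..t} (\<sigma> (max 0 u) z) * Mittag_Leffler \<alpha> (- \<theta> * (t' - \<sigma> (max 0 u) z) powr \<alpha>))"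
  unfolding residual_def by (subst integral_distr) auto
 show "0 <= residual \<theta> t t' u"
  unfolding residual_def using Mittag_Leffler_nonneg[of "t' - _" \<theta>] assms
  by (intro lebesgue_nonneg) (auto split: split_indicator)
qed

lemma residual_integral:
 assumes t: "0 <= t" "t <= t'" and \<theta>: "0 <= \<theta>"
 shows "(\<integral>\<^sup>+u. ennreal (ind {0..} u * residual \<theta> t t' u) \<partial>lborel)
  = ennreal (LINT y|lborel. ind {0..t} y * (Mittag_Leffler \<alpha> (- \<theta> * (t' - y) powr \<alpha>) * (y powr (\<alpha> - 1) / Gamma \<alpha>)))"
proof -
 note [measurable] = borel_measurable_Mittag_Leffler[OF \<alpha>]
 have G: "0 < Gamma \<alpha>" using \<alpha> by (rule Gamma_real_pos)
 have "(\<integral>\<^sup>+u. ennreal (ind {0..} u * residual \<theta> t t' u) \<partial>lborel)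
  = (\<integral>\<^sup>+u. ennreal (ind {0..} u * (u ^ 0 / fact 0)) * (\<integral>\<^sup>+z. ennreal (ind {..t} (\<sigma> (max 0 u) z) * Mittag_Leffler \<alpha> (- \<theta> * (t' - \<sigma> (max 0 u) z) powr \<alpha>)) \<partial>N) \<partial>lborel)"
 proof (rule nn_integral_cong)
  fix u :: real
  have "(\<integral>\<^sup>+z. ennreal (ind {..t} (\<sigma> (max 0 u) z) * Mittag_Leffler \<alpha> (- \<theta> * (t' - \<sigma> (max 0 u) z) powr \<alpha>)) \<partial>N) = ennreal (residual \<theta> t t' u)"
   unfolding residual_bounds(2)[OF t \<theta>]
  proof (rule nn_integral_eq_integral)
   show "integrable N (%z. ind {..t} (\<sigma> (max 0 u) z) * Mittag_Leffler \<alpha> (- \<theta> * (t' - \<sigma> (max 0 u) z) powr \<alpha>))"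
   proof (rule integrable_const_bound[of _ 1])
    show "AE z in N. norm (ind {..t} (\<sigma> (max 0 u) z) * Mittag_Leffler \<alpha> (- \<theta> * (t' - \<sigma> (max 0 u) z) powr \<alpha>)) <= 1"
     using Mittag_Leffler_bounds[of "t' - \<sigma> (max 0 u) _" \<theta>] \<theta> t by (auto split: split_indicator)
   qed measurable
   show "AE z in N. 0 <= ind {..t} (\<sigma> (max 0 u) z) * Mittag_Leffler \<alpha> (- \<theta> * (t' - \<sigma> (max 0 u) z) powr \<alpha>)"
    using Mittag_Leffler_nonneg[of "t' - \<sigma> (max 0 u) _" \<theta>] \<theta> t by (auto split: split_indicator)
  qed
  thus "ennreal (ind {0..} u * residual \<theta> t t' u) = ennreal (ind {0..} u * (u ^ 0 / fact 0)) * (\<integral>\<^sup>+z. ennreal (ind {..t} (\<sigma> (max 0 u) z) * Mittag_Leffler \<alpha> (- \<theta> * (t' - \<sigma> (max 0 u) z) powr \<alpha>)) \<partial>N)"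
   by (auto split: split_indicator)
 qed
 also have "... = (\<integral>\<^sup>+y. ennreal (ind {0..} y * (y powr (\<alpha> * real (Suc 0) - 1) / Gamma (\<alpha> * real (Suc 0)))) * ennreal (ind {..t} y * Mittag_Leffler \<alpha> (- \<theta> * (t' - y) powr \<alpha>)) \<partial>lborel)"
  by (rule nn_integral_potential) measurable
 also have "... = (\<integral>\<^sup>+y. ennreal (ind {0..t} y * (Mittag_Leffler \<alpha> (- \<theta> * (t' - y) powr \<alpha>) * (y powr (\<alpha> - 1) / Gamma \<alpha>))) \<partial>lborel)"
  using G t \<theta> Mittag_Leffler_nonneg[of "t' - _" \<theta>]
  by (intro nn_integral_cong) (auto split: split_indicator simp: ennreal_mult[symmetric] mult.commute)
 also have "... = ennreal (LINT y|lborel. ind {0..t} y * (Mittag_Leffler \<alpha> (- \<theta> * (t' - y) powr \<alpha>) * (y powr (\<alpha> - 1) / Gamma \<alpha>)))"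
 proof (rule nn_integral_eq_integral)
  show "integrable lborel (%y. ind {0..t} y * (Mittag_Leffler \<alpha> (- \<theta> * (t' - y) powr \<alpha>) * (y powr (\<alpha> - 1) / Gamma \<alpha>)))"
  proof (rule integrable_by)
   show "integrable lborel (%y. 1 / Gamma \<alpha> * (ind {0..t} y * y powr (\<alpha> - 1)))"
    using integral_powr_Icc[OF \<alpha> t(1)] by (intro integrable_mult_right) (auto simp: has_bochner_integral_iff)
   show "AE y in lborel. norm (ind {0..t} y * (Mittag_Leffler \<alpha> (- \<theta> * (t' - y) powr \<alpha>) * (y powr (\<alpha> - 1) / Gamma \<alpha>)))
    <= norm (1 / Gamma \<alpha> * (ind {0..t} y * y powr (\<alpha> - 1)))"
   proof (rule AE_I2)
    fix y
    have "\<bar>Mittag_Leffler \<alpha> (- \<theta> * (t' - y) powr \<alpha>)\<bar> * (y powr (\<alpha> - 1) / Gamma \<alpha>) <= 1 * (y powr (\<alpha> - 1) / Gamma \<alpha>)" if "0 <= y" "y <= t"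
     by (intro mult_right_mono Mittag_Leffler_bounds) (use that t \<theta> G in auto)
    thus "norm (ind {0..t} y * (Mittag_Leffler \<alpha> (- \<theta> * (t' - y) powr \<alpha>) * (y powr (\<alpha> - 1) / Gamma \<alpha>)))
     <= norm (1 / Gamma \<alpha> * (ind {0..t} y * y powr (\<alpha> - 1)))"
     using G by (auto simp: abs_mult split: split_indicator)
   qed
  qed measurable
  show "AE y in lborel. 0 <= ind {0..t} y * (Mittag_Leffler \<alpha> (- \<theta> * (t' - y) powr \<alpha>) * (y powr (\<alpha> - 1) / Gamma \<alpha>))"
   using Mittag_Leffler_nonneg[of "t' - _" \<theta>] \<theta> t G by (auto split: split_indicator)
 qed
 finally show ?thesis .
qed

lemma measurable_residual [measurable]:
 assumes t: "0 <= t" "t <= t'" and \<theta>: "0 <= \<theta>"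
 shows "residual \<theta> t t' : BM borel"
proof -
 note [measurable] = borel_measurable_Mittag_Leffler[OF \<alpha>]
 have \<sigma>m2[measurable]: "(%x. \<sigma> (max 0 (fst x)) (snd x)) : BM (borel \<Otimes>\<^sub>M N)"
  using measurable_\<sigma>_pair by (simp add: case_prod_beta)
 have "(%u. \<integral>z. ind {..t} (\<sigma> (max 0 u) z) * Mittag_Leffler \<alpha> (- \<theta> * (t' - \<sigma> (max 0 u) z) powr \<alpha>) \<partial>N) : BM borel"
  by (rule borel_measurable_lebesgue_integral) (simp add: case_prod_beta)
 thus ?thesis unfolding residual_bounds(2)[OF t \<theta>, abs_def] .
qed

lemma residual_integrable:
 assumes t: "0 <= t" "t <= t'" and \<theta>: "0 <= \<theta>"
 shows "integrable lborel (%u. ind {0..} u * residual \<theta> t t' u)"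
 using residual_integral[OF assms] residual_bounds(1)[OF assms] measurable_residual[OF assms]
 by (intro integrableI_nonneg) auto

text \<open>Write the integrand at L(t) as its value at 0 plus the integral of its derivative over [0,
L(t)], with the discount up to L(t'); the boundary term is Laplace_L, and the rest is integrated
level by level with residual_eq.\<close>

lemma expectation_time_changed:
 fixes \<psi> \<psi>' :: "real => real"
 assumes t: "0 <= t" "t <= t'" and \<theta>: "0 <= \<theta>"
  and deriv: "\<And>u. 0 <= u ==> (\<psi> has_real_derivative \<psi>' u) (at u within {0..})"
  and cont: "continuous_on {0..} \<psi>'"
  and bound: "\<And>u. 0 <= u ==> \<bar>\<psi> u\<bar> <= C" "\<And>u. 0 <= u ==> \<bar>\<psi>' u\<bar> <= C"
 shows "integrable lborel (%u. ind {0..} u * ((\<theta> * \<psi> u + \<psi>' u) * residual \<theta> t t' u))" (is ?i1)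
  and "(LINT z|N. exp (- \<theta> * (L t' z - L t z)) * \<psi> (L t z))
   = \<psi> 0 * Mittag_Leffler \<alpha> (- \<theta> * t' powr \<alpha>) + (LINT u|lborel. ind {0..} u * ((\<theta> * \<psi> u + \<psi>' u) * residual \<theta> t t' u))" (is ?eq)
proof -
 interpret LN: pair_sigma_finite lborel N by unfold_locales
 have t': "0 <= t'" using t by simp
 have C0: "0 <= C" using bound(1)[of 0] by simp
 note [measurable] = measurable_L[OF t(1)] measurable_L[OF t'] measurable_residual[OF t \<theta>]
 have \<psi>cont: "continuous_on {0..} \<psi>"
  using deriv by (auto simp: continuous_on_eq_continuous_within intro!: DERIV_continuous)
 define \<rho> where "\<rho> u = ind {0..} u * (\<theta> * \<psi> u + \<psi>' u)" for u
 have \<rho>m[measurable]: "\<rho> : BM borel"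
 proof -
  have "(%u. ind {0..} u *\<^sub>R (\<theta> * \<psi> u + \<psi>' u)) : BM borel"
   by (intro borel_measurable_continuous_on_indicator continuous_intros \<psi>cont cont) simp
  thus ?thesis by (simp add: \<rho>_def[abs_def])
 qed
 define D where "D = (\<theta> + 1) * C"
 have \<rho>b: "\<bar>\<rho> u\<bar> <= D" for u
 proof (cases "0 <= u")
  case True
  have "\<bar>\<theta> * \<psi> u + \<psi>' u\<bar> <= \<bar>\<theta> * \<psi> u\<bar> + \<bar>\<psi>' u\<bar>" by (rule abs_triangle_ineq)
  also have "\<bar>\<theta> * \<psi> u\<bar> <= \<theta> * C" using bound(1)[OF True] \<theta> by (simp add: abs_mult mult_left_mono)
  also have "\<bar>\<psi>' u\<bar> <= C" using bound(2)[OF True] .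
  finally show ?thesis using True by (simp add: \<rho>_def D_def algebra_simps)
 qed (use C0 \<theta> in \<open>simp add: \<rho>_def D_def\<close>)
 have D0: "0 <= D" using C0 \<theta> by (simp add: D_def)
 define \<phi> where "\<phi> u z = \<rho> u * (ind {..t} (\<sigma> (max 0 u) z) * exp (- \<theta> * max 0 (L t' z - u)))" for u z
 have \<sigma>m2[measurable]: "(%x. \<sigma> (max 0 (fst x)) (snd x)) : BM (lborel \<Otimes>\<^sub>M N)"
  using measurable_\<sigma>_pair by (simp add: case_prod_beta cong: measurable_cong_sets)
 have \<phi>m: "case_prod \<phi> : BM (lborel \<Otimes>\<^sub>M N)"
  unfolding \<phi>_def case_prod_beta' by measurable
 have \<phi>N: "(LINT z|N. \<phi> u z) = ind {0..} u * ((\<theta> * \<psi> u + \<psi>' u) * residual \<theta> t t' u)" for u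
  using residual_eq[OF t \<theta>, of u] by (cases "0 <= u") (simp_all add: \<phi>_def \<rho>_def)
 have \<phi>bound: "norm (\<phi> u z) <= D * (ind {0..} u * ind {..t} (\<sigma> (max 0 u) z))" for u z
 proof -
  have "\<bar>\<rho> u\<bar> * exp (- \<theta> * max 0 (L t' z - u)) <= D * 1"
   using \<rho>b \<theta> D0 by (intro mult_mono) auto
  thus ?thesis by (cases "0 <= u") (auto simp: \<phi>_def \<rho>_def abs_mult split: split_indicator)
 qed
 have int_occ: "integrable (lborel \<Otimes>\<^sub>M N) (%(u, z). D * (ind {0..} u * ind {..t} (\<sigma> (max 0 u) z)))"
 proof -
  have "(\<integral>\<^sup>+x. ennreal (ind {0..} (fst x) * ind {..t} (\<sigma> (max 0 (fst x)) (snd x))) \<partial>(lborel \<Otimes>\<^sub>M N))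
   = (\<integral>\<^sup>+z. (\<integral>\<^sup>+u. ennreal (ind {0..} u * (u ^ 0 / fact 0)) * ind {..t} (\<sigma> (max 0 u) z) \<partial>lborel) \<partial>N)"
   by (subst LN.nn_integral_snd[symmetric]) (auto intro!: nn_integral_cong split: split_indicator)
  also have "... < \<infinity>" unfolding potential_atMost[OF t(1)] by simp
  finally have "integrable (lborel \<Otimes>\<^sub>M N) (%x. ind {0..} (fst x) * ind {..t} (\<sigma> (max 0 (fst x)) (snd x)) :: real)"
   by (intro integrableI_nonneg) auto
  thus ?thesis unfolding case_prod_beta' by (intro integrable_mult_right)
 qed
 have int\<phi>: "integrable (lborel \<Otimes>\<^sub>M N) (case_prod \<phi>)"
  by (rule integrable_by[OF int_occ \<phi>m])
   (use \<phi>bound D0 in \<open>auto simp: case_prod_beta abs_mult\<close>)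
 show ?i1 using LN.integrable_fst'[OF int\<phi>] by (simp add: \<phi>N)
 have path_eq: "AE z in N. exp (- \<theta> * (L t' z - L t z)) * \<psi> (L t z) = \<psi> 0 * exp (- \<theta> * L t' z) + (LINT u|lborel. \<phi> u z)"
  using AE_occupied[OF t(1)] AE_occupied[OF t'] AE_space
 proof eventually_elim
  case (elim z)
  let ?l = "L t z"
  have l0: "0 <= ?l" using L_nonneg[OF t(1)] elim by simp
  have ll: "?l <= L t' z" using L_mono[of t t' z] t elim by simp
  have FTC: "(LINT u|lborel. ind {0..?l} u *\<^sub>R (exp (\<theta> * u) * (\<theta> * \<psi> u + \<psi>' u))) = exp (\<theta> * ?l) * \<psi> ?l - exp (\<theta> * 0) * \<psi> 0"
  proof (rule integral_FTC_Icc[OF l0])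
   fix u assume u: "0 <= u" "u <= ?l"
   have "(\<psi> has_real_derivative \<psi>' u) (at u within {0..?l})"
    by (rule DERIV_subset[OF deriv[OF u(1)]]) auto
   moreover have "((%u. exp (\<theta> * u)) has_real_derivative exp (\<theta> * u) * \<theta>) (at u within {0..?l})"
    by (auto intro!: derivative_eq_intros)
   ultimately have "((%u. exp (\<theta> * u) * \<psi> u) has_real_derivative (exp (\<theta> * u) * \<theta> * \<psi> u + \<psi>' u * exp (\<theta> * u))) (at u within {0..?l})"
    by (rule DERIV_mult[rotated])
   thus "((%u. exp (\<theta> * u) * \<psi> u) has_vector_derivative exp (\<theta> * u) * (\<theta> * \<psi> u + \<psi>' u)) (at u within {0..?l})"
    by (simp add: has_real_derivative_iff_has_vector_derivative[symmetric] algebra_simps)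
  next
   show "continuous_on {0..?l} (%u. exp (\<theta> * u) * (\<theta> * \<psi> u + \<psi>' u))"
    by (intro continuous_intros continuous_on_subset[OF \<psi>cont] continuous_on_subset[OF cont]) auto
  qed
  have "(LINT u|lborel. \<phi> u z) = (LINT u|lborel. exp (- \<theta> * L t' z) * (ind {0..?l} u *\<^sub>R (exp (\<theta> * u) * (\<theta> * \<psi> u + \<psi>' u))))"
  proof (rule integral_cong_AE)
   show "(%u. \<phi> u z) : BM lborel"
    using measurable_Pair2'[OF elim(3), of lborel] measurable_compose[OF _ \<phi>m, of "%u. (u, z)" lborel] by simp
   have "(%u. ind {0..?l} u *\<^sub>R (exp (\<theta> * u) * (\<theta> * \<psi> u + \<psi>' u))) : BM borel"
    by (intro borel_measurable_continuous_on_indicator continuous_intros continuous_on_subset[OF \<psi>cont] continuous_on_subset[OF cont]) auto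
   thus "(%u. exp (- \<theta> * L t' z) * (ind {0..?l} u *\<^sub>R (exp (\<theta> * u) * (\<theta> * \<psi> u + \<psi>' u)))) : BM lborel"
    by measurable
   show "AE u in lborel. \<phi> u z = exp (- \<theta> * L t' z) * (ind {0..?l} u *\<^sub>R (exp (\<theta> * u) * (\<theta> * \<psi> u + \<psi>' u)))"
    using occupation_indicator[OF t(1) elim(3,1), where 'a=real]
   proof eventually_elim
    case (elim u)
    show ?case
    proof (cases "0 <= u \<and> u <= ?l")
     case True
     hence "ind {..t} (\<sigma> (max 0 u) z) = (1::real)" using elim by simp
     thus ?thesis using True ll
      by (simp add: \<phi>_def \<rho>_def max_absorb2 exp_diff exp_minus divide_inverse algebra_simps)
    next
     case False
     hence "ind {0..} u * ind {..t} (\<sigma> (max 0 u) z) = (0::real)" using elim by auto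
     thus ?thesis using False by (auto simp: \<phi>_def \<rho>_def)
    qed
   qed
  qed
  also have "... = exp (- \<theta> * L t' z) * (exp (\<theta> * ?l) * \<psi> ?l - \<psi> 0)"
   unfolding integral_mult_right_zero FTC by simp
  finally show ?case by (simp add: algebra_simps exp_diff exp_minus divide_inverse)
 qed
 have \<phi>int2: "integrable N (%z. \<integral>u. \<phi> u z \<partial>lborel)" using LN.integrable_snd[OF int\<phi>] .
 have i1: "integrable N (%z. \<psi> 0 * exp (- \<theta> * L t' z))"
  using Laplace_L[OF t', of \<theta>] by (intro integrable_mult_right) (simp add: has_bochner_integral_iff)
 have \<psi>m: "(%z. \<psi> (L t z)) : BM N"
 proof -
  have "(%u. ind {0..} u *\<^sub>R \<psi> u) : BM borel"
   by (intro borel_measurable_continuous_on_indicator \<psi>cont) simp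
  hence "(%z. ind {0..} (L t z) *\<^sub>R \<psi> (L t z)) : BM N" by measurable
  thus ?thesis by (rule measurable_cong[THEN iffD1, rotated]) (simp add: L_nonneg t)
 qed
 have "(LINT z|N. exp (- \<theta> * (L t' z - L t z)) * \<psi> (L t z)) = (LINT z|N. \<psi> 0 * exp (- \<theta> * L t' z) + (LINT u|lborel. \<phi> u z))"
  using path_eq \<psi>m i1 \<phi>int2 by (intro integral_cong_AE) auto
 also have "... = \<psi> 0 * Mittag_Leffler \<alpha> (- \<theta> * t' powr \<alpha>) + (LINT z|N. (LINT u|lborel. \<phi> u z))"
  using i1 \<phi>int2 Laplace_L[OF t', of \<theta>] by (simp add: has_bochner_integral_iff)
 also have "(LINT z|N. (LINT u|lborel. \<phi> u z)) = (LINT u|lborel. (LINT z|N. \<phi> u z))"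
  using LN.Fubini_integral[OF int\<phi>] .
 finally show ?eq by (simp add: \<phi>N)
qed

text \<open>The density of the potential measure of order 1 is the kernel y^(alpha - 1) / Gamma(alpha) that
appears in F_hat.\<close>

lemma F_hat_eq_residual:
 assumes s: "0 <= s" and t: "0 <= t" and \<theta>: "0 <= \<theta>"
 shows "F_hat \<alpha> s t \<theta> = Mittag_Leffler \<alpha> (- \<theta> * (t + s) powr \<alpha>) + \<theta> * (LINT u|lborel. ind {0..} u * residual \<theta> t (t + s) u)"
proof -
 have ts: "t <= t + s" using s by simp
 have "ennreal (LINT u|lborel. ind {0..} u * residual \<theta> t (t + s) u) = (\<integral>\<^sup>+u. ennreal (ind {0..} u * residual \<theta> t (t + s) u) \<partial>lborel)"
  using residual_integrable[OF t ts \<theta>] residual_bounds(1)[OF t ts \<theta>] by (intro nn_integral_eq_integral[symmetric]) auto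
 also have "... = ennreal (LINT y|lborel. ind {0..t} y * (Mittag_Leffler \<alpha> (- \<theta> * (t + s - y) powr \<alpha>) * (y powr (\<alpha> - 1) / Gamma \<alpha>)))"
  by (rule residual_integral[OF t ts \<theta>])
 finally have "(LINT u|lborel. ind {0..} u * residual \<theta> t (t + s) u) = (LINT y|lborel. ind {0..t} y * (Mittag_Leffler \<alpha> (- \<theta> * (t + s - y) powr \<alpha>) * (y powr (\<alpha> - 1) / Gamma \<alpha>)))"
 proof (subst (asm) ennreal_inj)
  show "0 <= (LINT u|lborel. ind {0..} u * residual \<theta> t (t + s) u)"
   using residual_bounds(1)[OF t ts \<theta>] by (intro lebesgue_nonneg) auto
  show "0 <= (LINT y|lborel. ind {0..t} y * (Mittag_Leffler \<alpha> (- \<theta> * (t + s - y) powr \<alpha>) * (y powr (\<alpha> - 1) / Gamma \<alpha>)))"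
   using Mittag_Leffler_nonneg[of "t + s - _" \<theta>] \<theta> s t Gamma_real_pos[OF \<alpha>]
   by (intro lebesgue_nonneg) (auto split: split_indicator)
 qed
 thus ?thesis using F_hat_renewal[OF \<alpha> s t, of \<theta>] by simp
qed

lemma Laplace_increment_L:
 assumes s: "0 <= s" and t: "0 <= t" and \<theta>: "0 <= \<theta>"
 shows "(LINT z|N. exp (- \<theta> * (L (t + s) z - L t z))) = F_hat \<alpha> s t \<theta>"
proof -
 have ts: "t <= t + s" using s by simp
 have "(LINT z|N. exp (- \<theta> * (L (t + s) z - L t z)) * 1)
  = 1 * Mittag_Leffler \<alpha> (- \<theta> * (t + s) powr \<alpha>) + (LINT u|lborel. ind {0..} u * ((\<theta> * 1 + 0) * residual \<theta> t (t + s) u))"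
  by (rule expectation_time_changed(2)[OF t ts \<theta>, of "%_. 1" "%_. 0" 1]) auto
 also have "(LINT u|lborel. ind {0..} u * ((\<theta> * 1 + 0) * residual \<theta> t (t + s) u)) = (LINT u|lborel. \<theta> * (ind {0..} u * residual \<theta> t (t + s) u))"
  by (intro lebesgue_cong) auto
 finally show ?thesis using F_hat_eq_residual[OF s t \<theta>] by simp
qed

end

section \<open>Moment semigroups on a finite-dimensional space of functions\<close>

text \<open>Finite combinations of point evaluations. They commute with limits and derivatives of pointwise
convergent families, which transfers the analysis from functions to coefficients.\<close>

definition evaluation_functional :: "'x set => (('x => real) => real) => bool" where
 "evaluation_functional S l \<longleftrightarrow> (\<exists>ps. (\<forall>p\<in>set ps. fst p : S) \<and> l = (%u. \<Sum>p\<leftarrow>ps. snd p * u (fst p)))"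

lemma evaluation_functional_point: "x : S ==> evaluation_functional S (%u. u x)"
 unfolding evaluation_functional_def by (intro exI[of _ "[(x, 1)]"]) auto

lemma evaluation_functional_add:
 assumes "evaluation_functional S l" "evaluation_functional S l'"
 shows "evaluation_functional S (%u. l u + l' u)"
proof -
 obtain ps ps' where "(\<forall>p\<in>set ps. fst p : S) \<and> l = (%u. \<Sum>p\<leftarrow>ps. snd p * u (fst p))"
  "(\<forall>p\<in>set ps'. fst p : S) \<and> l' = (%u. \<Sum>p\<leftarrow>ps'. snd p * u (fst p))"
  using assms unfolding evaluation_functional_def by blast
 thus ?thesis unfolding evaluation_functional_def by (intro exI[of _ "ps @ ps'"]) auto
qed

lemma evaluation_functional_cmult:
 assumes "evaluation_functional S l" shows "evaluation_functional S (%u. a * l u)"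
proof -
 obtain ps where "(\<forall>p\<in>set ps. fst p : S) \<and> l = (%u. \<Sum>p\<leftarrow>ps. snd p * u (fst p))"
  using assms unfolding evaluation_functional_def by blast
 thus ?thesis unfolding evaluation_functional_def
  by (intro exI[of _ "map (%p. (fst p, a * snd p)) ps"]) (auto simp: comp_def sum_list_const_mult[symmetric] mult.assoc)
qed

lemma evaluation_functional_sum:
 assumes "finite A" "\<And>i. i : A ==> evaluation_functional S (l i)"
 shows "evaluation_functional S (%u. \<Sum>i\<in>A. a i * l i u)"
 using assms
proof (induction A rule: finite_induct)
 case empty
 then show ?case unfolding evaluation_functional_def by (intro exI[of _ "[]"]) auto
qed (auto intro!: evaluation_functional_add evaluation_functional_cmult)

lemma evaluation_functional_lincomb:
 assumes "evaluation_functional S l"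
 shows "l (%x. \<Sum>i\<in>A. c i * u i x) = (\<Sum>i\<in>A. c i * l (u i))"
proof -
 obtain ps where l: "l = (%u. \<Sum>p\<leftarrow>ps. snd p * u (fst p))"
  using assms unfolding evaluation_functional_def by blast
 show ?thesis unfolding l
 proof (induction ps)
  case (Cons p ps)
  then show ?case by (simp add: distrib_left sum.distrib sum_distrib_left mult_ac)
 qed simp
qed

lemma evaluation_functional_cong:
 assumes "evaluation_functional S l" "\<And>x. x : S ==> u x = u' x"
 shows "l u = l u'"
proof -
 obtain ps where ps: "\<forall>p\<in>set ps. fst p : S" and l: "l = (%u. \<Sum>p\<leftarrow>ps. snd p * u (fst p))"
  using assms unfolding evaluation_functional_def by blast
 have "map (%p. snd p * u (fst p)) ps = map (%p. snd p * u' (fst p)) ps" using ps assms(2) by auto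
 thus ?thesis unfolding l by metis
qed

lemma evaluation_functional_tendsto:
 assumes "evaluation_functional S l" "\<And>x. x : S ==> ((%n. u n x) \<longlongrightarrow> u' x) F"
 shows "((%n. l (u n)) \<longlongrightarrow> l u') F"
proof -
 obtain ps where ps: "\<forall>p\<in>set ps. fst p : S" and l: "l = (%u. \<Sum>p\<leftarrow>ps. snd p * u (fst p))"
  using assms unfolding evaluation_functional_def by blast
 show ?thesis unfolding l using ps
  by (induction ps) (auto intro!: tendsto_intros assms(2))
qed

text \<open>Linearly independent functions are separated by finitely many points.\<close>

lemma dual_evaluations:
 fixes H :: "nat => 'x => real"
 assumes "\<And>c. (\<And>x. x : S ==> (\<Sum>i<N. c i * H i x) = 0) ==> \<forall>i<N. c i = 0"
 shows "\<exists>l. (\<forall>j<N. evaluation_functional S (l j)) \<and> (\<forall>i<N. \<forall>j<N. l j (H i) = (if i = j then 1 else 0))"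
 using assms
proof (induction N)
 case (Suc N)
 have "\<forall>i<N. c i = 0" if c: "\<And>x. x : S ==> (\<Sum>i<N. c i * H i x) = 0" for c
 proof -
  have "\<forall>i<Suc N. (c(N := 0)) i = 0" using c by (intro Suc.prems) simp
  thus ?thesis by (metis fun_upd_other less_SucI nat_neq_iff)
 qed
 from Suc.IH[OF this] obtain l where l: "\<And>j. j < N ==> evaluation_functional S (l j)"
  "\<And>i j. i < N ==> j < N ==> l j (H i) = (if i = j then 1 else 0)" by blast
 define h where "h x = H N x - (\<Sum>j<N. l j (H N) * H j x)" for x
 obtain x where x: "x : S" "h x \<noteq> 0"
 proof (rule ccontr)
  assume "\<not> thesis"
  hence "(\<Sum>i<Suc N. (if i = N then 1 else - l i (H N)) * H i x) = 0" if "x : S" for x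
   using that \<open>\<not> thesis\<close> \<open>\<And>x. x : S ==> h x \<noteq> 0 ==> thesis\<close> by (force simp: h_def sum_negf)
  hence "\<forall>i<Suc N. (if i = N then 1 else - l i (H N)) = (0::real)" by (rule Suc.prems)
  thus False by auto
 qed
 define lN where "lN u = (1 / h x) * (u x + (\<Sum>j<N. (- H j x) * l j u))" for u
 have lN: "evaluation_functional S lN" unfolding lN_def
  by (intro evaluation_functional_cmult evaluation_functional_add evaluation_functional_point evaluation_functional_sum x l) auto
 have lN0: "lN (H i) = 0" if "i < N" for i
 proof -
  have "(\<Sum>j<N. (- H j x) * l j (H i)) = (\<Sum>j<N. if j = i then - H i x else 0)"
   by (intro sum.cong) (use l(2) that in auto)
  thus ?thesis using that by (simp add: lN_def)
 qed
 have lN1: "lN (H N) = 1"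
  using x(2) by (simp add: lN_def h_def sum_negf mult.commute)
 define l' where "l' j = (if j = N then lN else (%u. l j u + (- l j (H N)) * lN u))" for j
 show ?case
 proof (intro exI[of _ l'] conjI allI impI)
  show "evaluation_functional S (l' j)" if "j < Suc N" for j
  proof (cases "j = N")
   case False
   hence "evaluation_functional S (%u. l j u + (- l j (H N)) * lN u)"
    using that by (intro evaluation_functional_add evaluation_functional_cmult lN l) auto
   thus ?thesis using False by (simp add: l'_def)
  qed (simp add: l'_def lN)
  show "l' j (H i) = (if i = j then 1 else 0)" if "i < Suc N" "j < Suc N" for i j
   using that lN0 lN1 l(2) by (cases "i = N"; cases "j = N") (auto simp: l'_def)
 qed
qed simp

text \<open>Once the function is smaller than 1 at some time, it decays geometrically along the multiples of
that time.\<close>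

lemma submultiplicative_decay:
 fixes \<rho> :: "real => real"
 assumes nonneg: "\<And>t. 0 <= \<rho> t" and sub: "\<And>s t. 0 <= s ==> 0 <= t ==> \<rho> (s + t) <= \<rho> s * \<rho> t"
  and bound: "\<And>t. 0 <= t ==> \<rho> t <= K" and lim: "(\<rho> \<longlongrightarrow> 0) at_top"
 shows "\<exists>C \<kappa>. 0 < \<kappa> \<and> (\<forall>t\<ge>0. \<rho> t <= C * exp (- \<kappa> * t))"
proof -
 have "eventually (%t. \<rho> t < 1/2 \<and> t > 0) at_top"
  using order_tendstoD(2)[OF lim, of "1/2"] by (intro eventually_conj eventually_gt_at_top) auto
 then obtain T where T: "\<rho> T < 1/2" "0 < T" using eventually_happens' trivial_limit_at_top_linorder by blast
 have K: "0 <= K" using bound[of 0] nonneg[of 0] by simp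
 have pow: "\<rho> (real n * T + r) <= (1/2) ^ n * K" if "0 <= r" for n r
 proof (induction n)
  case 0
  then show ?case using bound that by simp
 next
  case (Suc n)
  have "\<rho> (T + (real n * T + r)) <= \<rho> T * \<rho> (real n * T + r)" using T that by (intro sub) auto
  also have "... <= 1/2 * ((1/2) ^ n * K)" using T Suc.IH nonneg K by (intro mult_mono) auto
  finally show ?case by (simp add: algebra_simps)
 qed
 have "\<rho> t <= (2 * K) * exp (- (ln 2 / T) * t)" if t: "0 <= t" for t
 proof -
  define n where "n = nat \<lfloor>t / T\<rfloor>"
  have "real n = of_int \<lfloor>t / T\<rfloor>" using t T by (simp add: n_def)
  hence n: "real n <= t / T" "t / T < real n + 1" by linarith+
  have r: "0 <= t - real n * T" using n(1) T by (simp add: field_simps)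
  have "\<rho> t <= (1/2) ^ n * K" using pow[OF r, of n] by simp
  also have "(1/2) ^ n = 2 * exp (- ln 2 * (real n + 1))"
  proof -
   have "exp (- ln 2 * (real n + 1)) = exp (real (Suc n) * (- ln 2))" by (simp add: algebra_simps)
   also have "... = exp (- ln 2) ^ Suc n" by (rule exp_of_nat_mult)
   also have "... = (1 / 2) ^ Suc n" by (simp add: exp_minus inverse_eq_divide)
   finally show ?thesis by simp
  qed
  also have "2 * exp (- ln 2 * (real n + 1)) <= 2 * exp (- ln 2 * (t / T))"
   using mult_left_mono[OF less_imp_le[OF n(2)], of "ln 2"] by simp
  finally show ?thesis using K by (simp add: mult_ac mult_right_mono)
 qed
 thus ?thesis using T by (intro exI[of _ "2 * K"] exI[of _ "ln 2 / T"]) auto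
qed

locale polynomial_semigroup =
 fixes S :: "'x set" and N :: nat and H :: "nat => 'x => real" and G :: "nat => nat => real"
  and T :: "nat => real => 'x => real"
 assumes independent: "\<And>c. (\<And>x. x : S ==> (\<Sum>i<N. c i * H i x) = 0) ==> \<forall>i<N. c i = 0"
  and T_cont: "\<And>x i. x : S ==> i < N ==> continuous_on {0..} (%t. T i t x)"
  and T_integral: "\<And>x i t. x : S ==> i < N ==> 0 <= t ==>
   ((%s. \<Sum>k<N. G k i * T k s x) has_integral (T i t x - H i x)) {0..t}"
begin

definition ev :: "nat => ('x => real) => real" where
 "ev = (SOME l. (\<forall>j<N. evaluation_functional S (l j)) \<and> (\<forall>i<N. \<forall>j<N. l j (H i) = (if i = j then 1 else 0)))"

lemma ev_functional: "j < N ==> evaluation_functional S (ev j)"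
 and ev_H: "i < N ==> j < N ==> ev j (H i) = (if i = j then 1 else 0)"
 using someI_ex[OF dual_evaluations[where S=S and N=N and H=H, OF independent]] unfolding ev_def[symmetric] by auto

lemma ev_lincomb: "j < N ==> ev j (%x. \<Sum>i<N. c i * H i x) = c j"
 by (simp add: evaluation_functional_lincomb[OF ev_functional] ev_H if_distrib cong: if_cong)

definition E :: "nat => nat => real => real" where
 "E j i t = ev j (T i t)"

primrec picard :: "nat => nat => nat => real => real" where
 "picard 0 j i t = 0"
| "picard (Suc m) j i t = (if i = j then 1 else 0) + integral {0..t} (%s. \<Sum>k<N. G k i * picard m j k s)"

lemma picard_cont: "continuous_on {0..b} (picard m j i)"
proof (induction m arbitrary: i)
 case (Suc m)
 have "(%s. \<Sum>k<N. G k i * picard m j k s) integrable_on {0..b}"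
  by (intro integrable_continuous_real continuous_intros Suc.IH)
 then show ?case by (simp add: indefinite_integral_continuous_1 continuous_intros)
qed simp

lemma picard_integral:
 "((%s. \<Sum>k<N. G k i * picard m j k s) has_integral (picard (Suc m) j i t - (if i = j then 1 else 0))) {0..t}"
proof -
 have "(%s. \<Sum>k<N. G k i * picard m j k s) integrable_on {0..t}"
  by (intro integrable_continuous_real continuous_intros picard_cont)
 thus ?thesis by (simp add: has_integral_integral[symmetric])
qed

lemma picard_error:
 assumes x: "x : S" and g: "0 <= g" "\<And>k i. k < N ==> i < N ==> \<bar>G k i\<bar> <= g"
  and B: "\<And>i s. i < N ==> 0 <= s ==> s <= b ==> \<bar>T i s x\<bar> <= B" and B0: "0 <= B"
  and i: "i < N" and t: "0 <= t" "t <= b"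
 shows "\<bar>T i t x - (\<Sum>j<N. picard m j i t * H j x)\<bar> <= B * ((real N * g * t) ^ m / fact m)"
 using i t
proof (induction m arbitrary: i t)
 case 0
 then show ?case using B by simp
next
 case (Suc m)
 define e where "e k s = T k s x - (\<Sum>j<N. picard m j k s * H j x)" for k s
 have H: "(\<Sum>j<N. (if i = j then 1 else 0) * H j x) = H i x"
  using Suc.prems(1) by (simp add: if_distrib[of "%a. a * _"] cong: if_cong)
 have "((%s. \<Sum>j<N. (\<Sum>k<N. G k i * picard m j k s) * H j x) has_integral (\<Sum>j<N. (picard (Suc m) j i t - (if i = j then 1 else 0)) * H j x)) {0..t}"
  by (intro has_integral_sum has_integral_mult_left picard_integral) simp
 also have "(\<Sum>j<N. (picard (Suc m) j i t - (if i = j then 1 else 0)) * H j x) = (\<Sum>j<N. picard (Suc m) j i t * H j x) - H i x"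
  by (simp only: left_diff_distrib sum_subtractf H)
 finally have "((%s. (\<Sum>k<N. G k i * T k s x) - (\<Sum>j<N. (\<Sum>k<N. G k i * picard m j k s) * H j x)) has_integral
  (T i t x - H i x) - ((\<Sum>j<N. picard (Suc m) j i t * H j x) - H i x)) {0..t}"
  by (intro has_integral_diff T_integral x Suc.prems)
 also have "(%s. (\<Sum>k<N. G k i * T k s x) - (\<Sum>j<N. (\<Sum>k<N. G k i * picard m j k s) * H j x)) = (%s. \<Sum>k<N. G k i * e k s)"
 proof
  fix s
  have "(\<Sum>j<N. (\<Sum>k<N. G k i * picard m j k s) * H j x) = (\<Sum>k<N. G k i * (\<Sum>j<N. picard m j k s * H j x))"
   unfolding sum_distrib_left sum_distrib_right by (subst sum.swap) (simp add: mult.assoc)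
  thus "(\<Sum>k<N. G k i * T k s x) - (\<Sum>j<N. (\<Sum>k<N. G k i * picard m j k s) * H j x) = (\<Sum>k<N. G k i * e k s)"
   by (simp add: e_def right_diff_distrib sum_subtractf)
 qed
 finally have I: "((%s. \<Sum>k<N. G k i * e k s) has_integral (T i t x - (\<Sum>j<N. picard (Suc m) j i t * H j x))) {0..t}"
  by simp
 have J: "((%s. B * (real N * g) ^ Suc m * s ^ m / fact m) has_integral (B * (real N * g) ^ Suc m * t ^ Suc m / fact (Suc m)
   - B * (real N * g) ^ Suc m * 0 ^ Suc m / fact (Suc m))) {0..t}"
 proof (rule fundamental_theorem_of_calculus)
  fix s assume "s : {0..t}"
  have "((%s. B * (real N * g) ^ Suc m / fact (Suc m) * s ^ Suc m) has_real_derivative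
    B * (real N * g) ^ Suc m / fact (Suc m) * (real (Suc m) * s ^ (Suc m - Suc 0))) (at s within {0..t})"
   by (intro DERIV_cmult DERIV_pow)
  thus "((%s. B * (real N * g) ^ Suc m * s ^ Suc m / fact (Suc m)) has_vector_derivative B * (real N * g) ^ Suc m * s ^ m / fact m) (at s within {0..t})"
   by (simp add: has_real_derivative_iff_has_vector_derivative[symmetric] mult_ac)
 qed (use Suc.prems in simp)
 have "norm (integral {0..t} (%s. \<Sum>k<N. G k i * e k s)) <= integral {0..t} (%s. B * (real N * g) ^ Suc m * s ^ m / fact m)"
 proof (rule integral_norm_bound_integral)
  fix s assume s: "s : {0..t}"
  have "norm (\<Sum>k<N. G k i * e k s) <= (\<Sum>k<N. g * (B * ((real N * g * s) ^ m / fact m)))"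
  proof (rule order_trans[OF norm_sum sum_mono])
   fix k assume "k : {..<N}"
   thus "norm (G k i * e k s) <= g * (B * ((real N * g * s) ^ m / fact m))"
    unfolding e_def real_norm_def abs_mult
    using g(2)[of k i] Suc.IH[of k s] Suc.prems s g(1) by (intro mult_mono) auto
  qed
  also have "... = B * (real N * g) ^ Suc m * s ^ m / fact m" by (simp add: power_mult_distrib mult_ac)
  finally show "norm (\<Sum>k<N. G k i * e k s) <= B * (real N * g) ^ Suc m * s ^ m / fact m" .
 qed (use I J in \<open>auto intro: has_integral_integrable\<close>)
 moreover have "integral {0..t} (%s. B * (real N * g) ^ Suc m * s ^ m / fact m) = B * ((real N * g * t) ^ Suc m / fact (Suc m))"
  using integral_unique[OF J] by (simp only: power_mult_distrib) simp
 ultimately show ?case unfolding integral_unique[OF I] by (simp only: real_norm_def)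
qed

text \<open>The expectations of the basis functions solve a linear system in t, so that Picard iteration
started in the span converges to them without leaving the span.\<close>

lemma picard_tendsto:
 assumes x: "x : S" and i: "i < N" and t: "0 <= t"
 shows "(%m. \<Sum>j<N. picard m j i t * H j x) \<longlonglongrightarrow> T i t x"
proof -
 define g where "g = (\<Sum>k<N. \<Sum>i<N. \<bar>G k i\<bar>)"
 have g0: "0 <= g" unfolding g_def by (intro sum_nonneg) auto
 have g: "\<bar>G k i\<bar> <= g" if "k < N" "i < N" for k i
 proof -
  have "\<bar>G k i\<bar> <= (\<Sum>i<N. \<bar>G k i\<bar>)" using that by (intro member_le_sum) auto
  also have "... <= g" unfolding g_def using that by (intro member_le_sum sum_nonneg) auto
  finally show ?thesis .
 qed
 have "\<exists>B. \<forall>s\<in>{0..t}. \<bar>T i s x\<bar> <= B" if "i < N" for i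
 proof -
  have "bounded ((%s. T i s x) ` {0..t})"
   by (intro compact_imp_bounded compact_continuous_image continuous_on_subset[OF T_cont[OF x that]]) auto
  thus ?thesis by (auto simp: bounded_iff)
 qed
 then obtain Bf where Bf: "\<And>i s. i < N ==> s : {0..t} ==> \<bar>T i s x\<bar> <= Bf i" by metis
 define B where "B = (\<Sum>i<N. \<bar>Bf i\<bar>)"
 have B: "\<bar>T i s x\<bar> <= B" if "i < N" "0 <= s" "s <= t" for i s
 proof -
  have "\<bar>T i s x\<bar> <= \<bar>Bf i\<bar>" using Bf[of i s] that by auto
  also have "... <= B" unfolding B_def using that by (intro member_le_sum) auto
  finally show ?thesis .
 qed
 have B0: "0 <= B" unfolding B_def by (intro sum_nonneg) auto
 have "(%m. (real N * g * t) ^ m / fact m) \<longlonglongrightarrow> 0"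
  using summable_LIMSEQ_zero[OF summable_exp_generic[of "real N * g * t"]] by (simp add: divide_inverse mult.commute)
 from tendsto_mult_left[OF this, of B] have lim0: "(%m. B * ((real N * g * t) ^ m / fact m)) \<longlonglongrightarrow> 0" by simp
 have "\<forall>\<^sub>F m in sequentially. norm (T i t x - (\<Sum>j<N. picard m j i t * H j x)) <= B * ((real N * g * t) ^ m / fact m)"
  using picard_error[OF x g0 g B B0 i t order_refl] by (intro always_eventually allI) simp
 hence "(%m. T i t x - (\<Sum>j<N. picard m j i t * H j x)) \<longlonglongrightarrow> 0"
  using lim0 by (rule Lim_null_comparison)
 hence "(%m. T i t x - (T i t x - (\<Sum>j<N. picard m j i t * H j x))) \<longlonglongrightarrow> T i t x - 0"
  by (intro tendsto_intros)
 thus ?thesis by simp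
qed

lemma picard_tendsto_E:
 assumes i: "i < N" and j: "j < N" and t: "0 <= t"
 shows "(%m. picard m j i t) \<longlonglongrightarrow> E j i t"
proof -
 have "(%m. ev j (%x. \<Sum>k<N. picard m k i t * H k x)) \<longlonglongrightarrow> ev j (T i t)"
  by (rule evaluation_functional_tendsto[OF ev_functional[OF j]]) (rule picard_tendsto[OF _ i t])
 thus ?thesis unfolding E_def by (simp add: ev_lincomb[OF j])
qed

lemma T_eq:
 assumes x: "x : S" and i: "i < N" and t: "0 <= t"
 shows "T i t x = (\<Sum>j<N. E j i t * H j x)"
proof (rule LIMSEQ_unique[OF picard_tendsto[OF assms]])
 show "(%m. \<Sum>j<N. picard m j i t * H j x) \<longlonglongrightarrow> (\<Sum>j<N. E j i t * H j x)"
  by (intro tendsto_sum tendsto_mult_right picard_tendsto_E i t) auto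
qed

lemma E_deriv:
 assumes i: "i < N" and j: "j < N" and t: "0 <= t"
 shows "((%t. E j i t) has_real_derivative (\<Sum>k<N. G k i * E j k t)) (at t within {0..})"
proof -
 have T_deriv: "((%t. T i t x) has_real_derivative (\<Sum>k<N. G k i * T k t x)) (at t within {0..})" if x: "x : S" for x
 proof -
  let ?g = "%s. \<Sum>k<N. G k i * T k s x"
  have "continuous_on {0..t + 1} ?g"
   using continuous_on_subset[OF T_cont[OF x]] by (intro continuous_intros) auto
  hence "((%t. integral {0..t} ?g) has_real_derivative ?g t) (at t within {0..t + 1})"
   using t by (intro integral_has_real_derivative) auto
  hence "((%t. H i x + integral {0..t} ?g) has_real_derivative ?g t) (at t within {0..t + 1})"
   by (auto intro!: derivative_eq_intros)
  hence "((%t. T i t x) has_real_derivative ?g t) (at t within {0..t + 1})"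
   by (rule has_field_derivative_transform_within[where d=1])
    (use t integral_unique[OF T_integral[OF x i]] in \<open>auto simp: dist_real_def\<close>)
  also have "at t within {0..t + 1} = at t within {0..}"
   by (rule at_within_nhd[where S="{..<t + 1}"]) (use t in auto)
  finally show ?thesis .
 qed
 obtain ps where ps: "\<forall>p\<in>set ps. fst p : S" "ev j = (%u. \<Sum>p\<leftarrow>ps. snd p * u (fst p))"
  using ev_functional[OF j] unfolding evaluation_functional_def by blast
 have "((%t. \<Sum>p\<leftarrow>ps. snd p * T i t (fst p)) has_real_derivative (\<Sum>p\<leftarrow>ps. snd p * (\<Sum>k<N. G k i * T k t (fst p)))) (at t within {0..})"
  using ps(1) by (induction ps) (auto intro!: derivative_eq_intros T_deriv)
 moreover have "(\<Sum>k<N. G k i * E j k t) = (\<Sum>p\<leftarrow>ps. snd p * (\<Sum>k<N. G k i * T k t (fst p)))"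
  using evaluation_functional_lincomb[OF ev_functional[OF j], of "%k. G k i" "%k. T k t" "{..<N}"]
  unfolding E_def ps(2) by simp
 ultimately show ?thesis unfolding E_def ps(2) by simp
qed

text \<open>The combination is annihilated in each Picard step.\<close>

lemma left_null_invariant:
 assumes v: "\<And>i. i < N ==> (\<Sum>j<N. v j * G j i) = 0" and i: "i < N" and t: "0 <= t"
 shows "(\<Sum>j<N. v j * E j i t) = v i"
proof -
 have p: "(\<Sum>j<N. v j * picard (Suc m) j i t) = v i" if "i < N" "0 <= t" for m i t
  using that
 proof (induction m arbitrary: i t)
  case 0
  have "(\<Sum>j<N. v j * picard (Suc 0) j i t) = (\<Sum>j<N. if j = i then v i else 0)"
   by (intro sum.cong) auto
  then show ?case using 0 by simp
 next
  case (Suc m)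
  have "((%s. \<Sum>j<N. v j * (\<Sum>k<N. G k i * picard (Suc m) j k s)) has_integral
    (\<Sum>j<N. v j * (picard (Suc (Suc m)) j i t - (if i = j then 1 else 0)))) {0..t}"
   by (intro has_integral_sum has_integral_mult_right picard_integral) simp
  moreover have "((%s. \<Sum>j<N. v j * (\<Sum>k<N. G k i * picard (Suc m) j k s)) has_integral 0) {0..t}"
  proof (rule has_integral_eq[OF _ has_integral_0])
   fix s assume s: "s : {0..t}"
   have "(\<Sum>j<N. v j * (\<Sum>k<N. G k i * picard (Suc m) j k s)) = (\<Sum>k<N. G k i * (\<Sum>j<N. v j * picard (Suc m) j k s))"
    unfolding sum_distrib_left by (subst sum.swap) (simp add: mult_ac)
   also have "... = (\<Sum>k<N. v k * G k i)"
    by (intro sum.cong refl) (use Suc.IH s in \<open>simp del: picard.simps\<close>)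
   also have "... = 0" using v Suc.prems by simp
   finally show "0 = (\<Sum>j<N. v j * (\<Sum>k<N. G k i * picard (Suc m) j k s))" ..
  qed
  ultimately have "(\<Sum>j<N. v j * (picard (Suc (Suc m)) j i t - (if i = j then 1 else 0))) = 0"
   by (rule has_integral_unique)
  moreover have "(\<Sum>j<N. v j * (if i = j then 1 else 0)) = v i" using Suc.prems by (simp add: if_distrib cong: if_cong)
  ultimately show ?case by (simp only: right_diff_distrib sum_subtractf)
 qed
 have "(%m. \<Sum>j<N. v j * picard (Suc m) j i t) \<longlonglongrightarrow> (\<Sum>j<N. v j * E j i t)"
  by (intro tendsto_sum tendsto_mult_left LIMSEQ_Suc[OF picard_tendsto_E[OF i _ t]]) auto
 hence "(%m. v i) \<longlonglongrightarrow> (\<Sum>j<N. v j * E j i t)" by (simp only: p[OF i t])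
 thus ?thesis using LIMSEQ_unique tendsto_const by blast
qed

end

locale ergodic_polynomial_semigroup = polynomial_semigroup +
 fixes m :: "nat => real"
 assumes N_pos: "0 < N" and H_0: "\<And>x. x : S ==> H 0 x = 1"
  and T_0: "\<And>x t. x : S ==> 0 <= t ==> T 0 t x = 1"
  and T_lim: "\<And>x i. x : S ==> i < N ==> ((%t. T i t x) \<longlongrightarrow> m i) at_top"
  and T_add: "\<And>x i s t. x : S ==> i < N ==> 0 <= s ==> 0 <= t ==> T i (s + t) x = (\<Sum>k<N. E k i t * T k s x)"
  and nonempty: "S \<noteq> {}"
begin

lemma ev_const: "j < N ==> ev j (%_. a) = (if j = 0 then a else 0)"
proof -
 assume j: "j < N"
 have "ev j (%_. a) = ev j (%x. \<Sum>i<N. (if i = 0 then a else 0) * H i x)"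
  by (rule evaluation_functional_cong[OF ev_functional[OF j]])
   (simp add: H_0 N_pos if_distrib[of "%a. a * _"] cong: if_cong)
 thus ?thesis by (simp add: ev_lincomb[OF j])
qed

lemma E_lim: "i < N ==> j < N ==> ((%t. E j i t) \<longlongrightarrow> (if j = 0 then m i else 0)) at_top"
 unfolding E_def ev_const[symmetric]
 by (rule evaluation_functional_tendsto[OF ev_functional]) (auto intro: T_lim)

text \<open>Invariance for finite t persists in the limit, where only the coefficient of the constant
function survives.\<close>

lemma left_null_eq_limit:
 assumes v: "\<And>i. i < N ==> (\<Sum>j<N. v j * G j i) = 0" and v0: "v 0 = 1" and i: "i < N"
 shows "v i = m i"
proof -
 have "((%t. \<Sum>j<N. v j * E j i t) \<longlongrightarrow> (\<Sum>j<N. v j * (if j = 0 then m i else 0))) at_top"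
  by (intro tendsto_sum tendsto_mult_left E_lim i) auto
 also have "(\<Sum>j<N. v j * (if j = 0 then m i else 0)) = m i"
  using N_pos v0 by (simp add: if_distrib cong: if_cong)
 finally have 1: "((%t. \<Sum>j<N. v j * E j i t) \<longlongrightarrow> m i) at_top" .
 have 2: "eventually (%t. (\<Sum>j<N. v j * E j i t) = v i) at_top"
  using eventually_ge_at_top[of 0] by eventually_elim (rule left_null_invariant[OF v i])
 have "((%t::real. v i) \<longlongrightarrow> m i) at_top" by (rule Lim_transform_eventually[OF 1]) (rule 2)
 thus ?thesis by (rule tendsto_unique[OF trivial_limit_at_top_linorder tendsto_const])
qed

lemma m_0: "m 0 = 1"
proof -
 obtain x where x: "x : S" using nonempty by auto
 have 1: "eventually (%t. T 0 t x = 1) at_top"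
  using eventually_ge_at_top[of 0] by eventually_elim (rule T_0[OF x])
 have "((%t::real. 1) \<longlongrightarrow> m 0) at_top" by (rule Lim_transform_eventually[OF T_lim[OF x N_pos]]) (rule 1)
 thus ?thesis by (rule tendsto_unique[OF trivial_limit_at_top_linorder _ tendsto_const])
qed

lemma m_invariant: assumes i: "i < N" and t: "0 <= t" shows "(\<Sum>k<N. m k * E k i t) = m i"
proof -
 obtain x where x: "x : S" using nonempty by auto
 have 1: "((%s. \<Sum>k<N. E k i t * T k s x) \<longlongrightarrow> (\<Sum>k<N. E k i t * m k)) at_top"
  by (intro tendsto_sum tendsto_mult_left T_lim x) auto
 have 2: "eventually (%s. (\<Sum>k<N. E k i t * T k s x) = T i (s + t) x) at_top"
  using eventually_ge_at_top[of 0] by eventually_elim (rule T_add[OF x i _ t, symmetric])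
 have 3: "((%s. T i (s + t) x) \<longlongrightarrow> (\<Sum>k<N. E k i t * m k)) at_top"
  by (rule Lim_transform_eventually[OF 1 2])
 have "filterlim (%s. t + s) at_top at_top"
  by (rule filterlim_tendsto_add_at_top[OF tendsto_const filterlim_ident])
 hence "filterlim (%s. s + t) at_top at_top" by (simp add: add.commute)
 from filterlim_compose[OF T_lim[OF x i] this]
 have "(\<Sum>k<N. E k i t * m k) = m i" by (rule tendsto_unique[OF trivial_limit_at_top_linorder 3])
 thus ?thesis by (simp add: mult.commute)
qed

lemma E_bounded: "\<exists>K. \<forall>i<N. \<forall>j<N. \<forall>t\<ge>0. \<bar>E j i t\<bar> <= K"
proof -
 have "\<exists>K. \<forall>t\<ge>0. \<bar>E j i t\<bar> <= K" if ij: "i < N" "j < N" for i j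
 proof -
  have cont: "continuous_on {0..} (%t. E j i t)"
  proof -
   have "((%s. E j i s) \<longlongrightarrow> E j i t) (at t within {0..})" if "t : {0..}" for t
    unfolding E_def
    by (rule evaluation_functional_tendsto[OF ev_functional[OF ij(2)]])
     (use T_cont[OF _ ij(1)] that in \<open>auto simp: continuous_on_def\<close>)
   thus ?thesis by (auto simp: continuous_on_def)
  qed
  obtain b where b: "\<And>t. t \<ge> b ==> \<bar>E j i t - (if j = 0 then m i else 0)\<bar> < 1"
   using tendstoD[OF E_lim[OF ij], of 1] by (auto simp: eventually_at_top_linorder dist_real_def)
  have "bounded ((%t. E j i t) ` {0..max 0 b})"
   by (intro compact_imp_bounded compact_continuous_image continuous_on_subset[OF cont]) auto
  then obtain K where K: "\<forall>t\<in>{0..max 0 b}. \<bar>E j i t\<bar> <= K" by (auto simp: bounded_iff)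
  have "\<bar>E j i t\<bar> <= max K (1 + \<bar>m i\<bar>)" if "0 <= t" for t
  proof (cases "t <= max 0 b")
   case False
   hence "\<bar>E j i t - (if j = 0 then m i else 0)\<bar> < 1" by (intro b) simp
   thus ?thesis by (auto split: if_splits)
  qed (use K that in \<open>auto simp: le_max_iff_disj\<close>)
  thus ?thesis by blast
 qed
 then obtain K where K: "\<And>i j t. i < N ==> j < N ==> 0 <= t ==> \<bar>E j i t\<bar> <= K i j" by metis
 have "\<bar>E j i t\<bar> <= (\<Sum>i<N. \<Sum>j<N. \<bar>K i j\<bar>)" if "i < N" "j < N" "0 <= t" for i j t
 proof -
  have "\<bar>E j i t\<bar> <= \<bar>K i j\<bar>" using K[OF that] by linarith
  also have "... <= (\<Sum>j<N. \<bar>K i j\<bar>)" using that by (intro member_le_sum) auto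
  also have "... <= (\<Sum>i<N. \<Sum>j<N. \<bar>K i j\<bar>)" using that by (intro member_le_sum[of i _ "%i. \<Sum>j<N. \<bar>K i j\<bar>"] sum_nonneg) auto
  finally show ?thesis .
 qed
 thus ?thesis by blast
qed

text \<open>The deviation from the limit is itself a semigroup of matrices.\<close>

lemma E_exponential:
 "\<exists>C \<kappa>. 0 < \<kappa> \<and> (\<forall>i<N. \<forall>j<N. \<forall>t\<ge>0. \<bar>E j i t - (if j = 0 then m i else 0)\<bar> <= C * exp (- \<kappa> * t))"
proof -
 define a where "a j i t = E j i t - (if j = 0 then m i else 0)" for j i t
 define \<rho> where "\<rho> t = (\<Sum>j<N. \<Sum>i<N. \<bar>a j i t\<bar>)" for t
 have E_add: "E j i (s + t) = (\<Sum>k<N. E j k s * E k i t)" if "i < N" "j < N" "0 <= s" "0 <= t" for i j s t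
 proof -
  have "E j i (s + t) = ev j (%x. \<Sum>k<N. E k i t * T k s x)"
   unfolding E_def[of j i] by (rule evaluation_functional_cong[OF ev_functional[OF that(2)]]) (rule T_add[OF _ that(1,3,4)])
  also have "... = (\<Sum>k<N. E k i t * ev j (T k s))"
   by (rule evaluation_functional_lincomb[OF ev_functional[OF that(2)]])
  finally show ?thesis by (simp add: E_def mult.commute)
 qed
 have E0: "E j 0 t = (if j = 0 then 1 else 0)" if "j < N" "0 <= t" for j t
 proof -
  have "E j 0 t = ev j (%_. 1)" unfolding E_def
   by (rule evaluation_functional_cong[OF ev_functional[OF that(1)]]) (rule T_0[OF _ that(2)])
  thus ?thesis by (simp add: ev_const that)
 qed
 have a_add: "a j i (s + t) = (\<Sum>k<N. a j k s * a k i t)" if "i < N" "j < N" "0 <= s" "0 <= t" for i j s t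
 proof -
  let ?d = "%j i. if j = 0 then m i else 0"
  have "(\<Sum>k<N. a j k s * a k i t) = (\<Sum>k<N. E j k s * E k i t) - (\<Sum>k<N. E j k s * ?d k i) - (\<Sum>k<N. ?d j k * E k i t) + (\<Sum>k<N. ?d j k * ?d k i)"
   by (simp add: a_def algebra_simps sum.distrib sum_subtractf)
  moreover have "(\<Sum>k<N. E j k s * ?d k i) = ?d j i"
   using N_pos E0[OF that(2,3)] by (simp add: if_distrib cong: if_cong)
  moreover have "(\<Sum>k<N. ?d j k * E k i t) = ?d j i" using m_invariant[OF that(1,4)] by (cases "j = 0") simp_all
  moreover have "(\<Sum>k<N. ?d j k * ?d k i) = ?d j i"
   using N_pos m_0 by (cases "j = 0") (simp_all add: if_distrib cong: if_cong)
  ultimately show ?thesis using E_add[OF that] by (simp add: a_def)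
 qed
 obtain K where K: "\<And>i j t. i < N ==> j < N ==> 0 <= t ==> \<bar>E j i t\<bar> <= K" using E_bounded by blast
 have "\<exists>C \<kappa>. 0 < \<kappa> \<and> (\<forall>t\<ge>0. \<rho> t <= C * exp (- \<kappa> * t))"
 proof (rule submultiplicative_decay)
  show "0 <= \<rho> t" for t unfolding \<rho>_def by (intro sum_nonneg) auto
  show "\<rho> (s + t) <= \<rho> s * \<rho> t" if st: "0 <= s" "0 <= t" for s t
  proof -
   have "\<rho> (s + t) <= (\<Sum>j<N. \<Sum>i<N. \<Sum>k<N. \<bar>a j k s\<bar> * \<bar>a k i t\<bar>)"
    unfolding \<rho>_def
    by (intro sum_mono) (simp add: a_add st abs_mult[symmetric] sum_abs)
   also have "... = (\<Sum>j<N. \<Sum>k<N. \<bar>a j k s\<bar> * (\<Sum>i<N. \<bar>a k i t\<bar>))"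
    unfolding sum_distrib_left by (intro sum.cong refl sum.swap)
   also have "... <= (\<Sum>j<N. \<Sum>k<N. \<bar>a j k s\<bar> * \<rho> t)"
    unfolding \<rho>_def by (intro sum_mono mult_left_mono member_le_sum[of _ _ "%k. \<Sum>i<N. \<bar>a k i t\<bar>"] sum_nonneg) auto
   also have "... = \<rho> s * \<rho> t" by (simp add: \<rho>_def[of s] sum_distrib_right)
   finally show ?thesis .
  qed
  show "\<rho> t <= (\<Sum>j<N. \<Sum>i<N. K + \<bar>m i\<bar>)" if "0 <= t" for t
   unfolding \<rho>_def
  proof (intro sum_mono)
   fix i j assume "i : {..<N}" "j : {..<N}"
   thus "\<bar>a j i t\<bar> <= K + \<bar>m i\<bar>" using K[of i j t] that by (auto simp: a_def)
  qed
  have "((%t. \<Sum>j<N. \<Sum>i<N. \<bar>a j i t\<bar>) \<longlongrightarrow> (\<Sum>j<N. \<Sum>i<N. \<bar>0\<bar>)) at_top"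
   unfolding a_def by (intro tendsto_sum tendsto_rabs LIM_zero E_lim) auto
  thus "(\<rho> \<longlongrightarrow> 0) at_top" by (simp add: \<rho>_def[abs_def])
 qed
 then obtain C \<kappa> where C: "0 < \<kappa>" "\<And>t. 0 <= t ==> \<rho> t <= C * exp (- \<kappa> * t)" by blast
 have "\<bar>a j i t\<bar> <= C * exp (- \<kappa> * t)" if "i < N" "j < N" "0 <= t" for i j t
 proof -
  have "\<bar>a j i t\<bar> <= (\<Sum>i<N. \<bar>a j i t\<bar>)" using that by (intro member_le_sum) auto
  also have "... <= \<rho> t" unfolding \<rho>_def using that by (intro member_le_sum[of j _ "%j. \<Sum>i<N. \<bar>a j i t\<bar>"] sum_nonneg) auto
  finally show ?thesis using C(2)[OF that(3)] by simp
 qed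
 thus ?thesis using C(1) unfolding a_def by blast
qed

end

section \<open>The Markov property and local martingales\<close>

context cadlag_markov_process
begin

abbreviation "SB \<equiv> restrict_space borel S"

lemma P_prob: assumes "x : S" shows "prob_space (P x)" and sets_P: "sets (P x) = sets M" and space_P: "space (P x) = space M"
proof -
 have "P x : space (prob_algebra M)"
  using measurable_space[OF kernel, of x] assms by (simp add: space_restrict_space)
 thus "prob_space (P x)" "sets (P x) = sets M" by (simp_all add: space_prob_algebra)
 thus "space (P x) = space M" by (rule_tac sets_eq_imp_space_eq)
qed

lemma X_in_S: "0 <= t ==> z : space M ==> X t z : S"
 using measurable_space[OF adapted, of t z] by (simp add: space_restrict_space space_F)

lemma measurable_X_F: "0 <= t ==> X t : BM (F t)"
 using measurable_compose[OF adapted measurable_restrict_space1[OF measurable_ident]] by simp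

lemma measurable_F_M: "f : F t \<rightarrow>\<^sub>M L ==> f : M \<rightarrow>\<^sub>M L"
 unfolding measurable_def using space_F[of t] sets_F[of t] by auto

lemma measurable_F_mono: "s <= t ==> f : F s \<rightarrow>\<^sub>M L ==> f : F t \<rightarrow>\<^sub>M L"
 using sets_F_mono[of s t] space_F by (auto simp: measurable_def)

lemma measurable_X: "0 <= t ==> X t : BM M"
 by (rule measurable_F_M[OF measurable_X_F])

lemma measurable_X_S: "0 <= t ==> X t : M \<rightarrow>\<^sub>M SB"
 by (rule measurable_F_M[OF adapted])

lemma measurable_X_pair:
 fixes u :: "real^'d => real"
 assumes u: "continuous_on UNIV u"
 shows "(%(t, z). u (X (max 0 t) z)) : BM (borel \<Otimes>\<^sub>M M)"
proof (rule measurable_right_continuous[where Y="%t z. u (X t z)"])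
 show "(%z. u (X t z)) : BM M" if "0 <= t" for t
  using measurable_compose[OF measurable_X[OF that] borel_measurable_continuous_onI[OF u]] .
 show "continuous (at_right t) (%s. u (X s z))" if "0 <= t" "z : space M" for t z
 proof -
  have "((%s. X s z) \<longlongrightarrow> X t z) (at_right t)"
   using right_continuous[OF that] by (simp add: continuous_within)
  moreover have "isCont u (X t z)" using u by (simp add: continuous_on_eq_continuous_at)
  ultimately have "((%s. u (X s z)) \<longlongrightarrow> u (X t z)) (at_right t)" by (rule isCont_tendsto_compose[rotated])
  thus ?thesis by (simp add: continuous_within)
 qed
qed

lemma subalgebra_F: "x : S ==> subalgebra (P x) (F t)"
 using sets_F by (simp add: subalgebra_def space_P space_F sets_P)

lemma cond_exp_F:
 assumes "x : S"
 shows "finite_measure_subalgebra (P x) (F t)"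
proof -
 interpret prob_space "P x" by (rule P_prob[OF assms])
 show ?thesis using subalgebra_F[OF assms] by unfold_locales
qed

lemma kernel_at: "0 <= s ==> 0 <= t ==> (%z. distr (P (X s z)) SB (X t)) : M \<rightarrow>\<^sub>M subprob_algebra SB"
 using measurable_compose[OF measurable_compose[OF measurable_X_S[of s] measurable_prob_algebraD[OF kernel]] measurable_distr[OF measurable_X_S[of t]]] by simp

lemma markov_nn_integral:
 assumes x: "x : S" and st: "0 <= s" "0 <= t" and A: "A : sets (F s)" and h: "h : BM SB"
 shows "(\<integral>\<^sup>+z. ind A z * h (X (s + t) z) \<partial>P x) = (\<integral>\<^sup>+z. ind A z * (\<integral>\<^sup>+z'. h (X t z') \<partial>P (X s z)) \<partial>P x)"
proof -
 interpret prob_space "P x" by (rule P_prob[OF x])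
 interpret C: finite_measure_subalgebra "P x" "F s" by (rule cond_exp_F[OF x])
 note [measurable_cong] = sets_P[OF x]
 have AM[measurable]: "A : sets M" using A sets_F by auto
 have st0: "0 <= s + t" using st by simp
 note [measurable] = measurable_X_S[OF st0] measurable_X_S[OF st(2)] h
 define K where "K z = distr (P (X s z)) SB (X t)" for z
 let ?Q = "density (P x) (ind A)"
 have K: "K : ?Q \<rightarrow>\<^sub>M subprob_algebra SB" using kernel_at[OF st] unfolding K_def by (simp cong: measurable_cong_sets)
 have ne: "space ?Q \<noteq> {}" using not_empty by simp
 have "distr ?Q SB (X (s + t)) = ?Q \<bind> K"
 proof (rule measure_eqI)
  show "sets (distr ?Q SB (X (s + t))) = sets (?Q \<bind> K)" using sets_bind[OF sets_kernel[OF K] ne] by simp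
  fix B assume "B : sets (distr ?Q SB (X (s + t)))"
  hence B[measurable]: "B : sets SB" by simp
  have meas: "{z' : space M. X t z' : B} : sets M" by measurable
  have Kmeas: "emeasure (K z) B = ennreal (measure (P (X s z)) {z' : space M. X t z' : B})" if "z : space M" for z
  proof -
   have y: "X s z : S" by (rule X_in_S[OF st(1) that])
   interpret Y: prob_space "P (X s z)" by (rule P_prob[OF y])
   have "X t : P (X s z) \<rightarrow>\<^sub>M SB" using measurable_X_S[OF st(2)] by (simp cong: measurable_cong_sets add: sets_P[OF y])
   hence "emeasure (K z) B = emeasure (P (X s z)) (X t -` B \<inter> space M)"
    unfolding K_def by (subst emeasure_distr) (auto simp: space_P[OF y])
   also have "X t -` B \<inter> space M = {z' : space M. X t z' : B}" by auto
   finally show ?thesis by (simp add: Y.emeasure_eq_measure)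
  qed
  have Kb: "(%z. emeasure (K z) B) : BM M"
   using measurable_emeasure_kernel[OF K B] by simp
  have int: "integrable (P x) (%z. ind B (X (s + t) z) :: real)"
   by (rule integrable_const_bound[of _ 1]) (auto split: split_indicator)
  have "emeasure (distr ?Q SB (X (s + t))) B = (\<integral>\<^sup>+y. ind B y \<partial>distr ?Q SB (X (s + t)))" by simp
  also have "... = (\<integral>\<^sup>+z. ind A z * ind B (X (s + t) z) \<partial>P x)"
   by (subst nn_integral_distr, simp, simp) (subst nn_integral_density, auto)
  also have "... = ennreal (\<integral>z\<in>A. ind B (X (s + t) z) \<partial>P x)"
   unfolding set_lebesgue_integral_def using integrable_real_mult_indicator[OF _ int, of A]
   by (subst nn_integral_eq_integral[symmetric]) (auto simp: mult.commute intro!: nn_integral_cong split: split_indicator)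
  also have "(\<integral>z\<in>A. ind B (X (s + t) z) \<partial>P x) = (\<integral>z\<in>A. real_cond_exp (P x) (F s) (%z. ind B (X (s + t) z)) z \<partial>P x)"
   by (rule C.real_cond_exp_intA[OF int A])
  also have "... = (\<integral>z\<in>A. measure (P (X s z)) {z' : space M. X t z' : B} \<partial>P x)"
  proof -
   have "(%z. measure (P (X s z)) {z' : space M. X t z' : B}) : BM M"
    using Kb by (rule measurable_cong[THEN iffD1, rotated, OF borel_measurable_enn2real]) (simp add: Kmeas)
   thus ?thesis using markov[OF x st B] unfolding set_lebesgue_integral_def
    by (intro integral_cong_AE) auto
  qed
  also have "ennreal ... = (\<integral>\<^sup>+z. ind A z * emeasure (K z) B \<partial>P x)"
  proof -
   have m: "(%z. measure (P (X s z)) {z' : space M. X t z' : B}) : BM M"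
    using Kb by (rule measurable_cong[THEN iffD1, rotated, OF borel_measurable_enn2real]) (simp add: Kmeas)
   have "integrable (P x) (%z. ind A z *\<^sub>R measure (P (X s z)) {z' : space M. X t z' : B})"
   proof (rule integrable_const_bound[of _ 1])
    show "AE z in P x. norm (ind A z *\<^sub>R measure (P (X s z)) {z' : space M. X t z' : B}) <= 1"
    proof (rule AE_I2)
     fix z assume "z : space (P x)"
     hence "X s z : S" using X_in_S st by (simp add: space_P[OF x])
     then interpret Y: prob_space "P (X s z)" by (rule P_prob)
     show "norm (ind A z *\<^sub>R measure (P (X s z)) {z' : space M. X t z' : B}) <= 1"
      by (auto split: split_indicator)
    qed
   qed (use m in measurable)
   thus ?thesis unfolding set_lebesgue_integral_def
    by (subst nn_integral_eq_integral[symmetric]) (auto intro!: nn_integral_cong simp: Kmeas space_P[OF x] split: split_indicator)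
  qed
  also have "... = (\<integral>\<^sup>+z. emeasure (K z) B \<partial>?Q)"
   using Kb by (subst nn_integral_density) auto
  also have "... = emeasure (?Q \<bind> K) B"
   by (rule emeasure_bind[OF ne K B, symmetric])
  finally show "emeasure (distr ?Q SB (X (s + t))) B = emeasure (?Q \<bind> K) B" .
 qed
 hence "(\<integral>\<^sup>+y. h y \<partial>distr ?Q SB (X (s + t))) = (\<integral>\<^sup>+y. h y \<partial>(?Q \<bind> K))" by simp
 moreover have "(\<integral>\<^sup>+y. h y \<partial>distr ?Q SB (X (s + t))) = (\<integral>\<^sup>+z. ind A z * h (X (s + t) z) \<partial>P x)"
  by (subst nn_integral_distr, simp, simp) (subst nn_integral_density, auto)
 moreover have "(\<integral>\<^sup>+y. h y \<partial>(?Q \<bind> K)) = (\<integral>\<^sup>+z. ind A z * (\<integral>\<^sup>+z'. h (X t z') \<partial>P (X s z)) \<partial>P x)"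
 proof -
  have m: "(%z. \<integral>\<^sup>+y. h y \<partial>K z) : BM M"
   using measurable_compose[OF kernel_at[OF st] nn_integral_measurable_subprob_algebra[OF h]] unfolding K_def .
  have "(\<integral>\<^sup>+y. h y \<partial>(?Q \<bind> K)) = (\<integral>\<^sup>+z. \<integral>\<^sup>+y. h y \<partial>K z \<partial>?Q)"
   by (rule nn_integral_bind[OF h K])
  also have "... = (\<integral>\<^sup>+z. ind A z * (\<integral>\<^sup>+y. h y \<partial>K z) \<partial>P x)"
   using m by (subst nn_integral_density) auto
  also have "... = (\<integral>\<^sup>+z. ind A z * (\<integral>\<^sup>+z'. h (X t z') \<partial>P (X s z)) \<partial>P x)"
  proof (rule nn_integral_cong)
   fix z assume "z : space (P x)"
   hence y: "X s z : S" using X_in_S st by (simp add: space_P[OF x])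
   have "X t : P (X s z) \<rightarrow>\<^sub>M SB" using measurable_X_S[OF st(2)] by (simp cong: measurable_cong_sets add: sets_P[OF y])
   thus "ind A z * (\<integral>\<^sup>+y. h y \<partial>K z) = ind A z * (\<integral>\<^sup>+z'. h (X t z') \<partial>P (X s z))"
    unfolding K_def using h by (subst nn_integral_distr) auto
  qed
  finally show ?thesis .
 qed
 ultimately show ?thesis by simp
qed

text \<open>Unbounded functions need the integrability at every starting point, which is then inherited by
the inner expectation.\<close>

lemma markov_integral:
 fixes h :: "real^'d => real"
 assumes x: "x : S" and st: "0 <= s" "0 <= t" and A: "A : sets (F s)" and h: "h : BM SB"
  and int: "\<And>y t. y : S ==> 0 <= t ==> integrable (P y) (%z. h (X t z))"
 shows "integrable (P x) (%z. \<integral>z'. h (X t z') \<partial>P (X s z))"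
  and "(LINT z|P x. ind A z * h (X (s + t) z)) = (LINT z|P x. ind A z * (LINT z'|P (X s z). h (X t z')))"
proof -
 note [measurable_cong] = sets_P[OF x]
 have st0: "0 <= s + t" using st by simp
 have AM[measurable]: "A : sets M" using A sets_F by auto
 have h': "(%z. h (X t z)) : BM M" if "0 <= t" for t
  using measurable_compose[OF measurable_X_S[OF that] h] .
 have hM[measurable]: "(%z. h (X (s + t) z)) : BM M" by (rule h'[OF st0])
 have part: "integrable (P x) (%z. \<integral>z'. k (X t z') \<partial>P (X s z)) \<and>
   (LINT z|P x. ind A z * k (X (s + t) z)) = (LINT z|P x. ind A z * (LINT z'|P (X s z). k (X t z')))"
  if k: "k : BM SB" and k0: "\<And>y. 0 <= k y"
   and kint: "\<And>y t. y : S ==> 0 <= t ==> integrable (P y) (%z. k (X t z))" for k :: "real^'d => real"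
 proof -
  have ken: "(%y. ennreal (k y)) : BM SB" using k by measurable
  have kM[measurable]: "(%z. k (X (s + t) z)) : BM M"
   using measurable_compose[OF measurable_X_S[OF st0] k] .
  have inner: "(\<integral>\<^sup>+z'. ennreal (k (X t z')) \<partial>P (X s z)) = ennreal (LINT z'|P (X s z). k (X t z'))" if "z : space M" for z
   using kint[OF X_in_S[OF st(1) that] st(2)] k0 by (intro nn_integral_eq_integral) auto
  have mm: "(%z. \<integral>\<^sup>+z'. ennreal (k (X t z')) \<partial>P (X s z)) : BM M"
  proof -
   have "(%z. \<integral>\<^sup>+y. ennreal (k y) \<partial>distr (P (X s z)) SB (X t)) : BM M"
    using measurable_compose[OF kernel_at[OF st] nn_integral_measurable_subprob_algebra[OF ken]] .
   moreover have "(\<integral>\<^sup>+y. ennreal (k y) \<partial>distr (P (X s z)) SB (X t)) = (\<integral>\<^sup>+z'. ennreal (k (X t z')) \<partial>P (X s z))" if "z : space M" for z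
   proof -
    have y: "X s z : S" by (rule X_in_S[OF st(1) that])
    have "X t : P (X s z) \<rightarrow>\<^sub>M SB" using measurable_X_S[OF st(2)] by (simp cong: measurable_cong_sets add: sets_P[OF y])
    thus ?thesis using ken by (subst nn_integral_distr) auto
   qed
   ultimately show ?thesis by (rule measurable_cong[THEN iffD1, rotated])
  qed
  have m: "(%z. \<integral>z'. k (X t z') \<partial>P (X s z)) : BM M"
   using borel_measurable_enn2real[OF mm] by (rule measurable_cong[THEN iffD1, rotated]) (simp add: inner k0)
  note [measurable] = m
  have nn: "(\<integral>\<^sup>+z. ind B z * ennreal (k (X (s + t) z)) \<partial>P x) = (\<integral>\<^sup>+z. ind B z * ennreal (LINT z'|P (X s z). k (X t z')) \<partial>P x)"
   if "B : sets (F s)" for B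
   unfolding markov_nn_integral[OF x st that ken] by (intro nn_integral_cong) (simp add: inner space_P[OF x])
  have pos: "0 <= (LINT z'|P (X s z). k (X t z'))" for z using k0 by simp
  have "(\<integral>\<^sup>+z. ennreal (LINT z'|P (X s z). k (X t z')) \<partial>P x) = (\<integral>\<^sup>+z. ennreal (k (X (s + t) z)) \<partial>P x)"
  proof -
   have "(\<integral>\<^sup>+z. ennreal (LINT z'|P (X s z). k (X t z')) \<partial>P x) = (\<integral>\<^sup>+z. ind (space M) z * ennreal (LINT z'|P (X s z). k (X t z')) \<partial>P x)"
    by (intro nn_integral_cong) (simp add: space_P[OF x])
   also have "... = (\<integral>\<^sup>+z. ind (space M) z * ennreal (k (X (s + t) z)) \<partial>P x)"
    using nn[of "space M"] sets.top[of "F s"] space_F[of s] by simp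
   also have "... = (\<integral>\<^sup>+z. ennreal (k (X (s + t) z)) \<partial>P x)"
    by (intro nn_integral_cong) (simp add: space_P[OF x])
   finally show ?thesis .
  qed
  also have "... < \<infinity>" using kint[OF x st0] k0 by (simp add: nn_integral_eq_integral)
  finally have I: "integrable (P x) (%z. \<integral>z'. k (X t z') \<partial>P (X s z))"
   using pos by (intro integrableI_nonneg) auto
  have J1: "integrable (P x) (%z. ind A z * k (X (s + t) z))"
   using integrable_real_mult_indicator[OF _ kint[OF x st0], of A] by (simp add: mult.commute)
  have J2: "integrable (P x) (%z. ind A z * (LINT z'|P (X s z). k (X t z')))"
   using integrable_real_mult_indicator[OF _ I, of A] by (simp add: mult.commute)
  have "ennreal (LINT z|P x. ind A z * k (X (s + t) z)) = ennreal (LINT z|P x. ind A z * (LINT z'|P (X s z). k (X t z')))"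
   using J1 J2 k0 pos nn[OF A]
   by (subst (1 2) nn_integral_eq_integral[symmetric]) (auto simp: ennreal_mult' ennreal_indicator)
  thus ?thesis using I k0 pos by (subst (asm) ennreal_inj) (auto intro!: lebesgue_nonneg)
 qed
 let ?p = "%y. max 0 (h y)" let ?n = "%y. max 0 (- h y)"
 have p: "?p : BM SB" "?n : BM SB" using h by measurable
 have ip: "integrable (P y) (%z. ?p (X t z))" "integrable (P y) (%z. ?n (X t z))" if "y : S" "0 <= t" for y t
  using int[OF that] by auto
 note P1 = part[OF p(1) _ ip(1)] and P2 = part[OF p(2) _ ip(2)]
 have hd: "h y = ?p y - ?n y" for y by auto
 have Td: "(LINT z'|P (X s z). h (X t z')) = (LINT z'|P (X s z). ?p (X t z')) - (LINT z'|P (X s z). ?n (X t z'))"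
  if "z : space M" for z
  using ip[OF X_in_S[OF st(1) that] st(2)] by (subst Bochner_Integration.integral_diff[symmetric]) (auto simp: hd[symmetric])
 have I: "integrable (P x) (%z. (LINT z'|P (X s z). ?p (X t z')) - (LINT z'|P (X s z). ?n (X t z')))"
  using P1 P2 by auto
 show "integrable (P x) (%z. \<integral>z'. h (X t z') \<partial>P (X s z))"
  using I by (rule Bochner_Integration.integrable_cong[THEN iffD1, rotated -1]) (simp_all add: Td space_P[OF x])
 have i3: "integrable (P x) (%z. ind A z * k z)" if "integrable (P x) k" for k :: "'w => real"
  using integrable_real_mult_indicator[OF _ that, of A] by (simp add: mult.commute)
 have "(LINT z|P x. ind A z * h (X (s + t) z)) = (LINT z|P x. ind A z * ?p (X (s + t) z) - ind A z * ?n (X (s + t) z))"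
  by (intro lebesgue_cong refl) (auto split: split_indicator)
 also have "... = (LINT z|P x. ind A z * ?p (X (s + t) z)) - (LINT z|P x. ind A z * ?n (X (s + t) z))"
  by (intro Bochner_Integration.integral_diff i3 ip x st0)
 also have "... = (LINT z|P x. ind A z * (LINT z'|P (X s z). ?p (X t z'))) - (LINT z|P x. ind A z * (LINT z'|P (X s z). ?n (X t z')))"
  using P1 P2 by simp
 also have "... = (LINT z|P x. ind A z * (LINT z'|P (X s z). ?p (X t z')) - ind A z * (LINT z'|P (X s z). ?n (X t z')))"
  using P1 P2 by (intro Bochner_Integration.integral_diff[symmetric] i3) auto
 also have "... = (LINT z|P x. ind A z * (LINT z'|P (X s z). h (X t z')))"
  by (intro lebesgue_cong refl) (simp add: Td space_P[OF x] right_diff_distrib)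
 finally show "(LINT z|P x. ind A z * h (X (s + t) z)) = (LINT z|P x. ind A z * (LINT z'|P (X s z). h (X t z')))" .
qed

end

text \<open>Integration by parts against exp(- c s).\<close>

lemma discounted_primitive:
 fixes b :: "real => real"
 assumes c: "0 <= c" and t: "0 <= t" and b: "integrable lborel (%r. ind {0..t} r * b r)" and bm[measurable]: "b : BM borel"
 defines "B \<equiv> %s. \<integral>r. ind {0..s} r * b r \<partial>lborel"
 shows "integrable lborel (%s. ind {0..t} s * (c * exp (- c * s) * B s))"
  and "exp (- c * t) * B t + (LINT s|lborel. ind {0..t} s * (c * exp (- c * s) * B s)) = (LINT s|lborel. ind {0..t} s * (exp (- c * s) * b s))"
proof -
 interpret lborel_pair: pair_sigma_finite lborel lborel by unfold_locales
 define f where "f r s = (ind {0..t} r * b r) * (ind {r..t} s * (c * exp (- c * s)))" for r s :: real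
 have FTC: "(LINT s|lborel. ind {r..t} s *\<^sub>R (c * exp (- c * s))) = - exp (- c * t) - - exp (- c * r)"
  and FTCi: "integrable lborel (%s. ind {r..t} s *\<^sub>R (c * exp (- c * s)))" if "r <= t" for r
 proof -
  show "(LINT s|lborel. ind {r..t} s *\<^sub>R (c * exp (- c * s))) = - exp (- c * t) - - exp (- c * r)"
  proof (rule integral_FTC_Icc[OF that])
   show "((%s. - exp (- c * s)) has_vector_derivative c * exp (- c * s)) (at s within {r..t})" for s
    unfolding has_real_derivative_iff_has_vector_derivative[symmetric] by (auto intro!: derivative_eq_intros)
  qed (auto intro!: continuous_intros)
  show "integrable lborel (%s. ind {r..t} s *\<^sub>R (c * exp (- c * s)))"
   by (intro borel_integrable_compact) (auto intro!: continuous_intros)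
 qed
 have fr: "(LINT s|lborel. f r s) = ind {0..t} r * b r * (exp (- c * r) - exp (- c * t))" for r
  unfolding f_def integral_mult_right_zero using FTC[of r] by (cases "r : {0..t}") auto
 have fint: "integrable lborel (f r)" for r
  unfolding f_def by (cases "r : {0..t}") (use FTCi[of r] in \<open>auto intro!: integrable_mult_right\<close>)
 have nf: "(LINT s|lborel. norm (f r s)) = \<bar>ind {0..t} r * b r\<bar> * (exp (- c * r) - exp (- c * t))" for r
 proof -
  have "norm (f r s) = \<bar>ind {0..t} r * b r\<bar> * (ind {r..t} s * (c * exp (- c * s)))" for s
   using c by (simp add: f_def abs_mult)
  thus ?thesis using FTC[of r] by (cases "r : {0..t}") simp_all
 qed
 have fm: "case_prod f : BM (lborel \<Otimes>\<^sub>M lborel)"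
 proof -
  have "f = (%r s. (ind {0..t} r * b r) * (of_bool (r <= s \<and> s <= t) * (c * exp (- c * s))))"
   by (auto simp: f_def fun_eq_iff indicator_def)
  thus ?thesis by (simp add: case_prod_beta')
 qed
 have fi: "integrable (lborel \<Otimes>\<^sub>M lborel) (case_prod f)"
 proof (rule lborel_pair.Fubini_integrable[OF fm])
  show "integrable lborel (%r. \<integral>s. norm (case_prod f (r, s)) \<partial>lborel)"
  proof (rule integrable_by[OF b])
   show "AE r in lborel. norm (LINT s|lborel. norm (case_prod f (r, s))) <= norm (ind {0..t} r * b r)"
   proof (rule AE_I2)
    fix r
    have "\<bar>b r\<bar> * \<bar>exp (- c * r) - exp (- c * t)\<bar> <= \<bar>b r\<bar> * 1" if "0 <= r" "r <= t"
    proof (rule mult_left_mono)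
     have "exp (- c * r) <= 1" "exp (- c * t) <= 1" using c that t by auto
     thus "\<bar>exp (- c * r) - exp (- c * t)\<bar> <= 1"
      using exp_ge_zero[of "- c * t"] exp_ge_zero[of "- c * r"] by (simp only: abs_le_iff) linarith
    qed simp
    thus "norm (LINT s|lborel. norm (case_prod f (r, s))) <= norm (ind {0..t} r * b r)"
     unfolding prod.case nf by (auto simp: abs_mult split: split_indicator)
   qed
   show "(%r. \<integral>s. norm (case_prod f (r, s)) \<partial>lborel) : BM lborel"
    by (simp add: nf del: real_norm_def)
  qed
  show "AE r in lborel. integrable lborel (%s. case_prod f (r, s))" using fint by simp
 qed
 have fs: "(LINT r|lborel. f r s) = ind {0..t} s * (c * exp (- c * s) * B s)" for s
 proof -
  have "f r s = (ind {0..t} s * (c * exp (- c * s))) * (ind {0..s} r * b r)" for r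
   by (auto simp: f_def split: split_indicator)
  thus ?thesis by (simp add: B_def)
 qed
 show "integrable lborel (%s. ind {0..t} s * (c * exp (- c * s) * B s))"
  using lborel_pair.integrable_snd[OF fi] by (simp add: fs)
 have "(LINT s|lborel. ind {0..t} s * (c * exp (- c * s) * B s)) = (\<integral>r. \<integral>s. f r s \<partial>lborel \<partial>lborel)"
  using lborel_pair.Fubini_integral[OF fi] by (simp add: fs)
 also have "... = (LINT r|lborel. ind {0..t} r * (exp (- c * r) * b r) - exp (- c * t) * (ind {0..t} r * b r))"
  by (intro lebesgue_cong refl) (simp add: fr algebra_simps)
 also have "... = (LINT r|lborel. ind {0..t} r * (exp (- c * r) * b r)) - exp (- c * t) * B t"
 proof -
  have "integrable lborel (%r. ind {0..t} r * (exp (- c * r) * b r))"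
   by (rule integrable_by[OF b])
    (use c in \<open>auto simp: abs_mult mult_left_le_one_le split: split_indicator\<close>)
  thus ?thesis using b by (simp add: B_def)
 qed
 finally show "exp (- c * t) * B t + (LINT s|lborel. ind {0..t} s * (c * exp (- c * s) * B s)) = (LINT s|lborel. ind {0..t} s * (exp (- c * s) * b s))"
  by simp
qed

context cadlag_markov_process
begin

definition path_integral :: "(real^'d => real) => real => 'w => real" where
 "path_integral g t z = (LINT s:{0..t}|lborel. g (X s z))"

lemma path_integral_eq: "path_integral g t z = (LINT s|lborel. ind {0..t} s * g (X (max 0 s) z))"
 unfolding path_integral_def set_lebesgue_integral_def
 by (intro lebesgue_cong refl) (auto split: split_indicator)

lemma measurable_path_integral_pair:
 assumes g: "continuous_on UNIV g"
 shows "(%(t, z). path_integral g t z) : BM (borel \<Otimes>\<^sub>M M)"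
proof -
 have [measurable]: "(%x. g (X (max 0 (snd x)) (snd (fst x)))) : BM ((borel \<Otimes>\<^sub>M M) \<Otimes>\<^sub>M lborel)"
  using measurable_compose[OF _ measurable_X_pair[OF g], of "%x. (snd x, snd (fst x))" "(borel \<Otimes>\<^sub>M M) \<Otimes>\<^sub>M lborel"]
  by (simp add: case_prod_beta)
 have "(%x. \<integral>s. of_bool (0 <= s \<and> s <= fst x) * g (X (max 0 s) (snd x)) \<partial>lborel) : BM (borel \<Otimes>\<^sub>M M)"
  by (rule lborel.borel_measurable_lebesgue_integral) (simp add: case_prod_beta')
 thus ?thesis by (simp add: case_prod_beta' path_integral_eq indicator_def)
qed

lemma martingale_set_integral:
 assumes x: "x : S" and Z: "martingale (P x) F Z" and st: "0 <= s" "s <= t" and A: "A : sets (F s)"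
 shows "(\<integral>z\<in>A. Z s z \<partial>P x) = (\<integral>z\<in>A. Z t z \<partial>P x)"
proof -
 interpret C: finite_measure_subalgebra "P x" "F s" by (rule cond_exp_F[OF x])
 have int: "integrable (P x) (Z t)" "integrable (P x) (Z s)" and ae: "AE z in P x. real_cond_exp (P x) (F s) (Z t) z = Z s z"
  using Z st by (auto simp: martingale_def)
 have AM: "A : sets (P x)" using A sets_F sets_P[OF x] by auto
 have "(\<integral>z\<in>A. Z t z \<partial>P x) = (\<integral>z\<in>A. real_cond_exp (P x) (F s) (Z t) z \<partial>P x)"
  by (rule C.real_cond_exp_intA[OF int(1) A])
 also have "... = (\<integral>z\<in>A. Z s z \<partial>P x)"
  unfolding set_lebesgue_integral_def using ae AM borel_measurable_integrable[OF int(2)]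
  by (intro integral_cong_AE) auto
 finally show ?thesis ..
qed

lemma
 assumes x: "x : S" and Z: "martingale (P x) F Z" and st: "0 <= s" "s <= t"
 shows martingale_expectation: "(LINT z|P x. Z s z) = (LINT z|P x. Z t z)"
  and martingale_abs: "(LINT z|P x. \<bar>Z s z\<bar>) <= (LINT z|P x. \<bar>Z t z\<bar>)"
proof -
 have int: "integrable (P x) (Z t)" "integrable (P x) (Z s)" and ms: "Z s : BM (F s)"
  using Z st by (auto simp: martingale_def)
 have sp: "set_lebesgue_integral (P x) (space M) f = integral\<^sup>L (P x) f" for f :: "'w => real"
  using set_integral_space[of "P x" f] Bochner_Integration.integrable_cong
  by (auto simp: set_lebesgue_integral_def space_P[OF x] intro!: lebesgue_cong)
 have top: "space M : sets (F s)" using sets.top[of "F s"] space_F[of s] by simp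
 show "(LINT z|P x. Z s z) = (LINT z|P x. Z t z)"
  using martingale_set_integral[OF x Z st top] by (simp add: sp)
 let ?A = "{z : space M. 0 <= Z s z}" and ?B = "{z : space M. Z s z < 0}"
 have A: "?A : sets (F s)" "?B : sets (F s)"
  unfolding space_F[of s, symmetric] using ms by measurable
 have AM: "?A : sets (P x)" "?B : sets (P x)" using A sets_F sets_P[OF x] by auto
 have si: "set_integrable (P x) C f" if "C : sets (P x)" "integrable (P x) f" for C and f :: "'w => real"
  unfolding set_integrable_def using integrable_mult_indicator[OF that] .
 have split: "integral\<^sup>L (P x) f = (\<integral>z\<in>?A. f z \<partial>P x) + (\<integral>z\<in>?B. f z \<partial>P x)" if "integrable (P x) f" for f :: "'w => real"
 proof -
  have "?A \<union> ?B = space M" "?A \<inter> ?B = {}" by auto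
  thus ?thesis using set_integral_Un[of ?A ?B "P x" f] si[OF AM(1) that] si[OF AM(2) that] sp[of f] by auto
 qed
 have "(LINT z|P x. \<bar>Z s z\<bar>) = (\<integral>z\<in>?A. \<bar>Z s z\<bar> \<partial>P x) + (\<integral>z\<in>?B. \<bar>Z s z\<bar> \<partial>P x)"
  using int by (intro split) auto
 also have "(\<integral>z\<in>?A. \<bar>Z s z\<bar> \<partial>P x) = (\<integral>z\<in>?A. Z s z \<partial>P x)"
  unfolding set_lebesgue_integral_def by (intro lebesgue_cong refl) (auto split: split_indicator)
 also have "... = (\<integral>z\<in>?A. Z t z \<partial>P x)" by (rule martingale_set_integral[OF x Z st A(1)])
 also have "... <= (\<integral>z\<in>?A. \<bar>Z t z\<bar> \<partial>P x)"
  using si[OF AM(1)] int by (intro set_integral_mono) auto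
 also have "(\<integral>z\<in>?B. \<bar>Z s z\<bar> \<partial>P x) = (\<integral>z\<in>?B. - Z s z \<partial>P x)"
  unfolding set_lebesgue_integral_def by (intro lebesgue_cong refl) (auto split: split_indicator)
 also have "... = - (\<integral>z\<in>?B. Z s z \<partial>P x)" by (simp add: set_lebesgue_integral_def)
 also have "(\<integral>z\<in>?B. Z s z \<partial>P x) = (\<integral>z\<in>?B. Z t z \<partial>P x)" by (rule martingale_set_integral[OF x Z st A(2)])
 also have "- (\<integral>z\<in>?B. Z t z \<partial>P x) = (\<integral>z\<in>?B. - Z t z \<partial>P x)" by (simp add: set_lebesgue_integral_def)
 also have "... <= (\<integral>z\<in>?B. \<bar>Z t z\<bar> \<partial>P x)"
  using si[OF AM(2)] int by (intro set_integral_mono) auto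
 also have "(\<integral>z\<in>?A. \<bar>Z t z\<bar> \<partial>P x) + (\<integral>z\<in>?B. \<bar>Z t z\<bar> \<partial>P x) = (LINT z|P x. \<bar>Z t z\<bar>)"
  using int by (intro split[symmetric]) auto
 finally show "(LINT z|P x. \<bar>Z s z\<bar>) <= (LINT z|P x. \<bar>Z t z\<bar>)" by simp
qed

definition localizer :: "(real^'d => real) => (real^'d => real) => real^'d => ('w => real) => bool" where
 "localizer u g x T \<longleftrightarrow> stopping_time F T \<and> (\<forall>z. 0 <= T z) \<and>
  martingale (P x) F (%t z. u (X (min t (T z)) z) - u x - path_integral g (min t (T z)) z)"

lemma localizer_exists:
 assumes "ext_generator S F X P u g" "x : S"
 obtains T where "\<And>n. localizer u g x (T n)"
  "AE z in P x. filterlim (%n. T n z) at_top sequentially"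
  "AE z in P x. \<forall>t\<ge>0. set_integrable lborel {0..t} (%s. g (X s z))"
proof -
 have ae: "AE z in P x. \<forall>t\<ge>0. set_integrable lborel {0..t} (%s. g (X s z))"
  and lm: "local_martingale (P x) F (%t z. u (X t z) - u x - (LINT s:{0..t}|lborel. g (X s z)))"
  using assms by (auto simp: ext_generator_def)
 obtain T where T: "\<And>n. stopping_time F (T n)" "\<And>n z. 0 <= T n z"
  "AE z in P x. incseq (%n. T n z) \<and> filterlim (%n. T n z) at_top sequentially"
  "\<And>n. martingale (P x) F (%t z. u (X (min t (T n z)) z) - u x - (LINT s:{0..min t (T n z)}|lborel. g (X s z)))"
  using lm unfolding local_martingale_def by blast
 show thesis
 proof (rule that[of T])
  show "localizer u g x (T n)" for n using T by (simp add: localizer_def path_integral_def)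
  show "AE z in P x. filterlim (%n. T n z) at_top sequentially" using T(3) by eventually_elim simp
 qed (rule ae)
qed

lemma measurable_stopping: "stopping_time F T ==> T : BM M"
 by (rule measurable_stopping_time[OF _ sets_F space_F])

lemma measurable_X_stopped:
 fixes u :: "real^'d => real"
 assumes u: "continuous_on UNIV u" and T: "\<And>z. 0 <= T z" "T : BM M"
 shows "(%z. u (X (T z) z)) : BM M"
 using measurable_compose[OF _ measurable_X_pair[OF u], of "%z. (T z, z)" M] T by simp

text \<open>Gronwall's inequality would need a finite expectation in advance. Discounting inside the
pathwise identity avoids this: the drift of the discounted process is nonpositive.\<close>

lemma discounted_bound:
 assumes x: "x : S" and fc: "continuous_on UNIV f" and gc: "continuous_on UNIV g"
  and c: "0 <= c" and f0: "\<And>y. y : S ==> 0 <= f y" and gf: "\<And>y. y : S ==> g y <= c * f y"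
  and T: "localizer f g x T" and ae: "AE z in P x. \<forall>t\<ge>0. set_integrable lborel {0..t} (%s. g (X s z))" and t: "0 <= t"
 shows "(\<integral>\<^sup>+z. ennreal (f (X (min t (T z)) z)) \<partial>P x) <= ennreal (exp (c * t) * f x)"
proof -
 interpret prob_space "P x" by (rule P_prob[OF x])
 interpret LP: pair_sigma_finite lborel "P x" by unfold_locales
 note [measurable_cong] = sets_P[OF x]
 have st: "stopping_time F T" and T0: "\<And>z. 0 <= T z" using T by (auto simp: localizer_def)
 note [measurable] = measurable_stopping[OF st]
 define Y where "Y s z = f (X (min s (T z)) z) - f x - path_integral g (min s (T z)) z" for s z
 have mart: "martingale (P x) F Y" using T by (simp add: localizer_def Y_def[abs_def])
 have Yint: "integrable (P x) (Y s)" if "0 <= s" for s using mart that by (simp add: martingale_def)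
 have fX[measurable]: "(%p. f (X (max 0 (min (fst p) (T (snd p)))) (snd p))) : BM (borel \<Otimes>\<^sub>M M)"
  using measurable_compose[OF _ measurable_X_pair[OF fc], of "%p. (min (fst p) (T (snd p)), snd p)" "borel \<Otimes>\<^sub>M M"] by simp
 have gI[measurable]: "(%p. path_integral g (min (fst p) (T (snd p))) (snd p)) : BM (borel \<Otimes>\<^sub>M M)"
  using measurable_compose[OF _ measurable_path_integral_pair[OF gc], of "%p. (min (fst p) (T (snd p)), snd p)" "borel \<Otimes>\<^sub>M M"] by simp
 define \<phi> where "\<phi> s z = ind {0..t} s * (c * exp (- c * s) * Y s z)" for s z
 have \<phi>m: "case_prod \<phi> : BM (lborel \<Otimes>\<^sub>M P x)"
 proof -
  have "case_prod \<phi> = (%p. ind {0..t} (fst p) * (c * exp (- c * fst p) *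
    (f (X (max 0 (min (fst p) (T (snd p)))) (snd p)) - f x - path_integral g (min (fst p) (T (snd p))) (snd p))))"
   using T0 by (auto simp: \<phi>_def Y_def fun_eq_iff split: split_indicator)
  thus ?thesis by (simp cong: measurable_cong_sets)
 qed
 have Y0: "(LINT z|P x. Y s z) = 0" if "0 <= s" for s
 proof -
  have "(LINT z|P x. Y s z) = (LINT z|P x. Y 0 z)" using martingale_expectation[OF x mart order_refl that] ..
  also have "... = 0"
  proof (rule integral_eq_zero_AE)
   show "AE z in P x. Y 0 z = 0"
    using start[OF x]
   proof eventually_elim
    case (elim z)
    have "path_integral g 0 z = 0"
     unfolding path_integral_eq
    proof (rule integral_eq_zero_AE)
     show "AE s in lborel. ind {0..0} s * g (X (max 0 s) z) = 0"
      using AE_lborel_singleton[of "0::real"] by eventually_elim auto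
    qed
    then show ?case using elim T0 by (simp add: Y_def min_absorb1)
   qed
  qed
  finally show ?thesis .
 qed
 have \<phi>i: "integrable (lborel \<Otimes>\<^sub>M P x) (case_prod \<phi>)"
 proof (rule LP.Fubini_integrable[OF \<phi>m])
  have nb: "(LINT z|P x. norm (\<phi> s z)) <= ind {0..t} s * (c * (LINT z|P x. \<bar>Y t z\<bar>))" for s
  proof (cases "s : {0..t}")
   case True
   have "(LINT z|P x. norm (\<phi> s z)) = c * exp (- c * s) * (LINT z|P x. \<bar>Y s z\<bar>)"
    using True c by (simp add: \<phi>_def abs_mult)
   also have "... <= c * 1 * (LINT z|P x. \<bar>Y t z\<bar>)"
    using True c martingale_abs[OF x mart, of s t] by (intro mult_mono) auto
   finally show ?thesis using True by simp
  qed (simp add: \<phi>_def)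
  show "integrable lborel (%s. \<integral>z. norm (case_prod \<phi> (s, z)) \<partial>P x)"
  proof (rule integrable_by)
   show "integrable lborel (%s. ind {0..t} s * (c * (LINT z|P x. \<bar>Y t z\<bar>)))"
    using t by (intro integrable_mult_left integrable_real_indicator) auto
   show "(%s. \<integral>z. norm (case_prod \<phi> (s, z)) \<partial>P x) : BM lborel"
    using \<phi>m by measurable
   show "AE s in lborel. norm (LINT z|P x. norm (case_prod \<phi> (s, z))) <= norm (ind {0..t} s * (c * (LINT z|P x. \<bar>Y t z\<bar>)))"
    using nb c by (intro AE_I2) (auto simp: abs_of_nonneg integral_nonneg_AE)
  qed
  show "AE s in lborel. integrable (P x) (%z. case_prod \<phi> (s, z))"
  proof (rule AE_I2)
   fix s :: real
   show "integrable (P x) (%z. case_prod \<phi> (s, z))"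
    by (cases "s : {0..t}") (auto simp: \<phi>_def intro!: integrable_mult_right Yint)
  qed
 qed
 define Z where "Z z = exp (- c * t) * Y t z + (LINT s|lborel. \<phi> s z)" for z
 have Zi: "integrable (P x) Z"
  unfolding Z_def using LP.integrable_snd[OF \<phi>i] Yint[OF t] by auto
 have EZ: "(LINT z|P x. Z z) = 0"
 proof -
  have "(LINT z|P x. (LINT s|lborel. \<phi> s z)) = (LINT s|lborel. (LINT z|P x. \<phi> s z))"
   using LP.Fubini_integral[OF \<phi>i] .
  also have "... = (\<integral>s. (0::real) \<partial>(lborel::real measure))"
  proof (rule lebesgue_cong[OF refl])
   fix s :: real show "(LINT z|P x. \<phi> s z) = 0" using Y0[of s] by (cases "s : {0..t}") (simp_all add: \<phi>_def)
  qed
  finally show ?thesis unfolding Z_def using LP.integrable_snd[OF \<phi>i] Yint[OF t] Y0[OF t] by simp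
 qed
 have ineq: "AE z in P x. exp (- c * t) * f (X (min t (T z)) z) <= f x + Z z"
  using ae LP.AE_integrable_snd[OF \<phi>i] AE_space
 proof eventually_elim
  case (elim z)
  have z: "z : space M" using elim(3) by (simp add: space_P[OF x])
  have gm: "(%s. g (X (max 0 s) z)) : BM borel"
   using measurable_compose[OF measurable_Pair2'[OF z], OF measurable_X_pair[OF gc]] by simp
  define b where "b r = ind {..T z} r * g (X (max 0 r) z)" for r
  have bm[measurable]: "b : BM borel" unfolding b_def using gm by measurable
  have gint: "integrable lborel (%r. ind {0..s} r * g (X (max 0 r) z))" if "0 <= s" for s
  proof -
   have "(%r. ind {0..s} r * g (X (max 0 r) z)) = (%r. ind {0..s} r *\<^sub>R g (X r z))"
    by (auto simp: fun_eq_iff split: split_indicator)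
   thus ?thesis using elim(1) that by (simp add: set_integrable_def)
  qed
  have bi: "integrable lborel (%r. ind {0..t} r * b r)"
  proof -
   have "(%r. ind {0..t} r * b r) = (%r. ind {0..min t (T z)} r * g (X (max 0 r) z))"
    by (auto simp: fun_eq_iff b_def split: split_indicator)
   thus ?thesis using gint[of "min t (T z)"] t T0 by simp
  qed
  have B: "(LINT r|lborel. ind {0..s} r * b r) = path_integral g (min s (T z)) z" for s
   unfolding path_integral_eq by (intro lebesgue_cong refl) (auto simp: b_def split: split_indicator)
  define a where "a s = f (X (min s (T z)) z)" for s
  have a0: "0 <= a s" if "0 <= s" for s
   unfolding a_def using that T0 by (intro f0 X_in_S z) auto
  have d1: "integrable lborel (%s. ind {0..t} s * (c * exp (- c * s) * path_integral g (min s (T z)) z))"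
   and d2: "exp (- c * t) * path_integral g (min t (T z)) z + (LINT s|lborel. ind {0..t} s * (c * exp (- c * s) * path_integral g (min s (T z)) z))
    = (LINT s|lborel. ind {0..t} s * (exp (- c * s) * b s))"
   using discounted_primitive[OF c t bi bm] unfolding B by auto
  have e1: "integrable lborel (%s. ind {0..t} s *\<^sub>R (c * exp (- c * s)))"
   by (intro borel_integrable_compact) (auto intro!: continuous_intros)
  have e2: "(LINT s|lborel. ind {0..t} s *\<^sub>R (c * exp (- c * s))) = - exp (- c * t) - - exp (- c * 0)"
  proof (rule integral_FTC_Icc[OF t])
   show "((%s. - exp (- c * s)) has_vector_derivative c * exp (- c * s)) (at s within {0..t})" for s
    unfolding has_real_derivative_iff_has_vector_derivative[symmetric] by (auto intro!: derivative_eq_intros)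
  qed (auto intro!: continuous_intros)
  have dec: "ind {0..t} s * (c * exp (- c * s) * a s) = \<phi> s z + f x * (ind {0..t} s *\<^sub>R (c * exp (- c * s)))
   + ind {0..t} s * (c * exp (- c * s) * path_integral g (min s (T z)) z)" for s
   by (simp add: \<phi>_def Y_def a_def algebra_simps)
  have ai: "integrable lborel (%s. ind {0..t} s * (c * exp (- c * s) * a s))"
   unfolding dec using elim(2) e1 d1 by auto
  have aI: "(LINT s|lborel. ind {0..t} s * (c * exp (- c * s) * a s)) = (LINT s|lborel. \<phi> s z) + f x * (1 - exp (- c * t))
   + (LINT s|lborel. ind {0..t} s * (c * exp (- c * s) * path_integral g (min s (T z)) z))"
   unfolding dec using elim(2) e1 d1 e2 by simp
  have "(LINT s|lborel. ind {0..t} s * (exp (- c * s) * b s)) <= (LINT s|lborel. ind {0..t} s * (c * exp (- c * s) * a s))"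
  proof (rule integral_mono)
   show "integrable lborel (%s. ind {0..t} s * (exp (- c * s) * b s))"
    by (rule integrable_by[OF bi])
     (use c in \<open>auto simp: abs_mult mult_left_le_one_le split: split_indicator\<close>)
   fix s
   have "b s <= c * a s" if "0 <= s"
   proof (cases "s <= T z")
    case True
    thus ?thesis using gf[OF X_in_S[OF that z]] that by (simp add: b_def a_def)
   qed (use a0[OF that] c in \<open>simp add: b_def\<close>)
   hence "exp (- c * s) * b s <= exp (- c * s) * (c * a s)" if "0 <= s" using that by (intro mult_left_mono) auto
   thus "ind {0..t} s * (exp (- c * s) * b s) <= ind {0..t} s * (c * exp (- c * s) * a s)"
    by (auto simp: mult_ac split: split_indicator)
  qed (rule ai)
  then show ?case using aI d2 by (simp add: Z_def Y_def a_def algebra_simps)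
 qed
 have X1: "f (X (min t (T z)) z) \<ge> 0" if "z : space M" for z
  using that T0 t by (intro f0 X_in_S) auto
 have [measurable]: "(%z. f (X (min t (T z)) z)) : BM M"
  by (rule measurable_X_stopped[OF fc]) (use T0 t in auto)
 have "(\<integral>\<^sup>+z. ennreal (f (X (min t (T z)) z)) \<partial>P x) = (\<integral>\<^sup>+z. ennreal (exp (c * t)) * ennreal (exp (- c * t) * f (X (min t (T z)) z)) \<partial>P x)"
  by (intro nn_integral_cong) (simp add: ennreal_mult'[symmetric] mult.assoc[symmetric] exp_add[symmetric])
 also have "... = ennreal (exp (c * t)) * (\<integral>\<^sup>+z. ennreal (exp (- c * t) * f (X (min t (T z)) z)) \<partial>P x)"
  by (intro nn_integral_cmult) measurable
 also have "(\<integral>\<^sup>+z. ennreal (exp (- c * t) * f (X (min t (T z)) z)) \<partial>P x) <= (\<integral>\<^sup>+z. ennreal (f x + Z z) \<partial>P x)"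
  using ineq by (intro nn_integral_mono_AE) (auto intro: ennreal_leI)
 also have "(\<integral>\<^sup>+z. ennreal (f x + Z z) \<partial>P x) = ennreal (LINT z|P x. f x + Z z)"
 proof (rule nn_integral_eq_integral)
  show "integrable (P x) (%z. f x + Z z)" using Zi by auto
  show "AE z in P x. 0 <= f x + Z z"
   using ineq AE_space
  proof eventually_elim
   case (elim z)
   have "0 <= exp (- c * t) * f (X (min t (T z)) z)" using X1 elim(2) by (simp add: space_P[OF x])
   then show ?case using elim(1) by simp
  qed
 qed
 also have "(LINT z|P x. f x + Z z) = f x" using Zi EZ by (simp add: prob_space)
 finally show ?thesis using f0[OF x] by (simp add: ennreal_mult mult_left_mono)
qed

end

section \<open>Dynkin's formula for functions of quadratic growth\<close>

lemma Fatou_real: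
 fixes h :: "nat => 'a => real"
 assumes meas: "h' : BM N" and int: "\<And>n. integrable N (h n)" and nonneg: "\<And>n. AE x in N. 0 <= h n x"
  and lim: "AE x in N. (%n. h n x) \<longlonglongrightarrow> h' x" and le: "\<And>n. integral\<^sup>L N (h n) <= b n" and b: "b \<longlonglongrightarrow> b'"
 shows "integrable N h'" and "integral\<^sup>L N h' <= b'"
proof -
 have nn: "AE x in N. 0 <= h' x"
 proof -
  have "AE x in N. \<forall>n. 0 <= h n x" using nonneg by (simp add: AE_all_countable)
  with lim show ?thesis by eventually_elim (auto intro: LIMSEQ_le_const)
 qed
 have b0: "0 <= b n" for n using le[of n] integral_nonneg_AE[OF nonneg[of n]] by linarith
 hence b'0: "0 <= b'" using b by (auto intro: LIMSEQ_le_const)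
 have "(\<integral>\<^sup>+x. ennreal (h' x) \<partial>N) = (\<integral>\<^sup>+x. liminf (%n. ennreal (h n x)) \<partial>N)"
  by (rule nn_integral_cong_AE) (use lim in eventually_elim, auto intro!: lim_imp_Liminf[symmetric] tendsto_ennrealI)
 also have "... <= liminf (%n. \<integral>\<^sup>+x. ennreal (h n x) \<partial>N)"
  using int by (intro nn_integral_liminf) auto
 also have "... <= liminf (%n. ennreal (b n))"
  by (intro Liminf_mono always_eventually allI) (use int nonneg le in \<open>auto simp: nn_integral_eq_integral intro!: ennreal_leI\<close>)
 also have "... = ennreal b'"
  by (intro lim_imp_Liminf tendsto_ennrealI b) simp
 finally have le': "(\<integral>\<^sup>+x. ennreal (h' x) \<partial>N) <= ennreal b'" .
 hence "(\<integral>\<^sup>+x. ennreal (h' x) \<partial>N) < \<infinity>" using le_less_trans[OF _ ennreal_less_top] by auto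
 thus i: "integrable N h'" using meas nn by (intro integrableI_nonneg)
 show "integral\<^sup>L N h' <= b'"
  using le' b'0 nn_integral_eq_integral[OF i nn] integral_nonneg_AE[OF nn] by simp
qed

lemma right_limit_sequence:
 fixes h :: "real => 'a::topological_space"
 assumes h: "(h \<longlongrightarrow> h a) (at_right a)" and \<tau>: "\<tau> \<longlonglongrightarrow> a" "\<And>n. a <= \<tau> n"
 shows "(%n. h (\<tau> n)) \<longlonglongrightarrow> h a"
proof (rule topological_tendstoI)
 fix U assume U: "open U" "h a : U"
 from topological_tendstoD[OF h U] obtain b where b: "a < b" "\<And>y. a < y ==> y < b ==> h y : U"
  by (auto simp: eventually_at_right_field)
 have "eventually (%n. \<tau> n < b) sequentially" using order_tendstoD(2)[OF \<tau>(1) b(1)] .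
 thus "eventually (%n. h (\<tau> n) : U) sequentially"
 proof eventually_elim
  case (elim n)
  show ?case using b(2)[of "\<tau> n"] elim \<tau>(2)[of n] U(2) by (cases "\<tau> n = a") auto
 qed
qed

text \<open>Boundedness in L^2 gives uniform integrability: apply Fatou's lemma to e h^2 + 1/(4 e) plus or
minus h, which is nonnegative.\<close>

lemma (in prob_space) L2_bounded_convergence:
 fixes h :: "nat => 'a => real"
 assumes meas: "h' : BM M" "\<And>n. h n : BM M"
  and lim: "AE x in M. (%n. h n x) \<longlonglongrightarrow> h' x"
  and bound: "\<And>n. (\<integral>\<^sup>+x. ennreal ((h n x)\<^sup>2) \<partial>M) <= ennreal K"
 shows "integrable M h'" and "\<And>n. integrable M (h n)" and "(%n. expectation (h n)) \<longlonglongrightarrow> expectation h'"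
proof -
 note [measurable] = meas
 have sq: "integrable M (%x. (h n x)\<^sup>2)" for n
 proof (rule integrableI_nonneg)
  show "(\<integral>\<^sup>+x. ennreal ((h n x)\<^sup>2) \<partial>M) < \<infinity>" using le_less_trans[OF bound[of n] ennreal_less_top] by simp
 qed auto
 have K0: "expectation (%x. (h n x)\<^sup>2) <= max 0 K" for n
 proof -
  have "ennreal (expectation (%x. (h n x)\<^sup>2)) <= ennreal K"
   using bound[of n] nn_integral_eq_integral[OF sq[of n]] by simp
  also have "... <= ennreal (max 0 K)" by (rule ennreal_leI) simp
  finally show ?thesis by (subst (asm) ennreal_le_iff) auto
 qed
 define K' where "K' = max 0 K"
 have sq': "integrable M (%x. (h' x)\<^sup>2)" and K': "expectation (%x. (h' x)\<^sup>2) <= K'"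
 proof -
  have *: "AE x in M. (%n. (h n x)\<^sup>2) \<longlonglongrightarrow> (h' x)\<^sup>2" using lim by eventually_elim (intro tendsto_intros)
  show "integrable M (%x. (h' x)\<^sup>2)" "expectation (%x. (h' x)\<^sup>2) <= K'"
   by (rule Fatou_real[OF _ sq _ * K0[folded K'_def] tendsto_const]; simp)+
 qed
 have L1: "integrable M k" if "k : BM M" "integrable M (%x. (k x)\<^sup>2)" for k :: "'a => real"
 proof (rule integrable_by)
  show "integrable M (%x. 1 + (k x)\<^sup>2)" using that by simp
  show "AE x in M. norm (k x) <= norm (1 + (k x)\<^sup>2)"
  proof (rule AE_I2)
   fix x
   have "0 <= (\<bar>k x\<bar> - 1)\<^sup>2" by simp
   hence "2 * \<bar>k x\<bar> <= 1 + (k x)\<^sup>2" by (simp add: power2_diff)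
   thus "norm (k x) <= norm (1 + (k x)\<^sup>2)" by simp
  qed
 qed (use that in simp)
 show i': "integrable M h'" by (rule L1[OF meas(1) sq'])
 show i: "\<And>n. integrable M (h n)" by (rule L1[OF meas(2) sq])
 define d where "d n x = h n x - h' x" for n x
 have dm[measurable]: "d n : BM M" for n unfolding d_def by measurable
 have d2: "(d n x)\<^sup>2 <= 2 * (h n x)\<^sup>2 + 2 * (h' x)\<^sup>2" for n x
 proof -
  have "0 <= (h n x + h' x)\<^sup>2" by simp
  thus ?thesis by (simp add: d_def power2_sum power2_diff)
 qed
 have d2i: "integrable M (%x. (d n x)\<^sup>2)" for n
  by (rule integrable_by[of _ "%x. 2 * (h n x)\<^sup>2 + 2 * (h' x)\<^sup>2"])
   (use sq sq' d2 in \<open>auto intro!: AE_I2\<close>)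
 have d2b: "expectation (%x. (d n x)\<^sup>2) <= 4 * K'" for n
 proof -
  have "expectation (%x. (d n x)\<^sup>2) <= expectation (%x. 2 * (h n x)\<^sup>2 + 2 * (h' x)\<^sup>2)"
   using d2i sq sq' d2 by (intro integral_mono) auto
  also have "... <= 4 * K'" using sq sq' K' K0[of n] by (simp add: K'_def)
  finally show ?thesis .
 qed
 have di: "integrable M (d n)" for n unfolding d_def using i i' by auto
 have trunc: "(%n. expectation (%x. min \<bar>d n x\<bar> a)) \<longlonglongrightarrow> 0" if a: "0 < a" for a
 proof -
  have "(%n. expectation (%x. min \<bar>d n x\<bar> a)) \<longlonglongrightarrow> expectation (%x. 0)"
  proof (rule integral_dominated_convergence[where w="%_. a"])
   show "AE x in M. (%n. min \<bar>d n x\<bar> a) \<longlonglongrightarrow> 0"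
    using lim
   proof eventually_elim
    case (elim x)
    have "(%n. min \<bar>h n x - h' x\<bar> a) \<longlonglongrightarrow> min \<bar>h' x - h' x\<bar> a" by (intro tendsto_intros elim)
    then show ?case using a by (simp add: d_def)
   qed
  qed (use a in auto)
  thus ?thesis by simp
 qed
 have "(%n. expectation (h n) - expectation h') \<longlonglongrightarrow> 0"
 proof (rule tendstoI)
  fix e :: real assume e: "0 < e"
  define a where "a = 8 * K' / e + 1"
  have a: "0 < a" using e by (simp add: a_def K'_def add_nonneg_pos)
  have Ka: "4 * K' / a <= e / 2"
  proof -
   have "8 * K' <= a * e" using e by (simp add: a_def field_simps)
   thus ?thesis using a by (simp add: field_simps)
  qed
  have "eventually (%n. expectation (%x. min \<bar>d n x\<bar> a) < e / 2) sequentially"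
   using order_tendstoD(2)[OF trunc[OF a], of "e/2"] e by simp
  thus "eventually (%n. dist (expectation (h n) - expectation h') 0 < e) sequentially"
  proof eventually_elim
   case (elim n)
   have "\<bar>expectation (h n) - expectation h'\<bar> = \<bar>expectation (%x. d n x)\<bar>" unfolding d_def using i i' by simp
   also have "... <= expectation (%x. \<bar>d n x\<bar>)" by (rule integral_abs_bound)
   also have "... <= expectation (%x. min \<bar>d n x\<bar> a + (d n x)\<^sup>2 / a)"
   proof (rule integral_mono)
    show "integrable M (%x. min \<bar>d n x\<bar> a + (d n x)\<^sup>2 / a)"
     using di d2i by auto
    fix x
    show "\<bar>d n x\<bar> <= min \<bar>d n x\<bar> a + (d n x)\<^sup>2 / a"
    proof (cases "\<bar>d n x\<bar> <= a")
     case False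
     hence "a * \<bar>d n x\<bar> <= \<bar>d n x\<bar> * \<bar>d n x\<bar>" by (intro mult_right_mono) auto
     hence "\<bar>d n x\<bar> <= (d n x)\<^sup>2 / a" using a by (simp add: pos_le_divide_eq power2_eq_square mult.commute)
     thus ?thesis using a by (simp add: min_def)
    qed (use a in \<open>simp add: min_def\<close>)
   qed (use di in auto)
   also have "... = expectation (%x. min \<bar>d n x\<bar> a) + expectation (%x. (d n x)\<^sup>2) / a"
    using di d2i by (subst Bochner_Integration.integral_add) auto
   also have "... < e / 2 + 4 * K' / a"
    using elim d2b[of n] a by (intro add_less_le_mono divide_right_mono) auto
   also have "... <= e" using Ka by simp
   finally show ?case by simp
  qed
 qed
 thus "(%n. expectation (h n)) \<longlonglongrightarrow> expectation h'" by (simp add: LIM_zero_iff)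
qed

text \<open>The functions in D1 play the role of polynomials of half the degree; their squares lie in D and
span it.\<close>

locale moment_setting = cadlag_markov_process M F S X P
 for M :: "'w measure" and F and S :: "(real^'d) set" and X P +
 fixes D D1 :: "(real^'d => real) set" and \<G> :: "(real^'d => real) => real^'d => real" and f :: "real^'d => real"
 assumes D_cont: "\<And>u. u : D ==> continuous_on UNIV u"
  and D_lin: "\<And>u w a b. u : D ==> w : D ==> (%x. a * u x + b * w x) : D"
  and \<G>_D: "\<And>u. u : D ==> \<G> u : D"
  and \<G>_ext: "\<And>u. u : D ==> ext_generator S F X P u (\<G> u)"
  and \<G>_lin: "\<And>u w a b x. u : D ==> w : D ==> x : S ==> \<G> (%x. a * u x + b * w x) x = a * \<G> u x + b * \<G> w x"
  and D1_D: "D1 \<subseteq> D"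
  and D1_square: "\<And>p. p : D1 ==> \<exists>w\<in>D. \<forall>x\<in>S. w x = (p x)\<^sup>2"
  and D1_ext: "\<And>p. p : D1 ==> \<exists>g\<in>D1. ext_generator S F X P p g"
  and f_D: "f : D" and f_ge: "\<And>x. x : S ==> 1 <= f x"
  and f_dom: "\<And>u. u : D ==> \<exists>C\<ge>0. \<forall>x\<in>S. \<bar>u x\<bar> <= C * f x"
  and D_squares: "\<And>u. u : D ==> \<exists>(R :: nat set) c w. finite R \<and> (\<forall>r\<in>R. w r : D \<and> (\<exists>p\<in>D1. \<forall>x\<in>S. w r x = (p x)\<^sup>2)) \<and> u = (%x. \<Sum>r\<in>R. c r * w r x)"
begin

lemma f_pos: "x : S ==> 0 <= f x" using f_ge[of x] by simp

definition growth :: real where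
 "growth = (SOME c. 0 <= c \<and> (\<forall>x\<in>S. \<bar>\<G> f x\<bar> <= c * f x))"

lemma growth: "0 <= growth" "x : S ==> \<bar>\<G> f x\<bar> <= growth * f x"
 using someI_ex[OF f_dom[OF \<G>_D[OF f_D], unfolded Bex_def]] unfolding growth_def by auto

lemma measurable_uX [measurable]: "u : D ==> 0 <= t ==> (%z. u (X t z)) : BM M"
 by (rule measurable_compose[OF measurable_X borel_measurable_continuous_onI[OF D_cont]])

lemma nn_integral_f: 
 assumes x: "x : S" and t: "0 <= t"
 shows "(\<integral>\<^sup>+z. ennreal (f (X t z)) \<partial>P x) <= ennreal (exp (growth * t) * f x)"
proof -
 note [measurable_cong] = sets_P[OF x]
 obtain T where T: "\<And>n. localizer f (\<G> f) x (T n)" "AE z in P x. filterlim (%n. T n z) at_top sequentially"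
  "AE z in P x. \<forall>t\<ge>0. set_integrable lborel {0..t} (%s. \<G> f (X s z))"
  using localizer_exists[OF \<G>_ext[OF f_D] x] by blast
 have b: "(\<integral>\<^sup>+z. ennreal (f (X (min t (T n z)) z)) \<partial>P x) <= ennreal (exp (growth * t) * f x)" for n
  by (rule discounted_bound[OF x D_cont[OF f_D] D_cont[OF \<G>_D[OF f_D]] growth(1) f_pos _ T(1,3) t])
   (use growth(2) abs_le_iff in blast)+
 have T': "0 <= T n z" "T n : BM M" for n z
  using T(1)[of n] measurable_stopping by (auto simp: localizer_def)
 have [measurable]: "(%z. f (X (min t (T n z)) z)) : BM M" for n
  by (rule measurable_X_stopped[OF D_cont[OF f_D]]) (use T' t in auto)
 have "(\<integral>\<^sup>+z. ennreal (f (X t z)) \<partial>P x) = (\<integral>\<^sup>+z. liminf (%n. ennreal (f (X (min t (T n z)) z))) \<partial>P x)"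
 proof (rule nn_integral_cong_AE)
  show "AE z in P x. ennreal (f (X t z)) = liminf (%n. ennreal (f (X (min t (T n z)) z)))"
   using T(2)
  proof eventually_elim
   case (elim z)
   have "eventually (%n. t <= T n z) sequentially" using elim by (simp add: filterlim_at_top)
   hence "eventually (%n. ennreal (f (X (min t (T n z)) z)) = ennreal (f (X t z))) sequentially"
    by eventually_elim (simp add: min_absorb1)
   then show ?case by (intro lim_imp_Liminf[symmetric] tendsto_eventually) auto
  qed
 qed
 also have "... <= liminf (%n. \<integral>\<^sup>+z. ennreal (f (X (min t (T n z)) z)) \<partial>P x)"
  by (rule nn_integral_liminf) measurable
 also have "... <= liminf (%n. ennreal (exp (growth * t) * f x))"
  by (intro Liminf_mono always_eventually allI b)
 also have "... = ennreal (exp (growth * t) * f x)" by (simp add: Liminf_const)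
 finally show ?thesis .
qed

lemma integrable_f: "x : S ==> 0 <= t ==> integrable (P x) (%z. f (X t z))"
proof (rule integrableI_nonneg)
 assume x: "x : S" and t: "0 <= t"
 show "(%z. f (X t z)) : BM (P x)" using measurable_uX[OF f_D t] by (simp cong: measurable_cong_sets add: sets_P[OF x])
 show "AE z in P x. 0 <= f (X t z)" by (intro AE_I2 f_pos X_in_S t) (simp add: space_P[OF x])
 show "(\<integral>\<^sup>+z. ennreal (f (X t z)) \<partial>P x) < \<infinity>"
  using le_less_trans[OF nn_integral_f[OF x t] ennreal_less_top] by simp
qed

lemma expectation_f_le:
 assumes x: "x : S" and t: "0 <= t" shows "(LINT z|P x. f (X t z)) <= exp (growth * t) * f x"
proof -
 have "ennreal (LINT z|P x. f (X t z)) <= ennreal (exp (growth * t) * f x)"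
  using nn_integral_f[OF x t] integrable_f[OF x t]
  by (subst nn_integral_eq_integral[symmetric]) (auto intro!: AE_I2 f_pos X_in_S t simp: space_P[OF x])
 thus ?thesis using f_pos[OF x] by (subst (asm) ennreal_le_iff) auto
qed

lemma integrable_u:
 assumes u: "u : D" and x: "x : S" and t: "0 <= t"
 shows "integrable (P x) (%z. u (X t z))"
proof -
 obtain C where C: "0 <= C" "\<And>x. x : S ==> \<bar>u x\<bar> <= C * f x" using f_dom[OF u] by blast
 show ?thesis
 proof (rule integrable_by)
  show "integrable (P x) (%z. C * f (X t z))" using integrable_f[OF x t] by simp
  show "(%z. u (X t z)) : BM (P x)" using measurable_uX[OF u t] by (simp cong: measurable_cong_sets add: sets_P[OF x])
  show "AE z in P x. norm (u (X t z)) <= norm (C * f (X t z))"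
   using C f_pos X_in_S[OF t] by (intro AE_I2) (auto simp: space_P[OF x] abs_mult)
 qed
qed

lemma integrable_time:
 assumes g: "g : D" and x: "x : S" and t: "0 <= t"
 shows "integrable (lborel \<Otimes>\<^sub>M P x) (%(s, z). ind {0..t} s * g (X (max 0 s) z))"
proof -
 interpret prob_space "P x" by (rule P_prob[OF x])
 interpret LP: pair_sigma_finite lborel "P x" by unfold_locales
 obtain C where C: "0 <= C" "\<And>x. x : S ==> \<bar>g x\<bar> <= C * f x" using f_dom[OF g] by blast
 have gm: "(%(s, z). ind {0..t} s * g (X (max 0 s) z)) : BM (lborel \<Otimes>\<^sub>M P x)"
  using measurable_X_pair[OF D_cont[OF g]] by (simp add: case_prod_beta' cong: measurable_cong_sets add: sets_P[OF x])
 show ?thesis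
 proof (rule LP.Fubini_integrable[OF gm])
  show "integrable lborel (%s. \<integral>z. norm (case (s, z) of (s, z) => ind {0..t} s * g (X (max 0 s) z)) \<partial>P x)"
  proof (rule integrable_by)
   show "integrable lborel (%s. ind {0..t} s * (C * (exp (growth * t) * f x)))"
    using t by (intro integrable_mult_left integrable_real_indicator) auto
   show "(%s. \<integral>z. norm (case (s, z) of (s, z) => ind {0..t} s * g (X (max 0 s) z)) \<partial>P x) : BM lborel"
    using gm by measurable
   show "AE s in lborel. norm (LINT z|P x. norm (case (s, z) of (s, z) => ind {0..t} s * g (X (max 0 s) z)))
     <= norm (ind {0..t} s * (C * (exp (growth * t) * f x)))"
   proof (rule AE_I2)
    fix s
    show "norm (LINT z|P x. norm (case (s, z) of (s, z) => ind {0..t} s * g (X (max 0 s) z)))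
     <= norm (ind {0..t} s * (C * (exp (growth * t) * f x)))"
    proof (cases "s : {0..t}")
     case True
     have "(LINT z|P x. \<bar>g (X s z)\<bar>) <= (LINT z|P x. C * f (X s z))"
      using C True X_in_S integrable_u[OF g x] integrable_f[OF x]
      by (intro integral_mono) (auto simp: space_P[OF x])
     also have "... <= C * (exp (growth * s) * f x)"
      using C(1) expectation_f_le[OF x, of s] True by (simp add: mult_left_mono)
     also have "... <= C * (exp (growth * t) * f x)"
      using C(1) True growth(1) f_pos[OF x] by (intro mult_left_mono mult_right_mono) (auto intro: mult_left_mono)
     finally show ?thesis using True C(1) f_pos[OF x] by simp
    qed simp
   qed
  qed
  show "AE s in lborel. integrable (P x) (%z. case (s, z) of (s, z) => ind {0..t} s * g (X (max 0 s) z))"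
   using integrable_u[OF g x] by (intro AE_I2) auto
 qed
qed

lemma
 assumes g: "g : D" and x: "x : S" and t: "0 <= t"
 shows AE_path_integrable: "AE z in P x. integrable lborel (%s. ind {0..t} s * g (X (max 0 s) z))"
  and integrable_path_integral: "integrable (P x) (path_integral g t)"
  and expectation_path_integral: "(LINT z|P x. path_integral g t z) = (LINT s|lborel. ind {0..t} s * (LINT z|P x. g (X (max 0 s) z)))"
  and integrable_expectation_time: "integrable lborel (%s. ind {0..t} s * (LINT z|P x. g (X (max 0 s) z)))"
proof -
 interpret prob_space "P x" by (rule P_prob[OF x])
 interpret LP: pair_sigma_finite lborel "P x" by unfold_locales
 note i = integrable_time[OF assms]
 show "AE z in P x. integrable lborel (%s. ind {0..t} s * g (X (max 0 s) z))"
  using LP.AE_integrable_snd[OF i] .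
 show "integrable (P x) (path_integral g t)"
  using LP.integrable_snd[OF i] by (simp add: path_integral_eq[abs_def])
 show "(LINT z|P x. path_integral g t z) = (LINT s|lborel. ind {0..t} s * (LINT z|P x. g (X (max 0 s) z)))"
  using LP.Fubini_integral[OF i] by (simp add: path_integral_eq)
 show "integrable lborel (%s. ind {0..t} s * (LINT z|P x. g (X (max 0 s) z)))"
  using LP.integrable_fst[OF i] by simp
qed

lemma abs_path_integral_le:
 assumes "integrable lborel (%s. ind {0..t} s * g (X (max 0 s) z))" "s <= t"
 shows "\<bar>path_integral g s z\<bar> <= path_integral (%x. \<bar>g x\<bar>) t z"
proof -
 have "\<bar>path_integral g s z\<bar> <= (LINT r|lborel. \<bar>ind {0..s} r * g (X (max 0 r) z)\<bar>)"
  unfolding path_integral_eq by (rule integral_abs_bound)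
 also have "... <= (LINT r|lborel. ind {0..t} r * \<bar>g (X (max 0 r) z)\<bar>)"
 proof (rule integral_mono)
  show I: "integrable lborel (%r. ind {0..t} r * \<bar>g (X (max 0 r) z)\<bar>)"
   using integrable_abs[OF assms(1)] by (simp add: abs_mult)
  have "integrable lborel (%r. ind {0..s} r *\<^sub>R (ind {0..t} r * g (X (max 0 r) z)))"
   by (rule integrable_mult_indicator[OF _ assms(1)]) simp
  also have "(%r. ind {0..s} r *\<^sub>R (ind {0..t} r * g (X (max 0 r) z))) = (%r. ind {0..s} r * g (X (max 0 r) z))"
   using assms(2) by (auto simp: fun_eq_iff split: split_indicator)
  finally show "integrable lborel (%r. \<bar>ind {0..s} r * g (X (max 0 r) z)\<bar>)" by (rule integrable_abs)
  show "\<bar>ind {0..s} r * g (X (max 0 r) z)\<bar> <= ind {0..t} r * \<bar>g (X (max 0 r) z)\<bar>" for r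
   using assms(2) by (auto simp: abs_mult split: split_indicator)
 qed
 finally show ?thesis by (simp add: path_integral_eq)
qed

lemma path_integral_tendsto:
 assumes i: "integrable lborel (%s. ind {0..t} s * g (X (max 0 s) z))" and \<tau>: "\<tau> \<longlonglongrightarrow> a" "\<And>n. \<tau> n <= t" "a <= t"
 shows "(%n. path_integral g (\<tau> n) z) \<longlonglongrightarrow> path_integral g a z"
 unfolding path_integral_eq
proof (rule integral_dominated_convergence[where w="%r. \<bar>ind {0..t} r * g (X (max 0 r) z)\<bar>"])
 have m: "(%r. ind {0..s} r * g (X (max 0 r) z)) : BM lborel" if "s <= t" for s
 proof -
  have "(%r. ind {0..s} r * (ind {0..t} r * g (X (max 0 r) z))) : BM lborel"
   using borel_measurable_integrable[OF i] by measurable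
  also have "(%r. ind {0..s} r * (ind {0..t} r * g (X (max 0 r) z))) = (%r. ind {0..s} r * g (X (max 0 r) z))"
   using that by (auto simp: fun_eq_iff split: split_indicator)
  finally show ?thesis .
 qed
 show "(%r. ind {0..a} r * g (X (max 0 r) z)) : BM lborel" by (rule m[OF \<tau>(3)])
 show "(%r. ind {0..\<tau> n} r * g (X (max 0 r) z)) : BM lborel" for n by (rule m[OF \<tau>(2)])
 show "integrable lborel (%r. \<bar>ind {0..t} r * g (X (max 0 r) z)\<bar>)" using i by (rule integrable_abs)
 show "AE r in lborel. norm (ind {0..\<tau> n} r * g (X (max 0 r) z)) <= \<bar>ind {0..t} r * g (X (max 0 r) z)\<bar>" for n
  using \<tau>(2)[of n] by (auto simp: abs_mult split: split_indicator)
 show "AE r in lborel. (%n. ind {0..\<tau> n} r * g (X (max 0 r) z)) \<longlonglongrightarrow> ind {0..a} r * g (X (max 0 r) z)"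
  using AE_lborel_singleton[of a]
 proof eventually_elim
  case (elim r)
  have "eventually (%n. ind {0..\<tau> n} r = (ind {0..a} r :: real)) sequentially"
  proof (cases "r < a")
   case True
   hence "eventually (%n. r < \<tau> n) sequentially" using order_tendstoD(1)[OF \<tau>(1)] by simp
   thus ?thesis by eventually_elim (use True in \<open>auto split: split_indicator\<close>)
  next
   case False
   hence "a < r" using elim by simp
   hence "eventually (%n. \<tau> n < r) sequentially" using order_tendstoD(2)[OF \<tau>(1)] by simp
   thus ?thesis by eventually_elim (use \<open>a < r\<close> in \<open>auto split: split_indicator\<close>)
  qed
  hence "eventually (%n. ind {0..\<tau> n} r * g (X (max 0 r) z) = ind {0..a} r * g (X (max 0 r) z)) sequentially"
   by eventually_elim simp
  then show ?case by (rule tendsto_eventually)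
 qed
qed

end

context moment_setting
begin

lemma localizer_expectation:
 assumes u: "u : D" and g: "g : D" and x: "x : S" and t: "0 <= t" and T: "localizer u g x T"
 shows "integrable (P x) (%z. u (X (min t (T z)) z))"
  and "integrable (P x) (%z. path_integral g (min t (T z)) z)"
  and "(LINT z|P x. u (X (min t (T z)) z)) = u x + (LINT z|P x. path_integral g (min t (T z)) z)"
proof -
 interpret prob_space "P x" by (rule P_prob[OF x])
 note [measurable_cong] = sets_P[OF x]
 define Y where "Y s z = u (X (min s (T z)) z) - u x - path_integral g (min s (T z)) z" for s z
 have mart: "martingale (P x) F Y" and T0: "\<And>z. 0 <= T z" and Tm[measurable]: "T : BM M"
  using T measurable_stopping by (auto simp: localizer_def Y_def[abs_def])
 have Yi: "integrable (P x) (Y t)" using mart t by (simp add: martingale_def)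
 have pm: "(%z. path_integral g (min t (T z)) z) : BM M"
  using measurable_compose[OF _ measurable_path_integral_pair[OF D_cont[OF g]], of "%z. (min t (T z), z)" M] by simp
 have "continuous_on UNIV (%x. \<bar>g x\<bar>)" using D_cont[OF g] by (intro continuous_intros)
 obtain C where C: "0 <= C" "\<And>x. x : S ==> \<bar>g x\<bar> <= C * f x" using f_dom[OF g] by blast
 show pi: "integrable (P x) (%z. path_integral g (min t (T z)) z)"
 proof (rule integrable_by)
  show "integrable (P x) (%z. C * path_integral f t z)" using integrable_path_integral[OF f_D x t] by simp
  show "(%z. path_integral g (min t (T z)) z) : BM (P x)" using pm by simp
  show "AE z in P x. norm (path_integral g (min t (T z)) z) <= norm (C * path_integral f t z)"
   using AE_path_integrable[OF g x t] AE_path_integrable[OF f_D x t] AE_space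
  proof eventually_elim
   case (elim z)
   have "\<bar>path_integral g (min t (T z)) z\<bar> <= path_integral (%x. \<bar>g x\<bar>) t z"
    by (rule abs_path_integral_le[OF elim(1)]) simp
   also have "... <= C * path_integral f t z"
    unfolding path_integral_eq integral_mult_right_zero[symmetric]
   proof (rule integral_mono)
    show "integrable lborel (%s. ind {0..t} s * \<bar>g (X (max 0 s) z)\<bar>)"
     using integrable_abs[OF elim(1)] by (simp add: abs_mult)
    show "integrable lborel (%s. C * (ind {0..t} s * f (X (max 0 s) z)))" using elim(2) by simp
    show "ind {0..t} s * \<bar>g (X (max 0 s) z)\<bar> <= C * (ind {0..t} s * f (X (max 0 s) z))" for s
     using C(2)[OF X_in_S[of "max 0 s" z]] elim(3) by (auto simp: space_P[OF x] split: split_indicator)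
   qed
   finally show ?case by simp
  qed
 qed
 have eq: "u (X (min t (T z)) z) = Y t z + u x + path_integral g (min t (T z)) z" for z by (simp add: Y_def)
 show "integrable (P x) (%z. u (X (min t (T z)) z))" unfolding eq using Yi pi by auto
 have "(LINT z|P x. Y t z) = (LINT z|P x. Y 0 z)" using martingale_expectation[OF x mart order_refl t] ..
 also have "... = 0"
 proof (rule integral_eq_zero_AE)
  show "AE z in P x. Y 0 z = 0"
   using start[OF x]
  proof eventually_elim
   case (elim z)
   have "path_integral g 0 z = 0"
    unfolding path_integral_eq
   proof (rule integral_eq_zero_AE)
    show "AE s in lborel. ind {0..0} s * g (X (max 0 s) z) = 0"
     using AE_lborel_singleton[of "0::real"] by eventually_elim auto
   qed
   then show ?case using elim T0 by (simp add: Y_def min_absorb1)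
  qed
 qed
 finally show "(LINT z|P x. u (X (min t (T z)) z)) = u x + (LINT z|P x. path_integral g (min t (T z)) z)"
  unfolding eq using Yi pi by (simp add: prob_space)
qed

lemma localizer_sequence:
 assumes u: "u : D" and g: "g : D" and x: "x : S" and t: "0 <= t" and e: "ext_generator S F X P u g"
 obtains T where "\<And>n. stopping_time F (T n)" "\<And>n z. 0 <= T n z"
  "AE z in P x. eventually (%n. t <= T n z) sequentially"
  "\<And>n. integrable (P x) (%z. u (X (min t (T n z)) z))"
  "(%n. \<integral>z. u (X (min t (T n z)) z) \<partial>P x) \<longlonglongrightarrow> u x + (LINT z|P x. path_integral g t z)"
proof -
 note [measurable_cong] = sets_P[OF x]
 obtain T where T: "\<And>n. localizer u g x (T n)" "AE z in P x. filterlim (%n. T n z) at_top sequentially"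
  "AE z in P x. \<forall>t\<ge>0. set_integrable lborel {0..t} (%s. g (X s z))"
  by (rule localizer_exists[OF e x], rule that)
 have T': "stopping_time F (T n)" "0 <= T n z" "T n : BM M" for n z
  using T(1)[of n] measurable_stopping by (auto simp: localizer_def)
 have ev: "AE z in P x. eventually (%n. t <= T n z) sequentially"
  using T(2) by eventually_elim (simp add: filterlim_at_top)
 obtain C where C: "0 <= C" "\<And>x. x : S ==> \<bar>g x\<bar> <= C * f x" using f_dom[OF g] by blast
 have "(%n. \<integral>z. path_integral g (min t (T n z)) z \<partial>P x) \<longlonglongrightarrow> (LINT z|P x. path_integral g t z)"
 proof (rule integral_dominated_convergence[where w="%z. C * path_integral f t z"])
  show "integrable (P x) (%z. C * path_integral f t z)" using integrable_path_integral[OF f_D x t] by simp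
  show "path_integral g t : BM (P x)" using integrable_path_integral[OF g x t] by simp
  show "(%z. path_integral g (min t (T n z)) z) : BM (P x)" for n
   using localizer_expectation(2)[OF u g x t T(1)] by simp
  show "AE z in P x. (%n. path_integral g (min t (T n z)) z) \<longlonglongrightarrow> path_integral g t z"
   using ev
  proof eventually_elim
   case (elim z)
   hence "eventually (%n. path_integral g (min t (T n z)) z = path_integral g t z) sequentially"
    by eventually_elim (simp add: min_absorb1)
   then show ?case by (rule tendsto_eventually)
  qed
  show "AE z in P x. norm (path_integral g (min t (T n z)) z) <= C * path_integral f t z" for n
   using AE_path_integrable[OF g x t] AE_path_integrable[OF f_D x t] AE_space
  proof eventually_elim
   case (elim z)
   have "\<bar>path_integral g (min t (T n z)) z\<bar> <= path_integral (%x. \<bar>g x\<bar>) t z"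
    by (rule abs_path_integral_le[OF elim(1)]) simp
   also have "... <= C * path_integral f t z"
    unfolding path_integral_eq integral_mult_right_zero[symmetric]
   proof (rule integral_mono)
    show "integrable lborel (%s. ind {0..t} s * \<bar>g (X (max 0 s) z)\<bar>)"
     using integrable_abs[OF elim(1)] by (simp add: abs_mult)
    show "integrable lborel (%s. C * (ind {0..t} s * f (X (max 0 s) z)))" using elim(2) by simp
    show "ind {0..t} s * \<bar>g (X (max 0 s) z)\<bar> <= C * (ind {0..t} s * f (X (max 0 s) z))" for s
     using C(2)[OF X_in_S[of "max 0 s" z]] elim(3) by (auto simp: space_P[OF x] split: split_indicator)
   qed
   finally show ?case by simp
  qed
 qed
 hence "(%n. u x + (LINT z|P x. path_integral g (min t (T n z)) z)) \<longlonglongrightarrow> u x + (LINT z|P x. path_integral g t z)"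
  by (intro tendsto_intros)
 hence "(%n. \<integral>z. u (X (min t (T n z)) z) \<partial>P x) \<longlonglongrightarrow> u x + (LINT z|P x. path_integral g t z)"
  using localizer_expectation(3)[OF u g x t T(1)] by simp
 thus thesis using that[of T] T' ev localizer_expectation(1)[OF u g x t T(1)] by blast
qed

end

text \<open>The stopping time truncated at t is rounded up to a multiple of t / m, so that it becomes a
stopping time with finitely many values, which decreases to the original one.\<close>

definition grid_index :: "nat => real => real => nat" where
 "grid_index m t r = (if r \<ge> t then m else nat \<lceil>real m * r / t\<rceil>)"

lemma grid_index_le: "0 < t ==> grid_index m t r <= m"
proof -
 assume t: "0 < t"
 show ?thesis
 proof (cases "r \<ge> t")
  case False
  hence "real m * r / t <= real m" using t by (simp add: pos_divide_le_eq mult_left_mono)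
  hence "nat \<lceil>real m * r / t\<rceil> <= m" by linarith
  thus ?thesis using False by (simp add: grid_index_def)
 qed (simp add: grid_index_def)
qed

lemma grid_index_le_iff:
 assumes t: "0 < t" and j: "j < m"
 shows "grid_index m t r <= j \<longleftrightarrow> r <= real j * t / real m"
proof (cases "r \<ge> t")
 case True
 have "real j * t / real m < t" using j t by (simp add: field_simps)
 thus ?thesis using True j by (simp add: grid_index_def)
next
 case False
 have "nat \<lceil>real m * r / t\<rceil> <= j \<longleftrightarrow> real m * r / t <= real j" by (simp add: nat_le_iff ceiling_le_iff)
 also have "... \<longleftrightarrow> r <= real j * t / real m" using t j by (simp add: field_simps)
 finally show ?thesis using False by (simp add: grid_index_def)
qed

lemma grid_index_bounds:
 assumes t: "0 < t" and r: "0 <= r" and m: "0 < m"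
 shows "min t r <= real (grid_index m t r) * t / real m" and "real (grid_index m t r) * t / real m <= min t (r + t / real m)"
proof -
 have le: "real (grid_index m t r) * t / real m <= t" using grid_index_le[OF t, of m r] t m by (simp add: field_simps)
 show "min t r <= real (grid_index m t r) * t / real m"
 proof (cases "r \<ge> t")
  case True
  thus ?thesis using m by (simp add: grid_index_def)
 next
  case False
  have "real m * r / t <= real (nat \<lceil>real m * r / t\<rceil>)" by linarith
  thus ?thesis using False t m by (simp add: grid_index_def field_simps)
 qed
 have "real (grid_index m t r) * t / real m <= r + t / real m"
 proof (cases "r \<ge> t")
  case True
  thus ?thesis using le t m by (simp add: add_increasing2 order_trans[OF le])
 next
  case False
  have "0 <= real m * r / t" using r t by simp
  hence "real (nat \<lceil>real m * r / t\<rceil>) <= real m * r / t + 1" by linarith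
  hence "real (nat \<lceil>real m * r / t\<rceil>) * (t / real m) <= (real m * r / t + 1) * (t / real m)"
   using t by (intro mult_right_mono) auto
  also have "... = r + t / real m" using t m by (simp add: field_simps)
  finally show ?thesis using False by (simp add: grid_index_def)
 qed
 with le show "real (grid_index m t r) * t / real m <= min t (r + t / real m)" by simp
qed

lemma grid_limit:
 assumes t: "0 < t" and r: "0 <= r"
 shows "(%m. real (grid_index (Suc m) t r) * t / real (Suc m)) \<longlonglongrightarrow> min t r"
proof (rule tendsto_sandwich)
 show "\<forall>\<^sub>F m in sequentially. min t r <= real (grid_index (Suc m) t r) * t / real (Suc m)"
  using grid_index_bounds(1)[OF t r] by (intro always_eventually allI) blast
 show "\<forall>\<^sub>F m in sequentially. real (grid_index (Suc m) t r) * t / real (Suc m) <= min t (r + t / real (Suc m))"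
  using grid_index_bounds(2)[OF t r] by (intro always_eventually allI) blast
 have "(%m. t * (1 / real (Suc m))) \<longlonglongrightarrow> t * 0"
  by (intro tendsto_intros lim_1_over_n[THEN LIMSEQ_Suc])
 hence "(%m. min t (r + t / real (Suc m))) \<longlonglongrightarrow> min t (r + 0)"
  by (intro tendsto_intros) simp
 thus "(%m. min t (r + t / real (Suc m))) \<longlonglongrightarrow> min t r" by simp
qed simp

context cadlag_markov_process
begin

lemma grid_index_sets:
 assumes T: "stopping_time F T" and t: "0 < t" and j: "j < m"
 shows "{z : space M. j < grid_index m t (T z)} : sets (F (real j * t / real m))"
proof -
 have "{z : space (F (real j * t / real m)). real j * t / real m < T z} : sets (F (real j * t / real m))"
  using stopping_timeD2[OF T, of "real j * t / real m"] by measurable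
 also have "{z : space (F (real j * t / real m)). real j * t / real m < T z} = {z : space M. j < grid_index m t (T z)}"
  using grid_index_le_iff[OF t j] by (auto simp: space_F not_le[symmetric])
 finally show ?thesis .
qed

lemma grid_index_measurable: 
 assumes T: "stopping_time F T" and t: "0 < t"
 shows "(%z. grid_index m t (T z)) : M \<rightarrow>\<^sub>M count_space UNIV"
proof -
 have [measurable]: "T : BM M" by (rule measurable_stopping[OF T])
 show ?thesis unfolding grid_index_def by measurable
qed

end

context moment_setting
begin

text \<open>Optional stopping for the discounted process, first on the grid and then in the limit by right
continuity and Fatou's lemma.\<close>

lemma stopped_f:
 assumes x: "x : S" and t: "0 <= t" and T: "stopping_time F T" "\<And>z. 0 <= T z"
 shows "(\<integral>\<^sup>+z. ennreal (f (X (min t (T z)) z)) \<partial>P x) <= ennreal (exp (growth * t) * f x)"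
proof (cases "t = 0")
 case True
 hence "(\<integral>\<^sup>+z. ennreal (f (X (min t (T z)) z)) \<partial>P x) = (\<integral>\<^sup>+z. ennreal (f (X t z)) \<partial>P x)"
  using T(2) by (intro nn_integral_cong) (simp add: min_absorb1)
 thus ?thesis using nn_integral_f[OF x t] by simp
next
 case False
 hence t0: "0 < t" using t by simp
 interpret prob_space "P x" by (rule P_prob[OF x])
 note [measurable_cong] = sets_P[OF x]
 have Tm[measurable]: "T : BM M" by (rule measurable_stopping[OF T(1)])
 have fm: "(%y. ennreal (f y)) : BM SB"
  using borel_measurable_continuous_onI[OF D_cont[OF f_D]] by (intro measurable_restrict_space1) measurable
 have step: "(\<integral>\<^sup>+z. ind A z * ennreal (f (X (s + r) z)) \<partial>P x) <= (\<integral>\<^sup>+z. ind A z * ennreal (exp (growth * r) * f (X s z)) \<partial>P x)"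
  if "0 <= s" "0 <= r" "A : sets (F s)" for A s r
  unfolding markov_nn_integral[OF x that fm]
  by (intro nn_integral_mono mult_left_mono nn_integral_f X_in_S that) (auto simp: space_P[OF x])
 have bound: "(\<integral>\<^sup>+z. ennreal (f (X (real (grid_index m t (T z)) * t / real m) z)) \<partial>P x) <= ennreal (exp (growth * t) * f x)" if m: "0 < m" for m
 proof -
  define d where "d = t / real m"
  have d0: "0 <= d" "real m * d = t" using t m by (auto simp: d_def)
  define k where "k z = grid_index m t (T z)" for z
  have km[measurable]: "k : M \<rightarrow>\<^sub>M count_space UNIV" unfolding k_def by (rule grid_index_measurable[OF T(1) t0])
  have kle: "k z <= m" for z unfolding k_def by (rule grid_index_le[OF t0])
  define Z where "Z j z = ennreal (exp (- growth * (real j * d)) * f (X (real j * d) z))" for j z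
  have jd: "0 <= real j * d" for j using d0 by simp
  note [measurable] = measurable_uX[OF f_D jd]
  have Zm[measurable]: "Z j : BM M" for j
   unfolding Z_def by measurable
  have Zk[measurable]: "(%z. Z (min (k z) j) z) : BM M" for j
   by (rule measurable_compose_countable[where f="%i z. Z i z" and g="%z. min (k z) j"]) measurable
  have main: "(\<integral>\<^sup>+z. Z (min (k z) j) z \<partial>P x) <= ennreal (f x)" if "j <= m" for j
   using that
  proof (induction j)
   case 0
   have "(\<integral>\<^sup>+z. Z (min (k z) 0) z \<partial>P x) = (\<integral>\<^sup>+z. ennreal (f (X 0 z)) \<partial>P x)" by (simp add: Z_def)
   also have "... <= ennreal (exp (growth * 0) * f x)" by (rule nn_integral_f[OF x]) simp
   finally show ?case by simp
  next
   case (Suc j)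
   let ?A = "{z : space M. j < k z}"
   have A: "?A : sets (F (real j * d))"
    using grid_index_sets[OF T(1) t0, of j m] Suc.prems by (simp add: k_def d_def)
   have [measurable]: "?A : sets M" by measurable
   have "(\<integral>\<^sup>+z. indicator ?A z * Z (Suc j) z \<partial>P x)
    = (\<integral>\<^sup>+z. ennreal (exp (- growth * (real (Suc j) * d))) * (indicator ?A z * ennreal (f (X (real j * d + d) z))) \<partial>P x)"
   proof (rule nn_integral_cong)
    fix z
    have "real (Suc j) * d = real j * d + d" by (simp add: algebra_simps)
    thus "indicator ?A z * Z (Suc j) z = ennreal (exp (- growth * (real (Suc j) * d))) * (indicator ?A z * ennreal (f (X (real j * d + d) z)))"
     by (simp only: Z_def ennreal_mult'[OF exp_ge_zero] mult.left_commute[of "indicator ?A z"])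
   qed
   also have "... = ennreal (exp (- growth * (real (Suc j) * d))) * (\<integral>\<^sup>+z. indicator ?A z * ennreal (f (X (real j * d + d) z)) \<partial>P x)"
    using measurable_uX[OF f_D, of "real j * d + d"] d0 by (intro nn_integral_cmult) auto
   also have "... <= ennreal (exp (- growth * (real (Suc j) * d))) * (\<integral>\<^sup>+z. indicator ?A z * ennreal (exp (growth * d) * f (X (real j * d) z)) \<partial>P x)"
    using d0 by (intro mult_left_mono step A) auto
   also have "... = (\<integral>\<^sup>+z. ennreal (exp (- growth * (real (Suc j) * d))) * (indicator ?A z * ennreal (exp (growth * d) * f (X (real j * d) z))) \<partial>P x)"
    using measurable_uX[OF f_D, of "real j * d"] d0 by (intro nn_integral_cmult[symmetric]) auto
   also have "... = (\<integral>\<^sup>+z. indicator ?A z * Z j z \<partial>P x)"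
   proof (rule nn_integral_cong)
    fix z
    have "- growth * (real (Suc j) * d) + growth * d = - growth * (real j * d)" by (simp add: algebra_simps)
    hence "exp (- growth * (real (Suc j) * d)) * exp (growth * d) = exp (- growth * (real j * d))"
     by (simp only: exp_add[symmetric])
    hence "exp (- growth * (real (Suc j) * d)) * (exp (growth * d) * f (X (real j * d) z)) = exp (- growth * (real j * d)) * f (X (real j * d) z)"
     by (simp only: mult.assoc[symmetric])
    hence "ennreal (exp (- growth * (real (Suc j) * d))) * ennreal (exp (growth * d) * f (X (real j * d) z)) = Z j z"
     unfolding Z_def by (simp only: ennreal_mult'[OF exp_ge_zero, symmetric])
    thus "ennreal (exp (- growth * (real (Suc j) * d))) * (indicator ?A z * ennreal (exp (growth * d) * f (X (real j * d) z))) = indicator ?A z * Z j z"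
     by (simp only: mult.left_commute[of _ "indicator ?A z"])
   qed
   finally have le: "(\<integral>\<^sup>+z. indicator ?A z * Z (Suc j) z \<partial>P x) <= (\<integral>\<^sup>+z. indicator ?A z * Z j z \<partial>P x)" .
   have "(\<integral>\<^sup>+z. Z (min (k z) (Suc j)) z \<partial>P x) = (\<integral>\<^sup>+z. ind (space M - ?A) z * Z (min (k z) j) z + indicator ?A z * Z (Suc j) z \<partial>P x)"
    by (intro nn_integral_cong) (auto simp: space_P[OF x] min_def indicator_def le_Suc_eq)
   also have "... = (\<integral>\<^sup>+z. ind (space M - ?A) z * Z (min (k z) j) z \<partial>P x) + (\<integral>\<^sup>+z. indicator ?A z * Z (Suc j) z \<partial>P x)"
    by (rule nn_integral_add) measurable
   also have "... <= (\<integral>\<^sup>+z. ind (space M - ?A) z * Z (min (k z) j) z \<partial>P x) + (\<integral>\<^sup>+z. indicator ?A z * Z j z \<partial>P x)"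
    using le by (rule add_left_mono)
   also have "... = (\<integral>\<^sup>+z. ind (space M - ?A) z * Z (min (k z) j) z + indicator ?A z * Z j z \<partial>P x)"
    by (rule nn_integral_add[symmetric]) measurable
   also have "... = (\<integral>\<^sup>+z. Z (min (k z) j) z \<partial>P x)"
    by (intro nn_integral_cong) (auto simp: space_P[OF x] min_def indicator_def)
   also have "... <= ennreal (f x)" using Suc by simp
   finally show ?case .
  qed
  have "(\<integral>\<^sup>+z. ennreal (f (X (real (grid_index m t (T z)) * t / real m) z)) \<partial>P x) <= (\<integral>\<^sup>+z. ennreal (exp (growth * t)) * Z (min (k z) m) z \<partial>P x)"
  proof (rule nn_integral_mono)
   fix z assume z: "z : space (P x)"
   have "real (k z) * d <= t" using kle[of z] d0 mult_right_mono[of "real (k z)" "real m" d] by simp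
   hence "1 <= exp (growth * t) * exp (- growth * (real (k z) * d))"
    using growth(1) by (simp add: exp_add[symmetric] mult_left_mono)
   moreover have "0 <= f (X (real (k z) * d) z)" using z d0 by (intro f_pos X_in_S) (auto simp: space_P[OF x])
   ultimately have "f (X (real (k z) * d) z) <= exp (growth * t) * exp (- growth * (real (k z) * d)) * f (X (real (k z) * d) z)"
    using mult_right_mono by fastforce
   thus "ennreal (f (X (real (grid_index m t (T z)) * t / real m) z)) <= ennreal (exp (growth * t)) * Z (min (k z) m) z"
    using kle[of z] by (simp add: Z_def min_absorb1 ennreal_mult'[symmetric] ennreal_leI mult.assoc k_def[symmetric]) (simp add: d_def ennreal_leI k_def mult.assoc)?
  qed
  also have "... = ennreal (exp (growth * t)) * (\<integral>\<^sup>+z. Z (min (k z) m) z \<partial>P x)"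
   by (rule nn_integral_cmult) measurable
  also have "... <= ennreal (exp (growth * t)) * ennreal (f x)" by (intro mult_left_mono main) auto
  finally show ?thesis using f_pos[OF x] by (simp add: ennreal_mult)
 qed
 have fXm: "(%z. ennreal (f (X (real (grid_index (Suc m) t (T z)) * t / real (Suc m)) z))) : BM M" for m
 proof -
  have "(%z. f (X (real (grid_index (Suc m) t (T z)) * t / real (Suc m)) z)) : BM M"
   using grid_index_measurable[OF T(1) t0, of "Suc m"] t0 by (intro measurable_X_stopped[OF D_cont[OF f_D]]) auto
  thus ?thesis by measurable
 qed
 have "(\<integral>\<^sup>+z. ennreal (f (X (min t (T z)) z)) \<partial>P x) = (\<integral>\<^sup>+z. liminf (%m. ennreal (f (X (real (grid_index (Suc m) t (T z)) * t / real (Suc m)) z))) \<partial>P x)"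
 proof (rule nn_integral_cong)
  fix z assume "z : space (P x)"
  hence z: "z : space M" by (simp add: space_P[OF x])
  have mt: "0 <= min t (T z)" using t T(2) by simp
  have "((%s. X s z) \<longlongrightarrow> X (min t (T z)) z) (at_right (min t (T z)))"
   using right_continuous[OF mt z] by (simp add: continuous_within)
  hence "(%m. X (real (grid_index (Suc m) t (T z)) * t / real (Suc m)) z) \<longlonglongrightarrow> X (min t (T z)) z"
   by (rule right_limit_sequence[OF _ grid_limit[OF t0 T(2)] grid_index_bounds(1)[OF t0 T(2)]]) simp
  hence "(%m. f (X (real (grid_index (Suc m) t (T z)) * t / real (Suc m)) z)) \<longlonglongrightarrow> f (X (min t (T z)) z)"
   using D_cont[OF f_D] by (intro isCont_tendsto_compose[of _ f]) (auto simp: continuous_on_eq_continuous_at)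
  thus "ennreal (f (X (min t (T z)) z)) = liminf (%m. ennreal (f (X (real (grid_index (Suc m) t (T z)) * t / real (Suc m)) z)))"
   by (intro lim_imp_Liminf[symmetric] tendsto_ennrealI) auto
 qed
 also have "... <= liminf (%m. \<integral>\<^sup>+z. ennreal (f (X (real (grid_index (Suc m) t (T z)) * t / real (Suc m)) z)) \<partial>P x)"
  using fXm by (intro nn_integral_liminf) simp
 also have "... <= liminf (%m::nat. ennreal (exp (growth * t) * f x))"
  by (intro Liminf_mono always_eventually allI bound) simp
 also have "... = ennreal (exp (growth * t) * f x)" by (simp add: Liminf_const)
 finally show ?thesis .
qed

end

context moment_setting
begin

text \<open>The Cauchy-Schwarz inequality, from the nonnegativity of the variance of g along the path.\<close>

lemma path_integral_square_le:
 assumes t: "0 <= t" and s: "s <= t"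
  and i: "integrable lborel (%r. ind {0..t} r * g (X (max 0 r) z))"
  and i2: "integrable lborel (%r. ind {0..t} r * w (X (max 0 r) z))"
  and w: "\<And>r. w (X (max 0 r) z) = (g (X (max 0 r) z))\<^sup>2"
 shows "(path_integral g s z)\<^sup>2 <= t * path_integral w t z"
proof (cases "t = 0")
 case True
 have "path_integral g s z = 0"
  unfolding path_integral_eq
 proof (rule integral_eq_zero_AE)
  show "AE r in lborel. ind {0..s} r * g (X (max 0 r) z) = 0"
   using AE_lborel_singleton[of "0::real"] by eventually_elim (use s True in \<open>auto split: split_indicator\<close>)
 qed
 thus ?thesis by (simp add: True)
next
 case False
 hence t0: "0 < t" using t by simp
 define a where "a = path_integral (%y. \<bar>g y\<bar>) t z"
 have i': "integrable lborel (%r. ind {0..t} r * \<bar>g (X (max 0 r) z)\<bar>)"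
  using integrable_abs[OF i] by (simp add: abs_mult)
 have ic: "integrable lborel (%r. ind {0..t} r * (a / t)\<^sup>2)" 
  using t by (intro integrable_mult_left integrable_real_indicator) auto
 have ca: "(LINT r|lborel. ind {0..t} r * \<bar>g (X (max 0 r) z)\<bar>) = a" by (simp add: a_def path_integral_eq)
 have "0 <= (LINT r|lborel. ind {0..t} r * (\<bar>g (X (max 0 r) z)\<bar> - a / t)\<^sup>2)"
  by (intro lebesgue_nonneg) auto
 also have "... = (LINT r|lborel. ind {0..t} r * w (X (max 0 r) z) - (2 * (a / t)) * (ind {0..t} r * \<bar>g (X (max 0 r) z)\<bar>) + ind {0..t} r * (a / t)\<^sup>2)"
  by (intro lebesgue_cong refl) (simp add: w power2_diff algebra_simps)
 also have "... = path_integral w t z - (2 * (a / t)) * a + t * (a / t)\<^sup>2"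
  using i' i2 ic ca t by (simp add: path_integral_eq)
 also have "... = path_integral w t z - a\<^sup>2 / t" using t0 by (simp add: power2_eq_square)
 finally have "a\<^sup>2 <= t * path_integral w t z" using t0 by (simp add: pos_divide_le_eq mult.commute)
 moreover have "(path_integral g s z)\<^sup>2 <= a\<^sup>2"
  using abs_path_integral_le[OF i s] unfolding a_def by (metis abs_ge_zero power2_abs power_mono)
 ultimately show ?thesis by simp
qed

definition half_martingale :: "(real^'d => real) => (real^'d => real) => real^'d => real => 'w => real" where
 "half_martingale p g x t z = p (X t z) - p x - path_integral g t z"

lemma measurable_path_integral_F:
 assumes g: "g : D" and t: "0 <= t"
 shows "path_integral g t : BM (F t)"
proof -
 have m: "(%(s, z). g (X (min (max 0 s) t) z)) : BM (borel \<Otimes>\<^sub>M F t)"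
 proof (rule measurable_right_continuous[where Y="%s z. g (X (min s t) z)"])
  show "(%z. g (X (min s t) z)) : BM (F t)" if "0 <= s" for s
  proof -
   have "X (min s t) : BM (F (min s t))" using that t by (intro measurable_X_F) simp
   hence "X (min s t) : BM (F t)" by (rule measurable_F_mono[rotated]) simp
   thus ?thesis by (rule measurable_compose[OF _ borel_measurable_continuous_onI[OF D_cont[OF g]]])
  qed
  show "continuous (at_right s) (%s. g (X (min s t) z))" if s: "0 <= s" and "z : space (F t)" for s z
  proof -
   have z: "z : space M" using that by (simp add: space_F)
   have "((%r. g (X (min r t) z)) \<longlongrightarrow> g (X (min s t) z)) (at_right s)"
   proof (cases "s < t")
    case True
    have "((%r. X r z) \<longlongrightarrow> X s z) (at_right s)" using right_continuous[OF s z] by (simp add: continuous_within)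
    hence "((%r. g (X r z)) \<longlongrightarrow> g (X s z)) (at_right s)"
     using D_cont[OF g] by (intro isCont_tendsto_compose[of _ g]) (auto simp: continuous_on_eq_continuous_at)
    moreover have "eventually (%r. g (X r z) = g (X (min r t) z)) (at_right s)"
     using True unfolding eventually_at_right_field by (intro exI[of _ t]) (auto simp: min_def)
    ultimately show ?thesis using True by (auto intro: Lim_transform_eventually simp: min_def)
   next
    case False
    hence "eventually (%r. g (X (min r t) z) = g (X (min s t) z)) (at_right s)"
     unfolding eventually_at_right_field by (intro exI[of _ "s + 1"]) (auto simp: min_def)
    thus ?thesis by (rule tendsto_eventually)
   qed
   thus ?thesis by (simp add: continuous_within)
  qed
 qed
 have "(%x. g (X (min (max 0 (snd x)) t) (fst x))) : BM (F t \<Otimes>\<^sub>M lborel)"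
  using measurable_compose[OF measurable_pair_swap' m] by (simp add: case_prod_beta' cong: measurable_cong_sets)
 hence "(%z. \<integral>s. ind {0..t} s * g (X (min (max 0 s) t) z) \<partial>lborel) : BM (F t)"
  by (intro lborel.borel_measurable_lebesgue_integral) (simp add: case_prod_beta')
 also have "(%z. \<integral>s. ind {0..t} s * g (X (min (max 0 s) t) z) \<partial>lborel) = path_integral g t"
  unfolding path_integral_eq[abs_def] by (intro ext lebesgue_cong refl) (auto split: split_indicator simp: min_absorb1)
 finally show ?thesis .
qed

lemma markov_D:
 assumes x: "x : S" and st: "0 <= s" "0 <= t" and A: "A : sets (F s)" and u: "u : D"
 shows "integrable (P x) (%z. \<integral>z'. u (X t z') \<partial>P (X s z))"
  and "(LINT z|P x. ind A z * u (X (s + t) z)) = (LINT z|P x. ind A z * (LINT z'|P (X s z). u (X t z')))"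
proof -
 have m: "u : BM SB"
  using borel_measurable_continuous_onI[OF D_cont[OF u]] by (rule measurable_restrict_space1)
 show "integrable (P x) (%z. \<integral>z'. u (X t z') \<partial>P (X s z))"
  "(LINT z|P x. ind A z * u (X (s + t) z)) = (LINT z|P x. ind A z * (LINT z'|P (X s z). u (X t z')))"
  using markov_integral[OF x st A m integrable_u[OF u]] by auto
qed

end

context moment_setting
begin

lemma half_martingale_square_le:
 "(half_martingale p g x t z)\<^sup>2 <= 2 * (p (X t z))\<^sup>2 + 4 * (p x)\<^sup>2 + 4 * (path_integral g t z)\<^sup>2"
 "(p (X t z))\<^sup>2 <= 2 * (half_martingale p g x t z)\<^sup>2 + 4 * (p x)\<^sup>2 + 4 * (path_integral g t z)\<^sup>2"
proof -
 have *: "(a + b)\<^sup>2 <= 2 * a\<^sup>2 + 2 * b\<^sup>2" for a b :: real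
  using zero_le_power2[of "a - b"] by (simp add: power2_eq_square algebra_simps)
 have b: "(p x + path_integral g t z)\<^sup>2 <= 2 * (p x)\<^sup>2 + 2 * (path_integral g t z)\<^sup>2" by (rule *)
 show "(p (X t z))\<^sup>2 <= 2 * (half_martingale p g x t z)\<^sup>2 + 4 * (p x)\<^sup>2 + 4 * (path_integral g t z)\<^sup>2"
  using *[of "half_martingale p g x t z" "p x + path_integral g t z"] b by (simp add: half_martingale_def)
 have "(- (p x + path_integral g t z))\<^sup>2 = (p x + path_integral g t z)\<^sup>2" by (rule power2_minus)
 thus "(half_martingale p g x t z)\<^sup>2 <= 2 * (p (X t z))\<^sup>2 + 4 * (p x)\<^sup>2 + 4 * (path_integral g t z)\<^sup>2"
  using *[of "p (X t z)" "- (p x + path_integral g t z)"] b by (simp add: half_martingale_def algebra_simps)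
qed

lemma path_integral_square_AE:
 assumes g: "g : D1" and x: "x : S" and t: "0 <= t"
 obtains w where "w : D" "\<And>y. y : S ==> w y = (g y)\<^sup>2"
  "AE z in P x. \<forall>s\<le>t. (path_integral g s z)\<^sup>2 <= t * path_integral w t z"
  "integrable (P x) (%z. (path_integral g t z)\<^sup>2)"
proof -
 have gD: "g : D" using g D1_D by auto
 obtain w where w: "w : D" "\<And>y. y : S ==> w y = (g y)\<^sup>2" using D1_square[OF g] by blast
 have ae: "AE z in P x. \<forall>s\<le>t. (path_integral g s z)\<^sup>2 <= t * path_integral w t z"
  using AE_path_integrable[OF gD x t] AE_path_integrable[OF w(1) x t] AE_space
 proof eventually_elim
  case (elim z)
  have "w (X (max 0 r) z) = (g (X (max 0 r) z))\<^sup>2" for r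
   using elim(3) by (intro w(2) X_in_S) (auto simp: space_P[OF x])
  then show ?case using path_integral_square_le[OF t _ elim(1,2)] by blast
 qed
 have "integrable (P x) (%z. (path_integral g t z)\<^sup>2)"
 proof (rule integrable_by)
  show "integrable (P x) (%z. t * path_integral w t z)" using integrable_path_integral[OF w(1) x t] by simp
  show "(%z. (path_integral g t z)\<^sup>2) : BM (P x)"
   using borel_measurable_integrable[OF integrable_path_integral[OF gD x t]] by measurable
  show "AE z in P x. norm ((path_integral g t z)\<^sup>2) <= norm (t * path_integral w t z)"
   using ae by eventually_elim force
 qed
 with w ae show thesis using that by blast
qed

lemma half_martingale_L2:
 assumes p: "p : D1" and g: "g : D1" and x: "x : S" and t: "0 <= t"
 shows "integrable (P x) (half_martingale p g x t)" "integrable (P x) (%z. (half_martingale p g x t z)\<^sup>2)"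
  and "half_martingale p g x t : BM (F t)"
proof -
 interpret prob_space "P x" by (rule P_prob[OF x])
 have D: "p : D" "g : D" using p g D1_D by auto
 show i: "integrable (P x) (half_martingale p g x t)"
  unfolding half_martingale_def[abs_def] using integrable_u[OF D(1) x t] integrable_path_integral[OF D(2) x t] by auto
 have "(%z. p (X t z)) : BM (F t)"
  using measurable_X_F[OF t] by (rule measurable_compose[OF _ borel_measurable_continuous_onI[OF D_cont[OF D(1)]]])
 thus "half_martingale p g x t : BM (F t)"
  unfolding half_martingale_def[abs_def] using measurable_path_integral_F[OF D(2) t] by measurable
 obtain w where w: "w : D" "\<And>y. y : S ==> w y = (p y)\<^sup>2" using D1_square[OF p] by blast
 have wp: "integrable (P x) (%z. (p (X t z))\<^sup>2)"
  using integrable_u[OF w(1) x t]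
  by (rule Bochner_Integration.integrable_cong[THEN iffD1, rotated -1]) (use w(2) X_in_S[OF t] in \<open>auto simp: space_P[OF x]\<close>)
 show "integrable (P x) (%z. (half_martingale p g x t z)\<^sup>2)"
 proof (rule path_integral_square_AE[OF g x t])
  assume I: "integrable (P x) (%z. (path_integral g t z)\<^sup>2)"
  show ?thesis
  proof (rule integrable_by)
   show "integrable (P x) (%z. 2 * (p (X t z))\<^sup>2 + 4 * (p x)\<^sup>2 + 4 * (path_integral g t z)\<^sup>2)"
    using I wp by simp
   show "(%z. (half_martingale p g x t z)\<^sup>2) : BM (P x)"
    using borel_measurable_integrable[OF i] by measurable
   show "AE z in P x. norm ((half_martingale p g x t z)\<^sup>2) <= norm (2 * (p (X t z))\<^sup>2 + 4 * (p x)\<^sup>2 + 4 * (path_integral g t z)\<^sup>2)"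
    using half_martingale_square_le(1) by (intro AE_I2) simp
  qed
 qed
qed

lemma measurable_half_martingale_stopped:
 assumes p: "p : D" and g: "g : D" and T: "\<And>z. 0 <= T z" "T : BM M"
 shows "(%z. half_martingale p g x (T z) z) : BM M"
proof -
 have "(%z. path_integral g (T z) z) : BM M"
  using measurable_compose[OF _ measurable_path_integral_pair[OF D_cont[OF g]], of "%z. (T z, z)" M] T(2) by simp
 thus ?thesis unfolding half_martingale_def using measurable_X_stopped[OF D_cont[OF p] T] by measurable
qed

text \<open>The stopped processes are martingales, and stopped_f bounds them in L^2 uniformly along the
localizing sequence, so that the limit may be taken inside the expectation.\<close>

lemma half_martingale_cond:
 assumes p: "p : D1" and g: "g : D1" and e: "ext_generator S F X P p g" and x: "x : S" and st: "0 <= s" "s <= t" and A: "A : sets (F s)"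
 shows "(LINT z|P x. ind A z * half_martingale p g x s z) = (LINT z|P x. ind A z * half_martingale p g x t z)"
proof -
 interpret prob_space "P x" by (rule P_prob[OF x])
 note [measurable_cong] = sets_P[OF x]
 let ?M = "half_martingale p g x"
 have D: "p : D" "g : D" using p g D1_D by auto
 have AM[measurable]: "A : sets M" using A sets_F by auto
 obtain T where T: "\<And>n. localizer p g x (T n)" and T_lim: "AE z in P x. filterlim (%n. T n z) at_top sequentially"
  by (rule localizer_exists[OF e x], rule that)
 have Ts: "stopping_time F (T n)" "0 <= T n z" for n z using T by (auto simp: localizer_def)
 obtain w where w: "w : D" "\<And>y. y : S ==> w y = (p y)\<^sup>2" using D1_square[OF p] by blast
 obtain C where C: "0 <= C" "\<And>y. y : S ==> \<bar>w y\<bar> <= C * f y" using f_dom[OF w(1)] by blast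
 have conv: "(%n. \<integral>z. ind A z * ?M (min r (T n z)) z \<partial>P x) \<longlonglongrightarrow> (LINT z|P x. ind A z * ?M r z)" if r: "0 <= r" for r
 proof (rule path_integral_square_AE[OF g x r])
  fix v assume v: "v : D" and vle: "AE z in P x. \<forall>s\<le>r. (path_integral g s z)\<^sup>2 <= r * path_integral v r z"
  define V where "V z = \<bar>4 * (p x)\<^sup>2 + 4 * (r * path_integral v r z)\<bar>" for z
  have Vi: "integrable (P x) V" unfolding V_def using integrable_path_integral[OF v x r] by simp
  have V_nn: "(\<integral>\<^sup>+z. ennreal (V z) \<partial>P x) = ennreal (LINT z|P x. V z)"
   by (rule nn_integral_eq_integral[OF Vi]) (simp add: V_def)
  have mr: "0 <= min r (T n z)" for n z using r Ts by simp
  have Mm[measurable]: "(%z. ?M (min r (T n z)) z) : BM M" for n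
   using measurable_half_martingale_stopped[OF D mr] measurable_stopping[OF Ts(1)] by simp
  have fm: "(%z. f (X (min r (T n z)) z)) : BM M" for n
   by (rule measurable_X_stopped[OF D_cont[OF f_D]]) (use mr measurable_stopping[OF Ts(1)] in auto)
  show ?thesis
  proof (rule L2_bounded_convergence(3))
   show "(%z. ind A z * ?M r z) : BM (P x)"
    using borel_measurable_integrable[OF half_martingale_L2(1)[OF p g x r]] by measurable
   show "(%z. ind A z * ?M (min r (T n z)) z) : BM (P x)" for n by measurable
   show "AE z in P x. (%n. ind A z * ?M (min r (T n z)) z) \<longlonglongrightarrow> ind A z * ?M r z"
    using T_lim
   proof eventually_elim
    case (elim z)
    hence "eventually (%n. r <= T n z) sequentially" by (simp add: filterlim_at_top)
    hence "eventually (%n. ind A z * ?M (min r (T n z)) z = ind A z * ?M r z) sequentially"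
     by eventually_elim (simp add: min_absorb1)
    then show ?case by (rule tendsto_eventually)
   qed
   show "(\<integral>\<^sup>+z. ennreal ((ind A z * ?M (min r (T n z)) z)\<^sup>2) \<partial>P x) <= ennreal (2 * C * (exp (growth * r) * f x) + (LINT z|P x. V z))" for n
   proof -
    have "(\<integral>\<^sup>+z. ennreal ((ind A z * ?M (min r (T n z)) z)\<^sup>2) \<partial>P x) <= (\<integral>\<^sup>+z. ennreal (2 * C) * ennreal (f (X (min r (T n z)) z)) + ennreal (V z) \<partial>P x)"
    proof (rule nn_integral_mono_AE)
     show "AE z in P x. ennreal ((ind A z * ?M (min r (T n z)) z)\<^sup>2) <= ennreal (2 * C) * ennreal (f (X (min r (T n z)) z)) + ennreal (V z)"
      using vle AE_space
     proof eventually_elim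
      case (elim z)
      have y: "X (min r (T n z)) z : S" using elim(2) by (intro X_in_S mr) (simp add: space_P[OF x])
      have "(ind A z * ?M (min r (T n z)) z)\<^sup>2 <= (?M (min r (T n z)) z)\<^sup>2" by (simp split: split_indicator)
      also have "... <= 2 * C * f (X (min r (T n z)) z) + V z"
       using half_martingale_square_le(1)[of p g x "min r (T n z)" z] elim(1)[rule_format, of "min r (T n z)"] C(2)[OF y] w(2)[OF y]
        abs_ge_self[of "4 * (p x)\<^sup>2 + 4 * (r * path_integral v r z)"]
       unfolding V_def mult.assoc[of 2] by (simp add: min.coboundedI1)
      finally show ?case
       using C(1) f_pos[OF y] by (simp add: V_def ennreal_mult[symmetric] ennreal_plus[symmetric] ennreal_leI del: ennreal_plus)
     qed
    qed
    also have "... = ennreal (2 * C) * (\<integral>\<^sup>+z. ennreal (f (X (min r (T n z)) z)) \<partial>P x) + (\<integral>\<^sup>+z. ennreal (V z) \<partial>P x)"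
     using fm borel_measurable_integrable[OF Vi] by (subst nn_integral_add) (simp_all add: nn_integral_cmult)
    also have "... <= ennreal (2 * C) * ennreal (exp (growth * r) * f x) + ennreal (LINT z|P x. V z)"
     unfolding V_nn by (intro add_mono mult_left_mono stopped_f[OF x r Ts]) simp_all
    also have "... = ennreal (2 * C * (exp (growth * r) * f x) + (LINT z|P x. V z))"
     using C(1) f_pos[OF x] by (simp add: ennreal_mult[symmetric] ennreal_plus[symmetric] V_def del: ennreal_plus)
    finally show ?thesis .
   qed
  qed
 qed
 have "(LINT z|P x. ind A z * ?M (min s (T n z)) z) = (LINT z|P x. ind A z * ?M (min t (T n z)) z)" for n
  using martingale_set_integral[OF x _ st A, of "%t z. ?M (min t (T n z)) z"] T[of n]
  by (simp add: localizer_def half_martingale_def set_lebesgue_integral_def)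
 thus ?thesis using conv[OF st(1)] conv[of t] st LIMSEQ_unique by auto
qed

lemma moment_half_degree:
 assumes p: "p : D1" and g: "g : D1" and e: "ext_generator S F X P p g" and x: "x : S" and t: "0 <= t"
 shows "(LINT z|P x. p (X t z)) = p x + (LINT z|P x. path_integral g t z)"
proof -
 interpret prob_space "P x" by (rule P_prob[OF x])
 have D: "p : D" "g : D" using p g D1_D by auto
 have Sp: "space M : sets (F 0)" using sets.top[of "F 0"] by (simp add: space_F)
 have "(LINT z|P x. ind (space M) z * half_martingale p g x r z) = (LINT z|P x. p (X r z)) - p x - (LINT z|P x. path_integral g r z)" if r: "0 <= r" for r
 proof -
  have "(LINT z|P x. ind (space M) z * half_martingale p g x r z) = (LINT z|P x. half_martingale p g x r z)"
   by (intro lebesgue_cong refl) (simp add: space_P[OF x])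
  thus ?thesis
   unfolding half_martingale_def using integrable_u[OF D(1) x r] integrable_path_integral[OF D(2) x r] by (simp add: prob_space)
 qed
 note E = this
 have "(LINT z|P x. p (X 0 z)) = (LINT z|P x. p x)"
  using start[OF x] measurable_uX[OF D(1), of 0] sets_P[OF x]
  by (intro integral_cong_AE) (auto cong: measurable_cong_sets)
 moreover have "(LINT z|P x. path_integral g 0 z) = 0"
  unfolding expectation_path_integral[OF D(2) x order_refl]
 proof (rule integral_eq_zero_AE)
  show "AE r in lborel. ind {0..0} r * (LINT z|P x. g (X (max 0 r) z)) = 0"
   using AE_lborel_singleton[of "0::real"] by eventually_elim simp
 qed
 ultimately show ?thesis
  using half_martingale_cond[OF p g e x order_refl t Sp] E[OF t] E[OF order_refl] by (simp add: prob_space)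
qed

text \<open>Orthogonality of martingale increments.\<close>

lemma half_martingale_square_mono:
 assumes p: "p : D1" and g: "g : D1" and e: "ext_generator S F X P p g" and x: "x : S" and st: "0 <= s" "s <= t" and A: "A : sets (F s)"
 shows "(LINT z|P x. ind A z * (half_martingale p g x s z)\<^sup>2) <= (LINT z|P x. ind A z * (half_martingale p g x t z)\<^sup>2)"
proof -
 interpret finite_measure_subalgebra "P x" "F s" by (rule cond_exp_F[OF x])
 note [measurable_cong] = sets_P[OF x]
 let ?M = "half_martingale p g x"
 have t: "0 <= t" using st by simp
 note i = half_martingale_L2[OF p g x t] half_martingale_L2[OF p g x st(1)]
 have AM[measurable]: "A : sets M" using A sets_F by auto
 have [measurable]: "?M s : BM M" "?M t : BM M"
  using borel_measurable_integrable[OF i(1)] borel_measurable_integrable[OF i(4)] by simp_all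
 have iA: "integrable (P x) (%z. ind A z * k z)" if "integrable (P x) k" for k :: "'w => real"
  using integrable_real_mult_indicator[OF _ that, of A] by (simp add: mult.commute)
 have ist: "integrable (P x) (%z. ?M s z * ?M t z)"
 proof (rule integrable_by)
  show "integrable (P x) (%z. (?M s z)\<^sup>2 + (?M t z)\<^sup>2)" using i by simp
  have "\<bar>a * b\<bar> <= a\<^sup>2 + b\<^sup>2" for a b :: real
  proof -
   have "2 * (\<bar>a\<bar> * \<bar>b\<bar>) <= a\<^sup>2 + b\<^sup>2" using sum_squares_bound[of "\<bar>a\<bar>" "\<bar>b\<bar>"] by (simp only: mult.assoc power2_abs)
   moreover have "0 <= \<bar>a\<bar> * \<bar>b\<bar>" by simp
   ultimately show ?thesis unfolding abs_mult by linarith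
  qed
  thus "AE z in P x. norm (?M s z * ?M t z) <= norm ((?M s z)\<^sup>2 + (?M t z)\<^sup>2)"
   by (intro AE_I2) simp
 qed measurable
 have "AE z in P x. real_cond_exp (P x) (F s) (?M t) z = ?M s z"
 proof (rule real_cond_exp_charact)
  show "(\<integral>z\<in>B. ?M t z \<partial>P x) = (\<integral>z\<in>B. ?M s z \<partial>P x)" if "B : sets (F s)" for B
   using half_martingale_cond[OF p g e x st that] by (simp add: set_lebesgue_integral_def)
 qed (use i in auto)
 hence c: "AE z in P x. (ind A z * ?M s z) * real_cond_exp (P x) (F s) (?M t) z = ind A z * (?M s z)\<^sup>2"
  by eventually_elim (simp add: power2_eq_square)
 have "(LINT z|P x. ind A z * (?M s z)\<^sup>2) = (LINT z|P x. (ind A z * ?M s z) * real_cond_exp (P x) (F s) (?M t) z)"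
 proof (rule integral_cong_AE)
  show "(%z. ind A z * ?M s z * real_cond_exp (P x) (F s) (?M t) z) : BM (P x)"
   by (intro borel_measurable_times borel_measurable_cond_exp2) measurable
  show "AE z in P x. ind A z * (?M s z)\<^sup>2 = ind A z * ?M s z * real_cond_exp (P x) (F s) (?M t) z"
   using c by eventually_elim (rule sym)
 qed measurable
 also have "... = (LINT z|P x. (ind A z * ?M s z) * ?M t z)"
 proof (rule real_cond_exp_intg(2))
  show "integrable (P x) (%z. ind A z * ?M s z * ?M t z)" using iA[OF ist] by (simp add: mult.assoc)
  show "(%z. ind A z * ?M s z) : BM (F s)" using i(6) A by measurable
 qed measurable
 finally have c: "(LINT z|P x. ind A z * (?M s z)\<^sup>2) = (LINT z|P x. ind A z * (?M s z * ?M t z))" by (simp only: mult.assoc)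
 have "0 <= (LINT z|P x. ind A z * (?M t z - ?M s z)\<^sup>2)" by (intro lebesgue_nonneg) auto
 also have "... = (LINT z|P x. ind A z * (?M t z)\<^sup>2 - 2 * (ind A z * (?M s z * ?M t z)) + ind A z * (?M s z)\<^sup>2)"
  by (intro lebesgue_cong refl) (simp add: power2_diff algebra_simps)
 also have "... = (LINT z|P x. ind A z * (?M t z)\<^sup>2) - 2 * (LINT z|P x. ind A z * (?M s z * ?M t z)) + (LINT z|P x. ind A z * (?M s z)\<^sup>2)"
  using iA[OF i(2)] iA[OF ist] iA[OF i(5)] by simp
 finally show ?thesis using c by simp
qed

text \<open>Split according to the value of the discretised stopping time; each piece is increased by moving
on to time t.\<close>

lemma half_martingale_stopped:
 assumes p: "p : D1" and g: "g : D1" and e: "ext_generator S F X P p g" and x: "x : S" and t: "0 <= t"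
  and T: "stopping_time F T" "\<And>z. 0 <= T z"
 shows "(\<integral>\<^sup>+z. ennreal ((half_martingale p g x (min t (T z)) z)\<^sup>2) \<partial>P x) <= ennreal (LINT z|P x. (half_martingale p g x t z)\<^sup>2)"
proof (cases "t = 0")
 case True
 hence "(\<integral>\<^sup>+z. ennreal ((half_martingale p g x (min t (T z)) z)\<^sup>2) \<partial>P x) = (\<integral>\<^sup>+z. ennreal ((half_martingale p g x t z)\<^sup>2) \<partial>P x)"
  using T(2) by (intro nn_integral_cong) (simp add: min_absorb1)
 thus ?thesis using half_martingale_L2(2)[OF p g x t] by (simp add: nn_integral_eq_integral)
next
 case False
 hence t0: "0 < t" using t by simp
 interpret prob_space "P x" by (rule P_prob[OF x])
 note [measurable_cong] = sets_P[OF x]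
 have D: "p : D" "g : D" using p g D1_D by auto
 let ?M = "half_martingale p g x"
 have Tm[measurable]: "T : BM M" by (rule measurable_stopping[OF T(1)])
 have bound: "(\<integral>\<^sup>+z. ennreal ((?M (real (grid_index m t (T z)) * t / real m) z)\<^sup>2) \<partial>P x) <= ennreal (LINT z|P x. (?M t z)\<^sup>2)" if m: "0 < m" for m
 proof -
  define d where "d j = real j * t / real m" for j
  have d0: "0 <= d j" "j <= m ==> d j <= t" for j using t0 m by (auto simp: d_def divide_le_eq mult.commute)
  define k where "k z = grid_index m t (T z)" for z
  have km[measurable]: "k : M \<rightarrow>\<^sub>M count_space UNIV" unfolding k_def by (rule grid_index_measurable[OF T(1) t0])
  have kle: "k z <= m" for z unfolding k_def by (rule grid_index_le[OF t0])
  define A where "A j = {z : space M. k z = j}" for j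
  have Am[measurable]: "A j : sets M" for j unfolding A_def by measurable
  have gt: "{z : space M. i < k z} : sets (F (d j))" if "i <= j" "j <= m" for i j
  proof (cases "i < m")
   case True
   have "{z : space M. i < k z} : sets (F (d i))" using grid_index_sets[OF T(1) t0 True] by (simp add: k_def d_def)
   moreover have "d i <= d j" using that t0 unfolding d_def by (intro divide_right_mono mult_right_mono) auto
   ultimately show ?thesis using sets_F_mono[of "d i" "d j"] by auto
  next
   case False
   hence "\<not> i < k z" for z using kle[of z] by simp
   thus ?thesis by simp
  qed
  have AF: "A j : sets (F (d j))" if "j <= m" for j
  proof (cases j)
   case 0
   have "A j = space (F (d j)) - {z : space M. 0 < k z}" by (auto simp: A_def 0 space_F)
   thus ?thesis using gt[of 0 j] that by auto
  next
   case (Suc i)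
   have "A j = {z : space M. i < k z} - {z : space M. j < k z}" by (auto simp: A_def Suc)
   thus ?thesis using gt[of i j] gt[of j j] that Suc by auto
  qed
  have Mm[measurable]: "?M (d j) : BM M" for j
   using borel_measurable_integrable[OF half_martingale_L2(1)[OF p g x d0(1)]] by simp
  have iA: "integrable (P x) (%z. ind (A j) z * (?M s z)\<^sup>2)" if "0 <= s" for j s
   using integrable_real_mult_indicator[OF _ half_martingale_L2(2)[OF p g x that], of "A j"] by (simp add: mult.commute)
  have sum1: "(?M (d (k z)) z)\<^sup>2 = (\<Sum>j\<le>m. ind (A j) z * (?M (d j) z)\<^sup>2)" if "z : space M" for z
  proof -
   have "(\<Sum>j\<le>m. ind (A j) z * (?M (d j) z)\<^sup>2) = (\<Sum>j\<le>m. if j = k z then (?M (d j) z)\<^sup>2 else 0)"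
    using that by (intro sum.cong) (auto simp: A_def)
   thus ?thesis using kle[of z] by simp
  qed
  have sum2: "(?M t z)\<^sup>2 = (\<Sum>j\<le>m. ind (A j) z * (?M t z)\<^sup>2)" if "z : space M" for z
  proof -
   have "(\<Sum>j\<le>m. ind (A j) z * (?M t z)\<^sup>2) = (\<Sum>j\<le>m. if j = k z then (?M t z)\<^sup>2 else 0)"
    using that by (intro sum.cong) (auto simp: A_def)
   thus ?thesis using kle[of z] by simp
  qed
  have "(\<integral>\<^sup>+z. ennreal ((?M (d (k z)) z)\<^sup>2) \<partial>P x) = (\<integral>\<^sup>+z. ennreal (\<Sum>j\<le>m. ind (A j) z * (?M (d j) z)\<^sup>2) \<partial>P x)"
   by (intro nn_integral_cong) (simp add: sum1 space_P[OF x])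
  also have "... = ennreal (LINT z|P x. (\<Sum>j\<le>m. ind (A j) z * (?M (d j) z)\<^sup>2))"
   by (intro nn_integral_eq_integral Bochner_Integration.integrable_sum AE_I2 sum_nonneg iA[OF d0(1)]) simp
  also have "(LINT z|P x. (\<Sum>j\<le>m. ind (A j) z * (?M (d j) z)\<^sup>2)) = (\<Sum>j\<le>m. \<integral>z. ind (A j) z * (?M (d j) z)\<^sup>2 \<partial>P x)"
   by (rule lebesgue_sum) (rule iA[OF d0(1)])
  also have "ennreal ... <= ennreal (\<Sum>j\<le>m. \<integral>z. ind (A j) z * (?M t z)\<^sup>2 \<partial>P x)"
   by (intro ennreal_leI sum_mono half_martingale_square_mono[OF p g e x d0(1)] d0(2) AF) auto
  also have "(\<Sum>j\<le>m. \<integral>z. ind (A j) z * (?M t z)\<^sup>2 \<partial>P x) = (LINT z|P x. (\<Sum>j\<le>m. ind (A j) z * (?M t z)\<^sup>2))"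
   by (rule lebesgue_sum[symmetric]) (rule iA[OF t])
  also have "... = (LINT z|P x. (?M t z)\<^sup>2)"
   by (intro lebesgue_cong refl sum2[symmetric]) (simp add: space_P[OF x])
  finally show ?thesis by (simp add: d_def k_def)
 qed
 have fXm: "(%z. ennreal ((?M (real (grid_index (Suc m) t (T z)) * t / real (Suc m)) z)\<^sup>2)) : BM M" for m
 proof -
  have "(%z. ?M (real (grid_index (Suc m) t (T z)) * t / real (Suc m)) z) : BM M"
   using grid_index_measurable[OF T(1) t0, of "Suc m"] t0 by (intro measurable_half_martingale_stopped[OF D]) auto
  thus ?thesis by measurable
 qed
 have "(\<integral>\<^sup>+z. ennreal ((?M (min t (T z)) z)\<^sup>2) \<partial>P x) = (\<integral>\<^sup>+z. liminf (%m. ennreal ((?M (real (grid_index (Suc m) t (T z)) * t / real (Suc m)) z)\<^sup>2)) \<partial>P x)"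
 proof (rule nn_integral_cong_AE)
  show "AE z in P x. ennreal ((?M (min t (T z)) z)\<^sup>2) = liminf (%m. ennreal ((?M (real (grid_index (Suc m) t (T z)) * t / real (Suc m)) z)\<^sup>2))"
   using AE_path_integrable[OF D(2) x t] AE_space
  proof eventually_elim
   case (elim z)
   hence z: "z : space M" by (simp add: space_P[OF x])
   have mt: "0 <= min t (T z)" using t T(2) by simp
   have "((%s. X s z) \<longlongrightarrow> X (min t (T z)) z) (at_right (min t (T z)))"
    using right_continuous[OF mt z] by (simp add: continuous_within)
   hence "(%m. X (real (grid_index (Suc m) t (T z)) * t / real (Suc m)) z) \<longlonglongrightarrow> X (min t (T z)) z"
    by (rule right_limit_sequence[OF _ grid_limit[OF t0 T(2)] grid_index_bounds(1)[OF t0 T(2)]]) simp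
   hence 1: "(%m. p (X (real (grid_index (Suc m) t (T z)) * t / real (Suc m)) z)) \<longlonglongrightarrow> p (X (min t (T z)) z)"
    using D_cont[OF D(1)] by (intro isCont_tendsto_compose[of _ p]) (auto simp: continuous_on_eq_continuous_at)
   have 2: "(%m. path_integral g (real (grid_index (Suc m) t (T z)) * t / real (Suc m)) z) \<longlonglongrightarrow> path_integral g (min t (T z)) z"
   proof (rule path_integral_tendsto[OF elim(1) grid_limit[OF t0 T(2)]])
    show "real (grid_index (Suc m) t (T z)) * t / real (Suc m) <= t" for m
     using grid_index_bounds(2)[OF t0 T(2), of "Suc m" z] by (simp only: zero_less_Suc min.bounded_iff)
   qed simp
   show ?case
    by (rule lim_imp_Liminf[symmetric], simp)
     (intro tendsto_ennrealI tendsto_power, unfold half_martingale_def, intro tendsto_diff tendsto_const 1 2)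
  qed
 qed
 also have "... <= liminf (%m. \<integral>\<^sup>+z. ennreal ((?M (real (grid_index (Suc m) t (T z)) * t / real (Suc m)) z)\<^sup>2) \<partial>P x)"
  using fXm by (intro nn_integral_liminf) simp
 also have "... <= liminf (%m::nat. ennreal (LINT z|P x. (?M t z)\<^sup>2))"
  by (intro Liminf_mono always_eventually allI bound) simp
 also have "... = ennreal (LINT z|P x. (?M t z)\<^sup>2)" by (simp add: Liminf_const)
 finally show ?thesis .
qed

text \<open>One inequality is Fatou's lemma for the nonnegative w. For the other one, w is dominated by
twice the squared martingale plus an integrable function, and the expectations of the former at
stopping times do not exceed that at t; Fatou's lemma applies to the difference.\<close>

lemma moment_square:
 assumes w: "w : D" and p: "p : D1" and wp: "\<And>y. y : S ==> w y = (p y)\<^sup>2" and x: "x : S" and t: "0 <= t"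
 shows "(LINT z|P x. w (X t z)) = w x + (LINT z|P x. path_integral (\<G> w) t z)"
proof (rule antisym)
 interpret prob_space "P x" by (rule P_prob[OF x])
 note [measurable_cong] = sets_P[OF x]
 let ?b = "w x + (LINT z|P x. path_integral (\<G> w) t z)"
 obtain T where T: "\<And>n. stopping_time F (T n)" "\<And>n z. 0 <= T n z"
  "AE z in P x. eventually (%n. t <= T n z) sequentially"
  "\<And>n. integrable (P x) (%z. w (X (min t (T n z)) z))"
  "(%n. \<integral>z. w (X (min t (T n z)) z) \<partial>P x) \<longlonglongrightarrow> ?b"
  by (rule localizer_sequence[OF w \<G>_D[OF w] x t \<G>_ext[OF w]], rule that)
 have lim: "AE z in P x. (%n. h (min t (T n z)) z) \<longlonglongrightarrow> h t z" for h :: "real => 'w => real"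
  using T(3)
 proof eventually_elim
  case (elim z)
  hence "eventually (%n. h (min t (T n z)) z = h t z) sequentially" by eventually_elim (simp add: min_absorb1)
  then show ?case by (rule tendsto_eventually)
 qed
 have mt: "0 <= min t (T n z)" for n z using t T(2) by simp
 have wm: "(%z. w (X t z)) : BM (P x)" using measurable_uX[OF w t] by simp
 show "(LINT z|P x. w (X t z)) <= ?b"
 proof (rule Fatou_real(2)[OF wm T(4) _ lim[of "%t z. w (X t z)"] order_refl T(5)])
  show "AE z in P x. 0 <= w (X (min t (T n z)) z)" for n
   using wp X_in_S[OF mt] by (intro AE_I2) (simp add: space_P[OF x])
 qed
 obtain g where g: "g : D1" and e: "ext_generator S F X P p g" using D1_ext[OF p] by blast
 have D: "p : D" "g : D" using p g D1_D by auto
 let ?M = "half_martingale p g x"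
 obtain v where v: "v : D" "\<And>y. y : S ==> v y = (g y)\<^sup>2"
  "AE z in P x. \<forall>s\<le>t. (path_integral g s z)\<^sup>2 <= t * path_integral v t z"
  by (rule path_integral_square_AE[OF g x t], rule that)
 define V where "V z = 4 * (p x)\<^sup>2 + 4 * (t * path_integral v t z)" for z
 have Vi: "integrable (P x) V" unfolding V_def using integrable_path_integral[OF v(1) x t] by simp
 have M2: "integrable (P x) (%z. (?M t z)\<^sup>2)" by (rule half_martingale_L2(2)[OF p g x t])
 have MTm: "(%z. ?M (min t (T n z)) z) : BM (P x)" for n
  using measurable_half_martingale_stopped[OF D mt] measurable_stopping[OF T(1)] by simp
 have MT: "integrable (P x) (%z. (?M (min t (T n z)) z)\<^sup>2)" for n
  using half_martingale_stopped[OF p g e x t T(1,2), of n] MTm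
  by (intro integrableI_nonneg) (auto simp: le_less_trans less_top[symmetric] top_unique)
 have MTle: "(LINT z|P x. (?M (min t (T n z)) z)\<^sup>2) <= (LINT z|P x. (?M t z)\<^sup>2)" for n
  using half_martingale_stopped[OF p g e x t T(1,2), of n] MT[of n] by (simp add: nn_integral_eq_integral)
 have "(LINT z|P x. 2 * (?M t z)\<^sup>2 + V z - w (X t z)) <= 2 * (LINT z|P x. (?M t z)\<^sup>2) + (LINT z|P x. V z) - ?b"
 proof (rule Fatou_real(2))
  show "(%z. 2 * (?M t z)\<^sup>2 + V z - w (X t z)) : BM (P x)"
   using borel_measurable_integrable[OF M2] borel_measurable_integrable[OF Vi] wm by measurable
  show "integrable (P x) (%z. 2 * (?M (min t (T n z)) z)\<^sup>2 + V z - w (X (min t (T n z)) z))" for n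
   using MT Vi T(4) by simp
  show "AE z in P x. 0 <= 2 * (?M (min t (T n z)) z)\<^sup>2 + V z - w (X (min t (T n z)) z)" for n
   using v(3) AE_space
  proof eventually_elim
   case (elim z)
   have "(path_integral g (min t (T n z)) z)\<^sup>2 <= t * path_integral v t z" using elim(1) by simp
   moreover have "w (X (min t (T n z)) z) = (p (X (min t (T n z)) z))\<^sup>2"
    using elim(2) by (intro wp X_in_S mt) (simp add: space_P[OF x])
   ultimately show ?case using half_martingale_square_le(2)[of p "min t (T n z)" z g x] by (simp add: V_def)
  qed
  show "AE z in P x. (%n. 2 * (?M (min t (T n z)) z)\<^sup>2 + V z - w (X (min t (T n z)) z)) \<longlonglongrightarrow> 2 * (?M t z)\<^sup>2 + V z - w (X t z)"
   using lim[of "%t z. 2 * (?M t z)\<^sup>2 + V z - w (X t z)"] .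
  show "(LINT z|P x. 2 * (?M (min t (T n z)) z)\<^sup>2 + V z - w (X (min t (T n z)) z))
    <= 2 * (LINT z|P x. (?M t z)\<^sup>2) + (LINT z|P x. V z) - (LINT z|P x. w (X (min t (T n z)) z))" for n
   using MT[of n] Vi T(4)[of n] MTle[of n] by simp
  show "(%n. 2 * (LINT z|P x. (?M t z)\<^sup>2) + (LINT z|P x. V z) - (LINT z|P x. w (X (min t (T n z)) z)))
    \<longlonglongrightarrow> 2 * (LINT z|P x. (?M t z)\<^sup>2) + (LINT z|P x. V z) - ?b"
   by (intro tendsto_intros T(5))
 qed
 thus "?b <= (LINT z|P x. w (X t z))" using M2 Vi integrable_u[OF w x t] by simp
qed

lemma Dynkin_formula:
 assumes u: "u : D" and x: "x : S" and t: "0 <= t"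
 shows "(LINT z|P x. u (X t z)) = u x + (LINT z|P x. path_integral (\<G> u) t z)"
proof -
 obtain R :: "nat set" and c w where R: "finite R" and w: "\<And>r. r : R ==> w r : D"
  and sq: "\<And>r. r : R ==> \<exists>p\<in>D1. \<forall>x\<in>S. w r x = (p x)\<^sup>2" and ueq: "u = (%x. \<Sum>r\<in>R. c r * w r x)"
  using D_squares[OF u] by (elim exE conjE) (rule that, auto)
 define Dy where "Dy u \<longleftrightarrow> u : D \<and> (LINT z|P x. u (X t z)) = u x + (LINT z|P x. path_integral (\<G> u) t z)" for u
 have pi: "path_integral (\<G> (%x. a * u x + b * w x)) t z = a * path_integral (\<G> u) t z + b * path_integral (\<G> w) t z"
  if "u : D" "w : D" "z : space M" "integrable lborel (%r. ind {0..t} r * \<G> u (X (max 0 r) z))"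
   "integrable lborel (%r. ind {0..t} r * \<G> w (X (max 0 r) z))" for u w a b z
 proof -
  have "\<G> (%x. a * u x + b * w x) (X (max 0 r) z) = a * \<G> u (X (max 0 r) z) + b * \<G> w (X (max 0 r) z)" for r
   using that by (intro \<G>_lin X_in_S) auto
  hence "path_integral (\<G> (%x. a * u x + b * w x)) t z
   = (LINT r|lborel. a * (ind {0..t} r * \<G> u (X (max 0 r) z)) + b * (ind {0..t} r * \<G> w (X (max 0 r) z)))"
   unfolding path_integral_eq by (intro lebesgue_cong refl) (simp add: algebra_simps)
  thus ?thesis using that by (simp add: path_integral_eq)
 qed
 have lin: "Dy (%x. a * u x + b * w x)" if u: "Dy u" and w: "Dy w" for u w a b
 proof -
  have D: "u : D" "w : D" using u w by (auto simp: Dy_def)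
  have "(LINT z|P x. path_integral (\<G> (%x. a * u x + b * w x)) t z) = (LINT z|P x. a * path_integral (\<G> u) t z + b * path_integral (\<G> w) t z)"
  proof (rule integral_cong_AE)
   show "path_integral (\<G> (%x. a * u x + b * w x)) t : BM (P x)"
    using integrable_path_integral[OF \<G>_D[OF D_lin[OF D]] x t] by (rule borel_measurable_integrable)
   show "(%z. a * path_integral (\<G> u) t z + b * path_integral (\<G> w) t z) : BM (P x)"
    using borel_measurable_integrable[OF integrable_path_integral[OF \<G>_D[OF D(1)] x t]]
     borel_measurable_integrable[OF integrable_path_integral[OF \<G>_D[OF D(2)] x t]] by measurable
   show "AE z in P x. path_integral (\<G> (%x. a * u x + b * w x)) t z = a * path_integral (\<G> u) t z + b * path_integral (\<G> w) t z"
    using AE_path_integrable[OF \<G>_D[OF D(1)] x t] AE_path_integrable[OF \<G>_D[OF D(2)] x t] AE_space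
    by eventually_elim (rule pi[OF D], simp_all add: space_P[OF x])
  qed
  also have "... = a * (LINT z|P x. path_integral (\<G> u) t z) + b * (LINT z|P x. path_integral (\<G> w) t z)"
   using integrable_path_integral[OF \<G>_D[OF D(1)] x t] integrable_path_integral[OF \<G>_D[OF D(2)] x t] by simp
  finally show ?thesis
   using u w D_lin[OF D, of a b] integrable_u[OF D(1) x t] integrable_u[OF D(2) x t]
   by (simp add: Dy_def algebra_simps)
 qed
 have Dw: "Dy (w r)" if "r : R" for r
  using w[OF that] sq[OF that] moment_square[OF w[OF that] _ _ x t] unfolding Dy_def by blast
 have z: "Dy (%x. 0)"
 proof -
  have "\<G> (%x. 0) (X (max 0 r) z) = 0" if "z : space M" for r z
   using \<G>_lin[OF u u X_in_S[OF _ that], of "max 0 r" 0 0] by simp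
  hence "(LINT z|P x. path_integral (\<G> (%x. 0)) t z) = (LINT z|P x. 0)"
   by (intro lebesgue_cong refl) (simp add: path_integral_eq space_P[OF x])
  thus ?thesis using D_lin[OF u u, of 0 0] by (simp add: Dy_def)
 qed
 have "Dy (%x. \<Sum>r\<in>R. c r * w r x)"
  using R Dw
 proof (induction R)
  case empty
  show ?case using z by simp
 next
  case (insert r R)
  have "Dy (%x. c r * w r x + 1 * (\<Sum>r\<in>R. c r * w r x))" using insert by (intro lin) auto
  then show ?case using insert.hyps by simp
 qed
 thus ?thesis using ueq by (simp add: Dy_def)
qed

lemma
 assumes g: "g : D" and x: "x : S"
  and u: "\<And>t. 0 <= t ==> (LINT z|P x. u (X t z)) = u x + (LINT z|P x. path_integral g t z)"
 shows expectation_has_integral: "0 <= t ==> ((%s. \<integral>z. g (X s z) \<partial>P x) has_integral ((LINT z|P x. u (X t z)) - u x)) {0..t}"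
  and continuous_on_expectation: "continuous_on {0..} (%t. \<integral>z. u (X t z) \<partial>P x)"
proof -
 let ?m = "%s. \<integral>z. g (X s z) \<partial>P x"
 have hi: "(?m has_integral ((LINT z|P x. u (X t z)) - u x)) {0..t}" if t: "0 <= t" for t
 proof -
  let ?m' = "%s. \<integral>z. g (X (max 0 s) z) \<partial>P x"
  have "set_integrable lborel {0..t} ?m'"
   using integrable_expectation_time[OF g x t] by (simp add: set_integrable_def)
  from set_borel_integral_eq_integral[OF this]
  have "(?m' has_integral (LINT s:{0..t}|lborel. ?m' s)) {0..t}" by (simp add: has_integral_integral)
  also have "(LINT s:{0..t}|lborel. ?m' s) = (LINT z|P x. u (X t z)) - u x"
   using u[OF t] expectation_path_integral[OF g x t] by (simp add: set_lebesgue_integral_def)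
  finally show ?thesis by (rule has_integral_eq[rotated]) (simp add: max_def)
 qed
 thus "0 <= t ==> (?m has_integral ((LINT z|P x. u (X t z)) - u x)) {0..t}" .
 show "continuous_on {0..} (%t. \<integral>z. u (X t z) \<partial>P x)"
  unfolding continuous_on_eq_continuous_within
 proof
  fix t :: real assume t: "t : {0..}"
  have "continuous_on {0..t + 1} (%s. integral {0..s} ?m)"
   using hi[of "t + 1"] t by (intro indefinite_integral_continuous_1) (auto simp: has_integral_iff)
  hence "continuous_on {0..t + 1} (%s. u x + integral {0..s} ?m)" by (intro continuous_intros)
  also have "?this \<longleftrightarrow> continuous_on {0..t + 1} (%t. \<integral>z. u (X t z) \<partial>P x)"
   using hi by (intro continuous_on_cong refl) (simp add: has_integral_iff)
  finally have "continuous (at t within {0..t + 1}) (%t. \<integral>z. u (X t z) \<partial>P x)"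
   using t by (simp add: continuous_on_eq_continuous_within)
  also have "at t within {0..t + 1} = at t within {0..}"
   by (rule at_within_nhd[where S="{..<t + 1}"]) (use t in auto)
  finally show "continuous (at t within {0..}) (%t. \<integral>z. u (X t z) \<partial>P x)" .
 qed
qed

lemma two_time_products:
 assumes p: "p : D1" and q: "q : D1" and x: "x : S" and ab: "0 <= a" "0 <= b"
  and u: "u : D" "\<And>y. y : S ==> u y = (p y)\<^sup>2" and v: "v : D" "\<And>y. y : S ==> v y = (q y)\<^sup>2"
 shows "integrable (P x) (%z. p (X b z) * q (X a z))"
  and "(LINT z|P x. \<bar>p (X b z) * q (X a z)\<bar>) <= (LINT z|P x. u (X b z)) + (LINT z|P x. v (X a z))"
proof -
 note [measurable_cong] = sets_P[OF x]
 have [measurable]: "(%z. p (X b z)) : BM M" "(%z. q (X a z)) : BM M"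
  using measurable_uX[of p b] measurable_uX[of q a] p q D1_D ab by auto
 have bd: "\<bar>p (X b z) * q (X a z)\<bar> <= u (X b z) + v (X a z)" if "z : space M" for z
 proof -
  have "2 * (\<bar>c\<bar> * \<bar>d\<bar>) <= c\<^sup>2 + d\<^sup>2" for c d :: real using sum_squares_bound[of "\<bar>c\<bar>" "\<bar>d\<bar>"] by (simp only: mult.assoc power2_abs)
  moreover have "0 <= \<bar>c\<bar> * \<bar>d\<bar>" for c d :: real by simp
  ultimately show ?thesis
   unfolding u(2)[OF X_in_S[OF ab(2) that]] v(2)[OF X_in_S[OF ab(1) that]] abs_mult by (smt (verit))
 qed
 have I: "integrable (P x) (%z. u (X b z) + v (X a z))"
  using integrable_u[OF u(1) x ab(2)] integrable_u[OF v(1) x ab(1)] by simp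
 show i: "integrable (P x) (%z. p (X b z) * q (X a z))"
  using bd by (intro integrable_by[OF I]) (auto intro!: AE_I2 order_trans[OF _ abs_ge_self] simp: space_P[OF x])
 have "(LINT z|P x. \<bar>p (X b z) * q (X a z)\<bar>) <= (LINT z|P x. u (X b z) + v (X a z))"
  using i I bd by (intro integral_mono) (auto simp: space_P[OF x])
 thus "(LINT z|P x. \<bar>p (X b z) * q (X a z)\<bar>) <= (LINT z|P x. u (X b z)) + (LINT z|P x. v (X a z))"
  using integrable_u[OF u(1) x ab(2)] integrable_u[OF v(1) x ab(1)] by simp
qed

lemma two_time_moment:
 assumes p: "p : D1" and q: "q : D1" and h: "h : D" and x: "x : S" and ar: "0 <= a" "0 <= r"
  and hp: "\<And>y. y : S ==> (LINT z|P y. p (X r z)) = h y"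
 shows "(LINT z|P x. p (X (a + r) z) * q (X a z)) = (LINT z|P x. h (X a z) * q (X a z))"
proof -
 interpret finite_measure_subalgebra "P x" "F a" by (rule cond_exp_F[OF x])
 note [measurable_cong] = sets_P[OF x]
 have b: "0 <= a + r" using ar by simp
 have D: "p : D" "q : D" using p q D1_D by auto
 obtain u v where u: "u : D" "\<And>y. y : S ==> u y = (p y)\<^sup>2" and v: "v : D" "\<And>y. y : S ==> v y = (q y)\<^sup>2"
  using D1_square[OF p] D1_square[OF q] by blast
 have [measurable]: "(%z. p (X (a + r) z)) : BM M" "(%z. q (X a z)) : BM M" "(%z. h (X a z)) : BM M"
  using measurable_uX[OF D(1) b] measurable_uX[OF D(2) ar(1)] measurable_uX[OF h ar(1)] by simp_all
 note i = two_time_products(1)[OF p q x ar(1) b u v]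
 have F: "(%z. w (X a z)) : BM (F a)" if "w : D" for w
  using measurable_X_F[OF ar(1)] by (rule measurable_compose[OF _ borel_measurable_continuous_onI[OF D_cont[OF that]]])
 have "AE z in P x. real_cond_exp (P x) (F a) (%z. p (X (a + r) z)) z = h (X a z)"
 proof (rule real_cond_exp_charact)
  show "(\<integral>z\<in>B. p (X (a + r) z) \<partial>P x) = (\<integral>z\<in>B. h (X a z) \<partial>P x)" if B: "B : sets (F a)" for B
  proof -
   have "(LINT z|P x. ind B z * p (X (a + r) z)) = (LINT z|P x. ind B z * h (X a z))"
    unfolding markov_D(2)[OF x ar B D(1)]
    by (intro lebesgue_cong refl) (simp add: hp X_in_S[OF ar(1)] space_P[OF x])
   thus ?thesis by (simp add: set_lebesgue_integral_def)
  qed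
 qed (use integrable_u[OF D(1) x b] integrable_u[OF h x ar(1)] F[OF h] in auto)
 hence c: "AE z in P x. q (X a z) * real_cond_exp (P x) (F a) (%z. p (X (a + r) z)) z = h (X a z) * q (X a z)"
  by eventually_elim simp
 have "(LINT z|P x. h (X a z) * q (X a z)) = (LINT z|P x. q (X a z) * real_cond_exp (P x) (F a) (%z. p (X (a + r) z)) z)"
 proof (rule integral_cong_AE)
  show "(%z. q (X a z) * real_cond_exp (P x) (F a) (%z. p (X (a + r) z)) z) : BM (P x)"
   by (intro borel_measurable_times borel_measurable_cond_exp2) measurable
  show "AE z in P x. h (X a z) * q (X a z) = q (X a z) * real_cond_exp (P x) (F a) (%z. p (X (a + r) z)) z"
   using c by eventually_elim (rule sym)
 qed measurable
 also have "... = (LINT z|P x. q (X a z) * p (X (a + r) z))"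
  by (rule real_cond_exp_intg(2)) (use i F[OF D(2)] in \<open>auto simp: mult.commute\<close>)
 finally show "(LINT z|P x. p (X (a + r) z) * q (X a z)) = (LINT z|P x. h (X a z) * q (X a z))"
  by (simp add: mult.commute)
qed

end

section \<open>Polynomials as combinations of squares\<close>

abbreviation mono_fun :: "('d::finite => nat) => real^'d => real" where
 "mono_fun m \<equiv> (%x. \<Prod>i\<in>UNIV. vec_nth x i ^ m i)"

lemma finite_exponents: "finite {m :: 'd::finite => nat. (\<Sum>i\<in>UNIV. m i) <= k}"
proof (rule finite_subset)
 show "{m :: 'd => nat. (\<Sum>i\<in>UNIV. m i) <= k} \<subseteq> (\<Pi>\<^sub>E i\<in>UNIV. {..k})"
 proof
  fix m :: "'d => nat" assume "m : {m. (\<Sum>i\<in>UNIV. m i) <= k}"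
  hence "m i <= k" for i by (intro order_trans[OF member_le_sum[of i UNIV m]]) auto
  thus "m : (\<Pi>\<^sub>E i\<in>UNIV. {..k})" by auto
 qed
 show "finite (\<Pi>\<^sub>E i\<in>(UNIV :: 'd set). {..k})" by (rule finite_PiE) auto
qed

lemma polysE:
 assumes "p : polys k"
 obtains c where "p = (%x. \<Sum>m | (\<Sum>i\<in>UNIV. m i) <= k. c m * mono_fun m x)"
 using assms by (auto simp: polys_def)

lemma polys_add: "p : polys k ==> q : polys k ==> (%x. p x + q x) : polys k"
proof (elim polysE)
 fix c c' assume "p = (%x. \<Sum>m | (\<Sum>i\<in>UNIV. m i) <= k. c m * mono_fun m x)" "q = (%x. \<Sum>m | (\<Sum>i\<in>UNIV. m i) <= k. c' m * mono_fun m x)"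
 thus ?thesis unfolding polys_def by (intro CollectI exI[of _ "%m. c m + c' m"]) (simp add: sum.distrib distrib_right)
qed

lemma polys_cmult: "p : polys k ==> (%x. a * p x) : polys k"
proof (elim polysE)
 fix c assume "p = (%x. \<Sum>m | (\<Sum>i\<in>UNIV. m i) <= k. c m * mono_fun m x)"
 thus ?thesis unfolding polys_def by (intro CollectI exI[of _ "%m. a * c m"]) (simp add: sum_distrib_left mult.assoc)
qed

lemma polys_0: "(%x. 0) : polys k"
 unfolding polys_def by (intro CollectI exI[of _ "%m. 0"]) simp

lemma polys_sum: "finite I ==> (\<And>i. i : I ==> p i : polys k) ==> (%x. \<Sum>i\<in>I. p i x) : polys k"
 by (induction I rule: finite_induct) (auto simp: polys_0 polys_add)

lemma mono_fun_polys: "(\<Sum>i\<in>UNIV. m i) <= k ==> mono_fun m : polys k"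
 unfolding polys_def
proof (intro CollectI exI[of _ "%m'. if m' = m then 1 else 0"] ext)
 fix x :: "real^'a" assume m: "(\<Sum>i\<in>UNIV. m i) <= k"
 have "(\<Sum>m' | sum m' UNIV <= k. (if m' = m then 1 else 0) * mono_fun m' x) = (\<Sum>m' | sum m' UNIV <= k. if m' = m then mono_fun m x else 0)"
  by (intro sum.cong) auto
 thus "mono_fun m x = (\<Sum>m' | sum m' UNIV <= k. (if m' = m then 1 else 0) * mono_fun m' x)"
  using m by (simp add: finite_exponents)
qed

lemma polys_mono: "k <= l ==> p : polys k ==> p : polys l"
 by (elim polysE) (auto intro!: polys_sum polys_cmult mono_fun_polys finite_exponents)

lemma mono_fun_mult: "mono_fun m x * mono_fun m' x = mono_fun (%i. m i + m' i) x"
 by (simp add: power_add prod.distrib)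

lemma polys_mult: "p : polys k ==> q : polys l ==> (%x. p x * q x) : polys (k + l)"
proof (elim polysE)
 fix c c' assume p: "p = (%x. \<Sum>m | (\<Sum>i\<in>UNIV. m i) <= k. c m * mono_fun m x)" and q: "q = (%x. \<Sum>m | (\<Sum>i\<in>UNIV. m i) <= l. c' m * mono_fun m x)"
 have "(%x. p x * q x) = (%x. \<Sum>m | (\<Sum>i\<in>UNIV. m i) <= k. \<Sum>m' | (\<Sum>i\<in>UNIV. m' i) <= l. (c m * c' m') * mono_fun (%i. m i + m' i) x)"
  unfolding p q sum_product mono_fun_mult[symmetric] by (intro ext sum.cong refl) simp
 also have "... : polys (k + l)"
  by (intro polys_sum polys_cmult mono_fun_polys finite_exponents) (auto simp: sum.distrib intro: add_mono)
 finally show ?thesis .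
qed

lemma continuous_on_polys: "p : polys k ==> continuous_on UNIV p"
 by (elim polysE) (auto intro!: continuous_intros)

text \<open>Used to split a monomial of degree at most 2k into two factors of degree at most k.\<close>

lemma exponent_below:
 fixes m :: "'d::finite => nat"
 shows "j <= (\<Sum>i\<in>UNIV. m i) ==> \<exists>m'. (\<forall>i. m' i <= m i) \<and> (\<Sum>i\<in>UNIV. m' i) = j"
proof (induction j)
 case 0 show ?case by (intro exI[of _ "%_. 0"]) simp
next
 case (Suc j)
 then obtain m' where m': "\<And>i. m' i <= m i" "(\<Sum>i\<in>UNIV. m' i) = j" by auto
 have "\<exists>i. m' i < m i"
 proof (rule ccontr)
  assume "\<not> (\<exists>i. m' i < m i)"
  hence "m = m'" using m'(1) by (intro ext antisym) (auto simp: not_less)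
  thus False using m'(2) Suc.prems by simp
 qed
 then obtain i where i: "m' i < m i" by blast
 have "(\<Sum>l\<in>UNIV. (m'(i := Suc (m' i))) l) = Suc (m' i) + (\<Sum>l\<in>UNIV - {i}. m' l)"
  by (subst sum.remove[of _ i]) auto
 also have "... = Suc j" using m'(2) by (subst (asm) sum.remove[of _ i]) auto
 finally show ?case using m'(1) i by (intro exI[of _ "m'(i := Suc (m' i))"]) auto
qed

lemma exponent_split:
 fixes m :: "'d::finite => nat"
 assumes "(\<Sum>i\<in>UNIV. m i) <= 2 * k"
 shows "\<exists>m1 m2. (\<Sum>i\<in>UNIV. m1 i) <= k \<and> (\<Sum>i\<in>UNIV. m2 i) <= k \<and> m = (%i. m1 i + m2 i)"
proof -
 obtain m1 where m1: "\<And>i. m1 i <= m i" "(\<Sum>i\<in>UNIV. m1 i) = min k (\<Sum>i\<in>UNIV. m i)"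
  using exponent_below[of "min k (\<Sum>i\<in>UNIV. m i)" m] by auto
 have "(\<Sum>i\<in>UNIV. m i - m1 i) = (\<Sum>i\<in>UNIV. m i) - (\<Sum>i\<in>UNIV. m1 i)"
  using m1(1) by (intro sum_subtractf_nat) auto
 thus ?thesis using m1 assms by (intro exI[of _ m1] exI[of _ "%i. m i - m1 i"]) auto
qed

text \<open>Polarisation of a product of two monomials: a b = ((a + b)^2 - (a - b)^2) / 4. The index set is
transported to the natural numbers, since the type of exponents would otherwise appear in the
locale above.\<close>

lemma polys_sum_of_squares:
 assumes "u : polys (2 * k)"
 obtains R :: "nat set" and c a where "finite R" "\<And>r. r : R ==> a r : polys k" "u = (%x. \<Sum>r\<in>R. c r * (a r x)\<^sup>2)"
proof -
 obtain c where u: "u = (%x. \<Sum>m | (\<Sum>i\<in>UNIV. m i) <= 2 * k. c m * mono_fun m x)" using assms by (elim polysE)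
 let ?M = "{m :: 'a => nat. (\<Sum>i\<in>UNIV. m i) <= 2 * k}"
 obtain l r where lr: "\<And>m. m : ?M ==> (\<Sum>i\<in>UNIV. l m i) <= k \<and> (\<Sum>i\<in>UNIV. r m i) <= k \<and> m = (%i. l m i + r m i)"
  using exponent_split[where k=k and 'd='a] by (metis (mono_tags, lifting) mem_Collect_eq)
 let ?I = "?M \<times> (UNIV :: bool set)"
 have fI: "finite ?I" by (intro finite_cartesian_product finite_exponents) simp
 define a where "a i = (%x. mono_fun (l (fst i)) x + (if snd i then 1 else - 1) * mono_fun (r (fst i)) x)" for i :: "('a => nat) \<times> bool"
 define d where "d i = (if snd i then 1 / 4 else - 1 / 4) * c (fst i)" for i :: "('a => nat) \<times> bool"
 have a: "a i : polys k" if "i : ?I" for i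
  unfolding a_def using lr[of "fst i"] that by (intro polys_add polys_cmult mono_fun_polys) auto
 have "u x = (\<Sum>i\<in>?I. d i * (a i x)\<^sup>2)" for x
 proof -
  have "(\<Sum>i\<in>?I. d i * (a i x)\<^sup>2) = (\<Sum>m\<in>?M. \<Sum>b\<in>UNIV. d (m, b) * (a (m, b) x)\<^sup>2)"
   by (simp add: sum.cartesian_product)
  also have "... = (\<Sum>m\<in>?M. c m * mono_fun m x)"
  proof (rule sum.cong[OF refl])
   fix m assume "m : ?M"
   hence m: "m = (%i. l m i + r m i)" using lr by blast
   have "mono_fun m x = mono_fun (l m) x * mono_fun (r m) x"
    unfolding mono_fun_mult using m by metis
   thus "(\<Sum>b\<in>UNIV. d (m, b) * (a (m, b) x)\<^sup>2) = c m * mono_fun m x"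
    by (simp add: UNIV_bool d_def a_def power2_sum power2_diff algebra_simps)
  qed
  finally show ?thesis by (simp add: u)
 qed
 moreover obtain h where h: "bij_betw h {0..<card ?I} ?I" using ex_bij_betw_nat_finite[OF fI] by blast
 ultimately have "u = (%x. \<Sum>r\<in>{0..<card ?I}. d (h r) * (a (h r) x)\<^sup>2)"
  by (intro ext) (simp add: sum.reindex_bij_betw[OF h, symmetric])
 moreover have "a (h r) : polys k" if "r : {0..<card ?I}" for r
  using bij_betwE[OF h] that by (intro a) auto
 ultimately show thesis using that[of "{0..<card ?I}" "%r. a (h r)" "%r. d (h r)"] by simp
qed

lemma lin_comb_polys: "(\<And>i. i < n ==> H i : polys k) ==> lin_comb n H c : polys k"
 unfolding lin_comb_def[abs_def] by (intro polys_sum polys_cmult) auto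

lemma lin_comb_add:
 "c : carrier_vec n ==> d : carrier_vec n ==> lin_comb n H (a \<cdot>\<^sub>v c + b \<cdot>\<^sub>v d) x = a * lin_comb n H c x + b * lin_comb n H d x"
 unfolding lin_comb_def sum_distrib_left sum.distrib[symmetric] by (intro sum.cong refl) (simp add: algebra_simps)

lemma lin_comb_unit: "i < n ==> lin_comb n H (unit_vec n i) = H i"
proof
 fix x assume i: "i < n"
 have "lin_comb n H (unit_vec n i) x = (\<Sum>j<n. if j = i then H i x else 0)"
  unfolding lin_comb_def by (intro sum.cong) (auto simp: unit_vec_def)
 thus "lin_comb n H (unit_vec n i) x = H i x" using i by simp
qed

lemma
 assumes b: "poly_basis S k n H"
 shows basis_polys: "i < n ==> H i : polys k"
  and coords_carrier: "p : polys k ==> coords S n H p : carrier_vec n"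
  and lin_comb_coords: "p : polys k ==> x : S ==> lin_comb n H (coords S n H p) x = p x"
  and coords_unique: "p : polys k ==> c : carrier_vec n ==> (\<And>x. x : S ==> p x = lin_comb n H c x) ==> coords S n H p = c"
proof -
 show "i < n ==> H i : polys k" using b by (simp add: poly_basis_def)
 have ex: "p : polys k ==> \<exists>!c. c : carrier_vec n \<and> (\<forall>x\<in>S. p x = lin_comb n H c x)" for p
  using b by (simp add: poly_basis_def)
 from theI'[OF ex, of p] show "p : polys k ==> coords S n H p : carrier_vec n"
  "p : polys k ==> x : S ==> lin_comb n H (coords S n H p) x = p x"
  by (auto simp: coords_def)
 show "p : polys k ==> c : carrier_vec n ==> (\<And>x. x : S ==> p x = lin_comb n H c x) ==> coords S n H p = c"
  unfolding coords_def using ex[of p] by (intro the1_equality) auto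
qed

lemma basis_independent:
 assumes b: "poly_basis S k n H" and z: "\<And>x. x : S ==> (\<Sum>i<n. c i * H i x) = 0"
 shows "\<forall>i<n. c i = 0"
proof -
 have "coords S n H (%x. 0) = vec n c"
  using z by (intro coords_unique[OF b polys_0]) (auto simp: lin_comb_def)
 moreover have "coords S n H (%x. 0) = 0\<^sub>v n"
  by (intro coords_unique[OF b polys_0]) (auto simp: lin_comb_def)
 ultimately have "vec n c = 0\<^sub>v n" by simp
 hence "vec n c $ i = 0" if "i < n" for i using that by simp
 thus ?thesis by simp
qed

locale nested_polynomial_basis =
 fixes S :: "(real^'d) set" and k N n :: nat and H :: "nat => real^'d => real"
 assumes nonempty: "S \<noteq> {}" and basis_2k: "poly_basis S (2 * k) N H" and basis_k: "poly_basis S k n H"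
  and H_0: "\<And>x. x : S ==> H 0 x = 1"
begin

lemma const_polys: "(%x. a) : polys j"
 using polys_cmult[OF mono_fun_polys[of "%_. 0" j], of a] by simp

lemma n_pos: "0 < n"
proof (rule ccontr)
 assume "\<not> 0 < n"
 obtain x where "x : S" using nonempty by blast
 from lin_comb_coords[OF basis_k const_polys this, of 1] \<open>\<not> 0 < n\<close> show False by (simp add: lin_comb_def)
qed

text \<open>Otherwise the basis element number N, which has degree at most k, would be a combination of the
preceding ones.\<close>

lemma n_le_N: "n <= N"
proof (rule ccontr)
 assume "\<not> n <= N"
 hence N: "N < n" by simp
 have p: "H N : polys (2 * k)" by (rule polys_mono[OF _ basis_polys[OF basis_k N]]) simp
 define c where "c i = (if i < N then coords S N H (H N) $ i else if i = N then - 1 else 0)" for i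
 have "\<forall>i<n. c i = 0"
 proof (rule basis_independent[OF basis_k])
  fix x assume x: "x : S"
  have "(\<Sum>i<n. c i * H i x) = (\<Sum>i<Suc N. c i * H i x)"
   using N by (intro sum.mono_neutral_right) (auto simp: c_def)
  also have "... = (\<Sum>i<N. coords S N H (H N) $ i * H i x) - H N x" by (simp add: c_def)
  finally show "(\<Sum>i<n. c i * H i x) = 0" using lin_comb_coords[OF basis_2k p x] by (simp add: lin_comb_def)
 qed
 thus False using N by (auto simp: c_def)
qed

lemma N_pos: "0 < N" using n_pos n_le_N by simp

definition D :: "(real^'d => real) set" where "D = lin_comb N H ` carrier_vec N"
definition D1 :: "(real^'d => real) set" where "D1 = lin_comb n H ` carrier_vec n"

lemma D_polys: "u : D ==> u : polys (2 * k)"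
 unfolding D_def using lin_comb_polys[OF basis_polys[OF basis_2k]] by auto
lemma D1_polys: "u : D1 ==> u : polys k"
 unfolding D1_def using lin_comb_polys[OF basis_polys[OF basis_k]] by auto
lemma D_coords: "u : D ==> lin_comb N H (coords S N H u) = u"
proof -
 assume u: "u : D"
 then obtain c where c: "c : carrier_vec N" "u = lin_comb N H c" unfolding D_def by blast
 have "coords S N H u = c" using c by (intro coords_unique[OF basis_2k D_polys[OF u]]) auto
 thus ?thesis using c by simp
qed
lemma in_D: "c : carrier_vec N ==> lin_comb N H c : D" by (simp add: D_def)
lemma in_D1: "c : carrier_vec n ==> lin_comb n H c : D1" by (simp add: D1_def)

lemma D_eqI:
 assumes "u : D" "w : D" "\<And>x. x : S ==> u x = w x" shows "u = w"
proof -
 have "coords S N H u = coords S N H w"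
  using assms coords_carrier[OF basis_2k D_polys[OF assms(2)]] D_coords[OF assms(2)]
  by (intro coords_unique[OF basis_2k D_polys[OF assms(1)]]) auto
 thus ?thesis using D_coords assms by metis
qed

lemma rep_D: assumes "p : polys (2 * k)" obtains u where "u : D" "\<And>x. x : S ==> u x = p x"
 using lin_comb_coords[OF basis_2k assms] in_D[OF coords_carrier[OF basis_2k assms]] by blast
lemma rep_D1: assumes "p : polys k" obtains u where "u : D1" "\<And>x. x : S ==> u x = p x"
 using lin_comb_coords[OF basis_k assms] in_D1[OF coords_carrier[OF basis_k assms]] by blast

lemma D_lin: assumes "u : D" "w : D" shows "(%x. a * u x + b * w x) : D"
proof -
 obtain c d where cd: "c : carrier_vec N" "d : carrier_vec N" "u = lin_comb N H c" "w = lin_comb N H d"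
  using assms unfolding D_def by blast
 have "(%x. a * u x + b * w x) = lin_comb N H (a \<cdot>\<^sub>v c + b \<cdot>\<^sub>v d)" unfolding cd(3,4) by (intro ext) (simp add: lin_comb_add cd)
 thus ?thesis using cd by (auto intro!: in_D)
qed

lemma D_sum: "finite I ==> (\<And>i. i : I ==> u i : D) ==> (%x. \<Sum>i\<in>I. c i * u i x) : D"
proof (induction I rule: finite_induct)
 case empty
 have "(%x. 0 :: real) = lin_comb N H (0\<^sub>v N)" by (auto simp: lin_comb_def)
 then show ?case by (simp add: in_D)
next
 case (insert i I)
 then show ?case using D_lin[of "u i" "%x. \<Sum>i\<in>I. c i * u i x" "c i" 1] by simp
qed

lemma H_D: "i < N ==> H i : D" using in_D[of "unit_vec N i"] by (simp add: lin_comb_unit)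
lemma H_D1: "i < n ==> H i : D1" using in_D1[of "unit_vec n i"] by (simp add: lin_comb_unit)

lemma D1_D: "D1 \<subseteq> D"
proof
 fix u assume "u : D1"
 then obtain c where c: "u = lin_comb n H c" unfolding D1_def by blast
 have "u = (%x. \<Sum>i\<in>{..<n}. c $ i * H i x)" unfolding c by (auto simp: lin_comb_def)
 also have "... : D" using n_le_N by (intro D_sum H_D) auto
 finally show "u : D" .
qed

lemma D1_square: assumes "p : D1" shows "\<exists>w\<in>D. \<forall>x\<in>S. w x = (p x)\<^sup>2"
proof -
 have "(%x. p x * p x) : polys (2 * k)" using polys_mult[OF D1_polys[OF assms] D1_polys[OF assms]] by (simp add: mult_2)
 from rep_D[OF this] show ?thesis by (metis power2_eq_square)
qed

lemma D_squares:
 assumes u: "u : D"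
 shows "\<exists>(R :: nat set) c w. finite R \<and> (\<forall>r\<in>R. w r : D \<and> (\<exists>p\<in>D1. \<forall>x\<in>S. w r x = (p x)\<^sup>2)) \<and> u = (%x. \<Sum>r\<in>R. c r * w r x)"
proof (rule polys_sum_of_squares[OF D_polys[OF u]])
 fix R :: "nat set" and c a assume R: "finite R" and a: "\<And>r. r : R ==> a r : polys k" and ueq: "u = (%x. \<Sum>r\<in>R. c r * (a r x)\<^sup>2)"
 have "\<exists>w. w : D \<and> (\<exists>p\<in>D1. \<forall>x\<in>S. w x = (p x)\<^sup>2) \<and> (\<forall>x\<in>S. w x = (a r x)\<^sup>2)" if r: "r : R" for r
 proof -
  obtain p where p: "p : D1" "\<And>x. x : S ==> p x = a r x" by (rule rep_D1[OF a[OF r]], rule that)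
  thus ?thesis using D1_square[OF p(1)] by metis
 qed
 then obtain w where w: "\<And>r. r : R ==> w r : D \<and> (\<exists>p\<in>D1. \<forall>x\<in>S. w r x = (p x)\<^sup>2) \<and> (\<forall>x\<in>S. w r x = (a r x)\<^sup>2)" by metis
 have "u = (%x. \<Sum>r\<in>R. c r * w r x)"
  using w ueq by (intro D_eqI[OF u] D_sum R) auto
 thus ?thesis using R w by blast
qed

definition dominating :: "real^'d => real" where
 "dominating = (SOME f. f : D \<and> (\<forall>x\<in>S. f x = 1 + (\<Sum>i<n. (H i x)\<^sup>2)))"

lemma dominating: "dominating : D" "x : S ==> dominating x = 1 + (\<Sum>i<n. (H i x)\<^sup>2)"
proof -
 have "(%x. H i x * H i x) : polys (2 * k)" if "i < n" for i
  using polys_mult[OF basis_polys[OF basis_k that] basis_polys[OF basis_k that]] by (simp add: mult_2)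
 hence "(%x. 1 + (\<Sum>i<n. (H i x)\<^sup>2)) : polys (2 * k)"
  unfolding power2_eq_square by (intro polys_add const_polys polys_sum) auto
 from rep_D[OF this] have "\<exists>f. f : D \<and> (\<forall>x\<in>S. f x = 1 + (\<Sum>i<n. (H i x)\<^sup>2))" by metis
 from someI_ex[OF this] show "dominating : D" "x : S ==> dominating x = 1 + (\<Sum>i<n. (H i x)\<^sup>2)"
  by (auto simp: dominating_def)
qed

lemma dominating_ge: "x : S ==> 1 <= dominating x"
 by (simp add: dominating sum_nonneg)

lemma D1_square_le: assumes "p : D1" shows "\<exists>C\<ge>0. \<forall>x\<in>S. (p x)\<^sup>2 <= C * dominating x"
proof -
 obtain c where c: "p = lin_comb n H c" using assms unfolding D1_def by blast
 show ?thesis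
 proof (intro exI[of _ "\<Sum>i<n. (c $ i)\<^sup>2"] conjI ballI)
  fix x assume x: "x : S"
  have "(p x)\<^sup>2 <= (\<Sum>i<n. (c $ i)\<^sup>2) * (\<Sum>i<n. (H i x)\<^sup>2)"
   unfolding c lin_comb_def by (rule Cauchy_Schwarz_ineq_sum)
  also have "... <= (\<Sum>i<n. (c $ i)\<^sup>2) * dominating x"
   unfolding dominating(2)[OF x] by (intro mult_left_mono sum_nonneg) auto
  finally show "(p x)\<^sup>2 <= (\<Sum>i<n. (c $ i)\<^sup>2) * dominating x" .
 qed (simp add: sum_nonneg)
qed

lemma D_dominated: assumes "u : D" shows "\<exists>C\<ge>0. \<forall>x\<in>S. \<bar>u x\<bar> <= C * dominating x"
proof -
 obtain R :: "nat set" and c w where R: "finite R" and w: "\<And>r. r : R ==> \<exists>p\<in>D1. \<forall>x\<in>S. w r x = (p x)\<^sup>2" and u: "u = (%x. \<Sum>r\<in>R. c r * w r x)"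
  using D_squares[OF assms] by blast
 have "\<exists>C. 0 <= C \<and> (\<forall>x\<in>S. \<bar>w r x\<bar> <= C * dominating x)" if "r : R" for r
  using w[OF that] D1_square_le by fastforce
 then obtain C where C: "\<And>r. r : R ==> 0 <= C r" "\<And>r x. r : R ==> x : S ==> \<bar>w r x\<bar> <= C r * dominating x" by metis
 show ?thesis
 proof (intro exI[of _ "\<Sum>r\<in>R. \<bar>c r\<bar> * C r"] conjI ballI)
  show "0 <= (\<Sum>r\<in>R. \<bar>c r\<bar> * C r)" using C(1) by (intro sum_nonneg) simp
  fix x assume x: "x : S"
  have "\<bar>u x\<bar> <= (\<Sum>r\<in>R. \<bar>c r * w r x\<bar>)" unfolding u by (rule sum_abs)
  also have "... <= (\<Sum>r\<in>R. \<bar>c r\<bar> * (C r * dominating x))"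
   using C(2)[OF _ x] by (intro sum_mono) (simp add: abs_mult mult_left_mono)
  finally show "\<bar>u x\<bar> <= (\<Sum>r\<in>R. \<bar>c r\<bar> * C r) * dominating x" by (simp add: sum_distrib_right mult.assoc)
 qed
qed

end

section \<open>Polynomial processes in equilibrium\<close>

locale markov_polynomials = cadlag_markov_process M F S X P + nested_polynomial_basis S k N n H
 for M :: "'w measure" and F and S :: "(real^'d) set" and X P and k N n H +
 fixes G A :: "real mat" and \<mu> :: "(real^'d) measure"
 assumes genG: "generator_matrix S F X P N H G" and genA: "generator_matrix S F X P n H A"
  and limit: "limiting (2 * k) S X P \<mu>"
begin

definition \<G> :: "(real^'d => real) => real^'d => real" where
 "\<G> u = lin_comb N H (G *\<^sub>v coords S N H u)"

lemma G_carrier: "G : carrier_mat N N" and A_carrier: "A : carrier_mat n n"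
 using genG genA by (auto simp: generator_matrix_def)

lemma \<G>_lin_comb: "c : carrier_vec N ==> \<G> (lin_comb N H c) = lin_comb N H (G *\<^sub>v c)"
 unfolding \<G>_def using coords_unique[OF basis_2k D_polys[OF in_D]] by simp

sublocale moment_setting M F S X P D D1 \<G> dominating
proof
 show "continuous_on UNIV u" if "u : D" for u using continuous_on_polys[OF D_polys[OF that]] .
 show "(%x. a * u x + b * w x) : D" if "u : D" "w : D" for u w a b using D_lin[OF that] .
 show "\<G> u : D" if "u : D" for u
  unfolding \<G>_def using G_carrier coords_carrier[OF basis_2k D_polys[OF that]] by (intro in_D) auto
 show "ext_generator S F X P u (\<G> u)" if "u : D" for u
 proof -
  obtain c where c: "c : carrier_vec N" "u = lin_comb N H c" using \<open>u : D\<close> unfolding D_def by blast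
  thus ?thesis using genG by (simp add: \<G>_lin_comb generator_matrix_def)
 qed
 show "\<G> (%x. a * u x + b * w x) x = a * \<G> u x + b * \<G> w x" if uw: "u : D" "w : D" for u w a b x
 proof -
  obtain c d where cd: "c : carrier_vec N" "d : carrier_vec N" "u = lin_comb N H c" "w = lin_comb N H d"
   using uw unfolding D_def by blast
  have e: "(%x. a * u x + b * w x) = lin_comb N H (a \<cdot>\<^sub>v c + b \<cdot>\<^sub>v d)" unfolding cd(3,4) by (intro ext) (simp add: lin_comb_add cd)
  have Gcd: "G *\<^sub>v (a \<cdot>\<^sub>v c + b \<cdot>\<^sub>v d) = a \<cdot>\<^sub>v (G *\<^sub>v c) + b \<cdot>\<^sub>v (G *\<^sub>v d)"
   using G_carrier cd by (simp add: mult_add_distrib_mat_vec[of _ N N] mult_mat_vec)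
  show ?thesis unfolding e unfolding cd(3,4) using cd G_carrier
   by (simp add: \<G>_lin_comb Gcd lin_comb_add)
 qed
 show "D1 \<subseteq> D" by (rule D1_D)
 show "\<exists>w\<in>D. \<forall>x\<in>S. w x = (p x)\<^sup>2" if "p : D1" for p by (rule D1_square[OF that])
 show "\<exists>g\<in>D1. ext_generator S F X P p g" if "p : D1" for p
 proof -
  obtain c where c: "c : carrier_vec n" "p = lin_comb n H c" using \<open>p : D1\<close> unfolding D1_def by blast
  hence "ext_generator S F X P p (lin_comb n H (A *\<^sub>v c))" using genA by (simp add: generator_matrix_def)
  moreover have "lin_comb n H (A *\<^sub>v c) : D1" using c A_carrier by (intro in_D1) auto
  ultimately show ?thesis by blast
 qed
 show "dominating : D" by (rule dominating)
 show "1 <= dominating x" if "x : S" for x by (rule dominating_ge[OF that])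
 show "\<exists>C\<ge>0. \<forall>x\<in>S. \<bar>u x\<bar> <= C * dominating x" if "u : D" for u by (rule D_dominated[OF that])
 show "\<exists>(R :: nat set) c w. finite R \<and> (\<forall>r\<in>R. w r : D \<and> (\<exists>p\<in>D1. \<forall>x\<in>S. w r x = (p x)\<^sup>2)) \<and> u = (%x. \<Sum>r\<in>R. c r * w r x)" if "u : D" for u
  by (rule D_squares[OF that])
qed

definition T :: "nat => real => real^'d => real" where
 "T i t x = (LINT z|P x. H i (X t z))"

lemma mult_unit_vec_lin_comb:
 assumes B: "B : carrier_mat j j" and i: "i < j"
 shows "lin_comb j H (B *\<^sub>v unit_vec j i) x = (\<Sum>l<j. B $$ (l, i) * H l x)"
 unfolding lin_comb_def using B i by (intro sum.cong refl) (simp add: scalar_prod_right_unit)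

text \<open>Applied twice: to all of the basis with G, and to its first part with A. The smaller system is
needed because a product of q with a polynomial of degree 2k would not be integrable.\<close>

lemma semigroup_instance:
 assumes B: "B : carrier_mat j j" and j: "j <= N" "0 < j" and bj: "poly_basis S k' j H" and k': "k' <= 2 * k"
  and dyn: "\<And>i x t. i < j ==> x : S ==> 0 <= t ==> T i t x = H i x + (LINT z|P x. path_integral (lin_comb j H (B *\<^sub>v unit_vec j i)) t z)"
 shows "ergodic_polynomial_semigroup S j H (%l i. B $$ (l, i)) T (%i. \<integral>y. H i y \<partial>\<mu>)"
proof -
 have HD: "H i : D" if "i < j" for i using that j by (intro H_D) simp
 have gD: "lin_comb j H (B *\<^sub>v unit_vec j i) : D" if "i < j" for i
 proof -
  have "lin_comb j H (B *\<^sub>v unit_vec j i) = (%x. \<Sum>l\<in>{..<j}. B $$ (l, i) * H l x)"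
   using mult_unit_vec_lin_comb[OF B that] by auto
  also have "... : D" using HD by (intro D_sum) auto
  finally show ?thesis .
 qed
 note dyn' = dyn[unfolded T_def]
 interpret polynomial_semigroup S j H "%l i. B $$ (l, i)" T
 proof
  show "\<forall>i<j. c i = 0" if "\<And>x. x : S ==> (\<Sum>i<j. c i * H i x) = 0" for c
   using basis_independent[OF bj that] .
  show "continuous_on {0..} (%t. T i t x)" if "x : S" "i < j" for x i
   unfolding T_def using continuous_on_expectation[OF gD[OF that(2)] that(1) dyn'[OF that(2,1)]] .
  show "((%s. \<Sum>l<j. B $$ (l, i) * T l s x) has_integral (T i t x - H i x)) {0..t}" if x: "x : S" and i: "i < j" and t: "0 <= t" for x i t
  proof (rule has_integral_eq[rotated])
   show "((%s. \<integral>z. lin_comb j H (B *\<^sub>v unit_vec j i) (X s z) \<partial>P x) has_integral (T i t x - H i x)) {0..t}"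
    unfolding T_def by (rule expectation_has_integral[OF gD[OF i] x dyn'[OF i x] t])
   show "(LINT z|P x. lin_comb j H (B *\<^sub>v unit_vec j i) (X s z)) = (\<Sum>l<j. B $$ (l, i) * T l s x)" if "s : {0..t}" for s
   proof -
    have int: "integrable (P x) (%z. H l (X s z))" if "l < j" for l using HD[OF that] x \<open>s : {0..t}\<close> by (intro integrable_u) auto
    show ?thesis unfolding mult_unit_vec_lin_comb[OF B i] T_def
     using int by (subst lebesgue_sum) auto
   qed
  qed
 qed
 show ?thesis
 proof
  show "0 < j" by (rule j)
  show "H 0 x = 1" if "x : S" for x by (rule H_0[OF that])
  show "T 0 t x = 1" if "x : S" "0 <= t" for x t
  proof -
   interpret prob_space "P x" by (rule P_prob[OF that(1)])
   have "T 0 t x = (LINT z|P x. 1)"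
    unfolding T_def using H_0 X_in_S[OF that(2)] by (intro lebesgue_cong refl) (simp add: space_P[OF that(1)])
   thus ?thesis by (simp add: prob_space)
  qed
  show "((%t. T i t x) \<longlongrightarrow> (LINT y|\<mu>. H i y)) at_top" if "x : S" "i < j" for x i
   using limit D_polys[OF HD[OF that(2)]] that(1) unfolding limiting_def T_def by blast
  show "S \<noteq> {}" by (rule nonempty)
  show "T i (s + t) x = (\<Sum>l<j. E l i t * T l s x)" if x: "x : S" and i: "i < j" and st: "0 <= s" "0 <= t" for x i s t
  proof -
   have int: "integrable (P x) (%z. H l (X s z))" if "l < j" for l using HD[OF that] x st by (intro integrable_u) auto
   have Sp: "space M : sets (F s)" using sets.top[of "F s"] by (simp add: space_F)
   have "T i (s + t) x = (LINT z|P x. ind (space M) z * H i (X (s + t) z))"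
    unfolding T_def by (intro lebesgue_cong refl) (simp add: space_P[OF x])
   also have "... = (LINT z|P x. ind (space M) z * (LINT z'|P (X s z). H i (X t z')))"
    by (rule markov_D(2)[OF x st Sp HD[OF i]])
   also have "... = (LINT z|P x. (\<Sum>l<j. E l i t * H l (X s z)))"
    using T_eq[OF X_in_S[OF st(1)] i st(2)] by (intro lebesgue_cong refl) (simp add: space_P[OF x] T_def)
   also have "... = (\<Sum>l<j. E l i t * T l s x)"
    unfolding T_def using int by (subst lebesgue_sum) auto
   finally show ?thesis .
  qed
 qed
qed

sublocale large: ergodic_polynomial_semigroup S N H "%l i. G $$ (l, i)" T "%i. \<integral>y. H i y \<partial>\<mu>"
proof (rule semigroup_instance[OF G_carrier order_refl N_pos basis_2k order_refl])
 fix i x t assume *: "i < N" "x : S" "(0::real) <= t"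
 show "T i t x = H i x + (LINT z|P x. path_integral (lin_comb N H (G *\<^sub>v unit_vec N i)) t z)"
  using Dynkin_formula[OF H_D[OF *(1)] *(2,3)] \<G>_lin_comb[of "unit_vec N i"] *(1)
  by (simp add: T_def lin_comb_unit)
qed

sublocale small: ergodic_polynomial_semigroup S n H "%l i. A $$ (l, i)" T "%i. \<integral>y. H i y \<partial>\<mu>"
proof (rule semigroup_instance[OF A_carrier n_le_N n_pos basis_k])
 fix i x t assume *: "i < n" "x : S" "(0::real) <= t"
 have "ext_generator S F X P (lin_comb n H (unit_vec n i)) (lin_comb n H (A *\<^sub>v unit_vec n i))"
  using genA by (simp add: generator_matrix_def)
 moreover have "lin_comb n H (A *\<^sub>v unit_vec n i) : D1" using A_carrier by (intro in_D1) auto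
 ultimately show "T i t x = H i x + (LINT z|P x. path_integral (lin_comb n H (A *\<^sub>v unit_vec n i)) t z)"
  using moment_half_degree[OF H_D1[OF *(1)] _ _ *(2,3)] *(1) by (simp add: T_def lin_comb_unit)
qed simp

end

context markov_polynomials
begin

lemma sets_\<mu>: "sets \<mu> = sets SB" and \<mu>_prob: "prob_space \<mu>"
 using limit by (auto simp: limiting_def)
lemma space_\<mu>: "space \<mu> = S"
 using sets_eq_imp_space_eq[OF sets_\<mu>] by (simp add: space_restrict_space)
lemma integrable_\<mu>: "u : polys (2 * k) ==> integrable \<mu> u"
 using limit by (auto simp: limiting_def)
lemma kernel_\<mu>: "P : \<mu> \<rightarrow>\<^sub>M subprob_algebra M"
 using measurable_prob_algebraD[OF kernel] sets_\<mu> by (simp cong: measurable_cong_sets)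

lemma bind_nonneg:
 fixes h :: "'w => real"
 assumes [measurable]: "h : BM M" and h0: "\<And>z. 0 <= h z" and W: "integrable \<mu> W"
  and hW: "\<And>x. x : S ==> integrable (P x) h \<and> (LINT z|P x. h z) <= W x"
 shows "integrable \<mu> (%x. \<integral>z. h z \<partial>P x)" "integrable (\<mu> \<bind> P) h" "(LINT z|(\<mu> \<bind> P). h z) = (LINT x|\<mu>. (LINT z|P x. h z))"
proof -
 have e: "(\<integral>\<^sup>+z. ennreal (h z) \<partial>P x) = ennreal (LINT z|P x. h z)" if "x : S" for x
  using hW[OF that] h0 by (simp add: nn_integral_eq_integral)
 have "(%x. enn2real (\<integral>\<^sup>+z. ennreal (h z) \<partial>P x)) : BM \<mu>"
  by (rule measurable_compose[OF _ borel_measurable_enn2real],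
    rule measurable_compose[OF kernel_\<mu> nn_integral_measurable_subprob_algebra]) measurable
 also have "?this \<longleftrightarrow> (%x. \<integral>z. h z \<partial>P x) : BM \<mu>"
  using h0 by (intro measurable_cong) (simp add: space_\<mu> e lebesgue_nonneg)
 finally have m: "(%x. \<integral>z. h z \<partial>P x) : BM \<mu>" .
 show i: "integrable \<mu> (%x. \<integral>z. h z \<partial>P x)"
  using hW h0 by (intro integrable_by[OF W m] AE_I2)
   (auto simp: space_\<mu> lebesgue_nonneg intro: order_trans[OF _ abs_ge_self])
 have "(\<integral>\<^sup>+z. ennreal (h z) \<partial>(\<mu> \<bind> P)) = (\<integral>\<^sup>+x. (\<integral>\<^sup>+z. ennreal (h z) \<partial>P x) \<partial>\<mu>)"
  by (rule nn_integral_bind[OF _ kernel_\<mu>]) measurable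
 also have "... = (\<integral>\<^sup>+x. ennreal (LINT z|P x. h z) \<partial>\<mu>)"
  using e by (intro nn_integral_cong) (simp add: space_\<mu>)
 also have "... = ennreal (LINT x|\<mu>. (LINT z|P x. h z))"
  using i h0 by (intro nn_integral_eq_integral AE_I2 lebesgue_nonneg) auto
 finally have n: "(\<integral>\<^sup>+z. ennreal (h z) \<partial>(\<mu> \<bind> P)) = ennreal (LINT x|\<mu>. (LINT z|P x. h z))" .
 have "sets (\<mu> \<bind> P) = sets M"
  using nonempty by (intro sets_bind[where N=M] sets_P) (simp_all add: space_\<mu>)
 hence hm: "h : BM (\<mu> \<bind> P)" by (simp cong: measurable_cong_sets)
 show "integrable (\<mu> \<bind> P) h" using n hm h0 by (intro integrableI_nonneg) auto
 show "(LINT z|(\<mu> \<bind> P). h z) = (LINT x|\<mu>. (LINT z|P x. h z))"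
  using n hm h0 by (subst integral_eq_nn_integral) (auto intro!: lebesgue_nonneg)
qed

lemma
 fixes h :: "'w => real"
 assumes m: "h : BM M" and W: "integrable \<mu> W"
  and i: "\<And>x. x : S ==> integrable (P x) h" and le: "\<And>x. x : S ==> (LINT z|P x. \<bar>h z\<bar>) <= W x"
 shows integrable_bind: "integrable (\<mu> \<bind> P) h" and integral_bind: "(LINT z|(\<mu> \<bind> P). h z) = (LINT x|\<mu>. (LINT z|P x. h z))"
proof -
 have *: "integrable (P x) (%z. max 0 (a * h z)) \<and> (LINT z|P x. max 0 (a * h z)) <= W x"
  if x: "x : S" and a: "a = 1 \<or> a = - 1" for x and a :: real
 proof
  have ai: "integrable (P x) (%z. a * h z)" using i[OF x] by simp
  show I: "integrable (P x) (%z. max 0 (a * h z))" by (intro integrable_max ai) simp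
  have "(LINT z|P x. max 0 (a * h z)) <= (LINT z|P x. \<bar>h z\<bar>)"
   using I i[OF x] a by (intro integral_mono) auto
  thus "(LINT z|P x. max 0 (a * h z)) <= W x" using le[OF x] by simp
 qed
 have mm: "(%z. max 0 (a * h z)) : BM M" for a using m by measurable
 note p = bind_nonneg[of "%z. max 0 (1 * h z)", OF mm _ W *]
 note n = bind_nonneg[of "%z. max 0 (- 1 * h z)", OF mm _ W *]
 have h: "h = (%z. max 0 (1 * h z) - max 0 (- 1 * h z))" by (auto simp: fun_eq_iff max_def)
 show "integrable (\<mu> \<bind> P) h" by (subst h) (intro Bochner_Integration.integrable_diff p(2) n(2), auto)
 have "(LINT z|(\<mu> \<bind> P). h z) = (LINT z|(\<mu> \<bind> P). max 0 (1 * h z)) - (LINT z|(\<mu> \<bind> P). max 0 (- 1 * h z))"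
  by (subst h) (intro Bochner_Integration.integral_diff p(2) n(2), auto)
 also have "... = (LINT x|\<mu>. (LINT z|P x. max 0 (1 * h z)) - (LINT z|P x. max 0 (- 1 * h z)))"
  using p n by simp
 also have "... = (LINT x|\<mu>. (LINT z|P x. h z))"
 proof (rule lebesgue_cong[OF refl])
  fix x assume "x : space \<mu>"
  hence x: "x : S" by (simp add: space_\<mu>)
  show "(LINT z|P x. max 0 (1 * h z)) - (LINT z|P x. max 0 (- 1 * h z)) = (LINT z|P x. h z)"
   using *[OF x, of 1] *[OF x, of "- 1"] by (subst (3) h) simp
 qed
 finally show "(LINT z|(\<mu> \<bind> P). h z) = (LINT x|\<mu>. (LINT z|P x. h z))" .
qed

text \<open>The coefficients of the expectation of u(X at t) as a function of the starting point. Being free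
of the starting point, they separate time from space in what follows.\<close>

definition flow :: "(real^'d => real) => nat => real => real" where
 "flow u j t = (\<Sum>i<N. coords S N H u $ i * large.E j i t)"

definition weight :: "real^'d => real" where
 "weight x = (\<Sum>j<N. \<bar>H j x\<bar>)"

lemma H_integrable: "j < N ==> integrable \<mu> (H j)"
 by (rule integrable_\<mu>[OF basis_polys[OF basis_2k]])

lemma integrable_weight: "integrable \<mu> weight"
 unfolding weight_def[abs_def] using H_integrable by auto

lemma D_integral: assumes "u : D" shows "(LINT x|\<mu>. u x) = (\<Sum>i<N. coords S N H u $ i * (LINT y|\<mu>. H i y))"
proof -
 have "(LINT x|\<mu>. u x) = (LINT x|\<mu>. lin_comb N H (coords S N H u) x)" by (simp add: D_coords[OF assms])
 thus ?thesis using H_integrable unfolding lin_comb_def by (subst (asm) lebesgue_sum) auto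
qed

lemma expectation_flow:
 assumes u: "u : D" and x: "x : S" and t: "0 <= t"
 shows "(LINT z|P x. u (X t z)) = (\<Sum>j<N. flow u j t * H j x)"
proof -
 have "(LINT z|P x. u (X t z)) = (LINT z|P x. lin_comb N H (coords S N H u) (X t z))" by (simp add: D_coords[OF u])
 also have "... = (\<Sum>i<N. coords S N H u $ i * T i t x)"
  unfolding lin_comb_def T_def using integrable_u[OF H_D x t] by (subst lebesgue_sum) auto
 also have "... = (\<Sum>i<N. \<Sum>j<N. coords S N H u $ i * (large.E j i t * H j x))"
  using large.T_eq[OF x _ t] by (simp add: sum_distrib_left)
 also have "... = (\<Sum>j<N. flow u j t * H j x)"
  unfolding flow_def sum_distrib_right by (subst sum.swap) (simp add: mult.assoc)
 finally show ?thesis .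
qed

lemma flow_invariant:
 assumes u: "u : D" and t: "0 <= t"
 shows "(\<Sum>j<N. flow u j t * (LINT y|\<mu>. H j y)) = (LINT x|\<mu>. u x)"
proof -
 have "(\<Sum>j<N. flow u j t * (LINT y|\<mu>. H j y)) = (\<Sum>i<N. coords S N H u $ i * (\<Sum>j<N. (LINT y|\<mu>. H j y) * large.E j i t))"
  unfolding flow_def sum_distrib_right sum_distrib_left by (subst sum.swap) (simp add: mult_ac)
 also have "... = (\<Sum>i<N. coords S N H u $ i * (LINT y|\<mu>. H i y))"
  using large.m_invariant[OF _ t] by simp
 finally show ?thesis using D_integral[OF u] by simp
qed

lemma stationary:
 assumes u: "u : D" and t: "0 <= t"
 shows "(LINT x|\<mu>. (LINT z|P x. u (X t z))) = (LINT x|\<mu>. u x)"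
proof -
 have "(LINT x|\<mu>. (LINT z|P x. u (X t z))) = (LINT x|\<mu>. (\<Sum>j<N. flow u j t * H j x))"
  using expectation_flow[OF u _ t] by (intro lebesgue_cong refl) (simp add: space_\<mu>)
 also have "... = (\<Sum>j<N. flow u j t * (LINT y|\<mu>. H j y))"
  using H_integrable by (subst lebesgue_sum) auto
 finally show ?thesis using flow_invariant[OF u t] by simp
qed

lemma flow_bounded: "\<exists>K\<ge>0. \<forall>j<N. \<forall>t\<ge>0. \<bar>flow u j t\<bar> <= K"
proof -
 obtain K where K: "\<And>i j t. i < N ==> j < N ==> 0 <= t ==> \<bar>large.E j i t\<bar> <= K" using large.E_bounded by blast
 have K0: "0 <= K" using K[of 0 0 0] N_pos by simp
 have "\<bar>flow u j t\<bar> <= (\<Sum>i<N. \<bar>coords S N H u $ i\<bar> * K)" if "j < N" "0 <= t" for j t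
  unfolding flow_def by (rule order_trans[OF sum_abs]) (intro sum_mono, simp add: abs_mult mult_left_mono K that)
 moreover have "0 <= (\<Sum>i<N. \<bar>coords S N H u $ i\<bar> * K)" using K0 by (intro sum_nonneg) simp
 ultimately show ?thesis by blast
qed

lemma expectation_bounded:
 assumes u: "u : D" shows "\<exists>K\<ge>0. \<forall>x\<in>S. \<forall>t\<ge>0. \<bar>\<integral>z. u (X t z) \<partial>P x\<bar> <= K * weight x"
proof -
 obtain K where K: "0 <= K" "\<And>j t. j < N ==> 0 <= t ==> \<bar>flow u j t\<bar> <= K" using flow_bounded by metis
 have "\<bar>\<integral>z. u (X t z) \<partial>P x\<bar> <= K * weight x" if "x : S" "0 <= t" for x t
  unfolding expectation_flow[OF u that] weight_def sum_distrib_left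
  by (rule order_trans[OF sum_abs]) (intro sum_mono, simp add: abs_mult mult_right_mono K that)
 thus ?thesis using K(1) by blast
qed

lemma flow_deriv:
 assumes u: "u : D" and j: "j < N" and t: "0 <= t"
 shows "((%t. flow u j t) has_real_derivative flow (\<G> u) j t) (at t within {0..})"
proof -
 have c: "coords S N H u : carrier_vec N" by (rule coords_carrier[OF basis_2k D_polys[OF u]])
 have "coords S N H (\<G> u) = G *\<^sub>v coords S N H u"
  using c G_carrier by (intro coords_unique[OF basis_2k D_polys[OF \<G>_D[OF u]]]) (auto simp: \<G>_def)
 hence "flow (\<G> u) j t = (\<Sum>l<N. \<Sum>i<N. coords S N H u $ i * (G $$ (l, i) * large.E j l t))"
  using c G_carrier by (simp add: flow_def scalar_prod_def lessThan_atLeast0 sum_distrib_right sum_distrib_left mult_ac)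
 also have "... = (\<Sum>i<N. coords S N H u $ i * (\<Sum>l<N. G $$ (l, i) * large.E j l t))"
  by (subst sum.swap) (simp add: sum_distrib_left)
 finally show ?thesis
  unfolding flow_def[of u] using large.E_deriv[OF _ j t] by (auto intro!: derivative_eq_intros sum.cong)
qed

lemma continuous_flow: "u : D ==> j < N ==> continuous_on {0..} (flow u j)"
 using flow_deriv DERIV_continuous by (fastforce simp: continuous_on_eq_continuous_within)

text \<open>The normalised left null vector consists of the means of the basis elements.\<close>

lemma null_vector_integral:
 assumes v: "v : carrier_vec N" "transpose_mat G *\<^sub>v v = 0\<^sub>v N" "v $ 0 = 1" and u: "u : polys (2 * k)"
 shows "v \<bullet> coords S N H u = (LINT x|\<mu>. u x)"
proof -
 have c: "coords S N H u : carrier_vec N" by (rule coords_carrier[OF basis_2k u])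
 have vm: "v $ i = (LINT y|\<mu>. H i y)" if "i < N" for i
 proof (rule large.left_null_eq_limit[of "%i. v $ i"])
  fix i assume i: "i < N"
  have "(transpose_mat G *\<^sub>v v) $ i = (\<Sum>j<N. v $ j * G $$ (j, i))"
   using i v(1) G_carrier by (simp add: scalar_prod_def lessThan_atLeast0 mult.commute)
  thus "(\<Sum>j<N. v $ j * G $$ (j, i)) = 0" using v(2) i by simp
 qed (use v(3) that in auto)
 have "(LINT x|\<mu>. u x) = (LINT x|\<mu>. lin_comb N H (coords S N H u) x)"
  using lin_comb_coords[OF basis_2k u] by (intro lebesgue_cong refl) (simp add: space_\<mu>)
 also have "... = (\<Sum>i<N. coords S N H u $ i * (LINT y|\<mu>. H i y))"
  using H_integrable unfolding lin_comb_def by (subst lebesgue_sum) auto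
 finally show ?thesis using c vm by (simp add: scalar_prod_def lessThan_atLeast0 mult.commute)
qed

lemma cross_bound:
 assumes p: "p : D1" and q: "q : D1"
 shows "\<exists>K\<ge>0. \<forall>x\<in>S. \<forall>a\<ge>0. \<forall>b\<ge>a. integrable (P x) (%z. p (X b z) * q (X a z)) \<and> (LINT z|P x. \<bar>p (X b z) * q (X a z)\<bar>) <= K * weight x"
proof -
 obtain u v where u: "u : D" "\<And>y. y : S ==> u y = (p y)\<^sup>2" and v: "v : D" "\<And>y. y : S ==> v y = (q y)\<^sup>2"
  using D1_square[OF p] D1_square[OF q] by blast
 obtain K1 where K1: "0 <= K1" "\<And>x t. x : S ==> 0 <= t ==> \<bar>\<integral>z. u (X t z) \<partial>P x\<bar> <= K1 * weight x"
  using expectation_bounded[OF u(1)] by blast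
 obtain K2 where K2: "0 <= K2" "\<And>x t. x : S ==> 0 <= t ==> \<bar>\<integral>z. v (X t z) \<partial>P x\<bar> <= K2 * weight x"
  using expectation_bounded[OF v(1)] by blast
 have "integrable (P x) (%z. p (X b z) * q (X a z)) \<and> (LINT z|P x. \<bar>p (X b z) * q (X a z)\<bar>) <= (K1 + K2) * weight x"
  if x: "x : S" and ab: "0 <= a" "a <= b" for x a b
 proof -
  have b: "0 <= b" using ab by simp
  note two = two_time_products[OF p q x ab(1) b u v]
  show ?thesis using two K1(2)[OF x b] K2(2)[OF x ab(1)] by (auto simp: distrib_right)
 qed
 thus ?thesis using K1(1) K2(1) by (intro exI[of _ "K1 + K2"]) auto
qed

end

context markov_polynomials
begin

lemma cross_moment_mean:
 assumes c: "c : carrier_vec n" and q: "q : D1" and s: "0 <= s" and t: "0 <= t"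
 defines "p \<equiv> lin_comb n H c"
 shows "integrable (\<mu> \<bind> P) (%z. p (X (t + s) z) * q (X t z))"
  and "(LINT z|(\<mu> \<bind> P). p (X (t + s) z) * q (X t z)) = (\<Sum>i<n. c $ i * (\<Sum>j<n. small.E j i s * (LINT y|\<mu>. H j y * q y)))"
proof -
 have p: "p : D1" unfolding p_def by (rule in_D1[OF c])
 have qk: "q : polys k" by (rule D1_polys[OF q])
 define h where "h x = (\<Sum>i<n. c $ i * (\<Sum>j<n. small.E j i s * H j x))" for x
 have "h = lin_comb n H (vec n (%j. \<Sum>i<n. c $ i * small.E j i s))"
  unfolding h_def lin_comb_def sum_distrib_left by (rule ext, subst sum.swap) (simp add: sum_distrib_right mult.assoc)
 hence h1: "h : D1" by (simp add: in_D1)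
 have hp: "(LINT z|P y. p (X s z)) = h y" if y: "y : S" for y
 proof -
  have i: "integrable (P y) (%z. H i (X s z))" if "i < n" for i
   using integrable_u[OF H_D _ s] y that n_le_N by simp
  have "(LINT z|P y. p (X s z)) = (\<Sum>i<n. c $ i * T i s y)"
   unfolding p_def lin_comb_def T_def using i by (subst lebesgue_sum) auto
  thus ?thesis using small.T_eq[OF y _ s] by (simp add: h_def)
 qed
 have "(%x. h x * q x) : polys (2 * k)" using polys_mult[OF D1_polys[OF h1] qk] by (simp add: mult_2)
 then obtain w where w: "w : D" "\<And>x. x : S ==> w x = h x * q x" by (rule rep_D) (rule that)
 obtain K where K: "\<And>x a b. x : S ==> 0 <= a ==> a <= b ==> integrable (P x) (%z. p (X b z) * q (X a z)) \<and> (LINT z|P x. \<bar>p (X b z) * q (X a z)\<bar>) <= K * weight x"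
  using cross_bound[OF p q] by blast
 have m: "(%z. p (X (t + s) z) * q (X t z)) : BM M"
  using p q D1_D s t by (intro borel_measurable_times measurable_uX) auto
 have W: "integrable \<mu> (%x. K * weight x)" using integrable_weight by simp
 note b = m W K[OF _ t, of _ "t + s", THEN conjunct1] K[OF _ t, of _ "t + s", THEN conjunct2]
 show "integrable (\<mu> \<bind> P) (%z. p (X (t + s) z) * q (X t z))" using s by (intro integrable_bind[OF b]) auto
 have "(LINT z|(\<mu> \<bind> P). p (X (t + s) z) * q (X t z)) = (LINT x|\<mu>. (LINT z|P x. p (X (t + s) z) * q (X t z)))"
  using s by (intro integral_bind[OF b]) auto
 also have "... = (LINT x|\<mu>. (LINT z|P x. w (X t z)))"
 proof (rule lebesgue_cong[OF refl])
  fix x assume "x : space \<mu>"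
  hence x: "x : S" by (simp add: space_\<mu>)
  have "(LINT z|P x. p (X (t + s) z) * q (X t z)) = (LINT z|P x. h (X t z) * q (X t z))"
   using h1 D1_D by (intro two_time_moment[OF p q _ x t s hp]) auto
  also have "... = (LINT z|P x. w (X t z))"
   using w(2) X_in_S[OF t] by (intro lebesgue_cong refl) (simp add: space_P[OF x])
  finally show "(LINT z|P x. p (X (t + s) z) * q (X t z)) = (LINT z|P x. w (X t z))" .
 qed
 also have "... = (LINT x|\<mu>. w x)" by (rule stationary[OF w(1) t])
 also have "... = (LINT x|\<mu>. (\<Sum>i<n. c $ i * (\<Sum>j<n. small.E j i s * (H j x * q x))))"
  using w(2) by (intro lebesgue_cong refl) (simp add: space_\<mu> h_def sum_distrib_right mult.assoc)
 also have "... = (\<Sum>i<n. c $ i * (\<Sum>j<n. small.E j i s * (LINT y|\<mu>. H j y * q y)))"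
 proof -
  have "integrable \<mu> (%x. H j x * q x)" if "j < n" for j
   using polys_mult[OF basis_polys[OF basis_k that] qk] by (intro integrable_\<mu>) (simp add: mult_2)
  hence hq: "integrable \<mu> (%x. small.E j i s * (H j x * q x))" if "j : {..<n}" for i j using that by simp
  have 1: "(LINT x|\<mu>. (\<Sum>j<n. small.E j i s * (H j x * q x))) = (\<Sum>j<n. small.E j i s * (LINT y|\<mu>. H j y * q y))" for i
   by (subst lebesgue_sum) (rule hq, assumption, simp)
  have "(LINT x|\<mu>. (\<Sum>i<n. c $ i * (\<Sum>j<n. small.E j i s * (H j x * q x)))) = (\<Sum>i<n. \<integral>x. c $ i * (\<Sum>j<n. small.E j i s * (H j x * q x)) \<partial>\<mu>)"
   by (rule lebesgue_sum) (intro integrable_mult_right Bochner_Integration.integrable_sum hq)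
  thus ?thesis by (simp only: integral_mult_right_zero 1)
 qed
 finally show "(LINT z|(\<mu> \<bind> P). p (X (t + s) z) * q (X t z)) = (\<Sum>i<n. c $ i * (\<Sum>j<n. small.E j i s * (LINT y|\<mu>. H j y * q y)))" .
qed

lemma short_range_dependence:
 assumes p: "p : D1" and q: "q : D1"
 shows "\<exists>C \<kappa>. 0 < \<kappa> \<and> (\<forall>s\<ge>0. \<forall>t\<ge>0. integrable (\<mu> \<bind> P) (%z. p (X (t + s) z) * q (X t z)) \<and>
  \<bar>(LINT z|(\<mu> \<bind> P). p (X (t + s) z) * q (X t z)) - (LINT x|\<mu>. p x) * (LINT x|\<mu>. q x)\<bar> <= C * exp (- \<kappa> * s))"
proof -
 obtain c where c: "c : carrier_vec n" "p = lin_comb n H c" using p unfolding D1_def by blast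
 obtain C \<kappa> where k: "0 < \<kappa>" and C: "\<And>i j t. i < n ==> j < n ==> 0 <= t ==> \<bar>small.E j i t - (if j = 0 then (LINT y|\<mu>. H i y) else 0)\<bar> <= C * exp (- \<kappa> * t)"
  using small.E_exponential by blast
 let ?m = "%j. \<integral>y. H j y * q y \<partial>\<mu>"
 have m0: "?m 0 = (LINT x|\<mu>. q x)" using H_0 by (intro lebesgue_cong refl) (simp add: space_\<mu>)
 have pm: "(LINT x|\<mu>. p x) = (\<Sum>i<n. c $ i * (LINT y|\<mu>. H i y))"
  unfolding c(2) lin_comb_def using H_integrable n_le_N by (subst lebesgue_sum) auto
 have "\<bar>(LINT z|(\<mu> \<bind> P). p (X (t + s) z) * q (X t z)) - (LINT x|\<mu>. p x) * (LINT x|\<mu>. q x)\<bar>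
   <= (\<Sum>i<n. \<bar>c $ i\<bar> * (\<Sum>j<n. C * \<bar>?m j\<bar>)) * exp (- \<kappa> * s)" if st: "0 <= s" "0 <= t" for s t
 proof -
  let ?d = "%i j. if j = 0 then (LINT y|\<mu>. H i y) else 0"
  have "(LINT x|\<mu>. p x) * (LINT x|\<mu>. q x) = (\<Sum>i<n. c $ i * (\<Sum>j<n. ?d i j * ?m j))"
  proof -
   have "(\<Sum>j<n. ?d i j * ?m j) = (\<Sum>j<n. if j = 0 then (LINT y|\<mu>. H i y) * ?m 0 else 0)" for i
    by (intro sum.cong) auto
   thus ?thesis using n_pos by (simp add: pm m0 sum_distrib_right mult.assoc)
  qed
  hence eq: "(LINT z|(\<mu> \<bind> P). p (X (t + s) z) * q (X t z)) - (LINT x|\<mu>. p x) * (LINT x|\<mu>. q x)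
   = (\<Sum>i<n. c $ i * (\<Sum>j<n. (small.E j i s - ?d i j) * ?m j))"
   using cross_moment_mean(2)[OF c(1) q st] c(2) by (simp only: left_diff_distrib right_diff_distrib sum_subtractf)
  have "\<bar>\<Sum>i<n. c $ i * (\<Sum>j<n. (small.E j i s - ?d i j) * ?m j)\<bar> <= (\<Sum>i<n. \<bar>c $ i\<bar> * (\<Sum>j<n. C * exp (- \<kappa> * s) * \<bar>?m j\<bar>))"
  proof (rule order_trans[OF sum_abs sum_mono])
   fix i assume i: "i : {..<n}"
   have "\<bar>\<Sum>j<n. (small.E j i s - ?d i j) * ?m j\<bar> <= (\<Sum>j<n. C * exp (- \<kappa> * s) * \<bar>?m j\<bar>)"
   proof (rule order_trans[OF sum_abs sum_mono])
    fix j assume "j : {..<n}"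
    thus "\<bar>(small.E j i s - ?d i j) * ?m j\<bar> <= C * exp (- \<kappa> * s) * \<bar>?m j\<bar>"
     unfolding abs_mult using i by (intro mult_right_mono C st) auto
   qed
   thus "\<bar>c $ i * (\<Sum>j<n. (small.E j i s - ?d i j) * ?m j)\<bar> <= \<bar>c $ i\<bar> * (\<Sum>j<n. C * exp (- \<kappa> * s) * \<bar>?m j\<bar>)"
    unfolding abs_mult by (rule mult_left_mono) simp
  qed
  also have "... = (\<Sum>i<n. \<bar>c $ i\<bar> * (\<Sum>j<n. C * \<bar>?m j\<bar>)) * exp (- \<kappa> * s)"
  proof -
   have e: "(\<Sum>j<n. C * exp (- \<kappa> * s) * \<bar>?m j\<bar>) = (\<Sum>j<n. C * \<bar>?m j\<bar>) * exp (- \<kappa> * s)"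
    unfolding sum_distrib_right by (intro sum.cong refl) (simp only: mult_ac)
   show ?thesis
    unfolding e by (simp only: sum_distrib_right[where f="%i. \<bar>c $ i\<bar> * (\<Sum>j<n. C * \<bar>?m j\<bar>)"] mult.assoc)
  qed
  finally show ?thesis unfolding eq .
 qed
 with k cross_moment_mean(1)[OF c(1) q] show ?thesis unfolding c(2) by (intro exI[of _ \<kappa>] exI conjI allI impI)
qed

text \<open>The expectation solves y' = - theta y.\<close>

lemma eigenfunction:
 assumes c: "c : carrier_vec n" "A *\<^sub>v c = (- \<theta>) \<cdot>\<^sub>v c" and x: "x : S" and t: "0 <= t"
 shows "(LINT z|P x. lin_comb n H c (X t z)) = exp (- \<theta> * t) * lin_comb n H c x"
proof -
 let ?w = "lin_comb n H c" and ?y = "%t. \<integral>z. lin_comb n H c (X t z) \<partial>P x"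
 have w1: "?w : D1" by (rule in_D1[OF c(1)])
 have e: "lin_comb n H ((- \<theta>) \<cdot>\<^sub>v c) = (%x. - \<theta> * ?w x)"
  using c(1) by (auto simp: lin_comb_def sum_distrib_left mult.assoc)
 have g1: "(%x. - \<theta> * ?w x) : D1" unfolding e[symmetric] using c(1) by (intro in_D1) auto
 hence g: "(%x. - \<theta> * ?w x) : D" using D1_D by auto
 have gen: "ext_generator S F X P ?w (%x. - \<theta> * ?w x)"
  using genA c unfolding generator_matrix_def e[symmetric] by metis
 note dyn = moment_half_degree[OF w1 g1 gen x]
 have cont: "continuous_on {0..} ?y" by (rule continuous_on_expectation[OF g x dyn])
 have "((%t. exp (\<theta> * t) * ?y t) has_real_derivative 0) (at t within {0..})" if t: "0 <= t" for t
 proof -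
  have "continuous_on {0..t + 1} (%s. - \<theta> * ?y s)" using continuous_on_subset[OF cont] by (intro continuous_intros) auto
  hence "((%t. integral {0..t} (%s. - \<theta> * ?y s)) has_real_derivative - \<theta> * ?y t) (at t within {0..t + 1})"
   using t by (intro integral_has_real_derivative) auto
  hence "((%t. ?w x + integral {0..t} (%s. - \<theta> * ?y s)) has_real_derivative - \<theta> * ?y t) (at t within {0..t + 1})"
   by (rule DERIV_cong[OF DERIV_add[OF DERIV_const]]) simp
  hence "(?y has_real_derivative - \<theta> * ?y t) (at t within {0..t + 1})"
   by (rule has_field_derivative_transform_within[where d=1])
    (use t integral_unique[OF expectation_has_integral[OF g x dyn]] in \<open>auto simp: dist_real_def\<close>)
  also have "at t within {0..t + 1} = at t within {0..}"
   by (rule at_within_nhd[where S="{..<t + 1}"]) (use t in auto)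
  finally show ?thesis by (auto intro!: derivative_eq_intros)
 qed
 then obtain d where d: "\<And>t. 0 <= t ==> exp (\<theta> * t) * ?y t = d"
  using has_field_derivative_zero_constant[of "{0..}" "%t. exp (\<theta> * t) * ?y t"] by auto
 have y0: "?y 0 = ?w x"
  using integral_unique[OF expectation_has_integral[OF g x dyn, of 0]] by simp
 have "exp (- \<theta> * t) * (exp (\<theta> * t) * ?y t) = exp (- \<theta> * t) * ?w x" using d[OF t] d[of 0] y0 by simp
 thus ?thesis by (simp add: mult.assoc[symmetric] exp_add[symmetric])
qed

lemma eigenfunction_mean:
 assumes c: "c : carrier_vec n" "A *\<^sub>v c = (- \<theta>) \<cdot>\<^sub>v c"
 shows "0 < \<theta> ==> (LINT x|\<mu>. lin_comb n H c x) = 0" and "\<theta> = 0 ==> x : S ==> lin_comb n H c x = (LINT x|\<mu>. lin_comb n H c x)"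
proof -
 let ?w = "lin_comb n H c"
 have lim: "((%t. exp (- \<theta> * t) * ?w x) \<longlongrightarrow> (LINT x|\<mu>. ?w x)) at_top" if x: "x : S" for x
 proof (rule Lim_transform_eventually)
  show "((%t. \<integral>z. ?w (X t z) \<partial>P x) \<longlongrightarrow> (LINT x|\<mu>. ?w x)) at_top"
   using limit D_polys D1_D in_D1[OF c(1)] x unfolding limiting_def by blast
  show "eventually (%t. (LINT z|P x. ?w (X t z)) = exp (- \<theta> * t) * ?w x) at_top"
   using eventually_ge_at_top[of 0] by eventually_elim (rule eigenfunction[OF c x])
 qed
 show "(LINT x|\<mu>. ?w x) = 0" if th: "0 < \<theta>"
 proof -
  obtain x where x: "x : S" using nonempty by blast
  have "filterlim (%t. - \<theta> * t) at_bot at_top"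
   using th by (intro filterlim_tendsto_neg_mult_at_bot[OF tendsto_const _ filterlim_ident]) simp
  hence "((%t. exp (- \<theta> * t) * ?w x) \<longlongrightarrow> 0) at_top"
   by (intro tendsto_mult_left_zero filterlim_compose[OF exp_at_bot])
  thus ?thesis using tendsto_unique[OF _ lim[OF x]] by simp
 qed
 show "?w x = (LINT x|\<mu>. ?w x)" if "\<theta> = 0" "x : S"
  using lim[OF that(2)] that(1) by (simp add: tendsto_const_iff)
qed

end

section \<open>Time change by the inverse subordinator\<close>

text \<open>A measurable space on which a path can be treated as a random element; joint measurability in
time and path is with respect to it.\<close>

definition process_algebra :: "'w set => (real => 'w => 'a::topological_space) => 'w measure" where
 "process_algebra \<Omega> Y = vimage_algebra \<Omega> (%z. \<lambda>t\<in>{0..}. Y t z) (PiM {0..} (%_. borel))"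

lemma space_process_algebra [simp]: "space (process_algebra \<Omega> Y) = \<Omega>"
 by (simp add: process_algebra_def)

lemma process_component:
 assumes t: "0 <= t" shows "Y t : BM (process_algebra \<Omega> Y)"
proof -
 have "(%z. \<lambda>t\<in>{0..}. Y t z) : process_algebra \<Omega> Y \<rightarrow>\<^sub>M PiM {0..} (%_. borel)"
  unfolding process_algebra_def by (rule measurable_vimage_algebra1) (auto simp: space_PiM)
 from measurable_compose[OF this measurable_component_singleton[of t]] show ?thesis using t by simp
qed

lemma process_algebra_id:
 assumes "\<And>t. 0 <= t ==> Y t : BM R"
 shows "(%z. z) : R \<rightarrow>\<^sub>M process_algebra (space R) Y"
 unfolding process_algebra_def using assms by (intro measurable_vimage_algebra2) auto

locale time_changed_polynomials = markov_polynomials M F S X P k N n H G A \<mu>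
 for M :: "'w measure" and F and S :: "(real^'d) set" and X P k N n H G A \<mu> +
 fixes \<alpha> :: real and \<sigma> :: "real => 'w => real"
 assumes \<alpha>: "0 < \<alpha>" and subordinator: "\<And>x. x : S ==> stable_subordinator (P x) \<alpha> \<sigma>"
  and processes_independent: "\<And>x. x : S ==> indep_processes (P x) X \<sigma>"
begin

lemma subordinator_space: "x : S ==> stable_subordinator_space (P x) \<alpha> \<sigma>"
 using P_prob subordinator \<alpha> by (simp add: stable_subordinator_space_def stable_subordinator_space_axioms_def)

abbreviation "L \<equiv> first_passage \<sigma>"

text \<open>Fubini's theorem for the product of the law of the path of X and the joint law of the two clock
values.\<close>

lemma time_change_integral:
 fixes \<phi> :: "'w \<times> real \<times> real => real"
 assumes x: "x : S" and t: "0 <= t" "0 <= t'" and \<phi>: "\<phi> : BM (process_algebra (space M) X \<Otimes>\<^sub>M (borel \<Otimes>\<^sub>M borel))"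
  and B: "AE z' in P x. (\<integral>\<^sup>+z. ennreal \<bar>\<phi> (z, L t z', L t' z')\<bar> \<partial>P x) <= ennreal B"
 shows "integrable (P x) (%z. \<phi> (z, L t z, L t' z))"
  and "(LINT z|P x. \<phi> (z, L t z, L t' z)) = (LINT z'|P x. (LINT z|P x. \<phi> (z, L t z', L t' z')))"
  and "0 <= B ==> (LINT z|P x. \<bar>\<phi> (z, L t z, L t' z)\<bar>) <= B"
  and "(%z'. \<integral>z. \<phi> (z, L t z', L t' z') \<partial>P x) : BM (P x)"
proof -
 interpret sub: stable_subordinator_space "P x" \<alpha> \<sigma> by (rule subordinator_space[OF x])
 let ?VX = "process_algebra (space M) X" and ?V\<sigma> = "process_algebra (space M) \<sigma>"
 let ?B2 = "borel \<Otimes>\<^sub>M borel :: (real \<times> real) measure"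
 let ?Z = "%z. (L t z, L t' z)"
 note sp = space_P[OF x]
 have idX: "(%z. z) : P x \<rightarrow>\<^sub>M ?VX"
  using process_algebra_id[of X "P x"] measurable_X by (simp add: sp sets_P[OF x] cong: measurable_cong_sets)
 have L\<sigma>: "L r : BM ?V\<sigma>" if "0 <= r" for r
  using that sub.path process_component by (intro borel_measurable_first_passage) (auto simp: sp)
 have Z\<sigma>: "?Z : ?V\<sigma> \<rightarrow>\<^sub>M ?B2" using L\<sigma> t by measurable
 have Zm: "?Z : P x \<rightarrow>\<^sub>M ?B2" using sub.measurable_L t by measurable
 have pm: "(%z. (z, ?Z z)) : P x \<rightarrow>\<^sub>M ?VX \<Otimes>\<^sub>M ?B2" by (intro measurable_Pair idX Zm)
 interpret Q1: prob_space "distr (P x) ?VX (%z. z)" by (rule sub.prob_space_distr[OF idX])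
 interpret Q2: prob_space "distr (P x) ?B2 ?Z" by (rule sub.prob_space_distr[OF Zm])
 have J: "distr (P x) ?VX (%z. z) \<Otimes>\<^sub>M distr (P x) ?B2 ?Z = distr (P x) (?VX \<Otimes>\<^sub>M ?B2) (%z. (z, ?Z z))"
 proof (rule pair_measure_eqI)
  fix C :: "'w set" and B' assume "C : sets (distr (P x) ?VX (%z. z))" "B' : sets (distr (P x) ?B2 ?Z)"
  hence C: "C : sets ?VX" and B': "B' : sets ?B2" by simp_all
  have CM: "C \<subseteq> space M" using sets.sets_into_space[OF C] by simp
  have "sub.indep_set (sets ?VX) (sets ?V\<sigma>)"
   using processes_independent[OF x] by (simp add: indep_processes_def process_events_def process_algebra_def sp)
  moreover have "?Z -` B' \<inter> space M : sets ?V\<sigma>" using measurable_sets[OF Z\<sigma> B'] by simp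
  ultimately have "sub.prob (C \<inter> (?Z -` B' \<inter> space M)) = sub.prob C * sub.prob (?Z -` B' \<inter> space M)"
   by (rule sub.indep_setD[OF _ C])
  moreover have "(%z. (z, ?Z z)) -` (C \<times> B') \<inter> space M = C \<inter> (?Z -` B' \<inter> space M)" using CM by auto
  moreover have "(%z. z) -` C \<inter> space M = C" using CM by auto
  ultimately show "emeasure (distr (P x) ?VX (%z. z)) C * emeasure (distr (P x) ?B2 ?Z) B' = emeasure (distr (P x) (?VX \<Otimes>\<^sub>M ?B2) (%z. (z, ?Z z))) (C \<times> B')"
   using C B' by (simp add: emeasure_distr[OF idX] emeasure_distr[OF Zm] emeasure_distr[OF pm] sp sub.emeasure_eq_measure ennreal_mult[symmetric])
 qed (simp_all add: Q1.sigma_finite_measure_axioms Q2.sigma_finite_measure_axioms cong: sets_pair_measure_cong)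
 interpret Q: pair_sigma_finite "distr (P x) ?VX (%z. z)" "distr (P x) ?B2 ?Z" by unfold_locales
 have swap: "(%y. (snd y, fst y)) : ?B2 \<Otimes>\<^sub>M P x \<rightarrow>\<^sub>M ?VX \<Otimes>\<^sub>M ?B2"
  by (intro measurable_Pair measurable_compose[OF measurable_snd idX] measurable_fst)
 have sec: "(%z. \<phi> (z, y)) : BM ?VX" for y
  using measurable_Pair1[OF \<phi>, of y] by (simp add: space_pair_measure)
 have nn: "(\<integral>\<^sup>+z. ennreal \<bar>\<phi> (z, ?Z z)\<bar> \<partial>P x) <= ennreal B"
 proof -
  have m: "(%y. ennreal \<bar>\<phi> y\<bar>) : BM (?VX \<Otimes>\<^sub>M ?B2)" using \<phi> by measurable
  have "(\<integral>\<^sup>+z. ennreal \<bar>\<phi> (z, ?Z z)\<bar> \<partial>P x) = (\<integral>\<^sup>+y. ennreal \<bar>\<phi> y\<bar> \<partial>distr (P x) (?VX \<Otimes>\<^sub>M ?B2) (%z. (z, ?Z z)))"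
   by (rule nn_integral_distr[OF pm, symmetric]) (simp add: m)
  also have "... = (\<integral>\<^sup>+y. (\<integral>\<^sup>+z. ennreal \<bar>\<phi> (z, y)\<bar> \<partial>distr (P x) ?VX (%z. z)) \<partial>distr (P x) ?B2 ?Z)"
   unfolding J[symmetric] using m by (intro Q.nn_integral_snd[symmetric]) (simp add: case_prod_beta' cong: measurable_cong_sets)
  also have "... = (\<integral>\<^sup>+y. (\<integral>\<^sup>+z. ennreal \<bar>\<phi> (z, y)\<bar> \<partial>P x) \<partial>distr (P x) ?B2 ?Z)"
   using sec by (intro nn_integral_cong nn_integral_distr[OF idX]) measurable
  also have "... = (\<integral>\<^sup>+z'. (\<integral>\<^sup>+z. ennreal \<bar>\<phi> (z, ?Z z')\<bar> \<partial>P x) \<partial>P x)"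
  proof (rule nn_integral_distr[OF Zm], subst measurable_distr_eq1)
   have "(%(y, z). ennreal \<bar>\<phi> (z, y)\<bar>) : BM (?B2 \<Otimes>\<^sub>M P x)"
    using measurable_compose[OF swap m] by (simp add: case_prod_beta')
   thus "(%y. \<integral>\<^sup>+z. ennreal \<bar>\<phi> (z, y)\<bar> \<partial>P x) : BM ?B2"
    by (intro sub.borel_measurable_nn_integral) simp
  qed
  also have "... <= (\<integral>\<^sup>+z'. ennreal B \<partial>P x)" by (rule nn_integral_mono_AE[OF B])
  finally show ?thesis by (simp add: sub.emeasure_space_1)
 qed
 have \<phi>m: "(%z. \<phi> (z, ?Z z)) : BM (P x)" using measurable_compose[OF pm \<phi>] .
 show i: "integrable (P x) (%z. \<phi> (z, ?Z z))"
  using \<phi>m nn by (intro integrableI_bounded) (auto intro: le_less_trans)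
 show "(LINT z|P x. \<bar>\<phi> (z, ?Z z)\<bar>) <= B" if "0 <= B"
  using nn i that by (simp add: nn_integral_eq_integral)
 have "(%(y, z). \<phi> (z, y)) : BM (?B2 \<Otimes>\<^sub>M P x)"
  using measurable_compose[OF swap \<phi>] by (simp add: case_prod_beta')
 hence im: "(%y. \<integral>z. \<phi> (z, y) \<partial>P x) : BM ?B2"
  by (intro sub.borel_measurable_lebesgue_integral) simp
 from measurable_compose[OF Zm this] show "(%z'. \<integral>z. \<phi> (z, ?Z z') \<partial>P x) : BM (P x)" .
 have "(LINT z|P x. \<phi> (z, ?Z z)) = (\<integral>y. \<phi> y \<partial>distr (P x) (?VX \<Otimes>\<^sub>M ?B2) (%z. (z, ?Z z)))"
  using integral_distr[OF pm \<phi>] by simp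
 also have "... = (LINT y|distr (P x) ?B2 ?Z. (\<integral>z. \<phi> (z, y) \<partial>distr (P x) ?VX (%z. z)))"
 proof -
  have "integrable (distr (P x) ?VX (%z. z) \<Otimes>\<^sub>M distr (P x) ?B2 ?Z) (%(z, y). \<phi> (z, y))"
   unfolding J using i integrable_distr_eq[OF pm \<phi>] by simp
  from Q.integral_snd[OF this] show ?thesis unfolding J by simp
 qed
 also have "... = (LINT y|distr (P x) ?B2 ?Z. (LINT z|P x. \<phi> (z, y)))"
  using integral_distr[OF idX sec] by simp
 also have "... = (LINT z'|P x. (LINT z|P x. \<phi> (z, ?Z z')))"
  by (rule integral_distr[OF Zm im])
 finally show "(LINT z|P x. \<phi> (z, ?Z z)) = (LINT z'|P x. (LINT z|P x. \<phi> (z, ?Z z')))" .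
qed

lemma
 assumes p: "p : D1" and q: "q : D1" and s: "0 <= s" and t: "0 <= t"
 shows time_change_bound: "\<exists>K. \<forall>x\<in>S. integrable (P x) (%z. p (X (L (t + s) z) z) * q (X (L t z) z)) \<and>
   (LINT z|P x. \<bar>p (X (L (t + s) z) z) * q (X (L t z) z)\<bar>) <= K * weight x"
  and time_change_Fubini: "x : S ==> (LINT z|P x. p (X (L (t + s) z) z) * q (X (L t z) z))
   = (LINT z'|P x. (LINT z|P x. p (X (L (t + s) z') z) * q (X (L t z') z)))"
  and time_change_measurable: "x : S ==> (%z'. \<integral>z. p (X (L (t + s) z') z) * q (X (L t z') z) \<partial>P x) : BM (P x)"
proof -
 obtain K where K0: "0 <= K" and K: "\<And>x a b. x : S ==> 0 <= a ==> a <= b ==> integrable (P x) (%z. p (X b z) * q (X a z)) \<and> (LINT z|P x. \<bar>p (X b z) * q (X a z)\<bar>) <= K * weight x"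
  using cross_bound[OF p q] by blast
 have ts: "0 <= t + s" "t <= t + s" using s t by simp_all
 define \<phi> where "\<phi> = (%(z, a, b). p (X (max 0 b) z) * q (X (max 0 a) z))"
 have "(%(r, z). u (X (max 0 r) z)) : BM (borel \<Otimes>\<^sub>M process_algebra (space M) X)" if u: "u : D" for u
 proof (rule measurable_right_continuous[where Y="%s z. u (X s z)"])
  show "(%z. u (X r z)) : BM (process_algebra (space M) X)" if "0 <= r" for r
   using process_component[OF that] by (rule measurable_compose[OF _ borel_measurable_continuous_onI[OF D_cont[OF u]]])
  show "continuous (at_right r) (%s. u (X s z))" if "0 <= r" "z : space (process_algebra (space M) X)" for r z
  proof -
   have "((%s. X s z) \<longlongrightarrow> X r z) (at_right r)" using right_continuous[of r z] that by (simp add: continuous_within)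
   thus ?thesis
    unfolding continuous_within using D_cont[OF u] by (intro isCont_tendsto_compose[of _ u]) (auto simp: continuous_on_eq_continuous_at)
  qed
 qed
 note um = this
 have *: "(%y. (f y, fst y)) : process_algebra (space M) X \<Otimes>\<^sub>M (borel \<Otimes>\<^sub>M borel) \<rightarrow>\<^sub>M borel \<Otimes>\<^sub>M process_algebra (space M) X"
  if "f : BM (process_algebra (space M) X \<Otimes>\<^sub>M (borel \<Otimes>\<^sub>M borel))" for f :: "'w \<times> real \<times> real => real"
  using that by (intro measurable_Pair measurable_fst)
 have \<phi>: "\<phi> : BM (process_algebra (space M) X \<Otimes>\<^sub>M (borel \<Otimes>\<^sub>M borel))"
  using measurable_compose[OF *[of "%y. snd (snd y)"] um[of p]] measurable_compose[OF *[of "%y. fst (snd y)"] um[of q]] p q D1_D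
  unfolding \<phi>_def case_prod_beta' by (intro borel_measurable_times) auto
 have main: "integrable (P x) (%z. p (X (L (t + s) z) z) * q (X (L t z) z)) \<and> (LINT z|P x. \<bar>p (X (L (t + s) z) z) * q (X (L t z) z)\<bar>) <= K * weight x \<and>
  (LINT z|P x. p (X (L (t + s) z) z) * q (X (L t z) z)) = (LINT z'|P x. (LINT z|P x. p (X (L (t + s) z') z) * q (X (L t z') z))) \<and>
  (%z'. \<integral>z. p (X (L (t + s) z') z) * q (X (L t z') z) \<partial>P x) : BM (P x)"
  if x: "x : S" for x
 proof -
  interpret sub: stable_subordinator_space "P x" \<alpha> \<sigma> by (rule subordinator_space[OF x])
  have L0: "0 <= L r z" if "0 <= r" "z : space (P x)" for r z using sub.L_nonneg that .
  have B: "AE z' in P x. (\<integral>\<^sup>+z. ennreal \<bar>\<phi> (z, L t z', L (t + s) z')\<bar> \<partial>P x) <= ennreal (K * weight x)"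
   using sub.AE_occupied[OF ts(1)] AE_space
  proof eventually_elim
   case (elim z')
   have "\<phi> (z, L t z', L (t + s) z') = p (X (L (t + s) z') z) * q (X (L t z') z)" for z
    using L0[OF t elim(2)] L0[OF ts(1) elim(2)] by (simp add: \<phi>_def)
   moreover note K[OF x L0[OF t elim(2)] sub.L_mono[OF t ts(2) elim(2,1)]]
   ultimately show ?case by (simp add: nn_integral_eq_integral ennreal_leI)
  qed
  have W: "0 <= K * weight x" using K0 by (simp add: weight_def sum_nonneg)
  note tc = time_change_integral[OF x t ts(1) \<phi> B]
  have e: "\<phi> (z, L t z', L (t + s) z') = p (X (L (t + s) z') z) * q (X (L t z') z)" if "z' : space (P x)" for z z'
   using L0[OF t that] L0[OF ts(1) that] by (simp add: \<phi>_def)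
  show ?thesis
   using tc(1,2,4) tc(3)[OF W] by (simp add: e cong: Bochner_Integration.integrable_cong lebesgue_cong measurable_cong)
 qed
 thus "\<exists>K. \<forall>x\<in>S. integrable (P x) (%z. p (X (L (t + s) z) z) * q (X (L t z) z)) \<and>
   (LINT z|P x. \<bar>p (X (L (t + s) z) z) * q (X (L t z) z)\<bar>) <= K * weight x" by blast
 show "x : S ==> (LINT z|P x. p (X (L (t + s) z) z) * q (X (L t z) z))
   = (LINT z'|P x. (LINT z|P x. p (X (L (t + s) z') z) * q (X (L t z') z)))" using main by blast
 show "x : S ==> (%z'. \<integral>z. p (X (L (t + s) z') z) * q (X (L t z') z) \<partial>P x) : BM (P x)" using main by blast
qed

lemma measurable_time_change:
 assumes u: "u : D" and x: "x : S" and t: "0 <= t"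
 shows "(%z. u (X (L t z) z)) : BM M"
proof -
 interpret sub: stable_subordinator_space "P x" \<alpha> \<sigma> by (rule subordinator_space[OF x])
 have "L t : BM M" using sub.measurable_L[OF t] sets_P[OF x] by (simp cong: measurable_cong_sets)
 hence "(%z. u (X (max 0 (L t z)) z)) : BM M" by (intro measurable_X_stopped D_cont[OF u]) auto
 also have "?this \<longleftrightarrow> (%z. u (X (L t z) z)) : BM M"
  using sub.L_nonneg[OF t] by (intro measurable_cong) (simp add: space_P[OF x])
 finally show ?thesis .
qed

text \<open>The right-hand side of expectation_time_changed involves the starting point only through the
laws of sigma.\<close>

lemma flow_expectation:
 assumes W: "W : D" and \<theta>: "0 <= \<theta>" and s: "0 <= s" and t: "0 <= t" and j: "j < N"
 shows "x : S ==> integrable (P x) (%z. exp (- \<theta> * (L (t + s) z - L t z)) * flow W j (L t z))"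
  and "x : S ==> y : S ==> (LINT z|P x. exp (- \<theta> * (L (t + s) z - L t z)) * flow W j (L t z))
   = (LINT z|P y. exp (- \<theta> * (L (t + s) z - L t z)) * flow W j (L t z))"
proof -
 have ts: "0 <= t + s" "t <= t + s" using s t by simp_all
 have GW: "\<G> W : D" by (rule \<G>_D[OF W])
 obtain K1 K2 where K1: "\<And>u. 0 <= u ==> \<bar>flow W j u\<bar> <= K1" and K2: "\<And>u. 0 <= u ==> \<bar>flow (\<G> W) j u\<bar> <= K2"
  using flow_bounded[of W] flow_bounded[of "\<G> W"] j by metis
 { fix x assume x: "x : S"
  interpret sub: stable_subordinator_space "P x" \<alpha> \<sigma> by (rule subordinator_space[OF x])
  note sub.expectation_time_changed(2)[OF t ts(2) \<theta> flow_deriv[OF W j] continuous_flow[OF GW j], of "max K1 K2"] }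
 note E = this
 show "integrable (P x) (%z. exp (- \<theta> * (L (t + s) z - L t z)) * flow W j (L t z))" if x: "x : S"
 proof -
  interpret sub: stable_subordinator_space "P x" \<alpha> \<sigma> by (rule subordinator_space[OF x])
  have "(%u. flow W j (max 0 u)) : BM borel"
   by (intro borel_measurable_continuous_onI continuous_on_compose2[OF continuous_flow[OF W j]] continuous_intros) auto
  hence "(%z. flow W j (max 0 (L t z))) : BM (P x)"
   using sub.measurable_L[OF t] by (rule measurable_compose[rotated])
  also have "?this \<longleftrightarrow> (%z. flow W j (L t z)) : BM (P x)"
   using sub.L_nonneg[OF t] by (intro measurable_cong) simp
  finally have m: "(%z. exp (- \<theta> * (L (t + s) z - L t z)) * flow W j (L t z)) : BM (P x)"
   using sub.measurable_L[OF t] sub.measurable_L[OF ts(1)] by measurable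
  show ?thesis
  proof (rule sub.integrable_const_bound[OF _ m])
   show "AE z in P x. norm (exp (- \<theta> * (L (t + s) z - L t z)) * flow W j (L t z)) <= K1"
    using sub.AE_occupied[OF ts(1)] AE_space
   proof eventually_elim
    case (elim z)
    have "exp (- \<theta> * (L (t + s) z - L t z)) <= 1" using sub.L_mono[OF t ts(2) elim(2,1)] \<theta> by simp
    moreover have "\<bar>flow W j (L t z)\<bar> <= K1" by (rule K1[OF sub.L_nonneg[OF t elim(2)]])
    ultimately have "exp (- \<theta> * (L (t + s) z - L t z)) * \<bar>flow W j (L t z)\<bar> <= 1 * K1" by (intro mult_mono) auto
    then show ?case by (simp add: abs_mult)
   qed
  qed
 qed
 show "(LINT z|P x. exp (- \<theta> * (L (t + s) z - L t z)) * flow W j (L t z))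
   = (LINT z|P y. exp (- \<theta> * (L (t + s) z - L t z)) * flow W j (L t z))" if xy: "x : S" "y : S"
 proof -
  note loc = subordinator_space[OF xy(1)] subordinator_space[OF xy(2)]
  have "stable_subordinator_space.residual (P x) \<alpha> \<sigma> \<theta> t (t + s) u = stable_subordinator_space.residual (P y) \<alpha> \<sigma> \<theta> t (t + s) u" for u
   unfolding stable_subordinator_space.residual_def[OF loc(1)] stable_subordinator_space.residual_def[OF loc(2)]
   using distr_\<sigma>_unique[OF loc, of "max 0 u"] by simp
  thus ?thesis
   using E[OF xy(1)] E[OF xy(2)] K1 K2 by (simp add: max.coboundedI1 max.coboundedI2)
 qed
qed

text \<open>For a fixed starting point the expectation is a combination of the basis functions, with
coefficients that do not depend on that point. Integration over the equilibrium law can hence be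
carried out inside the expectation over the clock, where flow_invariant removes the dependence
on L(t).\<close>

lemma time_changed_eigenfunction:
 assumes c: "c : carrier_vec n" "A *\<^sub>v c = (- \<theta>) \<cdot>\<^sub>v c" and \<theta>: "0 <= \<theta>" and q: "q : D1" and s: "0 <= s" and t: "0 <= t"
 defines "w \<equiv> lin_comb n H c"
 shows "integrable (\<mu> \<bind> P) (%z. w (X (L (t + s) z) z) * q (X (L t z) z))"
  and "(LINT z|(\<mu> \<bind> P). w (X (L (t + s) z) z) * q (X (L t z) z)) = (LINT x|\<mu>. w x * q x) * F_hat \<alpha> s t \<theta>"
proof -
 have w: "w : D1" unfolding w_def by (rule in_D1[OF c(1)])
 have D: "w : D" "q : D" using w q D1_D by auto
 have ts: "0 <= t + s" "t <= t + s" using s t by simp_all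
 obtain x0 where x0: "x0 : S" using nonempty by blast
 have "(%x. w x * q x) : polys (2 * k)" using polys_mult[OF D1_polys[OF w] D1_polys[OF q]] by (simp add: mult_2)
 then obtain W where W: "W : D" "\<And>x. x : S ==> W x = w x * q x" using rep_D by metis
 obtain K where K: "\<And>x. x : S ==> integrable (P x) (%z. w (X (L (t + s) z) z) * q (X (L t z) z))"
   "\<And>x. x : S ==> (LINT z|P x. \<bar>w (X (L (t + s) z) z) * q (X (L t z) z)\<bar>) <= K * weight x"
  using time_change_bound[OF w q s t] by blast
 have m: "(%z. w (X (L (t + s) z) z) * q (X (L t z) z)) : BM M"
  using measurable_time_change[OF D(1) x0 ts(1)] measurable_time_change[OF D(2) x0 t] by measurable
 have Wi: "integrable \<mu> (%x. K * weight x)" using integrable_weight by simp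
 show "integrable (\<mu> \<bind> P) (%z. w (X (L (t + s) z) z) * q (X (L t z) z))" by (rule integrable_bind[OF m Wi K])
 let ?e = "%z. exp (- \<theta> * (L (t + s) z - L t z))"
 define I where "I j = (LINT z|P x0. ?e z * flow W j (L t z))" for j
 have x: "(LINT z|P x. w (X (L (t + s) z) z) * q (X (L t z) z)) = (\<Sum>j<N. I j * H j x)" if x: "x : S" for x
 proof -
  interpret sub: stable_subordinator_space "P x" \<alpha> \<sigma> by (rule subordinator_space[OF x])
  note [measurable_cong] = sets_P[OF x]
  have fi: "integrable (P x) (%z. ?e z * flow W j (L t z) * H j x)" if "j < N" for j
   using flow_expectation(1)[OF W(1) \<theta> s t that x] by simp
  have "(LINT z'|P x. (LINT z|P x. w (X (L (t + s) z') z) * q (X (L t z') z))) = (LINT z|P x. (\<Sum>j<N. ?e z * flow W j (L t z) * H j x))"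
  proof (rule integral_cong_AE[OF time_change_measurable[OF w q s t x]])
   have "integrable (P x) (%z. \<Sum>j<N. ?e z * flow W j (L t z) * H j x)" using fi by (intro Bochner_Integration.integrable_sum) simp
   thus "(%z. \<Sum>j<N. ?e z * flow W j (L t z) * H j x) : BM (P x)" by (rule borel_measurable_integrable)
   show "AE z' in P x. (LINT z|P x. w (X (L (t + s) z') z) * q (X (L t z') z)) = (\<Sum>j<N. ?e z' * flow W j (L t z') * H j x)"
    using sub.AE_occupied[OF ts(1)] AE_space
   proof eventually_elim
    case (elim z')
    define a r where "a = L t z'" and "r = L (t + s) z' - L t z'"
    have ar: "0 <= a" "0 <= r" using sub.L_nonneg[OF t elim(2)] sub.L_mono[OF t ts(2) elim(2,1)] by (auto simp: a_def r_def)
    have h: "(%y. exp (- \<theta> * r) * w y) : D" using D_lin[OF D(1,1), of "exp (- \<theta> * r)" 0] by simp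
    have "(LINT z|P x. w (X (L (t + s) z') z) * q (X (L t z') z)) = (LINT z|P x. w (X (a + r) z) * q (X a z))" by (simp add: a_def r_def)
    also have "... = (LINT z|P x. (exp (- \<theta> * r) * w (X a z)) * q (X a z))"
     by (rule two_time_moment[OF w q h x ar]) (unfold w_def, rule eigenfunction[OF c _ ar(2)])
    also have "... = (LINT z|P x. exp (- \<theta> * r) * W (X a z))"
     using W(2) X_in_S[OF ar(1)] by (intro lebesgue_cong refl) (simp add: space_P[OF x])
    also have "... = exp (- \<theta> * r) * (\<Sum>j<N. flow W j a * H j x)"
     using expectation_flow[OF W(1) x ar(1)] by simp
    finally show ?case by (simp add: sum_distrib_left mult.assoc a_def r_def)
   qed
  qed
  also have "... = (\<Sum>j<N. (LINT z|P x. ?e z * flow W j (L t z) * H j x))"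
   by (rule lebesgue_sum) (simp only: fi lessThan_iff)
  also have "... = (\<Sum>j<N. I j * H j x)"
   unfolding I_def integral_mult_left_zero using flow_expectation(2)[OF W(1) \<theta> s t _ x x0] by simp
  finally show ?thesis unfolding time_change_Fubini[OF w q s t x] .
 qed
 have "(LINT z|(\<mu> \<bind> P). w (X (L (t + s) z) z) * q (X (L t z) z)) = (LINT x|\<mu>. (LINT z|P x. w (X (L (t + s) z) z) * q (X (L t z) z)))"
  by (rule integral_bind[OF m Wi K])
 also have "... = (LINT x|\<mu>. (\<Sum>j<N. I j * H j x))"
  using x by (intro lebesgue_cong[OF refl]) (simp add: space_\<mu>)
 also have "... = (\<Sum>j<N. I j * (LINT y|\<mu>. H j y))"
  using H_integrable by (subst lebesgue_sum) auto
 also have "... = (\<Sum>j<N. \<integral>z. ?e z * flow W j (L t z) * (LINT y|\<mu>. H j y) \<partial>P x0)"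
  unfolding I_def integral_mult_left_zero ..
 also have "... = (LINT z|P x0. (\<Sum>j<N. ?e z * flow W j (L t z) * (LINT y|\<mu>. H j y)))"
  using flow_expectation(1)[OF W(1) \<theta> s t _ x0] by (intro lebesgue_sum[symmetric]) simp
 also have "... = (LINT z|P x0. ?e z * (LINT x|\<mu>. W x))"
 proof (rule lebesgue_cong[OF refl])
  interpret sub: stable_subordinator_space "P x0" \<alpha> \<sigma> by (rule subordinator_space[OF x0])
  fix z assume "z : space (P x0)"
  from flow_invariant[OF W(1) sub.L_nonneg[OF t this]]
  show "(\<Sum>j<N. ?e z * flow W j (L t z) * (LINT y|\<mu>. H j y)) = ?e z * (LINT x|\<mu>. W x)"
   by (simp add: sum_distrib_left[symmetric] mult.assoc)
 qed
 also have "... = F_hat \<alpha> s t \<theta> * (LINT x|\<mu>. W x)"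
  using stable_subordinator_space.Laplace_increment_L[OF subordinator_space[OF x0] s t \<theta>] by simp
 also have "(LINT x|\<mu>. W x) = (LINT x|\<mu>. w x * q x)"
  using W(2) by (intro lebesgue_cong[OF refl]) (simp add: space_\<mu>)
 finally show "(LINT z|(\<mu> \<bind> P). w (X (L (t + s) z) z) * q (X (L t z) z)) = (LINT x|\<mu>. w x * q x) * F_hat \<alpha> s t \<theta>"
  by (simp add: mult.commute)
qed

lemma Laplace_increment_\<mu>:
 assumes s: "0 <= s" and t: "0 <= t" and \<theta>: "0 <= \<theta>"
 shows "(LINT z|(\<mu> \<bind> P). exp (- \<theta> * (L (t + s) z - L t z))) = F_hat \<alpha> s t \<theta>"
proof -
 interpret \<mu>: prob_space \<mu> by (rule \<mu>_prob)
 let ?e = "%z. exp (- \<theta> * (L (t + s) z - L t z))"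
 have ts: "0 <= t + s" "t <= t + s" using s t by simp_all
 obtain x0 where x0: "x0 : S" using nonempty by blast
 have em: "?e : BM M"
 proof -
  interpret sub: stable_subordinator_space "P x0" \<alpha> \<sigma> by (rule subordinator_space[OF x0])
  have "?e : BM (P x0)" using sub.measurable_L t ts(1) by measurable
  thus ?thesis using sets_P[OF x0] by (simp cong: measurable_cong_sets)
 qed
 have *: "integrable (P x) ?e \<and> (LINT z|P x. \<bar>?e z\<bar>) <= F_hat \<alpha> s t \<theta>" if x: "x : S" for x
 proof -
  interpret sub: stable_subordinator_space "P x" \<alpha> \<sigma> by (rule subordinator_space[OF x])
  have "integrable (P x) ?e"
  proof (rule sub.integrable_const_bound[where B=1])
   show "AE z in P x. norm (?e z) <= 1"
    using sub.AE_occupied[OF ts(1)] AE_space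
    by eventually_elim (use sub.L_mono[OF t ts(2)] \<theta> in simp)
  qed (use em sets_P[OF x] in \<open>simp cong: measurable_cong_sets\<close>)
  thus ?thesis using sub.Laplace_increment_L[OF s t \<theta>] by simp
 qed
 have "(LINT z|(\<mu> \<bind> P). ?e z) = (LINT x|\<mu>. (LINT z|P x. ?e z))"
  using * by (intro integral_bind[OF em, of "%_. F_hat \<alpha> s t \<theta>"]) auto
 also have "... = (LINT x|\<mu>. F_hat \<alpha> s t \<theta>)"
  using stable_subordinator_space.Laplace_increment_L[OF subordinator_space s t \<theta>]
  by (intro lebesgue_cong[OF refl]) (simp add: space_\<mu>)
 finally show ?thesis by (simp add: \<mu>.prob_space)
qed

end

section \<open>Spectral expansion and asymptotics\<close>

text \<open>If b or R is nonzero, then the remainder is also small compared to b + R h.\<close>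

lemma asymp_equiv_scaleI:
 assumes rem: "(%s. f s - (b + R * h s)) : o[at_top](h)" and h: "(h \<longlongrightarrow> 0) at_top" "eventually (%s. h s \<noteq> 0) at_top"
 shows "asymp_equiv_scale h f (%s. b + R * h s)" and "(f \<longlongrightarrow> b) at_top"
proof -
 have f: "((%s. (f s - (b + R * h s)) / h s) \<longlongrightarrow> 0) at_top" using rem by (rule smalloD_tendsto)
 have "((%s. (f s - (b + R * h s)) / h s * h s + (b + R * h s)) \<longlongrightarrow> 0 * 0 + (b + R * 0)) at_top"
  by (intro tendsto_intros f h)
 thus "(f \<longlongrightarrow> b) at_top"
  by (auto elim!: Lim_transform_eventually intro: eventually_mono[OF h(2)])
 have "f \<sim>[at_top] (%s. b + R * h s)" if fr: "\<exists>\<^sub>F s in at_top. b + R * h s \<noteq> 0"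
 proof -
  have "h : O[at_top](%s. b + R * h s)"
  proof (cases "b = 0")
   case True
   hence "R \<noteq> 0" using fr by (auto simp: frequently_def)
   thus ?thesis using True by simp
  next
   case False
   have g: "((%s. b + R * h s) \<longlongrightarrow> b + R * 0) at_top" by (intro tendsto_intros h)
   hence "eventually (%s. b + R * h s \<noteq> 0) at_top" using False tendsto_imp_eventually_ne[of _ b] by simp
   moreover have "((%s. h s / (b + R * h s)) \<longlongrightarrow> 0 / (b + R * 0)) at_top" using False by (intro tendsto_divide g h) simp
   ultimately have "h : o[at_top](%s. b + R * h s)" by (intro smalloI_tendsto) simp_all
   thus ?thesis by (rule landau_o.small_imp_big)
  qed
  thus ?thesis unfolding asymp_equiv_altdef using rem landau_o.small_big_trans by blast
 qed
 thus "asymp_equiv_scale h f (%s. b + R * h s)" using rem by (simp add: asymp_equiv_scale_def)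
qed

lemma R_asymp_eq: "R_asymp \<alpha> s t \<theta> = 1 / Gamma (1 - \<alpha>) * (1 / \<theta> + t powr \<alpha> / Gamma (1 + \<alpha>)) * (t + s) powr (- \<alpha>)"
 by (simp add: R_asymp_def powr_minus divide_inverse mult_ac)

context time_changed_polynomials
begin

lemma space_bind_\<mu>: "space (\<mu> \<bind> P) = space M"
 using nonempty sets_eq_imp_space_eq[OF sets_bind[where N=M and M=\<mu> and f=P]] by (simp add: sets_P space_\<mu>)

lemma L_nonneg: "0 <= t ==> z : space M ==> 0 <= L t z"
 using nonempty stable_subordinator_space.L_nonneg[OF subordinator_space, of _ t z] space_P by blast

lemma F_hat_0: assumes "0 <= s" "0 <= t" shows "F_hat \<alpha> s t 0 = 1"
proof -
 obtain x where x: "x : S" using nonempty by blast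
 interpret sub: stable_subordinator_space "P x" \<alpha> \<sigma> by (rule subordinator_space[OF x])
 show ?thesis using sub.Laplace_increment_L[OF assms, of 0] by (simp add: sub.prob_space)
qed

lemma F_hat_remainder:
 assumes "\<alpha> < 1" "0 < \<theta>" "0 <= t"
 shows "(%s. F_hat \<alpha> s t \<theta> - R_asymp \<alpha> s t \<theta>) : o[at_top](%s. (t + s) powr (- \<alpha>))"
proof (rule smalloI_tendsto)
 obtain x where x: "x : S" using nonempty by blast
 interpret sub: stable_subordinator_space "P x" \<alpha> \<sigma> by (rule subordinator_space[OF x])
 let ?r = "1 / Gamma (1 - \<alpha>) * (1 / \<theta> + t powr \<alpha> / Gamma (1 + \<alpha>))"
 show nz: "eventually (%s. (t + s) powr (- \<alpha>) \<noteq> 0) at_top"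
  using eventually_gt_at_top[of 0] by eventually_elim (use assms in simp)
 have "((%s. F_hat \<alpha> s t \<theta> * (t + s) powr \<alpha>) \<longlongrightarrow> ?r) at_top"
  using assms \<alpha> by (intro F_hat_asymp sub.Mittag_Leffler_nonneg sub.Mittag_Leffler_antimono) auto
 hence "((%s. F_hat \<alpha> s t \<theta> * (t + s) powr \<alpha> - ?r) \<longlongrightarrow> ?r - ?r) at_top" by (intro tendsto_diff tendsto_const)
 hence "((%s. F_hat \<alpha> s t \<theta> * (t + s) powr \<alpha> - ?r) \<longlongrightarrow> 0) at_top" by simp
 thus "((%s. (F_hat \<alpha> s t \<theta> - R_asymp \<alpha> s t \<theta>) / (t + s) powr (- \<alpha>)) \<longlongrightarrow> 0) at_top"
 proof (rule Lim_transform_eventually)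
  show "eventually (%s. F_hat \<alpha> s t \<theta> * (t + s) powr \<alpha> - ?r = (F_hat \<alpha> s t \<theta> - R_asymp \<alpha> s t \<theta>) / (t + s) powr (- \<alpha>)) at_top"
   using nz
  proof eventually_elim
   case (elim s)
   have "F_hat \<alpha> s t \<theta> * (t + s) powr \<alpha> = F_hat \<alpha> s t \<theta> / (t + s) powr (- \<alpha>)" by (simp add: powr_minus divide_inverse)
   then show ?case unfolding R_asymp_eq diff_divide_distrib using elim by simp
  qed
 qed
qed

text \<open>The coefficient b i is the mean of w i q times the i-th coordinate of p with respect to the
eigenfunctions w i. The eigenfunction with eigenvalue 0 is constant on S, and the others have
mean 0.\<close>

lemma spectral_expansion:
 assumes sim: "similar_mat_wit A (mat_diag n (%i. if i = 0 then 0 else - lam i)) Q Qinv"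
  and pos: "\<And>i. 0 < i ==> i < n ==> 0 < lam i"
  and p: "p : polys k" and q: "q : polys k"
 obtains b where "\<And>s t. 0 <= s ==> 0 <= t ==> integrable (\<mu> \<bind> P) (%z. p (X (L (t + s) z) z) * q (X (L t z) z))"
  and "\<And>s t. 0 <= s ==> 0 <= t ==> (LINT z|(\<mu> \<bind> P). p (X (L (t + s) z) z) * q (X (L t z) z)) = b 0 + (\<Sum>i\<in>{0<..<n}. b i * F_hat \<alpha> s t (lam i))"
  and "\<And>v f. v : carrier_vec N ==> transpose_mat G *\<^sub>v v = 0\<^sub>v N ==> v $ 0 = 1 ==>
   v \<bullet> ((mult_matrix S N n H q * Q * diag_one n f * Qinv) *\<^sub>v coords S n H p) = b 0 + (\<Sum>i\<in>{0<..<n}. b i * f i)"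
  and "b 0 = (LINT x|\<mu>. p x) * (LINT x|\<mu>. q x)"
proof -
 let ?D = "mat_diag n (%i. if i = 0 then 0 else - lam i)"
 define \<theta> where "\<theta> i = (if i = 0 then 0 else lam i)" for i
 have Q: "Q : carrier_mat n n" "Qinv : carrier_mat n n" "Q * Qinv = 1\<^sub>m n" "Qinv * Q = 1\<^sub>m n" "A = Q * ?D * Qinv"
  using similar_mat_witD2[OF A_carrier sim] by blast+
 define pv d where "pv = coords S n H p" and "d = Qinv *\<^sub>v pv"
 have pv: "pv : carrier_vec n" unfolding pv_def by (rule coords_carrier[OF basis_k p])
 have d: "d : carrier_vec n" unfolding d_def using Q pv by simp
 have Qd: "Q *\<^sub>v d = pv" unfolding d_def using Q pv by (simp add: assoc_mult_mat_vec[symmetric])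
 define w where "w i = lin_comb n H (col Q i)" for i
 have cQ: "col Q i : carrier_vec n" if "i < n" for i using Q that by (auto simp: col_def)
 have eig: "A *\<^sub>v col Q i = (- \<theta> i) \<cdot>\<^sub>v col Q i" if i: "i < n" for i
 proof -
  have "A * Q = Q * ?D"
  proof -
   have "A * Q = Q * ?D * (Qinv * Q)" unfolding Q(5) using Q(1,2) by (intro assoc_mult_mat[of _ n n _ n _ n]) auto
   thus ?thesis using Q(1,4) by (simp add: right_mult_one_mat[of _ n n])
  qed
  moreover have "A *\<^sub>v col Q i = col (A * Q) i" using col_mult2[OF A_carrier Q(1) i] by simp
  ultimately have "A *\<^sub>v col Q i = col (Q * ?D) i" by simp
  also have "... = (- \<theta> i) \<cdot>\<^sub>v col Q i"
   using Q(1) i by (intro eq_vecI) (auto simp: mat_diag_mult_right \<theta>_def)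
  finally show ?thesis .
 qed
 have sum0: "(\<Sum>i<n. a i) = a 0 + (\<Sum>i\<in>{0<..<n}. a i)" for a :: "nat => real"
 proof -
  have "{..<n} = insert 0 {0<..<n}" using n_pos by auto
  thus ?thesis by simp
 qed
 have w1: "w i : D1" if "i < n" for i unfolding w_def by (rule in_D1[OF cQ[OF that]])
 obtain q' where q': "q' : D1" "\<And>x. x : S ==> q' x = q x" by (rule rep_D1[OF q], rule that)
 have w_eq: "w i x = (\<Sum>j<n. Q $$ (j, i) * H j x)" if "i < n" for i x
  unfolding w_def lin_comb_def using Q(1) that by (intro sum.cong) auto
 have p_eq: "p x = (\<Sum>i<n. d $ i * w i x)" if x: "x : S" for x
 proof -
  have "pv $ j = (\<Sum>i<n. Q $$ (j, i) * d $ i)" if "j < n" for j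
   unfolding Qd[symmetric] using Q(1) d that by (simp add: scalar_prod_def lessThan_atLeast0)
  hence "lin_comb n H pv x = (\<Sum>j<n. \<Sum>i<n. Q $$ (j, i) * d $ i * H j x)"
   unfolding lin_comb_def by (intro sum.cong refl) (simp add: sum_distrib_right)
  also have "... = (\<Sum>i<n. d $ i * w i x)"
   by (subst sum.swap) (simp add: w_eq sum_distrib_left mult_ac)
  finally show ?thesis using lin_comb_coords[OF basis_k p x] by (simp add: pv_def)
 qed
 define b where "b i = (LINT x|\<mu>. w i x * q' x) * d $ i" for i
 have ev: "p (X (L (t + s) z) z) * q (X (L t z) z) = (\<Sum>i<n. d $ i * (w i (X (L (t + s) z) z) * q' (X (L t z) z)))"
  if "0 <= s" "0 <= t" "z : space M" for s t z
  using p_eq[OF X_in_S[OF L_nonneg]] q'(2)[OF X_in_S[OF L_nonneg]] that by (simp add: sum_distrib_right mult.assoc)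
 have th: "0 <= \<theta> i" if "i < n" for i using pos[of i] that by (simp add: \<theta>_def less_imp_le)
 note te = time_changed_eigenfunction[OF cQ eig th q'(1), folded w_def]
 have 1: "integrable (\<mu> \<bind> P) (%z. p (X (L (t + s) z) z) * q (X (L t z) z))" if st: "0 <= s" "0 <= t" for s t
 proof -
  have "integrable (\<mu> \<bind> P) (%z. \<Sum>i<n. d $ i * (w i (X (L (t + s) z) z) * q' (X (L t z) z)))"
   by (intro Bochner_Integration.integrable_sum integrable_mult_right te(1) st) auto
  thus ?thesis by (rule Bochner_Integration.integrable_cong[THEN iffD2, rotated -1]) (simp_all add: ev st space_bind_\<mu>)
 qed
 have 2: "(LINT z|(\<mu> \<bind> P). p (X (L (t + s) z) z) * q (X (L t z) z)) = b 0 + (\<Sum>i\<in>{0<..<n}. b i * F_hat \<alpha> s t (lam i))"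
  if st: "0 <= s" "0 <= t" for s t
 proof -
  have "(LINT z|(\<mu> \<bind> P). p (X (L (t + s) z) z) * q (X (L t z) z)) = (LINT z|(\<mu> \<bind> P). (\<Sum>i<n. d $ i * (w i (X (L (t + s) z) z) * q' (X (L t z) z))))"
   by (rule lebesgue_cong[OF refl]) (simp add: ev st space_bind_\<mu>)
  also have "... = (\<Sum>i<n. \<integral>z. d $ i * (w i (X (L (t + s) z) z) * q' (X (L t z) z)) \<partial>(\<mu> \<bind> P))"
   by (rule lebesgue_sum) (intro integrable_mult_right te(1) st, auto)
  also have "... = (\<Sum>i<n. b i * F_hat \<alpha> s t (\<theta> i))"
   using te(2)[OF _ _ _ st] by (simp add: b_def mult_ac)
  also have "... = b 0 + (\<Sum>i\<in>{0<..<n}. b i * F_hat \<alpha> s t (lam i))"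
   unfolding sum0 using F_hat_0[OF st] by (simp add: \<theta>_def)
  finally show ?thesis .
 qed
 have qk: "(%x. H j x * q x) : polys (2 * k)" if "j < n" for j
  using polys_mult[OF basis_polys[OF basis_k that] q] by (simp add: mult_2)
 have b_eq: "b i = (\<Sum>j<n. Q $$ (j, i) * (LINT x|\<mu>. H j x * q x)) * d $ i" if i: "i < n" for i
 proof -
  have "(LINT x|\<mu>. w i x * q' x) = (LINT x|\<mu>. (\<Sum>j<n. Q $$ (j, i) * (H j x * q x)))"
   using q'(2) by (intro lebesgue_cong[OF refl]) (simp add: space_\<mu> w_eq[OF i] sum_distrib_right mult.assoc)
  also have "... = (\<Sum>j<n. \<integral>x. Q $$ (j, i) * (H j x * q x) \<partial>\<mu>)"
   by (rule lebesgue_sum) (intro integrable_mult_right integrable_\<mu> qk, simp)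
  finally show ?thesis by (simp add: b_def)
 qed
 have 3: "v \<bullet> ((mult_matrix S N n H q * Q * diag_one n f * Qinv) *\<^sub>v pv) = b 0 + (\<Sum>i\<in>{0<..<n}. b i * f i)"
  if v: "v : carrier_vec N" "transpose_mat G *\<^sub>v v = 0\<^sub>v N" "v $ 0 = 1" for v f
 proof -
  let ?Mq = "mult_matrix S N n H q" and ?g = "%i. if i = 0 then 1 else f i"
  have Mq: "?Mq : carrier_mat N n" by (simp add: mult_matrix_def)
  have Dg: "diag_one n f : carrier_mat n n" by (simp add: diag_one_def)
  define z where "z = Q *\<^sub>v (diag_one n f *\<^sub>v d)"
  have z: "z : carrier_vec n" unfolding z_def using Q Dg d by simp
  have "(?Mq * Q * diag_one n f * Qinv) *\<^sub>v pv = ?Mq *\<^sub>v z"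
   unfolding z_def d_def using Mq Q(1,2) Dg pv by (simp add: assoc_mult_mat_vec[of _ N n _ n] assoc_mult_mat_vec[of _ n n _ n])
  moreover have "z $ j = (\<Sum>i<n. Q $$ (j, i) * (?g i * d $ i))" if "j < n" for j
  proof -
   have "(diag_one n f *\<^sub>v d) $ i = ?g i * d $ i" if "i < n" for i
   proof -
    have "(diag_one n f *\<^sub>v d) $ i = (\<Sum>j = 0..<n. (if i = j then ?g j else 0) * d $ j)"
     using that d by (simp add: diag_one_def mat_diag_def scalar_prod_def)
    also have "... = (\<Sum>j = 0..<n. if j = i then ?g i * d $ i else 0)" by (intro sum.cong) auto
    finally show ?thesis using that by simp
   qed
   thus ?thesis unfolding z_def using Q(1) Dg d that by (simp add: scalar_prod_def lessThan_atLeast0)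
  qed
  moreover have "v \<bullet> (?Mq *\<^sub>v z) = (\<Sum>j<n. z $ j * (v \<bullet> coords S N H (%x. H j x * q x)))"
  proof -
   have "v \<bullet> (?Mq *\<^sub>v z) = (\<Sum>a<N. \<Sum>j<n. z $ j * (v $ a * coords S N H (%x. H j x * q x) $ a))"
    using v(1) Mq z by (simp add: scalar_prod_def lessThan_atLeast0 sum_distrib_left mult_matrix_def mult_ac)
   also have "... = (\<Sum>j<n. z $ j * (v \<bullet> coords S N H (%x. H j x * q x)))"
    using carrier_vecD[OF coords_carrier[OF basis_2k qk]] by (subst sum.swap) (simp add: scalar_prod_def lessThan_atLeast0 sum_distrib_left)
   finally show ?thesis .
  qed
  ultimately have "v \<bullet> ((?Mq * Q * diag_one n f * Qinv) *\<^sub>v pv) = (\<Sum>j<n. \<Sum>i<n. Q $$ (j, i) * (?g i * d $ i) * (LINT x|\<mu>. H j x * q x))"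
   using null_vector_integral[OF v qk] by (simp add: sum_distrib_right)
  also have "... = (\<Sum>i<n. b i * ?g i)"
   by (subst sum.swap) (auto simp: b_eq sum_distrib_right sum_distrib_left mult_ac intro!: sum.cong)
  also have "... = b 0 + (\<Sum>i\<in>{0<..<n}. b i * f i)" unfolding sum0 by simp
  finally show ?thesis .
 qed
 have 4: "b 0 = (LINT x|\<mu>. p x) * (LINT x|\<mu>. q x)"
 proof -
  have wi: "integrable \<mu> (w i)" if "i < n" for i
   using D_polys w1[OF that] D1_D by (intro integrable_\<mu>) auto
  have "(LINT x|\<mu>. p x) = (LINT x|\<mu>. (\<Sum>i<n. d $ i * w i x))"
   using p_eq by (intro lebesgue_cong[OF refl]) (simp add: space_\<mu>)
  also have "... = (\<Sum>i<n. \<integral>x. d $ i * w i x \<partial>\<mu>)"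
   by (rule lebesgue_sum) (simp add: wi)
  also have "... = d $ 0 * (LINT x|\<mu>. w 0 x)"
   unfolding sum0 using eigenfunction_mean(1)[OF cQ eig] pos by (simp add: \<theta>_def w_def)
  finally have pm: "(LINT x|\<mu>. p x) = d $ 0 * (LINT x|\<mu>. w 0 x)" .
  have "(LINT x|\<mu>. w 0 x * q' x) = (LINT x|\<mu>. (LINT x|\<mu>. w 0 x) * q x)"
  proof (rule lebesgue_cong[OF refl])
   fix x assume "x : space \<mu>"
   hence x: "x : S" by (simp add: space_\<mu>)
   have "w 0 x = (LINT x|\<mu>. w 0 x)"
    unfolding w_def by (rule eigenfunction_mean(2)[OF cQ eig _ x]) (use n_pos in \<open>auto simp: \<theta>_def\<close>)
   thus "w 0 x * q' x = (LINT x|\<mu>. w 0 x) * q x" using q'(2)[OF x] by simp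
  qed
  thus ?thesis by (simp add: b_def pm)
 qed
 show thesis using that[OF 1 2 3[unfolded pv_def] 4] .
qed

lemma short_range_dependence_polys:
 assumes p: "p : polys k" and q: "q : polys k"
 shows "\<exists>C \<kappa>. 0 < \<kappa> \<and> (\<forall>s\<ge>0. \<forall>t\<ge>0. integrable (\<mu> \<bind> P) (%z. p (X (t + s) z) * q (X t z)) \<and>
  \<bar>(LINT z|(\<mu> \<bind> P). p (X (t + s) z) * q (X t z)) - (LINT x|\<mu>. p x) * (LINT x|\<mu>. q x)\<bar> <= C * exp (- \<kappa> * s))"
proof -
 obtain p' where p': "p' : D1" "\<And>x. x : S ==> p' x = p x" by (rule rep_D1[OF p], rule that)
 obtain q' where q': "q' : D1" "\<And>x. x : S ==> q' x = q x" by (rule rep_D1[OF q], rule that)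
 obtain C \<kappa> where \<kappa>: "0 < \<kappa>" and C: "\<And>s t. 0 <= s ==> 0 <= t ==> integrable (\<mu> \<bind> P) (%z. p' (X (t + s) z) * q' (X t z)) \<and>
  \<bar>(LINT z|(\<mu> \<bind> P). p' (X (t + s) z) * q' (X t z)) - (LINT x|\<mu>. p' x) * (LINT x|\<mu>. q' x)\<bar> <= C * exp (- \<kappa> * s)"
  using short_range_dependence[OF p'(1) q'(1)] by blast
 have m: "(LINT x|\<mu>. p' x) = (LINT x|\<mu>. p x)" "(LINT x|\<mu>. q' x) = (LINT x|\<mu>. q x)"
  using p'(2) q'(2) by (auto intro!: lebesgue_cong simp: space_\<mu>)
 have e: "p' (X (t + s) z) * q' (X t z) = p (X (t + s) z) * q (X t z)" if "0 <= s" "0 <= t" "z : space (\<mu> \<bind> P)" for s t z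
  using that X_in_S[of _ z] p'(2) q'(2) by (simp add: space_bind_\<mu>)
 show ?thesis
 proof (rule exI[of _ C], rule exI[of _ \<kappa>], intro conjI \<kappa> allI impI)
  fix s t :: real assume st: "0 <= s" "0 <= t"
  show "integrable (\<mu> \<bind> P) (%z. p (X (t + s) z) * q (X t z))"
   using C[OF st] by (subst (asm) Bochner_Integration.integrable_cong[OF refl e[OF st]]) simp_all
  show "\<bar>(LINT z|(\<mu> \<bind> P). p (X (t + s) z) * q (X t z)) - (LINT x|\<mu>. p x) * (LINT x|\<mu>. q x)\<bar> <= C * exp (- \<kappa> * s)"
   using C[OF st] unfolding m by (subst (asm) lebesgue_cong[OF refl e[OF st]]) simp_all
 qed
qed

end

theorem mainTheorem6:
  fixes S :: "(real^'d) set"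
    and k N n :: nat
    and \<alpha> :: real
    and H :: "nat \<Rightarrow> real^'d \<Rightarrow> real"
    and M :: "'w measure" and F :: "real \<Rightarrow> 'w measure"
    and X :: "real \<Rightarrow> 'w \<Rightarrow> real^'d" and P :: "real^'d \<Rightarrow> 'w measure"
    and \<sigma> :: "real \<Rightarrow> 'w \<Rightarrow> real"
    and \<mu> :: "(real^'d) measure"
    and G A :: "real mat" and v :: "real vec"
    and p q :: "real^'d \<Rightarrow> real"
  defines "L \<equiv> first_passage \<sigma>"
    and "P\<^sub>\<mu> \<equiv> \<mu> \<bind> P"
    and "\<mu>pq \<equiv> (\<integral>x. p x \<partial>\<mu>) * (\<integral>x. q x \<partial>\<mu>)"
    and "E \<equiv> cross_moment (\<mu> \<bind> P) (time_change X (first_passage \<sigma>)) p q"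
  assumes "closed S" and "interior S \<noteq> {}"
    and "0 < \<alpha>" and "\<alpha> < 1"
    and basis_2k: "poly_basis S (2 * k) N H" and basis_k: "poly_basis S k n H"
    and basis_0: "\<And>x. x \<in> S \<Longrightarrow> H 0 x = 1"
    and "cadlag_markov_process M F S X P"
    and "polynomial_process (2 * k) S F X P"
    and subordinator: "\<And>x. x \<in> S \<Longrightarrow> stable_subordinator (P x) \<alpha> \<sigma>"
    and independent: "\<And>x. x \<in> S \<Longrightarrow> indep_processes (P x) X \<sigma>"
    and "generator_matrix S F X P N H G" and "zero_stable G"
    and "generator_matrix S F X P n H A"
    and "limiting (2 * k) S X P \<mu>"
    and "eigenvector (transpose_mat G) v 0" and "v $ 0 = 1"
    and "p \<in> polys k" and "q \<in> polys k"
  shows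
    \<comment> \<open>short-range dependence of \<open>X\<close>\<close>
    "(\<exists>C \<kappa>. 0 < \<kappa> \<and> (\<forall>s\<ge>0. \<forall>t\<ge>0.
        integrable P\<^sub>\<mu> (\<lambda>\<omega>. p (X (t + s) \<omega>) * q (X t \<omega>)) \<and>
        \<bar>cross_moment P\<^sub>\<mu> X p q s t - \<mu>pq\<bar> \<le> C * exp (- \<kappa> * s)))
     \<and>
     \<comment> \<open>\<open>F_hat\<close> is the Laplace transform of the increments of \<open>L\<close>\<close>
     (\<forall>s\<ge>0. \<forall>t\<ge>0. \<forall>\<theta>>0.
        (\<integral>\<omega>. exp (- \<theta> * (L (t + s) \<omega> - L t \<omega>)) \<partial>P\<^sub>\<mu>) = F_hat \<alpha> s t \<theta>)
     \<and>
     (\<forall>l lam Q Qinv.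
        n = Suc l \<longrightarrow> (\<forall>i\<in>{1..l}. 0 < lam i) \<longrightarrow>
        similar_mat_wit A (mat_diag n (\<lambda>i. if i = 0 then 0 else - lam i)) Q Qinv \<longrightarrow>
        (let pv = coords S n H p; Mq = mult_matrix S N n H q in
          \<comment> \<open>(1)\<close>
          (\<forall>s\<ge>0. \<forall>t\<ge>0.
             integrable P\<^sub>\<mu> (\<lambda>\<omega>. p (X (L (t + s) \<omega>) \<omega>) * q (X (L t \<omega>) \<omega>)) \<and>
             E s t = v \<bullet> ((Mq * Q * diag_one n (\<lambda>i. F_hat \<alpha> s t (lam i)) * Qinv) *\<^sub>v pv))
          \<and>
          \<comment> \<open>(2)\<close>
          (\<forall>t\<ge>0.
             (\<forall>i\<in>{1..l}. (\<lambda>s. F_hat \<alpha> s t (lam i)) \<sim>[at_top] (\<lambda>s. R_asymp \<alpha> s t (lam i))) \<and>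
             asymp_equiv_scale (\<lambda>s. (t + s) powr (- \<alpha>)) (\<lambda>s. E s t)
               (\<lambda>s. v \<bullet> ((Mq * Q * diag_one n (\<lambda>i. R_asymp \<alpha> s t (lam i)) * Qinv) *\<^sub>v pv)))
          \<and>
          \<comment> \<open>(3)\<close>
          (\<forall>t\<ge>0.
             ((\<lambda>s. E s t) \<longlongrightarrow> (v \<bullet> coords S N H q) * (v \<bullet> coords S N H p)) at_top \<and>
             (v \<bullet> coords S N H q) * (v \<bullet> coords S N H p) = \<mu>pq)
          \<and>
          \<comment> \<open>(4)\<close>
          (\<exists>c. \<forall>t\<ge>0.
             asymp_equiv_scale (\<lambda>s. (t + s) powr (- \<alpha>)) (\<lambda>s. E s t)
               (\<lambda>s. \<mu>pq + 1 / ((t + s) powr \<alpha> * Gamma (1 - \<alpha>)) *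
                  (\<Sum>i=1..l. c i * (1 / lam i + t powr \<alpha> / Gamma (1 + \<alpha>)))))))"
proof -
 interpret time_changed_polynomials M F S X P k N n H G A \<mu> \<alpha> \<sigma>
 proof (intro time_changed_polynomials.intro markov_polynomials.intro nested_polynomial_basis.intro
   markov_polynomials_axioms.intro time_changed_polynomials_axioms.intro)
  show "S \<noteq> {}" using \<open>interior S \<noteq> {}\<close> interior_subset by blast
 qed (fact assms)+
 have v: "v : carrier_vec N" "transpose_mat G *\<^sub>v v = 0\<^sub>v N" "v $ 0 = 1"
  using \<open>eigenvector (transpose_mat G) v 0\<close> G_carrier \<open>v $ 0 = 1\<close> by (auto simp: eigenvector_def)
 have mean: "v \<bullet> coords S N H u = (LINT x|\<mu>. u x)" if "u : polys k" for u
  by (rule null_vector_integral[OF v polys_mono[OF _ that]]) simp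
 note p = \<open>p : polys k\<close> and q = \<open>q : polys k\<close>
 show ?thesis
 proof (intro conjI allI impI)
  show "\<exists>C \<kappa>. 0 < \<kappa> \<and> (\<forall>s\<ge>0. \<forall>t\<ge>0.
    integrable P\<^sub>\<mu> (%z. p (X (t + s) z) * q (X t z)) \<and>
    \<bar>cross_moment P\<^sub>\<mu> X p q s t - \<mu>pq\<bar> <= C * exp (- \<kappa> * s))"
   using short_range_dependence_polys[OF p q] unfolding P\<^sub>\<mu>_def \<mu>pq_def cross_moment_def .
  show "(\<integral>z. exp (- \<theta> * (L (t + s) z - L t z)) \<partial>P\<^sub>\<mu>) = F_hat \<alpha> s t \<theta>" if "0 <= s" "0 <= t" "0 < \<theta>" for s t \<theta>
   unfolding L_def P\<^sub>\<mu>_def using that by (intro Laplace_increment_\<mu>) simp_all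
  fix l lam Q Qinv
  assume n: "n = Suc l" and lam: "\<forall>i\<in>{1..l}. 0 < lam i"
   and sim: "similar_mat_wit A (mat_diag n (%i. if i = 0 then 0 else - lam i)) Q Qinv"
  have pos: "0 < lam i" if "0 < i" "i < n" for i using lam that n by simp
  have I: "{0<..<n} = {1..l}" using n by auto
  obtain b where b_int: "\<And>s t. 0 <= s ==> 0 <= t ==> integrable P\<^sub>\<mu> (%z. p (X (L (t + s) z) z) * q (X (L t z) z))"
   and b_E: "\<And>s t. 0 <= s ==> 0 <= t ==> E s t = b 0 + (\<Sum>i=1..l. b i * F_hat \<alpha> s t (lam i))"
   and b_mat: "\<And>f. v \<bullet> ((mult_matrix S N n H q * Q * diag_one n f * Qinv) *\<^sub>v coords S n H p) = b 0 + (\<Sum>i=1..l. b i * f i)"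
   and b_0: "b 0 = \<mu>pq"
  proof (rule spectral_expansion[OF sim pos p q], unfold I)
   fix b :: "nat => real"
   assume "\<And>s t. 0 <= s ==> 0 <= t ==> integrable (\<mu> \<bind> P) (%z. p (X (first_passage \<sigma> (t + s) z) z) * q (X (first_passage \<sigma> t z) z))"
    and "\<And>s t. 0 <= s ==> 0 <= t ==> (LINT z|(\<mu> \<bind> P). p (X (first_passage \<sigma> (t + s) z) z) * q (X (first_passage \<sigma> t z) z)) = b 0 + (\<Sum>i=1..l. b i * F_hat \<alpha> s t (lam i))"
    and "\<And>v f. v : carrier_vec N ==> transpose_mat G *\<^sub>v v = 0\<^sub>v N ==> v $ 0 = 1 ==>
     v \<bullet> ((mult_matrix S N n H q * Q * diag_one n f * Qinv) *\<^sub>v coords S n H p) = b 0 + (\<Sum>i=1..l. b i * f i)"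
    and "b 0 = (LINT x|\<mu>. p x) * (LINT x|\<mu>. q x)"
   thus thesis
    by (intro that[of b]) (simp_all add: v P\<^sub>\<mu>_def \<mu>pq_def E_def L_def cross_moment_def time_change_def)
  qed
  let ?h = "%t s. (t + s) powr (- \<alpha>)"
  let ?r = "%t i. 1 / lam i + t powr \<alpha> / Gamma (1 + \<alpha>)"
  define R where "R t = (\<Sum>i=1..l. b i * (1 / Gamma (1 - \<alpha>) * ?r t i))" for t
  have h: "(?h t \<longlongrightarrow> 0) at_top" "eventually (%s. ?h t s \<noteq> 0) at_top" if "0 <= t" for t
  proof -
   have "filterlim (%s. t + s) at_top at_top" by (rule filterlim_tendsto_add_at_top[OF tendsto_const filterlim_ident])
   thus "(?h t \<longlongrightarrow> 0) at_top" using \<open>0 < \<alpha>\<close> by (intro tendsto_neg_powr) simp_all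
   show "eventually (%s. ?h t s \<noteq> 0) at_top"
    using eventually_gt_at_top[of 0] by eventually_elim (use that in simp)
  qed
  have R_sum: "b 0 + (\<Sum>i=1..l. b i * R_asymp \<alpha> s t (lam i)) = b 0 + R t * ?h t s" for s t
   unfolding R_def R_asymp_eq sum_distrib_right by (simp add: mult_ac)
  have rem: "(%s. E s t - (b 0 + R t * ?h t s)) : o[at_top](?h t)" if t: "0 <= t" for t
  proof -
   have "(%s. \<Sum>i=1..l. b i * (F_hat \<alpha> s t (lam i) - R_asymp \<alpha> s t (lam i))) : o[at_top](?h t)"
   proof (rule big_sum_in_smallo)
    fix i assume "i : {1..l}"
    hence "(%s. F_hat \<alpha> s t (lam i) - R_asymp \<alpha> s t (lam i)) : o[at_top](?h t)"
     using lam by (intro F_hat_remainder \<open>\<alpha> < 1\<close> t) auto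
    thus "(%s. b i * (F_hat \<alpha> s t (lam i) - R_asymp \<alpha> s t (lam i))) : o[at_top](?h t)" by simp
   qed
   moreover have "eventually (%s. (\<Sum>i=1..l. b i * (F_hat \<alpha> s t (lam i) - R_asymp \<alpha> s t (lam i))) = E s t - (b 0 + R t * ?h t s)) at_top"
    using eventually_ge_at_top[of 0]
   proof eventually_elim
    case (elim s)
    show ?case unfolding b_E[OF elim t] R_sum[symmetric] right_diff_distrib sum_subtractf by simp
   qed
   ultimately show ?thesis by (rule landau_o.small.in_cong[THEN iffD1, rotated])
  qed
  note scale = asymp_equiv_scaleI[OF rem h]
  have 1: "\<forall>s\<ge>0. \<forall>t\<ge>0. integrable P\<^sub>\<mu> (%z. p (X (L (t + s) z) z) * q (X (L t z) z)) \<and>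
    E s t = v \<bullet> ((mult_matrix S N n H q * Q * diag_one n (%i. F_hat \<alpha> s t (lam i)) * Qinv) *\<^sub>v coords S n H p)"
   by (simp add: b_int b_E b_mat)
  have 2: "\<forall>t\<ge>0. (\<forall>i\<in>{1..l}. (%s. F_hat \<alpha> s t (lam i)) \<sim>[at_top] (%s. R_asymp \<alpha> s t (lam i))) \<and>
    asymp_equiv_scale (?h t) (%s. E s t)
     (%s. v \<bullet> ((mult_matrix S N n H q * Q * diag_one n (%i. R_asymp \<alpha> s t (lam i)) * Qinv) *\<^sub>v coords S n H p))"
  proof (intro allI impI conjI ballI)
   fix t :: real and i assume t: "0 <= t" and i: "i : {1..l}"
   let ?c = "1 / Gamma (1 - \<alpha>) * ?r t i"
   have c: "?c \<noteq> 0"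
   proof -
    have "0 < Gamma (1 - \<alpha>)" "0 < Gamma (1 + \<alpha>)" "0 < lam i" using \<open>0 < \<alpha>\<close> \<open>\<alpha> < 1\<close> lam i by (auto intro: Gamma_real_pos)
    hence "0 < ?r t i" by (intro add_pos_nonneg) auto
    thus ?thesis using \<open>0 < Gamma (1 - \<alpha>)\<close> by simp
   qed
   have "(%s. F_hat \<alpha> s t (lam i) - (0 + ?c * ?h t s)) : o[at_top](?h t)"
    using F_hat_remainder[OF \<open>\<alpha> < 1\<close> _ t, of "lam i"] lam i by (simp add: R_asymp_eq)
   from asymp_equiv_scaleI(1)[OF this h[OF t]]
   have "(\<exists>\<^sub>F s in at_top. 0 + ?c * ?h t s \<noteq> 0) \<longrightarrow> (%s. F_hat \<alpha> s t (lam i)) \<sim>[at_top] (%s. 0 + ?c * ?h t s)"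
    unfolding asymp_equiv_scale_def by blast
   moreover have "\<exists>\<^sub>F s in at_top. 0 + ?c * ?h t s \<noteq> 0"
    using h(2)[OF t] c by (intro eventually_frequently) (auto elim: eventually_mono)
   ultimately show "(%s. F_hat \<alpha> s t (lam i)) \<sim>[at_top] (%s. R_asymp \<alpha> s t (lam i))" by (simp add: R_asymp_eq)
  next
   fix t :: real assume t: "0 <= t"
   show "asymp_equiv_scale (?h t) (%s. E s t)
     (%s. v \<bullet> ((mult_matrix S N n H q * Q * diag_one n (%i. R_asymp \<alpha> s t (lam i)) * Qinv) *\<^sub>v coords S n H p))"
    unfolding b_mat R_sum by (rule scale(1)[OF t t t])
  qed
  have 3: "\<forall>t\<ge>0. ((%s. E s t) \<longlongrightarrow> (v \<bullet> coords S N H q) * (v \<bullet> coords S N H p)) at_top \<and>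
    (v \<bullet> coords S N H q) * (v \<bullet> coords S N H p) = \<mu>pq"
  proof (intro allI impI conjI)
   show m: "(v \<bullet> coords S N H q) * (v \<bullet> coords S N H p) = \<mu>pq"
    unfolding mean[OF p] mean[OF q] \<mu>pq_def by (rule mult.commute)
   show "((%s. E s t) \<longlongrightarrow> (v \<bullet> coords S N H q) * (v \<bullet> coords S N H p)) at_top" if "0 <= t" for t
    using scale(2)[OF that that that] unfolding m b_0 .
  qed
  have 4: "\<forall>t\<ge>0. asymp_equiv_scale (?h t) (%s. E s t)
    (%s. \<mu>pq + 1 / ((t + s) powr \<alpha> * Gamma (1 - \<alpha>)) * (\<Sum>i=1..l. b i * ?r t i))"
  proof (intro allI impI)
   fix t :: real assume t: "0 <= t"
   have "\<mu>pq + 1 / ((t + s) powr \<alpha> * Gamma (1 - \<alpha>)) * (\<Sum>i=1..l. b i * ?r t i) = b 0 + R t * ?h t s" for s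
    unfolding R_def b_0 sum_distrib_left sum_distrib_right by (simp add: powr_minus divide_inverse mult_ac)
   thus "asymp_equiv_scale (?h t) (%s. E s t)
    (%s. \<mu>pq + 1 / ((t + s) powr \<alpha> * Gamma (1 - \<alpha>)) * (\<Sum>i=1..l. b i * ?r t i))"
    using scale(1)[OF t t t] by simp
  qed
  show "let pv = coords S n H p; Mq = mult_matrix S N n H q in
    (\<forall>s\<ge>0. \<forall>t\<ge>0. integrable P\<^sub>\<mu> (%z. p (X (L (t + s) z) z) * q (X (L t z) z)) \<and>
      E s t = v \<bullet> ((Mq * Q * diag_one n (%i. F_hat \<alpha> s t (lam i)) * Qinv) *\<^sub>v pv)) \<and>
    (\<forall>t\<ge>0. (\<forall>i\<in>{1..l}. (%s. F_hat \<alpha> s t (lam i)) \<sim>[at_top] (%s. R_asymp \<alpha> s t (lam i))) \<and>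
      asymp_equiv_scale (?h t) (%s. E s t) (%s. v \<bullet> ((Mq * Q * diag_one n (%i. R_asymp \<alpha> s t (lam i)) * Qinv) *\<^sub>v pv))) \<and>
    (\<forall>t\<ge>0. ((%s. E s t) \<longlongrightarrow> (v \<bullet> coords S N H q) * (v \<bullet> coords S N H p)) at_top \<and>
      (v \<bullet> coords S N H q) * (v \<bullet> coords S N H p) = \<mu>pq) \<and>
    (\<exists>c. \<forall>t\<ge>0. asymp_equiv_scale (?h t) (%s. E s t)
       (%s. \<mu>pq + 1 / ((t + s) powr \<alpha> * Gamma (1 - \<alpha>)) * (\<Sum>i=1..l. c i * ?r t i)))"
   unfolding Let_def using 1 2 3 4 by blast
 qed
qed

end
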